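(* Let $0\le\alpha<n$, let $1\le p_0\le p\le q<q_0\le\infty$ satisfy $\frac1p-\frac1q=\frac{\alpha}{nq_0'}$, let $T\in S^{\alpha}(p_0,q_0)$ be an operator on $\mathbf{R}^n$, and let $w$ be a weight such that $w^q\in A_{\left(\frac1{p_0}-\frac1p\right)q+1}\cap RH_{(q_0/q)'}$. Then $$\|wT(w^{-1}\,\cdot\,)\|_{L^p\to L^{q,\infty}}\lesssim\begin{cases}[w^q]_{A_{\left(\frac1{p_0}-\frac1p\right)q+1}}^{\frac1q}\,[w^q]_{A_\infty}, & q_0=\infty,\\[2mm] [w^q]_{A_{\left(\frac1{p_0}-\frac1p\right)q+1}}^{\frac1q}\,[w^q]_{RH_{(q_0/q)'}}^{\left(\frac{q_0}{q}\right)'+\frac2q}, & 1<q_0<\infty,\end{cases}$$ with implicit constant independent of $w$.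
   Context: Notation. $\mathbf{R}^n$ carries Lebesgue measure; $|E|$ is the measure of $E$, $p'=p/(p-1)$ (with $1'=\infty$, $\infty'=1$; if $q_0=\infty$ then $(q_0/q)'=1$), and $\langle f,g\rangle=\int fg\,dx$. Cubes have sides parallel to the axes. A weight is a non-negative locally integrable function $w$, with $w(E)=\int_E w\,dx$. $L^p$ and $L^{q,\infty}$ are taken with respect to Lebesgue measure, $\|f\|_{L^{q,\infty}}=\sup_{y>0}y\,|\{|f|>y\}|^{1/q}$. For $0\le\alpha<n$, $1\le r<\infty$, $$\langle f\rangle_{\alpha,r,Q}=\Big(\frac1{|Q|^{1-\alpha/n}}\int_Q|f|^r\,dx\Big)^{1/r},\qquad \langle f\rangle_{r,Q}=\langle f\rangle_{0,r,Q},\qquad \langle f\rangle_Q=\langle f\rangle_{1,Q}.$$ The notation $a\lesssim b$ means $a\le Cb$ with $C$ independent of the important parameters; here $C$ may depend on $n,\alpha,p,q,p_0,q_0$ and on the parameters $N,\eta$ and the implicit constant in the sparse domination of $T$, but not on $w$ or the functions. Dyadic grids and sparse families. A dyadic grid $\mathcal D$ is a collection of cubes such that: each side length is $2^k$ for some $k\in\mathbf{Z}$; $Q\cap R\in\{\varnothing,Q,R\}$ for all $Q,R\in\mathcal D$; the cubes of a fixed side length $2^k$ partition $\mathbf{R}^n$. A collection $\mathcal S\subseteq\mathcal D$ is $\eta$-sparse ($0<\eta\le1$) if there are pairwise disjoint sets $(E_Q)_{Q\in\mathcal S}$ with $E_Q\subseteq Q$ and $|E_Q|\ge\eta|Q|$.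 The class $S^\alpha(p_0,q_0)$. Let $0\le\alpha<n$ and $1\le p_0<q_0\le\infty$ with $\frac1{p_0}-\frac1{q_0}>\frac{\alpha}{nq_0'}$ (standing assumption). A (sub)linear operator $T$, initially defined on $C_c^\infty$, belongs to $S^\alpha(p_0,q_0)$ if there are a positive integer $N$ and $0<\eta\le1$ such that for all $f,g\in C_c^\infty$ there exist $\eta$-sparse collections $\mathcal S_1,\dots,\mathcal S_N$ with $$|\langle Tf,g\rangle|\lesssim\sum_{j=1}^N\sum_{Q\in\mathcal S_j}\langle f\rangle_{p_0,Q}\,\langle g\rangle_{\alpha,q_0',Q}\,|Q|,$$ with implicit constant independent of $f,g$. Operator norm. $\|wT(w^{-1}\cdot)\|_{L^p\to L^{q,\infty}}$ is the least $K$ with $\|wT(w^{-1}f)\|_{L^{q,\infty}}\le K\|f\|_{L^p}$, equivalently $\|wTh\|_{L^{q,\infty}}\le K\|wh\|_{L^p}$ with $h=w^{-1}f$, where $T$, initially defined on $C_c^\infty$, is as usual extended by density. Weight classes. For $1\le r<\infty$, $v\in A_r$ means $[v]_{A_r}:=\sup_Q\big(\frac1{|Q|}\int_Qv\,dx\big)\big(\frac1{|Q|}\int_Qv^{1-r'}dx\big)^{r-1}<\infty$, where for $r=1$ the second factor is read as $(\operatorname{ess\,inf}_Qv)^{-1}$. $A_\infty=\bigcup_{r\ge1}A_r$, with Fujii–Wilson constant $[v]_{A_\infty}:=\sup_Q\frac1{v(Q)}\int_QM(v\chi_Q)\,dx$, where $Mf(x)=\sup_Q\langle f\rangle_Q\chi_Q(x)$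 is the Hardy–Littlewood maximal operator. For $1<s<\infty$, $v\in RH_s$ means $[v]_{RH_s}:=\sup_Q\langle v\rangle_{s,Q}/\langle v\rangle_Q<\infty$; for $s=1$, $RH_1:=A_\infty$ and $[v]_{RH_1}:=1$. *)

theory Defs
  imports "HOL-Analysis.Analysis"
begin

subsection \<open>Exponents\<close>

text \<open>Powers with values in \<open>[0,\<infinity>]\<close>, in particular \<open>0\<^sup>a = \<infinity>\<close> for \<open>a < 0\<close>
  (whereas \<open>0 powr a = 0\<close> on the reals).\<close>

definition epowr :: "ennreal \<Rightarrow> real \<Rightarrow> ennreal" where
  "epowr x a =
     (let y = (if x = \<infinity> then \<infinity> else ennreal (enn2real x powr \<bar>a\<bar>))
      in if a = 0 then 1 else if a > 0 then y else inverse y)"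

definition conj_exp :: "ereal \<Rightarrow> ereal" where
  "conj_exp p = (if p = 1 then \<infinity> else if p = \<infinity> then 1 else p / (p - 1))"


subsection \<open>Function spaces on Euclidean space\<close>

definition locally_integrable ::
    "(real ^ 'n \<Rightarrow> 'a :: {banach, second_countable_topology}) \<Rightarrow> bool" where
  "locally_integrable f \<longleftrightarrow> (\<forall>K. compact K \<longrightarrow> set_integrable lebesgue K f)"

primrec C_k :: "nat \<Rightarrow> (real ^ 'n \<Rightarrow> 'a :: real_normed_vector) \<Rightarrow> bool" where
  "C_k 0 f \<longleftrightarrow> continuous_on UNIV f"
| "C_k (Suc k) f \<longleftrightarrow> (\<forall>x. f differentiable (at x)) \<and>
     (\<forall>i. C_k k (\<lambda>x. frechet_derivative f (at x) (axis i 1)))"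

definition test_functions :: "(real ^ 'n \<Rightarrow> 'a :: real_normed_vector) set" where
  "test_functions = {f. (\<forall>k. C_k k f) \<and> compact (closure {x. f x \<noteq> 0})}"

definition Lp_norm :: "real \<Rightarrow> (real ^ 'n \<Rightarrow> 'a :: real_normed_vector) \<Rightarrow> ennreal" where
  "Lp_norm p f = epowr (\<integral>\<^sup>+x. ennreal (norm (f x) powr p) \<partial>lebesgue) (1 / p)"

definition weak_norm :: "real \<Rightarrow> (real ^ 'n \<Rightarrow> 'a :: real_normed_vector) \<Rightarrow> ennreal" where
  "weak_norm q f =
     (SUP y\<in>{0<..}. ennreal y * epowr (emeasure lebesgue {x. norm (f x) > y}) (1 / q))"


subsection \<open>Cubes, averages, dyadic grids and sparse families\<close>

text \<open>Any of the faces may be included in or excluded from a cube, so that both the half-open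
  cubes of dyadic grids and open or closed cubes are covered.\<close>

definition cube :: "real \<Rightarrow> (real ^ 'n) set \<Rightarrow> bool" where
  "cube l Q \<longleftrightarrow> l > 0 \<and>
     (\<exists>a I. (\<forall>i. {a $ i <..< a $ i + l} \<subseteq> I i \<and> I i \<subseteq> {a $ i .. a $ i + l}) \<and>
            Q = {x. \<forall>i. x $ i \<in> I i})"

definition cubes :: "(real ^ 'n) set set" where
  "cubes = {Q. \<exists>l. cube l Q}"

definition avg ::
    "real \<Rightarrow> real \<Rightarrow> (real ^ 'n) set \<Rightarrow> (real ^ 'n \<Rightarrow> 'a :: real_normed_vector) \<Rightarrow> ennreal" where
  "avg \<alpha> r Q f =
     epowr ((\<integral>\<^sup>+x\<in>Q. ennreal (norm (f x) powr r) \<partial>lebesgue)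
            / epowr (emeasure lebesgue Q) (1 - \<alpha> / real CARD('n))) (1 / r)"

definition dyadic_grid :: "(real ^ 'n) set set \<Rightarrow> bool" where
  "dyadic_grid D \<longleftrightarrow>
     (\<forall>Q\<in>D. \<exists>k::int. cube (2 powi k) Q) \<and>
     (\<forall>Q\<in>D. \<forall>R\<in>D. Q \<inter> R \<in> {{}, Q, R}) \<and>
     (\<forall>k::int. partition_on UNIV {Q \<in> D. cube (2 powi k) Q})"

definition sparse :: "real \<Rightarrow> (real ^ 'n) set set \<Rightarrow> bool" where
  "sparse \<eta> S \<longleftrightarrow>
     (\<exists>D. dyadic_grid D \<and> S \<subseteq> D) \<and>
     (\<exists>E. disjoint_family_on E S \<and>
          (\<forall>Q\<in>S. E Q \<in> sets lebesgue \<and> E Q \<subseteq> Q \<and>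
                 emeasure lebesgue (E Q) \<ge> ennreal \<eta> * emeasure lebesgue Q))"


subsection \<open>Operators with a sparse domination\<close>

text \<open>The scalar field is any type that is both a normed field and a Euclidean space, that is,
  \<open>real\<close> or \<open>complex\<close>. Operators act on test functions; their values elsewhere are irrelevant.
  Linear operators are sublinear in the sense below.\<close>

definition sublinear ::
    "((real ^ 'n \<Rightarrow> 'a :: {real_normed_field, euclidean_space}) \<Rightarrow> (real ^ 'n \<Rightarrow> 'a)) \<Rightarrow> bool" where
  "sublinear T \<longleftrightarrow>
     (\<forall>f\<in>test_functions. \<forall>g\<in>test_functions.
        AE x in lebesgue. norm (T (\<lambda>x. f x + g x) x) \<le> norm (T f x) + norm (T g x)) \<and>
     (\<forall>f\<in>test_functions. \<forall>c.
        AE x in lebesgue. norm (T (\<lambda>x. c * f x) x) = norm c * norm (T f x))"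

text \<open>The class \<open>S\<^sup>\<alpha>(p\<^sub>0,q\<^sub>0)\<close> is the union of the following sets over all \<open>N > 0\<close>,
  \<open>0 < \<eta> \<le> 1\<close> and \<open>c\<close>, where \<open>c\<close> is the implicit constant of the sparse domination. The parameters
  are kept explicit because the constant in the weighted estimate depends on them.
  Local integrability of \<open>T f\<close> makes the pairing of \<open>T f\<close> with test functions meaningful.\<close>

definition S_class ::
    "real \<Rightarrow> real \<Rightarrow> ereal \<Rightarrow> nat \<Rightarrow> real \<Rightarrow> real \<Rightarrow>
     ((real ^ 'n \<Rightarrow> 'a :: {real_normed_field, euclidean_space}) \<Rightarrow> (real ^ 'n \<Rightarrow> 'a)) set" where
  "S_class \<alpha> p\<^sub>0 q\<^sub>0 N \<eta> c =
     {T. sublinear T \<and> (\<forall>f\<in>test_functions. locally_integrable (T f)) \<and>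
         (\<forall>f\<in>test_functions. \<forall>g\<in>test_functions. \<exists>S. (\<forall>j<N. sparse \<eta> (S j)) \<and>
            ennreal (norm (\<integral>x. T f x * g x \<partial>lebesgue))
              \<le> ennreal c * (\<Sum>j<N. \<Sum>\<^sub>\<infinity>Q\<in>S j.
                   avg 0 p\<^sub>0 Q f * avg \<alpha> (real_of_ereal (conj_exp q\<^sub>0)) Q g * emeasure lebesgue Q))}"

text \<open>\<open>u\<close> is the value at \<open>h\<close> of the extension of \<open>T\<close> by density, from test functions to
  the space of all \<open>h\<close> with \<open>w h \<in> L\<^sup>p\<close>. Since
  \<open>\<bar>\<bar>T f\<bar> - \<bar>T g\<bar>\<bar> \<le> \<bar>T (f - g)\<bar>\<close> for sublinear \<open>T\<close> (but not without
  the inner absolute values), it is \<open>\<bar>T\<bar>\<close> that extends; this determines \<open>\<bar>u\<bar>\<close>, and the norm below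
  depends on nothing else.\<close>

definition density_value ::
    "real \<Rightarrow> real \<Rightarrow> (real ^ 'n \<Rightarrow> real) \<Rightarrow>
     ((real ^ 'n \<Rightarrow> 'a :: {real_normed_field, euclidean_space}) \<Rightarrow> (real ^ 'n \<Rightarrow> 'a)) \<Rightarrow>
     (real ^ 'n \<Rightarrow> 'a) \<Rightarrow> (real ^ 'n \<Rightarrow> 'a) \<Rightarrow> bool" where
  "density_value p q w T h u \<longleftrightarrow>
     u \<in> borel_measurable lebesgue \<and>
     (\<exists>\<phi>. (\<forall>k. \<phi> k \<in> test_functions) \<and>
          (\<lambda>k::nat. Lp_norm p (\<lambda>x. w x *\<^sub>R (\<phi> k x - h x))) \<longlonglongrightarrow> 0 \<and>
          (\<lambda>k. weak_norm q (\<lambda>x. w x * (norm (T (\<phi> k) x) - norm (u x)))) \<longlonglongrightarrow> 0)"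

text \<open>The norm of \<open>f \<mapsto> w T(w\<^sup>-\<^sup>1 f)\<close> from \<open>L\<^sup>p\<close> to weak \<open>L\<^sup>q\<close>. An admissible \<open>K\<close> entails that the
  extension of \<open>T\<close> is defined at \<open>w\<^sup>-\<^sup>1 f\<close> for every \<open>f \<in> L\<^sup>p\<close>.\<close>

definition weighted_weak_opnorm ::
    "real \<Rightarrow> real \<Rightarrow> (real ^ 'n \<Rightarrow> real) \<Rightarrow>
     ((real ^ 'n \<Rightarrow> 'a :: {real_normed_field, euclidean_space}) \<Rightarrow> (real ^ 'n \<Rightarrow> 'a)) \<Rightarrow> ennreal" where
  "weighted_weak_opnorm p q w T =
     Inf {K. \<forall>f \<in> borel_measurable lebesgue. Lp_norm p f < \<infinity> \<longrightarrow>
               (\<exists>u. density_value p q w T (\<lambda>x. inverse (w x) *\<^sub>R f x) u) \<and>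
               (\<forall>u. density_value p q w T (\<lambda>x. inverse (w x) *\<^sub>R f x) u \<longrightarrow>
                  weak_norm q (\<lambda>x. w x *\<^sub>R u x) \<le> K * Lp_norm p f)}"


subsection \<open>Weight classes\<close>

definition weight :: "(real ^ 'n \<Rightarrow> real) \<Rightarrow> bool" where
  "weight v \<longleftrightarrow> (\<forall>x. v x \<ge> 0) \<and> locally_integrable v"

definition ess_inf_on :: "(real ^ 'n) set \<Rightarrow> (real ^ 'n \<Rightarrow> real) \<Rightarrow> ennreal" where
  "ess_inf_on Q v = Sup {c. AE x in lebesgue. x \<in> Q \<longrightarrow> c \<le> ennreal (v x)}"

definition A_const :: "real \<Rightarrow> (real ^ 'n \<Rightarrow> real) \<Rightarrow> ennreal" where
  "A_const r v =
     (SUP Q\<in>cubes.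
        ((\<integral>\<^sup>+x\<in>Q. ennreal (v x) \<partial>lebesgue) / emeasure lebesgue Q) *
        (if r = 1 then inverse (ess_inf_on Q v)
         else epowr ((\<integral>\<^sup>+x\<in>Q. epowr (ennreal (v x)) (1 - r / (r - 1)) \<partial>lebesgue)
                     / emeasure lebesgue Q) (r - 1)))"

definition A_class :: "real \<Rightarrow> (real ^ 'n \<Rightarrow> real) set" where
  "A_class r = {v. weight v \<and> A_const r v < \<infinity>}"

definition A_inf_class :: "(real ^ 'n \<Rightarrow> real) set" where
  "A_inf_class = (\<Union>r\<in>{1..}. A_class r)"

definition maximal :: "(real ^ 'n \<Rightarrow> real) \<Rightarrow> real ^ 'n \<Rightarrow> ennreal" where
  "maximal f x = (SUP Q\<in>cubes. avg 0 1 Q f * indicator Q x)"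

definition A_inf_const :: "(real ^ 'n \<Rightarrow> real) \<Rightarrow> ennreal" where
  "A_inf_const v =
     (SUP Q\<in>cubes. (\<integral>\<^sup>+x\<in>Q. maximal (\<lambda>y. v y * indicator Q y) x \<partial>lebesgue)
                    / (\<integral>\<^sup>+x\<in>Q. ennreal (v x) \<partial>lebesgue))"

definition RH_const :: "real \<Rightarrow> (real ^ 'n \<Rightarrow> real) \<Rightarrow> ennreal" where
  "RH_const s v = (if s = 1 then 1 else (SUP Q\<in>cubes. avg 0 s Q v / avg 0 1 Q v))"

definition RH_class :: "real \<Rightarrow> (real ^ 'n \<Rightarrow> real) set" where
  "RH_class s = (if s = 1 then A_inf_class else {v. weight v \<and> RH_const s v < \<infinity>})"

end

theory Submission
  imports Defs
begin

text \<open>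
  Put \<open>\<mu> = w\<^sup>q\<close>. By duality, the weak type bound for \<open>w T h\<close> at height \<open>y\<close> is a bound for the pairing of
  \<open>T h\<close> with \<open>w\<close> times a phase on a set \<open>S\<close>, which consists of points where \<open>w \<bar>T h\<bar>\<close> exceeds \<open>y\<close>. The sparse domination
  turns the pairing into sums over sparse families of cubes, and every cube contributes two averages.

  The \<open>A\<^sub>r\<close> condition bounds the average of \<open>h\<close> by \<open>[\<mu>]\<^sup>1\<^sup>/\<^sup>q \<langle>\<mu>\<rangle>\<^sup>-\<^sup>1\<^sup>/\<^sup>q\<close> times a power of the average of
  \<open>F = \<bar>w h\<bar>\<^sup>p\<close> (\<open>mean_le_A_const\<close>). A reverse Hoelder inequality for \<open>\<mu>\<^sup>s\<close> with \<open>s = (q\<^sub>0 / q)'\<close> bounds the average of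
  the dual function by \<open>\<langle>\<mu>\<rangle>\<^sup>1\<^sup>/\<^sup>q\<close> times a power of the average of the indicator of \<open>S\<close>
  (\<open>mean_le_reverse_Holder\<close>). The weight cancels. The relation between \<open>p\<close>, \<open>q\<close> and \<open>\<alpha>\<close>
  makes the powers of \<open>\<bar>Q\<bar>\<close> fit, and leaves sums of \<open>\<bar>Q\<bar> \<langle>F\<rangle>\<^sup>1\<^sup>/\<^sup>q \<langle>1\<^sub>S\<rangle>\<^sup>b\<close>, where
  \<open>1 / q + b = 1 + \<delta>\<close> and \<open>\<delta>\<close> is proportional to the gain of integrability in the reverse Hoelder
  inequality. The set \<open>S\<close> is chosen, at the cost of half the measure, outside a level set of the maximal function of
  \<open>F\<close>; then only cubes matter on which \<open>\<langle>F\<rangle>\<close> is bounded. Bounded functions of weak type one have integrals of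
  the power \<open>1 + \<delta>\<close> of size \<open>1 / \<delta>\<close>, and this is the total cost of the sum (\<open>sparse_family_bound\<close>).

  By the sharp reverse Hoelder inequality (\<open>reverse_Holder\<close>), \<open>1 / \<delta>\<close> is of the order of the Fujii-Wilson constant of
  \<open>\<mu>\<^sup>s\<close>. If \<open>q\<^sub>0 = \<infinity>\<close>, then \<open>s = 1\<close> and this is the \<open>A\<^sub>\<infinity>\<close> constant of \<open>\<mu>\<close>. If \<open>q\<^sub>0\<close> is finite, the maximal theorem
  bounds it by the power \<open>s\<close> of the reverse Hoelder constant of \<open>\<mu>\<close> (\<open>Fujii_Wilson_of_reverse_Holder\<close>), and together
  with the power \<open>1 / q\<close> from the averages of \<open>\<mu>\<^sup>s\<close> this gives the power \<open>s + 1 / q\<close>, which is at most the power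
  \<open>s + 2 / q\<close> because the constant is at least one.

  Two limiting processes surround this core. The sparse domination holds for pairs of test functions, with families that depend on
  both; so the dual function is approximated by test functions in a way that changes the sparse form little, uniformly
  over all sparse families (\<open>sparse_form_continuous\<close>, \<open>level_set_le\<close>). And the bound for test functions is extended by
  density, which includes the construction of the extension as an almost everywhere limit (\<open>density_value_exists\<close>). Both rest on
  the density of test functions in weighted spaces, which starts from the smooth function \<open>exp (- 1 / t)\<close>.
  A weight in \<open>A\<^sub>r\<close> is positive almost everywhere or zero almost everywhere (\<open>A_class_zero_or_pos\<close>), and in
  the latter case the operator norm is zero.
\<close>

section \<open>Integrals of powers\<close>

lemma epowr_pos:
  assumes "x \<ge> 0" "a > 0"
  shows "epowr (ennreal x) a = ennreal (x powr a)"
  using assms by (simp add: epowr_def)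

lemma epowr_top [simp]: "a > 0 \<Longrightarrow> epowr top a = top"
  by (simp add: epowr_def)

lemma epowr_neg:
  assumes "x > 0" "a < 0"
  shows "epowr (ennreal x) a = ennreal (x powr a)"
  using assms by (simp add: epowr_def inverse_ennreal powr_minus)

lemma epowr_real:
  assumes "x > 0"
  shows "epowr (ennreal x) a = ennreal (x powr a)"
proof -
  consider "a = 0" | "a > 0" | "a < 0" by linarith
  then show ?thesis
    using assms epowr_pos[of x a] epowr_neg[of x a] by cases (auto simp: epowr_def)
qed

lemma epowr_mono:
  assumes "x \<le> y" "a > 0"
  shows "epowr x a \<le> epowr y a"
proof (cases "y = \<infinity>")
  case False
  then obtain y' where y: "y = ennreal y'" "y' \<ge> 0" by (cases y) auto
  then obtain x' where x: "x = ennreal x'" "x' \<ge> 0" using assms by (cases x) (auto simp: top_unique)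
  have "x' \<le> y'" using assms x y by (simp add: ennreal_le_iff)
  then show ?thesis using assms x y by (simp add: epowr_pos powr_mono2)
qed (use assms in auto)

lemma epowr_le_imp_le:
  assumes "epowr x (1 / a) \<le> ennreal b" "a > 0" "b \<ge> 0"
  shows "x \<le> ennreal (b powr a)"
proof (cases x)
  case (real r)
  then have "r powr (1/a) \<le> b" using assms by (simp add: epowr_pos)
  then have "(r powr (1/a)) powr a \<le> b powr a" using assms by (intro powr_mono2) auto
  then show ?thesis using assms real by (simp add: powr_powr)
qed (use assms in \<open>auto simp: top_unique\<close>)

lemma epowr_le:
  assumes "x \<le> ennreal (b powr a)" "a > 0" "b \<ge> 0"
  shows "epowr x (1 / a) \<le> ennreal b"
proof -
  have "epowr x (1 / a) \<le> epowr (ennreal (b powr a)) (1 / a)"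
    using assms by (intro epowr_mono) auto
  also have "\<dots> = ennreal b" using assms by (simp add: epowr_pos powr_powr)
  finally show ?thesis .
qed

lemma nn_integral_powr_below:
  fixes \<theta> u :: real
  assumes "\<theta> > 0" "u \<ge> 0"
  shows "(\<integral>\<^sup>+t. ennreal (\<theta> * t powr (\<theta> - 1)) * indicator {0<..<u} t \<partial>lborel) = ennreal (u powr \<theta>)"
proof -
  have "((\<lambda>t. \<theta> * t powr (\<theta> - 1)) has_integral (u powr \<theta> - 0 powr \<theta>)) {0..u}"
  proof (rule fundamental_theorem_of_calculus_interior)
    show "0 \<le> u" by fact
    show "continuous_on {0..u} (\<lambda>t. t powr \<theta>)"
      using assms by (intro continuous_on_powr' continuous_intros) auto
    show "((\<lambda>t. t powr \<theta>) has_vector_derivative \<theta> * x powr (\<theta> - 1)) (at x)"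
      if "x \<in> {0<..<u}" for x
      using that by (auto intro!: derivative_eq_intros has_real_derivative_iff_has_vector_derivative[THEN iffD1])
  qed
  then have "((\<lambda>t. \<theta> * t powr (\<theta> - 1)) has_integral (u powr \<theta>)) {0<..<u}"
    using has_integral_open_interval[of "\<lambda>t. \<theta> * t powr (\<theta> - 1)" "u powr \<theta>" 0 u] \<open>\<theta> > 0\<close> unfolding box_real cbox_interval
    by simp
  from nn_integral_has_integral_lebesgue'[OF _ this] assms show ?thesis by simp
qed

text \<open>Tonelli applied to the representation of \<open>u\<^sup>\<theta>\<close> as an integral over \<open>0 < t < u\<close>.\<close>

lemma layer_cake:
  fixes u :: "'a \<Rightarrow> real"
  assumes "sigma_finite_measure M"
    and [measurable]: "X \<in> borel_measurable M" "u \<in> borel_measurable M"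
    and u: "\<And>x. x \<in> space M \<Longrightarrow> u x \<ge> 0" and "\<theta> > 0"
  shows "(\<integral>\<^sup>+x. X x * ennreal (u x powr \<theta>) \<partial>M) =
         (\<integral>\<^sup>+t. ennreal (\<theta> * t powr (\<theta> - 1)) * indicator {0<..} t *
            (\<integral>\<^sup>+x. X x * indicator {x. t < u x} x \<partial>M) \<partial>lborel)"
proof -
  interpret pair_sigma_finite M lborel
    using assms(1) sigma_finite_lborel by (simp add: pair_sigma_finite_def)
  let ?k = "\<lambda>t. ennreal (\<theta> * t powr (\<theta> - 1))"
  have [measurable]: "(\<lambda>(x, t). indicator {x. t < u x} x :: ennreal) \<in> borel_measurable (M \<Otimes>\<^sub>M lborel)"
  proof -
    have "(\<lambda>(x, t). indicator {x. t < u x} x :: ennreal) =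
        indicator {z. snd z < u (fst z)}" by (auto simp: indicator_def fun_eq_iff)
    moreover have "indicator {z \<in> space (M \<Otimes>\<^sub>M lborel). snd z < u (fst z)} \<in> borel_measurable (M \<Otimes>\<^sub>M lborel)"
      by measurable
    ultimately show ?thesis
      by (subst measurable_cong[where g = "indicator {z \<in> space (M \<Otimes>\<^sub>M lborel). snd z < u (fst z)}"])
         (auto simp: indicator_def)
  qed
  have "(\<integral>\<^sup>+x. X x * ennreal (u x powr \<theta>) \<partial>M) =
        (\<integral>\<^sup>+x. (\<integral>\<^sup>+t. X x * (?k t * indicator {0<..} t * indicator {x. t < u x} x) \<partial>lborel) \<partial>M)"
  proof (intro nn_integral_cong)
    fix x assume x: "x \<in> space M"
    have "X x * ennreal (u x powr \<theta>) = X x * (\<integral>\<^sup>+t. ?k t * indicator {0<..<u x} t \<partial>lborel)"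
      using nn_integral_powr_below[OF \<open>\<theta> > 0\<close> u[OF x]] by simp
    also have "\<dots> = (\<integral>\<^sup>+t. X x * (?k t * indicator {0<..<u x} t) \<partial>lborel)"
      by (subst nn_integral_cmult) auto
    also have "\<dots> = (\<integral>\<^sup>+t. X x * (?k t * indicator {0<..} t * indicator {x. t < u x} x) \<partial>lborel)"
      by (intro nn_integral_cong) (auto simp: indicator_def)
    finally show "X x * ennreal (u x powr \<theta>) = \<dots>" .
  qed
  also have "\<dots> = (\<integral>\<^sup>+t. (\<integral>\<^sup>+x. X x * (?k t * indicator {0<..} t * indicator {x. t < u x} x) \<partial>M) \<partial>lborel)"
    by (rule Fubini'[symmetric]) measurable
  also have "\<dots> = (\<integral>\<^sup>+t. ?k t * indicator {0<..} t *
            (\<integral>\<^sup>+x. X x * indicator {x. t < u x} x \<partial>M) \<partial>lborel)"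
  proof (intro nn_integral_cong)
    fix t :: real
    have [measurable]: "(\<lambda>x. indicator {x. t < u x} x :: ennreal) \<in> borel_measurable M"
      by (subst measurable_cong[where g = "indicator {x \<in> space M. t < u x}"]) (auto simp: indicator_def)
    show "(\<integral>\<^sup>+x. X x * (?k t * indicator {0<..} t * indicator {x. t < u x} x) \<partial>M)
      = ?k t * indicator {0<..} t * (\<integral>\<^sup>+x. X x * indicator {x. t < u x} x \<partial>M)"
      by (subst nn_integral_cmult[symmetric]) (auto simp: ac_simps)
  qed
  finally show ?thesis .
qed

text \<open>Hoelder's inequality in the form that fits means over cubes: no conjugate exponents, and the
  two integrals are given as real numbers. After normalization it is the integrated Young inequality.\<close>

lemma nn_integral_Holder_powr:
  fixes f g :: "'a \<Rightarrow> real"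
  assumes [measurable]: "f \<in> borel_measurable M" "g \<in> borel_measurable M"
    and pos: "\<And>x. f x \<ge> 0" "\<And>x. g x \<ge> 0"
    and \<theta>: "0 < \<theta>" "\<theta> < 1"
    and F: "(\<integral>\<^sup>+x. ennreal (f x) \<partial>M) = ennreal F" "F \<ge> 0"
    and G: "(\<integral>\<^sup>+x. ennreal (g x) \<partial>M) = ennreal G" "G \<ge> 0"
  shows "(\<integral>\<^sup>+x. ennreal (f x powr \<theta> * g x powr (1 - \<theta>)) \<partial>M) \<le> ennreal (F powr \<theta> * G powr (1 - \<theta>))"
proof (cases "F = 0 \<or> G = 0")
  case True
  then have "AE x in M. f x = 0 \<or> g x = 0"
  proof (rule disjE)
    assume "F = 0"
    then have "AE x in M. ennreal (f x) = 0" using F by (subst nn_integral_0_iff_AE[symmetric]) auto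
    then show ?thesis by eventually_elim (use pos(1) in \<open>simp add: order_antisym\<close>)
  next
    assume "G = 0"
    then have "AE x in M. ennreal (g x) = 0" using G by (subst nn_integral_0_iff_AE[symmetric]) auto
    then show ?thesis by eventually_elim (use pos(2) in \<open>simp add: order_antisym\<close>)
  qed
  then have "(\<integral>\<^sup>+x. ennreal (f x powr \<theta> * g x powr (1 - \<theta>)) \<partial>M) = (\<integral>\<^sup>+x. 0 \<partial>M)"
    by (intro nn_integral_cong_AE, eventually_elim) auto
  then show ?thesis by simp
next
  case False
  then have FG: "F > 0" "G > 0" using F G by auto
  define K where "K = F powr \<theta> * G powr (1 - \<theta>)"
  have K: "K > 0" using FG by (simp add: K_def)
  have young: "f x powr \<theta> * g x powr (1 - \<theta>) \<le> K * (\<theta> / F) * f x + K * ((1 - \<theta>) / G) * g x" for x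
  proof (cases "f x = 0 \<or> g x = 0")
    case True
    then show ?thesis using pos[of x] \<theta> FG K by auto
  next
    case False
    then have "(f x / F) powr \<theta> * (g x / G) powr (1 - \<theta>) \<le> \<theta> * (f x / F) + (1 - \<theta>) * (g x / G)"
      using pos[of x] \<theta> FG by (intro Youngs_inequality_0) (auto simp: less_le)
    then have "K * ((f x / F) powr \<theta> * (g x / G) powr (1 - \<theta>)) \<le> K * (\<theta> * (f x / F) + (1 - \<theta>) * (g x / G))"
      using K by (intro mult_left_mono) auto
    moreover have "K * ((f x / F) powr \<theta> * (g x / G) powr (1 - \<theta>)) = f x powr \<theta> * g x powr (1 - \<theta>)"
      using FG pos by (simp add: K_def powr_divide field_simps)
    ultimately show ?thesis by (simp add: field_simps)
  qed
  have "(\<integral>\<^sup>+x. ennreal (f x powr \<theta> * g x powr (1 - \<theta>)) \<partial>M)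
      \<le> (\<integral>\<^sup>+x. ennreal (K * (\<theta> / F)) * ennreal (f x) + ennreal (K * ((1 - \<theta>) / G)) * ennreal (g x) \<partial>M)"
    using young pos \<theta> K FG
    by (intro nn_integral_mono) (simp add: ennreal_plus[symmetric] ennreal_mult[symmetric] del: ennreal_plus)
  also have "\<dots> = ennreal (K * (\<theta> / F)) * ennreal F + ennreal (K * ((1 - \<theta>) / G)) * ennreal G"
    by (simp add: nn_integral_add nn_integral_cmult F G)
  also have "\<dots> = ennreal K"
    using FG \<theta> K by (simp add: ennreal_mult[symmetric] ennreal_plus[symmetric] field_simps del: ennreal_plus)
  finally show ?thesis by (simp add: K_def)
qed

lemma sigma_finite_lebesgue: "sigma_finite_measure (lebesgue :: 'a::euclidean_space measure)"
proof
  define A where "A = range (\<lambda>n::nat. cball (0::'a) (real n))"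
  have "\<exists>a\<in>A. x \<in> a" for x :: 'a
    using real_arch_simple[of "norm x"] by (auto simp: A_def)
  then have "\<Union>A = space (lebesgue :: 'a measure)" by auto
  moreover have "\<forall>a\<in>A. emeasure lebesgue a \<noteq> \<infinity>"
    using fmeasurableD2[OF lmeasurable_cball] by (auto simp: A_def)
  moreover have "countable A" "A \<subseteq> sets lebesgue" by (auto simp: A_def)
  ultimately show "\<exists>A. countable A \<and> A \<subseteq> sets lebesgue \<and> \<Union>A = space (lebesgue :: 'a measure)
      \<and> (\<forall>a\<in>A. emeasure lebesgue a \<noteq> \<infinity>)"
    by (intro exI[of _ A] conjI)
qed

section \<open>Cubes and the weak type of averages\<close>

text \<open>The faces of a cube form a null set, so the measure-theoretic facts about cubes follow from
  those about the open and the closed box.\<close>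

lemma cube_between_boxes:
  fixes Q :: "(real ^ 'n) set"
  assumes "cube l Q"
  obtains a :: "real ^ 'n" where "l > 0" "box a (\<chi> i. a $ i + l) \<subseteq> Q" "Q \<subseteq> cbox a (\<chi> i. a $ i + l)"
proof -
  obtain a I where l: "l > 0" and I: "\<And>i. {a $ i <..< a $ i + l} \<subseteq> I i" "\<And>i. I i \<subseteq> {a $ i .. a $ i + l}"
    and Q: "Q = {x :: real ^ 'n. \<forall>i. x $ i \<in> I i}"
    using assms unfolding cube_def by blast
  show ?thesis
  proof (rule that[of a])
    show "box a (\<chi> i. a $ i + l) \<subseteq> Q"
      using I(1) by (force simp: Q mem_box_cart)
    show "Q \<subseteq> cbox a (\<chi> i. a $ i + l)"
      using I(2) by (force simp: Q mem_box_cart)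
  qed (fact l)
qed

lemma measure_box_side:
  fixes a :: "real ^ 'n"
  assumes "l > 0"
  shows "measure lebesgue (cbox a (\<chi> i. a $ i + l)) = l ^ CARD('n)"
    and "measure lebesgue (box a (\<chi> i. a $ i + l)) = l ^ CARD('n)"
proof -
  have "cbox a (\<chi> i. a $ i + l) \<noteq> {}"
    using assms by (simp add: interval_ne_empty_cart(1) less_imp_le)
  then show "measure lebesgue (cbox a (\<chi> i. a $ i + l)) = l ^ CARD('n)"
    using content_cbox_cart[of a "\<chi> i. a $ i + l"] by (simp add: measure_completion)
  then show "measure lebesgue (box a (\<chi> i. a $ i + l)) = l ^ CARD('n)"
    by (simp add: measure_completion measure_lborel_box_eq measure_lborel_cbox_eq flip: box_ne_empty)
qed

lemma cube_measure:
  fixes Q :: "(real ^ 'n) set"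
  assumes "cube l Q"
  shows "Q \<in> lmeasurable" "measure lebesgue Q = l ^ CARD('n)" "l > 0"
proof -
  obtain a where a: "l > 0" "box a (\<chi> i. a $ i + l) \<subseteq> Q" "Q \<subseteq> cbox a (\<chi> i. a $ i + l)"
    by (rule cube_between_boxes[OF assms])
  show "l > 0" by fact
  have neg: "negligible (Q - box a (\<chi> i. a $ i + l))"
    by (rule negligible_subset[OF negligible_frontier_interval]) (use a in blast)
  have "Q = box a (\<chi> i. a $ i + l) \<union> (Q - box a (\<chi> i. a $ i + l))" using a by blast
  moreover have "box a (\<chi> i. a $ i + l) \<union> (Q - box a (\<chi> i. a $ i + l)) \<in> lmeasurable"
    by (intro fmeasurable.Un negligible_imp_measurable neg lmeasurable_box)
  ultimately show Q: "Q \<in> lmeasurable" by simp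
  have "measure lebesgue Q \<le> l ^ CARD('n)"
    using measure_mono_fmeasurable[of Q "cbox a (\<chi> i. a $ i + l)" lebesgue] a Q measure_box_side(1)[OF a(1), of a] by (simp add: fmeasurableD)
  moreover have "measure lebesgue Q \<ge> l ^ CARD('n)"
    using measure_mono_fmeasurable[of "box a (\<chi> i. a $ i + l)" Q lebesgue] a Q measure_box_side(2)[OF a(1), of a] by (simp add: fmeasurableD)
  ultimately show "measure lebesgue Q = l ^ CARD('n)" by simp
qed

lemma cube_emeasure:
  fixes Q :: "(real ^ 'n) set"
  assumes "cube l Q"
  shows "emeasure lebesgue Q = ennreal (l ^ CARD('n))"
  using cube_measure[OF assms] emeasure_eq_measure2[of Q lebesgue] by simp

lemma cubes_measure:
  assumes "Q \<in> cubes"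
  shows "Q \<in> lmeasurable" "Q \<in> sets lebesgue" "measure lebesgue Q > 0"
    "emeasure lebesgue Q = ennreal (measure lebesgue Q)"
proof -
  obtain l where l: "cube l Q" using assms by (auto simp: cubes_def)
  show "Q \<in> lmeasurable" "Q \<in> sets lebesgue" "measure lebesgue Q > 0"
    using cube_measure[OF l] by (auto simp: fmeasurableD)
  show "emeasure lebesgue Q = ennreal (measure lebesgue Q)"
    using cube_measure(1)[OF l] emeasure_eq_measure2 by blast
qed

lemma cube_subset_ball:
  fixes Q :: "(real ^ 'n) set"
  assumes "cube l Q" "x \<in> Q"
  shows "Q \<subseteq> ball x (2 * real CARD('n) * l)"
proof
  fix y assume y: "y \<in> Q"
  obtain a where a: "l > 0" "Q \<subseteq> cbox a (\<chi> i. a $ i + l)"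
    using cube_between_boxes[OF assms(1)] by metis
  have "\<bar>(x - y) $ i\<bar> \<le> l" for i
  proof -
    have "x \<in> cbox a (\<chi> i. a $ i + l)" "y \<in> cbox a (\<chi> i. a $ i + l)" using a(2) assms(2) y by auto
    then have "a $ i \<le> x $ i" "x $ i \<le> a $ i + l" "a $ i \<le> y $ i" "y $ i \<le> a $ i + l"
      unfolding mem_box_cart by (metis vec_lambda_beta)+
    then show ?thesis by simp
  qed
  then have "dist x y \<le> (\<Sum>i::'n\<in>UNIV. l)"
    unfolding dist_norm by (intro order_trans[OF norm_le_l1_cart] sum_mono)
  also have "\<dots> < 2 * real CARD('n) * l" using a(1) by simp
  finally show "y \<in> ball x (2 * real CARD('n) * l)" by simp
qed

text \<open>The volume of a ball of radius \<open>2 n l\<close> divided by the volume of a cube of side \<open>l\<close>.\<close>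

definition ball_cube_ratio :: "nat \<Rightarrow> real" where
  "ball_cube_ratio n = unit_ball_vol n * (2 * real n) ^ n"

lemma ball_cube_ratio_pos: "n > 0 \<Longrightarrow> ball_cube_ratio n > 0"
  by (simp add: ball_cube_ratio_def)

text \<open>Where the maximal function over balls exceeds \<open>t\<close>. As a union of open balls the set is open, whatever
  the function \<open>G\<close>.\<close>

definition superlevel :: "(real ^ 'n \<Rightarrow> ennreal) \<Rightarrow> real \<Rightarrow> (real ^ 'n) set" where
  "superlevel G t = (\<Union>{ball c r | c r. 0 < r \<and>
     ennreal t * emeasure lebesgue (ball c r) < (\<integral>\<^sup>+x\<in>ball c r. G x \<partial>lebesgue)})"

lemma open_superlevel: "open (superlevel G t)"
  unfolding superlevel_def by (intro open_Union) auto

lemma sets_superlevel [measurable]: "superlevel G t \<in> sets lebesgue"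
  using open_superlevel[of G t] by (simp add: borel_open)

lemma emeasure_ball_lebesgue:
  fixes c :: "real ^ 'n"
  assumes "r \<ge> 0"
  shows "emeasure lebesgue (ball c r) = ennreal (unit_ball_vol (real CARD('n)) * r ^ CARD('n))"
    "emeasure lebesgue (cball c r) = ennreal (unit_ball_vol (real CARD('n)) * r ^ CARD('n))"
    "emeasure lborel (ball c r) = ennreal (unit_ball_vol (real CARD('n)) * r ^ CARD('n))"
    "emeasure lborel (cball c r) = ennreal (unit_ball_vol (real CARD('n)) * r ^ CARD('n))"
  using emeasure_ball[OF assms, of c] emeasure_cball[OF assms, of c] by simp_all

text \<open>The weak type (1,1) bound of the maximal function by the Vitali covering lemma. The balls that
  make up the set have bounded radii, as their volume is at most the integral of \<open>G\<close> divided by \<open>t\<close>;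
  a disjoint subfamily, enlarged five times, covers the set.\<close>

lemma superlevel_weak_type:
  fixes G :: "real ^ 'n \<Rightarrow> ennreal"
  assumes [measurable]: "G \<in> borel_measurable lebesgue" and t: "t > 0"
  shows "emeasure lebesgue (superlevel G t) \<le> ennreal (5 ^ CARD('n) / t) * (\<integral>\<^sup>+x. G x \<partial>lebesgue)"
proof (cases "(\<integral>\<^sup>+x. G x \<partial>lebesgue) = \<infinity>")
  case True
  then show ?thesis using t by (simp add: ennreal_mult_top)
next
  case False
  then obtain I where I: "(\<integral>\<^sup>+x. G x \<partial>lebesgue) = ennreal I" "I \<ge> 0"
    by (cases "\<integral>\<^sup>+x. G x \<partial>lebesgue") auto
  let ?n = "CARD('n)" and ?\<nu> = "density lebesgue G"
  define V where "V = unit_ball_vol (real ?n)"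
  have V: "V > 0" by (simp add: V_def)
  define K where "K = {(c::real^'n, r). 0 < r \<and>
     ennreal t * emeasure lebesgue (ball c r) < (\<integral>\<^sup>+x\<in>ball c r. G x \<partial>lebesgue)}"
  have rad: "0 < snd i \<and> snd i \<le> max 1 (I / (t * V))" if "i \<in> K" for i
  proof -
    obtain c r where i: "i = (c, r)" by fastforce
    have r: "r > 0" "ennreal t * emeasure lebesgue (ball c r) < (\<integral>\<^sup>+x\<in>ball c r. G x \<partial>lebesgue)"
      using that by (auto simp: K_def i)
    have "(\<integral>\<^sup>+x\<in>ball c r. G x \<partial>lebesgue) \<le> ennreal I"
      unfolding I(1)[symmetric] by (intro nn_integral_mono) (simp add: indicator_def)
    with r have "ennreal (t * (V * r ^ ?n)) < ennreal I"
      using t V by (simp add: emeasure_ball_lebesgue V_def ennreal_mult mult.assoc)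
    then have "t * (V * r ^ ?n) < I" using I t V r by (simp add: ennreal_less_iff)
    then have "r ^ ?n < I / (t * V)" using t V by (simp add: field_simps)
    moreover have "r \<le> r ^ ?n" if "r \<ge> 1" using that self_le_power[of r ?n] by simp
    ultimately have "r \<le> max 1 (I / (t * V))" by linarith
    then show ?thesis using r by (simp add: i)
  qed
  have cov: "superlevel G t \<subseteq> (\<Union>i\<in>K. cball (fst i) (snd i))"
  proof
    fix x assume "x \<in> superlevel G t"
    then obtain c r where "(c, r) \<in> K" "x \<in> ball c r" by (auto simp: superlevel_def K_def)
    then show "x \<in> (\<Union>i\<in>K. cball (fst i) (snd i))" by (intro UN_I[of "(c, r)"]) auto
  qed
  obtain C where C: "countable C" "C \<subseteq> K"
     "pairwise (\<lambda>i j. disjnt (cball (fst i) (snd i)) (cball (fst j) (snd j))) C"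
     and sub: "superlevel G t \<subseteq> (\<Union>i\<in>C. cball (fst i) (5 * snd i))"
    using Vitali_covering_lemma_cballs[OF cov rad] by blast
  have "emeasure lebesgue (superlevel G t) = (\<integral>\<^sup>+x. indicator (superlevel G t) x \<partial>lebesgue)"
    by (simp add: nn_integral_indicator[OF sets_superlevel])
  also have "\<dots> \<le> (\<integral>\<^sup>+x. \<integral>\<^sup>+i. indicator (cball (fst i) (5 * snd i)) x \<partial>count_space C \<partial>lebesgue)"
  proof (intro nn_integral_mono)
    fix x :: "real ^ 'n"
    show "indicator (superlevel G t) x \<le> (\<integral>\<^sup>+i. indicator (cball (fst i) (5 * snd i)) x \<partial>count_space C :: ennreal)"
    proof (cases "x \<in> superlevel G t")
      case True
      then obtain i where i: "i \<in> C" "x \<in> cball (fst i) (5 * snd i)" using sub by blast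
      have "(1::ennreal) = (\<integral>\<^sup>+j. indicator {i} j \<partial>count_space C)"
        using i by (simp add: nn_integral_count_space_indicator)
      also have "\<dots> \<le> (\<integral>\<^sup>+i. indicator (cball (fst i) (5 * snd i)) x \<partial>count_space C)"
        using i by (intro nn_integral_mono) (auto simp: indicator_def)
      finally show ?thesis using True by simp
    qed simp
  qed
  also have "\<dots> = (\<integral>\<^sup>+i. \<integral>\<^sup>+x. indicator (cball (fst i) (5 * snd i)) x \<partial>lebesgue \<partial>count_space C)"
    by (intro nn_integral_count_space_nn_integral C borel_measurable_indicator) simp
  also have "\<dots> \<le> (\<integral>\<^sup>+i. ennreal (5 ^ ?n / t) * emeasure ?\<nu> (ball (fst i) (snd i)) \<partial>count_space C)"
  proof (intro nn_integral_mono)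
    fix i assume "i \<in> space (count_space C)"
    then have i: "i \<in> K" using C by auto
    obtain c r where ci: "i = (c, r)" by fastforce
    have r: "r > 0" "ennreal t * emeasure lebesgue (ball c r) < (\<integral>\<^sup>+x\<in>ball c r. G x \<partial>lebesgue)"
      using i by (auto simp: K_def ci)
    have "(\<integral>\<^sup>+x. indicator (cball c (5 * r)) x \<partial>lebesgue) = ennreal (5 ^ ?n / t) * (ennreal t * emeasure lebesgue (ball c r))"
      using r(1) t by (simp add: emeasure_ball_lebesgue ennreal_mult[symmetric] power_mult_distrib)
    also have "\<dots> \<le> ennreal (5 ^ ?n / t) * (\<integral>\<^sup>+x\<in>ball c r. G x \<partial>lebesgue)"
      using r(2) by (intro mult_left_mono) auto
    finally show "(\<integral>\<^sup>+x. indicator (cball (fst i) (5 * snd i)) x \<partial>lebesgue) \<le> ennreal (5 ^ ?n / t) * emeasure ?\<nu> (ball (fst i) (snd i))"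
      by (simp add: ci emeasure_density)
  qed
  also have "\<dots> = ennreal (5 ^ ?n / t) * (\<integral>\<^sup>+i. emeasure ?\<nu> (ball (fst i) (snd i)) \<partial>count_space C)"
    by (simp add: nn_integral_cmult)
  also have "(\<integral>\<^sup>+i. emeasure ?\<nu> (ball (fst i) (snd i)) \<partial>count_space C) = emeasure ?\<nu> (\<Union>i\<in>C. ball (fst i) (snd i))"
  proof (rule emeasure_UN_countable[symmetric])
    show "disjoint_family_on (\<lambda>i. ball (fst i) (snd i)) C"
      using C(3) ball_subset_cball unfolding disjoint_family_on_def pairwise_def disjnt_def by blast
  qed (use C in auto)
  also have "\<dots> \<le> (\<integral>\<^sup>+x. G x \<partial>lebesgue)"
  proof -
    have "(\<Union>i\<in>C. ball (fst i) (snd i)) \<in> sets lebesgue" by (intro lmeasurable_ball sets.countable_UN'' C) auto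
    then show ?thesis by (subst emeasure_density) (auto intro!: nn_integral_mono simp: indicator_def)
  qed
  finally show ?thesis by (simp add: mult_left_mono)
qed

text \<open>Transfer from cubes to balls: a cube is contained in a comparable ball around each of its points.\<close>

lemma cube_subset_superlevel:
  fixes G :: "real ^ 'n \<Rightarrow> ennreal"
  assumes "Q \<in> cubes" "t \<ge> 0"
    and "ennreal (ball_cube_ratio CARD('n) * t) * emeasure lebesgue Q < (\<integral>\<^sup>+x\<in>Q. G x \<partial>lebesgue)"
  shows "Q \<subseteq> superlevel G t"
proof
  fix x assume x: "x \<in> Q"
  obtain l where l: "cube l Q" using assms by (auto simp: cubes_def)
  let ?n = "CARD('n)" and ?r = "2 * real CARD('n) * l"
  have "l > 0" by (rule cube_measure(3)[OF l])
  then have "?r \<ge> 0" by simp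
  have "ennreal t * emeasure lebesgue (ball x ?r) = ennreal (ball_cube_ratio ?n * t) * emeasure lebesgue Q"
    unfolding emeasure_ball_lebesgue(1)[OF \<open>?r \<ge> 0\<close>, of x]
    using assms(2) \<open>l > 0\<close> by (simp add: cube_emeasure[OF l] ennreal_mult[symmetric] ball_cube_ratio_def power_mult_distrib ac_simps del: emeasure_completion)
  also have "\<dots> < (\<integral>\<^sup>+x\<in>Q. G x \<partial>lebesgue)" by fact
  also have "\<dots> \<le> (\<integral>\<^sup>+y\<in>ball x ?r. G y \<partial>lebesgue)"
    using cube_subset_ball[OF l x] by (intro nn_integral_mono) (auto simp: indicator_def)
  finally show "x \<in> superlevel G t"
    using \<open>l > 0\<close> unfolding superlevel_def by (intro UnionI[of "ball x ?r"]) (auto intro!: exI)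
qed

section \<open>Powers of functions with a weak type bound\<close>

lemma nn_integral_indicator_superlevel:
  fixes u :: "'a \<Rightarrow> real"
  assumes [measurable]: "u \<in> borel_measurable M"
  shows "(\<integral>\<^sup>+x. 1 * indicator {x. t < u x} x \<partial>M) = emeasure M {x \<in> space M. t < u x}"
proof -
  have "(\<integral>\<^sup>+x. 1 * indicator {x. t < u x} x \<partial>M) = (\<integral>\<^sup>+x. indicator {x \<in> space M. t < u x} x \<partial>M)"
    by (intro nn_integral_cong) (simp add: indicator_def)
  also have "\<dots> = emeasure M {x \<in> space M. t < u x}"
    by (rule nn_integral_indicator) measurable
  finally show ?thesis .
qed

text \<open>A bounded function of weak type one has finite integrals of powers \<open>1 + \<delta>\<close>, and the price of
  a small \<open>\<delta>\<close> is the first power of \<open>1 / \<delta>\<close>. This single factor is the one that becomes the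
  \<open>A\<^sub>\<infinity>\<close> constant in the main theorem.\<close>

lemma nn_integral_powr_of_weak_type:
  fixes u :: "'a \<Rightarrow> real"
  assumes "sigma_finite_measure M" and [measurable]: "u \<in> borel_measurable M"
    and u: "\<And>x. x \<in> space M \<Longrightarrow> 0 \<le> u x" "\<And>x. x \<in> space M \<Longrightarrow> u x \<le> b" and "b > 0" "\<delta> > 0" "W \<ge> 0"
    and weak: "\<And>t. t > 0 \<Longrightarrow> emeasure M {x \<in> space M. t < u x} \<le> ennreal (W / t)"
  shows "(\<integral>\<^sup>+x. ennreal (u x powr (1 + \<delta>)) \<partial>M) \<le> ennreal (W * b powr \<delta> * (1 + \<delta>) / \<delta>)"
proof -
  have "(\<integral>\<^sup>+x. ennreal (u x powr (1 + \<delta>)) \<partial>M) = (\<integral>\<^sup>+x. 1 * ennreal (u x powr (1 + \<delta>)) \<partial>M)" by simp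
  also have "\<dots> = (\<integral>\<^sup>+t. ennreal ((1 + \<delta>) * t powr (1 + \<delta> - 1)) * indicator {0<..} t *
            (\<integral>\<^sup>+x. 1 * indicator {x. t < u x} x \<partial>M) \<partial>lborel)"
    using assms by (intro layer_cake) auto
  also have "\<dots> \<le> (\<integral>\<^sup>+t. ennreal (W * (1 + \<delta>) / \<delta>) * (ennreal (\<delta> * t powr (\<delta> - 1)) * indicator {0<..<b} t) \<partial>lborel)"
  proof (intro nn_integral_mono)
    fix t :: real
    note 1 = nn_integral_indicator_superlevel[OF assms(2), of t]
    consider "t \<le> 0" | "t \<ge> b" | "0 < t" "t < b" by linarith
    then show "ennreal ((1 + \<delta>) * t powr (1 + \<delta> - 1)) * indicator {0<..} t * (\<integral>\<^sup>+x. 1 * indicator {x. t < u x} x \<partial>M)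
      \<le> ennreal (W * (1 + \<delta>) / \<delta>) * (ennreal (\<delta> * t powr (\<delta> - 1)) * indicator {0<..<b} t)"
    proof cases
      case 2
      then have "{x \<in> space M. t < u x} = {}" using u by force
      then show ?thesis by (simp only: 1) simp
    next
      case 3
      have "ennreal ((1 + \<delta>) * t powr \<delta>) * emeasure M {x \<in> space M. t < u x} \<le> ennreal ((1 + \<delta>) * t powr \<delta>) * ennreal (W / t)"
        by (intro mult_left_mono weak 3) auto
      also have "\<dots> = ennreal (W * (1 + \<delta>) / \<delta>) * ennreal (\<delta> * t powr (\<delta> - 1))"
      proof -
        have "t powr (\<delta> - 1) = t powr \<delta> / t" using 3 by (subst powr_diff) simp
        then have "W * (1 + \<delta>) / \<delta> * (\<delta> * t powr (\<delta> - 1)) = (1 + \<delta>) * t powr \<delta> * (W / t)"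
          using assms 3 by simp
        then show ?thesis using assms 3 by (simp add: ennreal_mult[symmetric] del: times_divide_eq_left times_divide_eq_right)
      qed
      finally show ?thesis using 3 by (simp only: 1) simp
    qed simp
  qed
  also have "\<dots> = ennreal (W * (1 + \<delta>) / \<delta>) * ennreal (b powr \<delta>)"
    using assms by (subst nn_integral_cmult) (auto simp: nn_integral_powr_below)
  also have "\<dots> = ennreal (W * b powr \<delta> * (1 + \<delta>) / \<delta>)"
    using assms by (simp add: ennreal_mult[symmetric] field_simps)
  finally show ?thesis .
qed

lemma measurable_nn_integral_superlevel:
  fixes u :: "'a \<Rightarrow> real" and X :: "'a \<Rightarrow> ennreal"
  assumes "sigma_finite_measure M" and [measurable]: "X \<in> borel_measurable M" "u \<in> borel_measurable M"
  shows "(\<lambda>t. \<integral>\<^sup>+x. X x * indicator {x. t < u x} x \<partial>M) \<in> borel_measurable lborel"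
proof -
  interpret pair_sigma_finite lborel M
    using assms(1) sigma_finite_lborel by (simp add: pair_sigma_finite_def)
  have "(\<lambda>t. \<integral>\<^sup>+x. X x * indicator {z \<in> space (lborel \<Otimes>\<^sub>M M). fst z < u (snd z)} (t, x) \<partial>M) \<in> borel_measurable lborel"
    by measurable
  moreover have "(\<integral>\<^sup>+x. X x * indicator {z \<in> space (lborel \<Otimes>\<^sub>M M). fst z < u (snd z)} (t, x) \<partial>M)
      = (\<integral>\<^sup>+x. X x * indicator {x. t < u x} x \<partial>M)" for t
    by (intro nn_integral_cong) (auto simp: indicator_def space_pair_measure)
  ultimately show ?thesis by simp
qed

text \<open>Integrated form of a comparison of level sets that is known only above the height \<open>b\<close>; the
  heights below \<open>b\<close> contribute the first summand. The factor \<open>\<epsilon>\<close> in front of the second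
  summand is what makes the absorption in the reverse Hoelder inequality work.\<close>

lemma nn_integral_powr_of_superlevel_le:
  fixes u :: "'a \<Rightarrow> real" and X Y :: "'a \<Rightarrow> ennreal"
  assumes M: "sigma_finite_measure M"
    and [measurable]: "X \<in> borel_measurable M" "Y \<in> borel_measurable M" "u \<in> borel_measurable M"
    and u: "\<And>x. x \<in> space M \<Longrightarrow> u x \<ge> 0" and pos: "\<epsilon> > 0" "b \<ge> 0" "D \<ge> 0"
    and le: "\<And>t. t > 0 \<Longrightarrow> t \<ge> b \<Longrightarrow> (\<integral>\<^sup>+x. X x * indicator {x. t < u x} x \<partial>M)
                  \<le> ennreal (D * t) * (\<integral>\<^sup>+x. Y x * indicator {x. t < u x} x \<partial>M)"
  shows "(\<integral>\<^sup>+x. X x * ennreal (u x powr \<epsilon>) \<partial>M) \<le> ennreal (b powr \<epsilon>) * (\<integral>\<^sup>+x. X x \<partial>M)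
           + ennreal (D * \<epsilon> / (1 + \<epsilon>)) * (\<integral>\<^sup>+x. Y x * ennreal (u x powr (1 + \<epsilon>)) \<partial>M)"
proof -
  let ?X = "\<lambda>t. \<integral>\<^sup>+x. X x * indicator {x. t < u x} x \<partial>M"
  let ?Y = "\<lambda>t. \<integral>\<^sup>+x. Y x * indicator {x. t < u x} x \<partial>M"
  let ?D = "ennreal (D * \<epsilon> / (1 + \<epsilon>))"
  note [measurable] = measurable_nn_integral_superlevel[OF M assms(2,4)] measurable_nn_integral_superlevel[OF M assms(3,4)]
  have "(\<integral>\<^sup>+x. X x * ennreal (u x powr \<epsilon>) \<partial>M) = (\<integral>\<^sup>+t. ennreal (\<epsilon> * t powr (\<epsilon> - 1)) * indicator {0<..} t * ?X t \<partial>lborel)"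
    using assms by (intro layer_cake) auto
  also have "\<dots> \<le> (\<integral>\<^sup>+t. (ennreal (\<epsilon> * t powr (\<epsilon> - 1)) * indicator {0<..<b} t) * (\<integral>\<^sup>+x. X x \<partial>M)
      + ?D * (ennreal ((1 + \<epsilon>) * t powr (1 + \<epsilon> - 1)) * indicator {0<..} t * ?Y t) \<partial>lborel)"
  proof (intro nn_integral_mono)
    fix t :: real
    consider "t \<le> 0" | "0 < t" "t < b" | "t > 0" "t \<ge> b" by linarith
    then show "ennreal (\<epsilon> * t powr (\<epsilon> - 1)) * indicator {0<..} t * ?X t
      \<le> (ennreal (\<epsilon> * t powr (\<epsilon> - 1)) * indicator {0<..<b} t) * (\<integral>\<^sup>+x. X x \<partial>M)
      + ?D * (ennreal ((1 + \<epsilon>) * t powr (1 + \<epsilon> - 1)) * indicator {0<..} t * ?Y t)"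
    proof cases
      case 2
      have "?X t \<le> (\<integral>\<^sup>+x. X x \<partial>M)" by (intro nn_integral_mono) (simp add: indicator_def)
      then show ?thesis using 2 by (intro add_increasing2) (auto intro: mult_left_mono)
    next
      case 3
      have "\<epsilon> * t powr (\<epsilon> - 1) * (D * t) = D * \<epsilon> / (1 + \<epsilon>) * ((1 + \<epsilon>) * t powr (1 + \<epsilon> - 1))"
      proof -
        have "t powr (\<epsilon> - 1) = t powr \<epsilon> / t" using 3 by (subst powr_diff) simp
        then show ?thesis using pos 3 by simp
      qed
      then have e: "ennreal (\<epsilon> * t powr (\<epsilon> - 1)) * ennreal (D * t) = ?D * ennreal ((1 + \<epsilon>) * t powr (1 + \<epsilon> - 1))"
        using pos 3 by (simp add: ennreal_mult[symmetric] del: times_divide_eq_left)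
      have "ennreal (\<epsilon> * t powr (\<epsilon> - 1)) * ?X t \<le> ennreal (\<epsilon> * t powr (\<epsilon> - 1)) * (ennreal (D * t) * ?Y t)"
        by (intro mult_left_mono le 3) simp
      also have "\<dots> = ?D * (ennreal ((1 + \<epsilon>) * t powr (1 + \<epsilon> - 1)) * ?Y t)"
        by (simp only: mult.assoc[symmetric] e)
      finally show ?thesis using 3 by simp
    qed simp
  qed
  also have "\<dots> = (\<integral>\<^sup>+t. ennreal (\<epsilon> * t powr (\<epsilon> - 1)) * indicator {0<..<b} t \<partial>lborel) * (\<integral>\<^sup>+x. X x \<partial>M)
      + ?D * (\<integral>\<^sup>+t. ennreal ((1 + \<epsilon>) * t powr (1 + \<epsilon> - 1)) * indicator {0<..} t * ?Y t \<partial>lborel)"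
    by (simp add: nn_integral_add nn_integral_multc nn_integral_cmult)
  also have "(\<integral>\<^sup>+t. ennreal (\<epsilon> * t powr (\<epsilon> - 1)) * indicator {0<..<b} t \<partial>lborel) = ennreal (b powr \<epsilon>)"
    by (rule nn_integral_powr_below) fact+
  also have "(\<integral>\<^sup>+t. ennreal ((1 + \<epsilon>) * t powr (1 + \<epsilon> - 1)) * indicator {0<..} t * ?Y t \<partial>lborel)
     = (\<integral>\<^sup>+x. Y x * ennreal (u x powr (1 + \<epsilon>)) \<partial>M)"
    using assms by (intro layer_cake[symmetric]) auto
  finally show ?thesis .
qed

text \<open>Marcinkiewicz interpolation with the trivial bound at infinity, which is built into the truncation.\<close>

lemma nn_integral_powr_of_truncated_weak_type:
  fixes u G :: "'a \<Rightarrow> real"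
  assumes "sigma_finite_measure M" and [measurable]: "u \<in> borel_measurable M" "G \<in> borel_measurable M"
    and u: "\<And>x. x \<in> space M \<Longrightarrow> 0 \<le> u x" "\<And>x. x \<in> space M \<Longrightarrow> 0 \<le> G x" and "A \<ge> 0" "B > 0" "\<tau> > 1"
    and weak: "\<And>t. t > 0 \<Longrightarrow> emeasure M {x \<in> space M. t < u x}
                  \<le> ennreal (A / t) * (\<integral>\<^sup>+x. ennreal (G x) * indicator {x. t < B * G x} x \<partial>M)"
  shows "(\<integral>\<^sup>+x. ennreal (u x powr \<tau>) \<partial>M)
     \<le> ennreal (A * \<tau> / (\<tau> - 1) * B powr (\<tau> - 1)) * (\<integral>\<^sup>+x. ennreal (G x powr \<tau>) \<partial>M)"
proof -
  have "(\<integral>\<^sup>+x. ennreal (u x powr \<tau>) \<partial>M) = (\<integral>\<^sup>+x. 1 * ennreal (u x powr \<tau>) \<partial>M)" by simp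
  also have "\<dots> = (\<integral>\<^sup>+t. ennreal (\<tau> * t powr (\<tau> - 1)) * indicator {0<..} t *
            (\<integral>\<^sup>+x. 1 * indicator {x. t < u x} x \<partial>M) \<partial>lborel)"
    using assms by (intro layer_cake) auto
  also have "\<dots> \<le> (\<integral>\<^sup>+t. ennreal (A * \<tau> / (\<tau> - 1)) * (ennreal ((\<tau> - 1) * t powr (\<tau> - 1 - 1)) * indicator {0<..} t *
      (\<integral>\<^sup>+x. ennreal (G x) * indicator {x. t < B * G x} x \<partial>M)) \<partial>lborel)"
  proof (intro nn_integral_mono)
    fix t :: real
    note 1 = nn_integral_indicator_superlevel[OF assms(2), of t]
    show "ennreal (\<tau> * t powr (\<tau> - 1)) * indicator {0<..} t * (\<integral>\<^sup>+x. 1 * indicator {x. t < u x} x \<partial>M)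
      \<le> ennreal (A * \<tau> / (\<tau> - 1)) * (ennreal ((\<tau> - 1) * t powr (\<tau> - 1 - 1)) * indicator {0<..} t *
      (\<integral>\<^sup>+x. ennreal (G x) * indicator {x. t < B * G x} x \<partial>M))"
    proof (cases "t > 0")
      case True
      have "ennreal (\<tau> * t powr (\<tau> - 1)) * emeasure M {x \<in> space M. t < u x} \<le> ennreal (\<tau> * t powr (\<tau> - 1)) *
          (ennreal (A / t) * (\<integral>\<^sup>+x. ennreal (G x) * indicator {x. t < B * G x} x \<partial>M))"
        by (intro mult_left_mono weak True) auto
      also have "\<dots> = (ennreal (\<tau> * t powr (\<tau> - 1)) * ennreal (A / t)) * (\<integral>\<^sup>+x. ennreal (G x) * indicator {x. t < B * G x} x \<partial>M)"
        by (simp add: mult.assoc)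
      also have "ennreal (\<tau> * t powr (\<tau> - 1)) * ennreal (A / t) = ennreal (A * \<tau> / (\<tau> - 1)) * ennreal ((\<tau> - 1) * t powr (\<tau> - 1 - 1))"
      proof -
        have "t powr (\<tau> - 1 - 1) = t powr (\<tau> - 1) / t" using True by (subst powr_diff) simp
        then have "A * \<tau> / (\<tau> - 1) * ((\<tau> - 1) * t powr (\<tau> - 1 - 1)) = \<tau> * t powr (\<tau> - 1) * (A / t)"
          using assms True by simp
        then show ?thesis using assms True by (simp add: ennreal_mult[symmetric] del: times_divide_eq_left times_divide_eq_right)
      qed
      finally show ?thesis using True by (simp only: 1) (simp add: mult.assoc)
    qed simp
  qed
  also have "\<dots> = ennreal (A * \<tau> / (\<tau> - 1)) * (\<integral>\<^sup>+t. ennreal ((\<tau> - 1) * t powr (\<tau> - 1 - 1)) * indicator {0<..} t *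
      (\<integral>\<^sup>+x. ennreal (G x) * indicator {x. t < B * G x} x \<partial>M) \<partial>lborel)"
  proof (rule nn_integral_cmult)
    have [measurable]: "(\<lambda>x. B * G x) \<in> borel_measurable M" "(\<lambda>x. ennreal (G x)) \<in> borel_measurable M"
      by measurable
    note [measurable] = measurable_nn_integral_superlevel[OF assms(1) this(2) this(1)]
    show "(\<lambda>t. ennreal ((\<tau> - 1) * t powr (\<tau> - 1 - 1)) * indicator {0<..} t *
      (\<integral>\<^sup>+x. ennreal (G x) * indicator {x. t < B * G x} x \<partial>M)) \<in> borel_measurable lborel"
      by measurable
  qed
  also have "(\<integral>\<^sup>+t. ennreal ((\<tau> - 1) * t powr (\<tau> - 1 - 1)) * indicator {0<..} t *
      (\<integral>\<^sup>+x. ennreal (G x) * indicator {x. t < B * G x} x \<partial>M) \<partial>lborel) = (\<integral>\<^sup>+x. ennreal (G x) * ennreal ((B * G x) powr (\<tau> - 1)) \<partial>M)"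
    using assms by (intro layer_cake[symmetric]) auto
  also have "\<dots> = (\<integral>\<^sup>+x. ennreal (B powr (\<tau> - 1)) * ennreal (G x powr \<tau>) \<partial>M)"
  proof (intro nn_integral_cong)
    fix x assume x: "x \<in> space M"
    have "G x * (G x powr (\<tau> - 1)) = G x powr \<tau>"
      using u(2)[OF x] \<open>\<tau> > 1\<close> by (cases "G x = 0") (auto simp: powr_diff)
    then show "ennreal (G x) * ennreal ((B * G x) powr (\<tau> - 1)) = ennreal (B powr (\<tau> - 1)) * ennreal (G x powr \<tau>)"
      using u(2)[OF x] assms(7) by (simp add: ennreal_mult[symmetric] powr_mult)
  qed
  also have "\<dots> = ennreal (B powr (\<tau> - 1)) * (\<integral>\<^sup>+x. ennreal (G x powr \<tau>) \<partial>M)"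
    by (rule nn_integral_cmult) measurable
  also have "ennreal (A * \<tau> / (\<tau> - 1)) * (ennreal (B powr (\<tau> - 1)) * (\<integral>\<^sup>+x. ennreal (G x powr \<tau>) \<partial>M)) =
      ennreal (A * \<tau> / (\<tau> - 1) * B powr (\<tau> - 1)) * (\<integral>\<^sup>+x. ennreal (G x powr \<tau>) \<partial>M)"
    using assms(6-8) by (subst ennreal_mult) (auto simp: mult.assoc)
  finally show ?thesis .
qed

section \<open>Means over cubes and a Carleson embedding\<close>

text \<open>The mean as a real number; it is zero by convention if the integral is infinite.\<close>

definition mean :: "(real ^ 'n \<Rightarrow> real) \<Rightarrow> (real ^ 'n) set \<Rightarrow> real" where
  "mean G Q = enn2real (\<integral>\<^sup>+x\<in>Q. ennreal (G x) \<partial>lebesgue) / measure lebesgue Q"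

lemma mean_nonneg [simp]: "mean G Q \<ge> 0"
  by (simp add: mean_def)

lemma mean_pos_imp_finite:
  assumes "mean G Q > 0"
  shows "(\<integral>\<^sup>+x\<in>Q. ennreal (G x) \<partial>lebesgue) < \<infinity>"
proof (rule ccontr)
  assume "\<not> ?thesis"
  then have "(\<integral>\<^sup>+x\<in>Q. ennreal (G x) \<partial>lebesgue) = \<infinity>" by (simp add: less_top[symmetric])
  then show False using assms by (simp add: mean_def)
qed

lemma nn_integral_eq_mean:
  assumes "Q \<in> cubes" "(\<integral>\<^sup>+x\<in>Q. ennreal (G x) \<partial>lebesgue) < \<infinity>"
  shows "(\<integral>\<^sup>+x\<in>Q. ennreal (G x) \<partial>lebesgue) = ennreal (mean G Q * measure lebesgue Q)"
  using assms cubes_measure(3)[OF assms(1)] by (simp add: mean_def)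

text \<open>The weak type constant of the maximal function over cubes.\<close>

definition maximal_bound :: "nat \<Rightarrow> real" where
  "maximal_bound n = 5 ^ n * ball_cube_ratio n"

lemma maximal_bound_pos: "n > 0 \<Longrightarrow> maximal_bound n > 0"
  by (simp add: maximal_bound_def ball_cube_ratio_pos)

lemma mean_gt_imp_subset_superlevel:
  fixes G :: "real ^ 'n \<Rightarrow> real"
  assumes Q: "Q \<in> cubes" and t: "t > 0" "mean G Q > t"
  shows "Q \<subseteq> superlevel (\<lambda>x. ennreal (G x)) (t / ball_cube_ratio CARD('n))"
proof (rule cube_subset_superlevel[OF Q])
  have k: "ball_cube_ratio CARD('n) > 0" by (simp add: ball_cube_ratio_pos)
  show "t / ball_cube_ratio CARD('n) \<ge> 0" using t k by simp
  have "(\<integral>\<^sup>+x\<in>Q. ennreal (G x) \<partial>lebesgue) < \<infinity>"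
    using t by (intro mean_pos_imp_finite) simp
  then have "(\<integral>\<^sup>+x\<in>Q. ennreal (G x) \<partial>lebesgue) = ennreal (mean G Q * measure lebesgue Q)"
    by (rule nn_integral_eq_mean[OF Q])
  moreover have "ennreal (t * measure lebesgue Q) < ennreal (mean G Q * measure lebesgue Q)"
    using t cubes_measure(3)[OF Q] by (intro ennreal_lessI) auto
  ultimately show "ennreal (ball_cube_ratio CARD('n) * (t / ball_cube_ratio CARD('n))) * emeasure lebesgue Q
      < (\<integral>\<^sup>+x\<in>Q. ennreal (G x) \<partial>lebesgue)"
    using k t cubes_measure(3,4)[OF Q] by (simp add: ennreal_mult)
qed

lemma emeasure_le_of_large_means:
  fixes G :: "real ^ 'n \<Rightarrow> real"
  assumes [measurable]: "G \<in> borel_measurable lebesgue" and t: "t > 0"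
    and A: "\<And>x. x \<in> A \<Longrightarrow> \<exists>Q\<in>cubes. x \<in> Q \<and> mean G Q > t"
  shows "emeasure lebesgue A \<le> ennreal (maximal_bound CARD('n) / t) * (\<integral>\<^sup>+x. ennreal (G x) \<partial>lebesgue)"
proof -
  let ?k = "ball_cube_ratio CARD('n)"
  have k: "?k > 0" by (simp add: ball_cube_ratio_pos)
  have "A \<subseteq> superlevel (\<lambda>x. ennreal (G x)) (t / ?k)"
    using A mean_gt_imp_subset_superlevel[OF _ t] by blast
  then have "emeasure lebesgue A \<le> emeasure lebesgue (superlevel (\<lambda>x. ennreal (G x)) (t / ?k))"
    by (rule emeasure_mono) (rule sets_superlevel)
  also have "\<dots> \<le> ennreal (5 ^ CARD('n) / (t / ?k)) * (\<integral>\<^sup>+x. ennreal (G x) \<partial>lebesgue)"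
    using t k by (intro superlevel_weak_type) auto
  finally show ?thesis by (simp add: maximal_bound_def mult.commute)
qed

text \<open>The part of \<open>G\<close> below \<open>t / 2\<close> contributes at most \<open>t / 2\<close> to a mean, so a mean above
  \<open>t\<close> forces a mean above \<open>t / 2\<close> for the part of \<open>G\<close> above \<open>t / 2\<close>.\<close>

lemma emeasure_le_of_large_means_truncated:
  fixes G :: "real ^ 'n \<Rightarrow> real"
  assumes [measurable]: "G \<in> borel_measurable lebesgue" and t: "t > 0"
    and A: "\<And>x. x \<in> A \<Longrightarrow> \<exists>Q\<in>cubes. x \<in> Q \<and> mean G Q > t"
  shows "emeasure lebesgue A \<le> ennreal (2 * maximal_bound CARD('n) / t) *
           (\<integral>\<^sup>+x. ennreal (G x) * indicator {x. t < 2 * G x} x \<partial>lebesgue)"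
proof -
  define G' where "G' x = G x * indicator {x. t < 2 * G x} x" for x
  have [measurable]: "G' \<in> borel_measurable lebesgue"
    unfolding G'_def by measurable
  have "emeasure lebesgue A \<le> ennreal (maximal_bound CARD('n) / (t / 2)) * (\<integral>\<^sup>+x. ennreal (G' x) \<partial>lebesgue)"
  proof (rule emeasure_le_of_large_means)
    fix x assume "x \<in> A"
    then obtain Q where Q: "Q \<in> cubes" "x \<in> Q" "mean G Q > t" using A by blast
    have fin: "(\<integral>\<^sup>+x\<in>Q. ennreal (G x) \<partial>lebesgue) < \<infinity>"
      using Q(3) t by (intro mean_pos_imp_finite) simp
    note m = cubes_measure[OF Q(1)]
    have fin': "(\<integral>\<^sup>+x\<in>Q. ennreal (G' x) \<partial>lebesgue) < \<infinity>"
      by (rule le_less_trans[OF _ fin], intro nn_integral_mono) (auto simp: G'_def indicator_def)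
    have "ennreal (mean G Q * measure lebesgue Q) = (\<integral>\<^sup>+x\<in>Q. ennreal (G x) \<partial>lebesgue)"
      using nn_integral_eq_mean[OF Q(1) fin] by simp
    also have "\<dots> \<le> (\<integral>\<^sup>+x. ennreal (G' x) * indicator Q x + ennreal (t / 2) * indicator Q x \<partial>lebesgue)"
      by (intro nn_integral_mono) (auto simp: G'_def indicator_def intro: ennreal_leI)
    also have "\<dots> = ennreal (mean G' Q * measure lebesgue Q) + ennreal (t / 2) * emeasure lebesgue Q"
      using m(2) by (subst nn_integral_add) (auto simp: nn_integral_cmult_indicator nn_integral_eq_mean[OF Q(1) fin'])
    also have "\<dots> = ennreal ((mean G' Q + t / 2) * measure lebesgue Q)"
      using t m(3) unfolding m(4) by (simp add: ennreal_mult[symmetric] ennreal_plus[symmetric] algebra_simps del: ennreal_plus)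
    finally have "mean G Q * measure lebesgue Q \<le> (mean G' Q + t / 2) * measure lebesgue Q"
      using t m(3) by (subst (asm) ennreal_le_iff) auto
    then have "mean G Q \<le> mean G' Q + t / 2" using m(3) by simp
    then have "mean G' Q > t / 2" using Q(3) by simp
    then show "\<exists>Q\<in>cubes. x \<in> Q \<and> t / 2 < mean G' Q" using Q by blast
  qed (use t in auto)
  also have "(\<integral>\<^sup>+x. ennreal (G' x) \<partial>lebesgue) = (\<integral>\<^sup>+x. ennreal (G x) * indicator {x. t < 2 * G x} x \<partial>lebesgue)"
    by (intro nn_integral_cong) (auto simp: G'_def indicator_def)
  finally show ?thesis by (simp add: mult.commute)
qed

text \<open>A finite subfamily of an \<open>\<eta>\<close>-sparse family with a choice of the disjoint sets. An
  infinite sum of nonnegative terms is the supremum of its finite partial sums, so bounds for such subfamilies are enough.\<close>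

definition major_parts :: "real \<Rightarrow> (real ^ 'n) set set \<Rightarrow> ((real ^ 'n) set \<Rightarrow> (real ^ 'n) set) \<Rightarrow> bool" where
  "major_parts \<eta> F E \<longleftrightarrow> finite F \<and> F \<subseteq> cubes \<and> disjoint_family_on E F \<and>
     (\<forall>Q\<in>F. E Q \<in> sets lebesgue \<and> E Q \<subseteq> Q \<and> ennreal \<eta> * emeasure lebesgue Q \<le> emeasure lebesgue (E Q))"

text \<open>The coefficients of the cubes, moved to the disjoint major parts. For means this is a simple
  function below the maximal function.\<close>

definition spread :: "(real ^ 'n) set set \<Rightarrow> ((real ^ 'n) set \<Rightarrow> (real ^ 'n) set) \<Rightarrow> ((real ^ 'n) set \<Rightarrow> real) \<Rightarrow> real ^ 'n \<Rightarrow> real" where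
  "spread F E a x = (\<Sum>Q\<in>F. a Q * indicator (E Q) x)"

lemma spread_eq:
  assumes "major_parts \<eta> F E" "Q \<in> F" "x \<in> E Q"
  shows "spread F E a x = a Q"
proof -
  have "x \<notin> E R" if "R \<in> F - {Q}" for R
    using assms that by (auto simp: major_parts_def disjoint_family_on_def)
  then have "(\<Sum>R\<in>F - {Q}. a R * indicator (E R) x) = 0" by (intro sum.neutral) auto
  moreover have "spread F E a x = a Q * indicator (E Q) x + (\<Sum>R\<in>F - {Q}. a R * indicator (E R) x)"
    unfolding spread_def using assms by (intro sum.remove) (auto simp: major_parts_def)
  ultimately show ?thesis
    using assms by simp
qed

lemma spread_eq_0: "(\<And>Q. Q \<in> F \<Longrightarrow> x \<notin> E Q) \<Longrightarrow> spread F E a x = 0"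
  by (simp add: spread_def)

lemma spread_measurable:
  assumes "major_parts \<eta> F E"
  shows "spread F E a \<in> borel_measurable lebesgue"
  unfolding spread_def using assms
  by (intro borel_measurable_sum borel_measurable_times borel_measurable_indicator) (auto simp: major_parts_def)

lemma spread_cases:
  assumes "major_parts \<eta> F E"
  obtains Q where "Q \<in> F" "x \<in> E Q" "spread F E a x = a Q" | "\<And>Q. Q \<in> F \<Longrightarrow> x \<notin> E Q" "spread F E a x = 0"
  using spread_eq[OF assms] spread_eq_0 by metis

text \<open>How sparseness enters: up to the factor \<open>\<eta>\<close>, a sum over the cubes is an integral over the disjoint
  major parts.\<close>

lemma sum_le_nn_integral_spread:
  fixes F :: "(real ^ 'n) set set"
  assumes F: "major_parts \<eta> F E" and "\<eta> > 0" "\<tau> > 0"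
  shows "ennreal (\<eta> * (\<Sum>Q\<in>F. a Q powr \<tau> * measure lebesgue Q)) \<le> (\<integral>\<^sup>+x. ennreal (spread F E a x powr \<tau>) \<partial>lebesgue)"
proof -
  have fin: "finite F" and c: "\<And>Q. Q \<in> F \<Longrightarrow> Q \<in> cubes" using F by (auto simp: major_parts_def)
  have E [measurable]: "E Q \<in> sets lebesgue" if "Q \<in> F" for Q using F that by (simp add: major_parts_def)
  have "ennreal (\<eta> * (\<Sum>Q\<in>F. a Q powr \<tau> * measure lebesgue Q)) = (\<Sum>Q\<in>F. ennreal (\<eta> * (a Q powr \<tau> * measure lebesgue Q)))"
    unfolding sum_distrib_left using \<open>\<eta> > 0\<close> by (intro sum_ennreal[symmetric]) simp
  also have "\<dots> = (\<Sum>Q\<in>F. ennreal (a Q powr \<tau>) * (ennreal \<eta> * emeasure lebesgue Q))"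
    using \<open>\<eta> > 0\<close> by (intro sum.cong refl) (simp add: cubes_measure(4)[OF c] ennreal_mult[symmetric] ac_simps del: emeasure_completion)
  also have "\<dots> \<le> (\<Sum>Q\<in>F. ennreal (a Q powr \<tau>) * emeasure lebesgue (E Q))"
    using F by (intro sum_mono mult_left_mono) (auto simp: major_parts_def)
  also have "\<dots> = (\<Sum>Q\<in>F. \<integral>\<^sup>+x. ennreal (a Q powr \<tau>) * indicator (E Q) x \<partial>lebesgue)"
    by (intro sum.cong refl nn_integral_cmult_indicator[symmetric] E)
  also have "\<dots> = (\<integral>\<^sup>+x. (\<Sum>Q\<in>F. ennreal (a Q powr \<tau>) * indicator (E Q) x) \<partial>lebesgue)"
    by (intro nn_integral_sum[symmetric] borel_measurable_times_ennreal borel_measurable_const borel_measurable_indicator E)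
  also have "\<dots> \<le> (\<integral>\<^sup>+x. ennreal (spread F E a x powr \<tau>) \<partial>lebesgue)"
  proof (intro nn_integral_mono)
    fix x
    show "(\<Sum>Q\<in>F. ennreal (a Q powr \<tau>) * indicator (E Q) x) \<le> ennreal (spread F E a x powr \<tau>)"
    proof (cases rule: spread_cases[OF F, of x a])
      case (1 Q)
      have "(\<Sum>Q\<in>F. ennreal (a Q powr \<tau>) * indicator (E Q) x) = (\<Sum>R\<in>F. if R = Q then ennreal (a Q powr \<tau>) else 0)"
        using F 1 by (intro sum.cong) (auto simp: major_parts_def disjoint_family_on_def indicator_def)
      then show ?thesis using 1 fin by simp
    qed simp
  qed
  finally show ?thesis .
qed

text \<open>The spread means are a bounded function of weak type one, whence the factor \<open>1 / \<delta>\<close>.\<close>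

lemma carleson_bounded:
  fixes F :: "(real ^ 'n) set set"
  assumes F: "major_parts \<eta> F E" and \<eta>: "\<eta> > 0" and [measurable]: "G \<in> borel_measurable lebesgue"
    and I: "(\<integral>\<^sup>+x. ennreal (G x) \<partial>lebesgue) \<le> ennreal I" "I \<ge> 0"
    and b: "b > 0" "\<And>Q. Q \<in> F \<Longrightarrow> mean G Q \<le> b" and \<delta>: "\<delta> > 0"
  shows "(\<Sum>Q\<in>F. mean G Q powr (1 + \<delta>) * measure lebesgue Q)
           \<le> maximal_bound CARD('n) / \<eta> * I * b powr \<delta> * (1 + \<delta>) / \<delta>"
proof -
  define u where "u = spread F E (mean G)"
  have [measurable]: "u \<in> borel_measurable lebesgue" by (simp add: u_def spread_measurable[OF F])
  have u: "0 \<le> u x" "u x \<le> b" for x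
    by (cases rule: spread_cases[OF F, of x "mean G"]; use b in \<open>simp add: u_def\<close>)+
  let ?m = "maximal_bound CARD('n)"
  have m: "?m > 0" by (simp add: maximal_bound_pos)
  have "(\<integral>\<^sup>+x. ennreal (u x powr (1 + \<delta>)) \<partial>lebesgue) \<le> ennreal (?m * I * b powr \<delta> * (1 + \<delta>) / \<delta>)"
  proof (rule nn_integral_powr_of_weak_type[OF sigma_finite_lebesgue])
    fix t :: real assume t: "t > 0"
    have "emeasure lebesgue {x \<in> space lebesgue. t < u x} \<le> ennreal (?m / t) * (\<integral>\<^sup>+x. ennreal (G x) \<partial>lebesgue)"
    proof (rule emeasure_le_of_large_means[OF _ t])
      fix x assume "x \<in> {x \<in> space lebesgue. t < u x}"
      then have "t < u x" by simp
      then show "\<exists>Q\<in>cubes. x \<in> Q \<and> t < mean G Q"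
        by (cases rule: spread_cases[OF F, of x "mean G"]; use t F in \<open>force simp: u_def major_parts_def\<close>)
    qed simp
    also have "\<dots> \<le> ennreal (?m / t) * ennreal I" by (intro mult_left_mono I) simp
    also have "\<dots> = ennreal (?m * I / t)" using m t I by (simp add: ennreal_mult[symmetric])
    finally show "emeasure lebesgue {x \<in> space lebesgue. t < u x} \<le> ennreal (?m * I / t)" .
  qed (use u b \<delta> m I in auto)
  then have "ennreal (\<eta> * (\<Sum>Q\<in>F. mean G Q powr (1 + \<delta>) * measure lebesgue Q)) \<le> ennreal (?m * I * b powr \<delta> * (1 + \<delta>) / \<delta>)"
    using sum_le_nn_integral_spread[OF F \<eta>, of "1 + \<delta>" "mean G"] \<delta> unfolding u_def by (meson add_pos_pos order_trans zero_less_one)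
  then have "\<eta> * (\<Sum>Q\<in>F. mean G Q powr (1 + \<delta>) * measure lebesgue Q) \<le> ?m * I * b powr \<delta> * (1 + \<delta>) / \<delta>"
    using m I \<delta> by (subst (asm) ennreal_le_iff) auto
  then have "(\<Sum>Q\<in>F. mean G Q powr (1 + \<delta>) * measure lebesgue Q) \<le> ?m * I * b powr \<delta> * (1 + \<delta>) / \<delta> / \<eta>"
    by (subst pos_le_divide_eq[OF \<eta>]) (subst mult.commute)
  also have "\<dots> = ?m / \<eta> * I * b powr \<delta> * (1 + \<delta>) / \<delta>" by simp
  finally show ?thesis .
qed

definition carleson_const :: "nat \<Rightarrow> real \<Rightarrow> real" where
  "carleson_const n \<tau> = 2 * maximal_bound n * \<tau> / (\<tau> - 1) * 2 powr (\<tau> - 1)"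

lemma carleson_const_nonneg: "n > 0 \<Longrightarrow> \<tau> > 1 \<Longrightarrow> carleson_const n \<tau> \<ge> 0"
  using maximal_bound_pos[of n] by (simp add: carleson_const_def)

text \<open>The maximal theorem on \<open>L\<^sup>\<tau>\<close>, for any measurable function \<open>u\<close> that is dominated by the maximal function of
  \<open>G\<close>. The functions in question are simple functions, for which measurability is evident.\<close>

lemma nn_integral_powr_maximal:
  fixes u G :: "real ^ 'n \<Rightarrow> real"
  assumes [measurable]: "u \<in> borel_measurable lebesgue" "G \<in> borel_measurable lebesgue"
    and nonneg: "\<And>x. G x \<ge> 0" "\<And>x. u x \<ge> 0" and \<tau>: "\<tau> > 1"
    and u: "\<And>x t. 0 < t \<Longrightarrow> t < u x \<Longrightarrow> \<exists>Q\<in>cubes. x \<in> Q \<and> t < mean G Q"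
  shows "(\<integral>\<^sup>+x. ennreal (u x powr \<tau>) \<partial>lebesgue) \<le> ennreal (carleson_const CARD('n) \<tau>) * (\<integral>\<^sup>+x. ennreal (G x powr \<tau>) \<partial>lebesgue)"
  unfolding carleson_const_def
proof (rule nn_integral_powr_of_truncated_weak_type[OF sigma_finite_lebesgue, where B = 2])
  fix t :: real assume t: "t > 0"
  show "emeasure lebesgue {x \<in> space lebesgue. t < u x} \<le> ennreal (2 * maximal_bound CARD('n) / t) *
      (\<integral>\<^sup>+x. ennreal (G x) * indicator {x. t < 2 * G x} x \<partial>lebesgue)"
    by (rule emeasure_le_of_large_means_truncated[OF _ t]) (use u t in auto)
next
  show "2 * maximal_bound CARD('n) \<ge> 0" using maximal_bound_pos[of "CARD('n)"] by simp
qed (use nonneg \<tau> in auto)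

lemma carleson_strong:
  fixes F :: "(real ^ 'n) set set"
  assumes F: "major_parts \<eta> F E" and \<eta>: "\<eta> > 0" and [measurable]: "G \<in> borel_measurable lebesgue"
    and nonneg: "\<And>x. G x \<ge> 0" and \<tau>: "\<tau> > 1"
    and I: "(\<integral>\<^sup>+x. ennreal (G x powr \<tau>) \<partial>lebesgue) \<le> ennreal I" "I \<ge> 0"
  shows "(\<Sum>Q\<in>F. mean G Q powr \<tau> * measure lebesgue Q) \<le> carleson_const CARD('n) \<tau> / \<eta> * I"
proof -
  define u where "u = spread F E (mean G)"
  have "ennreal (\<eta> * (\<Sum>Q\<in>F. mean G Q powr \<tau> * measure lebesgue Q)) \<le> (\<integral>\<^sup>+x. ennreal (u x powr \<tau>) \<partial>lebesgue)"
    unfolding u_def using \<tau> by (intro sum_le_nn_integral_spread[OF F \<eta>]) simp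
  also have "\<dots> \<le> ennreal (carleson_const CARD('n) \<tau>) * (\<integral>\<^sup>+x. ennreal (G x powr \<tau>) \<partial>lebesgue)"
  proof (rule nn_integral_powr_maximal[OF _ _ nonneg _ \<tau>])
    show "u \<in> borel_measurable lebesgue" by (simp add: u_def spread_measurable[OF F])
    show "0 \<le> u x" for x
      by (cases rule: spread_cases[OF F, of x "mean G"]) (simp_all add: u_def)
    fix x and t :: real assume t: "t > 0" "t < u x"
    then show "\<exists>Q\<in>cubes. x \<in> Q \<and> t < mean G Q"
      by (cases rule: spread_cases[OF F, of x "mean G"]; use F in \<open>force simp: u_def major_parts_def\<close>)
  qed simp
  also have "\<dots> \<le> ennreal (carleson_const CARD('n) \<tau>) * ennreal I" by (intro mult_left_mono I) simp
  finally have "\<eta> * (\<Sum>Q\<in>F. mean G Q powr \<tau> * measure lebesgue Q) \<le> carleson_const CARD('n) \<tau> * I"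
    using I carleson_const_nonneg[of "CARD('n)" \<tau>] \<tau>
    by (simp add: ennreal_mult[symmetric])
  then show ?thesis using \<eta> by (simp add: field_simps)
qed

lemma mult_indicator_mono:
  fixes f g :: "'a \<Rightarrow> ennreal"
  shows "(x \<in> A \<Longrightarrow> f x \<le> g x) \<Longrightarrow> f x * indicator A x \<le> g x * indicator A x"
  by (auto simp: indicator_def)

section \<open>Dyadic subdivision of a half-open cube\<close>

text \<open>Cells of all generations \<open>j\<close>, of side length \<open>l / 2\<^sup>j\<close>, cover the whole space. The index of a
  cell is obtained by rounding down the rescaled coordinates, so the cells of one generation are the fibres of one function
  and their partition property is automatic.\<close>

locale dyadic_cells =
  fixes a :: "real ^ 'n" and l :: real
  assumes l_pos: "l > 0"
begin

definition cell_index :: "nat \<Rightarrow> real ^ 'n \<Rightarrow> int ^ 'n" where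
  "cell_index j x = (\<chi> i. \<lfloor>2 ^ j * ((x $ i - a $ i) / l)\<rfloor>)"

definition cell :: "nat \<Rightarrow> real ^ 'n \<Rightarrow> (real ^ 'n) set" where
  "cell j x = {y. cell_index j y = cell_index j x}"

lemma mem_cell [simp]: "x \<in> cell j x"
  by (simp add: cell_def)

lemma cell_eq: "y \<in> cell j x \<Longrightarrow> cell j y = cell j x"
  by (auto simp: cell_def)

text \<open>Nesting of the generations: halving an index, rounded down, gives the index of the parent.\<close>

lemma cell_Suc_subset: "cell (Suc j) x \<subseteq> cell j x"
proof -
  have *: "\<lfloor>2 ^ j * z\<rfloor> = \<lfloor>2 ^ Suc j * z\<rfloor> div 2" for z :: real
    using floor_divide_real_eq_div[of 2 "2 ^ Suc j * z"] by simp
  then have "cell_index j y = (\<chi> i. cell_index (Suc j) y $ i div 2)" for y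
    unfolding cell_index_def vec_eq_iff by (auto intro: * simp del: times_divide_eq_right power_Suc)
  then show ?thesis by (auto simp: cell_def)
qed

lemma cell_antimono: "i \<le> j \<Longrightarrow> cell j x \<subseteq> cell i x"
  by (rule lift_Suc_antimono_le[of "\<lambda>j. cell j x"]) (rule cell_Suc_subset)

lemma cube_cell: "cube (l / 2 ^ j) (cell j x)"
proof -
  define k where "k = cell_index j x"
  define b :: "real ^ 'n" where "b = (\<chi> i. a $ i + real_of_int (k $ i) * (l / 2 ^ j))"
  have "\<lfloor>2 ^ j * ((y - c) / l)\<rfloor> = m \<longleftrightarrow> y \<in> {c + real_of_int m * (l / 2 ^ j)..<c + real_of_int m * (l / 2 ^ j) + l / 2 ^ j}" for y c m
    using l_pos unfolding floor_eq_iff by (auto simp: field_simps)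
  then have "cell j x = {y. \<forall>i. y $ i \<in> {b $ i..<b $ i + l / 2 ^ j}}"
    by (auto simp: cell_def k_def[symmetric] b_def) (auto simp: cell_index_def vec_eq_iff)
  then show ?thesis
    unfolding cube_def using l_pos
    by (intro conjI exI[of _ b] exI[of _ "\<lambda>i. {b $ i..<b $ i + l / 2 ^ j}"]) auto
qed

lemma cell_in_cubes: "cell j x \<in> cubes"
  using cube_cell by (auto simp: cubes_def)

lemma measure_cell: "measure lebesgue (cell j x) = (l / 2 ^ j) ^ CARD('n)"
  by (rule cube_measure(2)[OF cube_cell])

lemma measure_cell_pos: "measure lebesgue (cell j x) > 0"
  using cubes_measure(3)[OF cell_in_cubes] .

lemma measure_cell_parent: "measure lebesgue (cell j x) = 2 ^ CARD('n) * measure lebesgue (cell (Suc j) x)"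
  by (simp add: measure_cell power_mult_distrib power_divide)

text \<open>Unions of cells of generation \<open>j\<close>.\<close>

definition saturated :: "nat \<Rightarrow> (real ^ 'n) set \<Rightarrow> bool" where
  "saturated j A \<longleftrightarrow> (\<forall>x\<in>A. cell j x \<subseteq> A)"

lemma saturated_UN: "saturated j A \<Longrightarrow> A = (\<Union>k\<in>cell_index j ` A. {y. cell_index j y = k})"
  by (auto simp: saturated_def cell_def)

lemma cell_sets: "{y. cell_index j y = cell_index j x} \<in> sets lebesgue"
  using cubes_measure(2)[OF cell_in_cubes, of j x] by (simp add: cell_def)

lemma saturated_sets:
  assumes "saturated j A"
  shows "A \<in> sets lebesgue"
proof -
  have "(\<Union>k\<in>cell_index j ` A. {y. cell_index j y = k}) \<in> sets lebesgue"
    by (rule sets.countable_UN'') (auto simp: cell_sets)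
  then show ?thesis using saturated_UN[OF assms] by simp
qed

lemma measurable_cellwise:
  assumes "\<And>x y. y \<in> cell j x \<Longrightarrow> f y = f x"
  shows "(f :: real ^ 'n \<Rightarrow> real) \<in> borel_measurable lebesgue"
  unfolding borel_measurable_iff_greater
proof (intro allI)
  fix t
  have "saturated j {x. t < f x}" using assms by (force simp: saturated_def)
  then show "{w \<in> space lebesgue. t < f w} \<in> sets lebesgue" using saturated_sets by simp
qed

text \<open>A union of cells is a countable disjoint union, so an inequality between integrals can be
  checked cell by cell.\<close>

lemma saturated_nn_integral_mono:
  assumes A: "saturated j A" and [measurable]: "f \<in> borel_measurable lebesgue" "g \<in> borel_measurable lebesgue"
    and le: "\<And>x. x \<in> A \<Longrightarrow> (\<integral>\<^sup>+y\<in>cell j x. f y \<partial>lebesgue) \<le> (\<integral>\<^sup>+y\<in>cell j x. g y \<partial>lebesgue)"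
  shows "(\<integral>\<^sup>+x\<in>A. f x \<partial>lebesgue) \<le> (\<integral>\<^sup>+x\<in>A. g x \<partial>lebesgue)"
proof -
  let ?I = "cell_index j ` A" and ?c = "\<lambda>k. {y. cell_index j y = k}"
  have sets: "?c k \<in> sets lebesgue" if "k \<in> ?I" for k using that cell_sets by auto
  have UN: "(\<integral>\<^sup>+x\<in>A. h x \<partial>lebesgue) = (\<integral>\<^sup>+k. (\<integral>\<^sup>+y\<in>?c k. h y \<partial>lebesgue) \<partial>count_space ?I)"
    if [measurable]: "h \<in> borel_measurable lebesgue" for h
  proof -
    have "(\<integral>\<^sup>+x\<in>A. h x \<partial>lebesgue) = emeasure (density lebesgue h) A"
      using saturated_sets[OF A] by (simp add: emeasure_density)
    also have "\<dots> = emeasure (density lebesgue h) (\<Union>k\<in>?I. ?c k)"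
      by (rule arg_cong[OF saturated_UN[OF A]])
    also have "emeasure (density lebesgue h) (\<Union>k\<in>?I. ?c k) = (\<integral>\<^sup>+k. emeasure (density lebesgue h) (?c k) \<partial>count_space ?I)"
      by (rule emeasure_UN_countable) (auto simp: cell_sets disjoint_family_on_def)
    also have "\<dots> = (\<integral>\<^sup>+k. (\<integral>\<^sup>+y\<in>?c k. h y \<partial>lebesgue) \<partial>count_space ?I)"
      using sets by (intro nn_integral_cong) (auto simp: emeasure_density)
    finally show ?thesis .
  qed
  have "(\<integral>\<^sup>+k. (\<integral>\<^sup>+y\<in>?c k. f y \<partial>lebesgue) \<partial>count_space ?I) \<le> (\<integral>\<^sup>+k. (\<integral>\<^sup>+y\<in>?c k. g y \<partial>lebesgue) \<partial>count_space ?I)"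
    using le by (intro nn_integral_mono[of "count_space ?I"]) (auto simp: cell_def)
  then show ?thesis by (simp add: UN)
qed

lemma cells_shrink:
  assumes "open U" "x \<in> U"
  shows "\<exists>j. cell j x \<subseteq> U"
proof -
  obtain e where e: "e > 0" "ball x e \<subseteq> U" using assms open_contains_ball by blast
  let ?c = "2 * real CARD('n) * l"
  have "(\<lambda>j. ?c * (1 / 2) ^ j) \<longlonglongrightarrow> ?c * 0"
    by (intro tendsto_intros LIMSEQ_realpow_zero) auto
  then have "eventually (\<lambda>j. ?c * (1 / 2) ^ j < e) sequentially"
    using e(1) by (intro order_tendstoD(2)) auto
  then obtain j where "?c * (1 / 2) ^ j < e" by (auto simp: eventually_sequentially)
  then have "2 * real CARD('n) * (l / 2 ^ j) \<le> e" by (simp add: power_divide)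
  then have "ball x (2 * real CARD('n) * (l / 2 ^ j)) \<subseteq> ball x e" by (rule subset_ball)
  moreover have "cell j x \<subseteq> ball x (2 * real CARD('n) * (l / 2 ^ j))"
    by (rule cube_subset_ball[OF cube_cell mem_cell])
  ultimately show ?thesis using e by blast
qed

end

section \<open>Dyadic differentiation and the reverse Hoelder inequality\<close>

locale dyadic_weight = dyadic_cells a l for a :: "real ^ 'n" and l +
  fixes v :: "real ^ 'n \<Rightarrow> real"
  assumes v_measurable [measurable]: "v \<in> borel_measurable lebesgue"
    and v_nonneg: "\<And>x. v x \<ge> 0"
    and v_finite: "(\<integral>\<^sup>+x. ennreal (v x) \<partial>lebesgue) < \<infinity>"
begin

text \<open>The conditional expectation of \<open>v\<close> on the cells of generation \<open>j\<close>.\<close>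

definition E :: "nat \<Rightarrow> real ^ 'n \<Rightarrow> real" where "E j x = mean v (cell j x)"

lemma E_nonneg [simp]: "E j x \<ge> 0" by (simp add: E_def)

lemma E_cell: "y \<in> cell j x \<Longrightarrow> E j y = E j x"
  by (simp add: E_def cell_eq)

lemma E_measurable [measurable]: "E j \<in> borel_measurable lebesgue"
  by (rule measurable_cellwise[of j]) (rule E_cell)

lemma nn_integral_cell: "(\<integral>\<^sup>+y\<in>cell j x. ennreal (v y) \<partial>lebesgue) = ennreal (E j x * measure lebesgue (cell j x))"
proof -
  have "(\<integral>\<^sup>+y\<in>cell j x. ennreal (v y) \<partial>lebesgue) < \<infinity>"
    by (rule le_less_trans[OF _ v_finite]) (intro nn_integral_mono, simp add: indicator_def)
  then show ?thesis unfolding E_def by (rule nn_integral_eq_mean[OF cell_in_cubes])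
qed

lemma E_Suc_le: "E (Suc j) x \<le> 2 ^ CARD('n) * E j x"
proof -
  have "ennreal (E (Suc j) x * measure lebesgue (cell (Suc j) x)) \<le> ennreal (E j x * measure lebesgue (cell j x))"
    unfolding nn_integral_cell[symmetric] using cell_Suc_subset[of j x]
    by (intro nn_integral_mono) (auto simp: indicator_def)
  then have "E (Suc j) x * measure lebesgue (cell (Suc j) x) \<le> (2 ^ CARD('n) * E j x) * measure lebesgue (cell (Suc j) x)"
    using measure_cell_pos[of j x] by (simp add: measure_cell_parent[of j x] ac_simps)
  then show ?thesis using measure_cell_pos[of "Suc j" x] by simp
qed

text \<open>Half of the differentiation theorem, by outer regularity: cover \<open>A\<close> by an open set \<open>U\<close> of
  almost the same measure, and \<open>A\<close> by the maximal cells inside \<open>U\<close> that meet \<open>A\<close>. On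
  these the mean is at most \<open>t\<close>.\<close>

lemma nn_integral_le_where_E_le:
  assumes A: "A \<in> sets lebesgue" and E: "\<And>x j. x \<in> A \<Longrightarrow> E j x \<le> t" and t: "t \<ge> 0"
  shows "(\<integral>\<^sup>+x\<in>A. ennreal (v x) \<partial>lebesgue) \<le> ennreal t * emeasure lebesgue A"
proof (rule ennreal_le_epsilon)
  fix e :: real assume e: "e > 0"
  define e' where "e' = e / (t + 1)"
  have e': "e' > 0" "t * e' \<le> e" using e t by (auto simp: e'_def field_simps)
  obtain U where U: "open U" "A \<subseteq> U" "emeasure lebesgue (U - A) < ennreal e'"
    using sets_lebesgue_outer_open[OF A e'(1)] by metis
  have [measurable]: "U \<in> sets lebesgue" using U(1) by (simp add: borel_open)
  define first where "first j x \<longleftrightarrow> cell j x \<subseteq> U \<and> (\<forall>i<j. \<not> cell i x \<subseteq> U)" for j x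
  define W where "W j = {x. first j x \<and> cell j x \<inter> A \<noteq> {}}" for j
  have first_cell: "first j y \<longleftrightarrow> first j x" if "y \<in> cell j x" for j x y
  proof -
    have "cell i y = cell i x" if "i \<le> j" for i
      using cell_antimono[OF that, of x] \<open>y \<in> cell j x\<close> by (intro cell_eq) blast
    then show ?thesis by (auto simp: first_def)
  qed
  have sat: "saturated j (W j)" for j
    unfolding saturated_def W_def using first_cell[of _ j] cell_eq[of _ j] by fast
  note [measurable] = saturated_sets[OF sat]
  have disj: "disjoint_family W"
    unfolding disjoint_family_on_def
  proof (intro ballI impI)
    fix i j :: nat assume "i \<noteq> j"
    then show "W i \<inter> W j = {}" by (cases "i < j") (auto simp: W_def first_def)
  qed
  have AW: "A \<subseteq> (\<Union>j. W j)"
  proof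
    fix x assume x: "x \<in> A"
    then obtain j0 where "cell j0 x \<subseteq> U" using cells_shrink[OF U(1)] U(2) by blast
    define j where "j = (LEAST j. cell j x \<subseteq> U)"
    have "first j x"
      unfolding first_def j_def using LeastI[of "\<lambda>j. cell j x \<subseteq> U", OF \<open>cell j0 x \<subseteq> U\<close>] not_less_Least by blast
    then have "x \<in> W j" using x mem_cell unfolding W_def by blast
    then show "x \<in> (\<Union>j. W j)" by blast
  qed
  have WU: "(\<Union>j. W j) \<subseteq> U" using mem_cell unfolding W_def first_def by blast
  have W: "(\<integral>\<^sup>+x\<in>W j. ennreal (v x) \<partial>lebesgue) \<le> (\<integral>\<^sup>+x\<in>W j. ennreal t \<partial>lebesgue)" for j
  proof (rule saturated_nn_integral_mono[OF sat])
    fix x assume "x \<in> W j"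
    then obtain y where "y \<in> cell j x" "y \<in> A" by (auto simp: W_def)
    then have "E j x \<le> t" using E[of y j] E_cell[of y j x] by simp
    then show "(\<integral>\<^sup>+y\<in>cell j x. ennreal (v y) \<partial>lebesgue) \<le> (\<integral>\<^sup>+y\<in>cell j x. ennreal t \<partial>lebesgue)"
      unfolding nn_integral_cell using t cubes_measure(2,4)[OF cell_in_cubes, of j x]
      by (simp add: nn_integral_cmult_indicator ennreal_mult mult_right_mono del: emeasure_completion)
  qed simp_all
  have UN: "(\<integral>\<^sup>+x\<in>(\<Union>j. W j). h x \<partial>lebesgue) = (\<Sum>j. \<integral>\<^sup>+x\<in>W j. h x \<partial>lebesgue)"
    if [measurable]: "h \<in> borel_measurable lebesgue" for h
    using suminf_emeasure[of W "density lebesgue h"] disj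
    by (simp add: emeasure_density image_subset_iff)
  have "(\<integral>\<^sup>+x\<in>A. ennreal (v x) \<partial>lebesgue) \<le> (\<integral>\<^sup>+x\<in>(\<Union>j. W j). ennreal (v x) \<partial>lebesgue)"
    using AW by (intro nn_integral_mono) (auto simp: indicator_def)
  also have "\<dots> \<le> (\<integral>\<^sup>+x\<in>(\<Union>j. W j). ennreal t \<partial>lebesgue)"
    by (simp add: UN suminf_le W)
  also have "\<dots> \<le> (\<integral>\<^sup>+x\<in>U. ennreal t \<partial>lebesgue)"
    using WU by (intro nn_integral_mono) (auto simp: indicator_def)
  also have "\<dots> = ennreal t * emeasure lebesgue U" by (simp add: nn_integral_cmult_indicator del: emeasure_completion)
  also have "emeasure lebesgue U = emeasure lebesgue (A \<union> (U - A))" using U(2) by (simp add: Un_absorb1)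
  also have "\<dots> \<le> emeasure lebesgue A + emeasure lebesgue (U - A)"
    using A by (intro emeasure_subadditive) auto
  also have "ennreal t * (emeasure lebesgue A + emeasure lebesgue (U - A)) \<le> ennreal t * (emeasure lebesgue A + ennreal e')"
    using U(3) by (intro mult_left_mono add_left_mono) (auto intro: less_imp_le)
  also have "\<dots> = ennreal t * emeasure lebesgue A + ennreal (t * e')"
    using t e' by (simp add: distrib_left ennreal_mult)
  also have "\<dots> \<le> ennreal t * emeasure lebesgue A + ennreal e"
    using e' by (intro add_left_mono ennreal_leI)
  finally show "(\<integral>\<^sup>+x\<in>A. ennreal (v x) \<partial>lebesgue) \<le> ennreal t * emeasure lebesgue A + ennreal e"
    by (simp add: mult_left_mono)
qed

text \<open>Almost everywhere, the weight is at most the supremum of its dyadic means: otherwise some set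
  \<open>A\<close> of positive measure has \<open>v > t\<close> but all means at most \<open>t\<close>, contradicting the preceding lemma.\<close>

lemma AE_less_E: "AE x in lebesgue. \<forall>t < v x. \<exists>j. t < E j x"
proof -
  have "AE x in lebesgue. of_rat q < v x \<longrightarrow> (\<exists>j. of_rat q < E j x)" if q: "q > 0" for q
  proof -
    define t :: real where "t = of_rat q"
    have t: "t > 0" using q by (simp add: t_def)
    define A where "A = {x. t < v x \<and> (\<forall>j. E j x \<le> t)}"
    have "{x \<in> space lebesgue. t < v x \<and> (\<forall>j. E j x \<le> t)} \<in> sets lebesgue" by measurable
    then have A [measurable]: "A \<in> sets lebesgue" by (simp add: A_def)
    have "ennreal t * emeasure lebesgue A = (\<integral>\<^sup>+x\<in>A. ennreal t \<partial>lebesgue)"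
      by (simp add: nn_integral_cmult_indicator del: emeasure_completion)
    also have "\<dots> \<le> (\<integral>\<^sup>+x. ennreal (v x) \<partial>lebesgue)"
      by (intro nn_integral_mono) (auto simp: indicator_def A_def intro!: ennreal_leI)
    finally have "ennreal t * emeasure lebesgue A \<noteq> \<infinity>" using v_finite by (auto simp: top_unique)
    then have tA: "(\<integral>\<^sup>+x\<in>A. ennreal t \<partial>lebesgue) \<noteq> \<infinity>"
      by (simp add: nn_integral_cmult_indicator del: emeasure_completion)
    have "(\<integral>\<^sup>+x\<in>A. ennreal (v x - t) \<partial>lebesgue) + (\<integral>\<^sup>+x\<in>A. ennreal t \<partial>lebesgue) = (\<integral>\<^sup>+x. ennreal (v x - t) * indicator A x + ennreal t * indicator A x \<partial>lebesgue)"
      by (rule nn_integral_add[symmetric]) measurable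
    also have "\<dots> = (\<integral>\<^sup>+x\<in>A. ennreal (v x) \<partial>lebesgue)"
      using t by (intro nn_integral_cong) (auto simp: indicator_def A_def ennreal_plus[symmetric] simp del: ennreal_plus)
    also have "\<dots> \<le> ennreal t * emeasure lebesgue A"
      using t by (intro nn_integral_le_where_E_le A) (auto simp: A_def)
    also have "\<dots> = 0 + (\<integral>\<^sup>+x\<in>A. ennreal t \<partial>lebesgue)" by (simp add: nn_integral_cmult_indicator del: emeasure_completion)
    finally have "(\<integral>\<^sup>+x\<in>A. ennreal (v x - t) \<partial>lebesgue) = 0"
      using tA ennreal_add_left_cancel_le[of "\<integral>\<^sup>+x\<in>A. ennreal t \<partial>lebesgue" "\<integral>\<^sup>+x\<in>A. ennreal (v x - t) \<partial>lebesgue" 0]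
      by (simp add: add.commute)
    then have "AE x in lebesgue. ennreal (v x - t) * indicator A x = 0"
      by (subst (asm) nn_integral_0_iff_AE) auto
    then show ?thesis
    proof eventually_elim
      case (elim x)
      show ?case
      proof (intro impI, rule ccontr)
        assume x: "of_rat q < v x" "\<not> (\<exists>j. of_rat q < E j x)"
        then have "x \<in> A" by (auto simp: A_def t_def not_less)
        then have "v x \<le> t" using elim by (simp add: ennreal_eq_0_iff)
        then show False using x(1) by (simp add: t_def)
      qed
    qed
  qed
  then have "AE x in lebesgue. \<forall>q::rat. q > 0 \<longrightarrow> of_rat q < v x \<longrightarrow> (\<exists>j. of_rat q < E j x)"
    by (subst AE_all_countable) (auto intro!: AE_impI)
  then show ?thesis
  proof eventually_elim
    case (elim x)
    show ?case
    proof (intro allI impI)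
      fix t assume t: "t < v x"
      show "\<exists>j. t < E j x"
      proof (cases "t < 0")
        case True
        then show ?thesis using E_nonneg[of 0 x] by (intro exI[of _ 0]) linarith
      next
        case False
        obtain q where "t < of_rat q" "of_rat q < v x" using of_rat_dense[OF t] by blast
        moreover from this False have "q > 0" by (metis le_less_trans not_less zero_less_of_rat_iff)
        ultimately show ?thesis using elim by (metis less_trans)
      qed
    qed
  qed
qed

end

context dyadic_weight
begin

text \<open>The dyadic maximal function of the generations from \<open>j\<close> to \<open>m\<close>. On a cell of generation
  \<open>j\<close> it only sees means over cells inside this cell.\<close>

definition Emax :: "nat \<Rightarrow> nat \<Rightarrow> real ^ 'n \<Rightarrow> real" where
  "Emax j m x = Max ((\<lambda>i. E i x) ` {j..m})"

lemma Emax_measurable [measurable]: "j \<le> m \<Longrightarrow> Emax j m \<in> borel_measurable lebesgue"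
  unfolding Emax_def
proof (induction m rule: dec_induct)
  case (step m)
  have "{j..Suc m} = insert (Suc m) {j..m}" using step by auto
  then have "(\<lambda>x. Max ((\<lambda>i. E i x) ` {j..Suc m})) = (\<lambda>x. max (E (Suc m) x) (Max ((\<lambda>i. E i x) ` {j..m})))"
    using step by (simp add: fun_eq_iff)
  then show ?case using step by simp
qed simp

lemma less_Emax_iff: "j \<le> m \<Longrightarrow> t < Emax j m x \<longleftrightarrow> (\<exists>i\<in>{j..m}. t < E i x)"
  unfolding Emax_def by (subst Max_gr_iff) auto

lemma Emax_le_iff: "j \<le> m \<Longrightarrow> Emax j m x \<le> t \<longleftrightarrow> (\<forall>i\<in>{j..m}. E i x \<le> t)"
  unfolding Emax_def by (subst Max_le_iff) auto

lemma Emax_nonneg: "j \<le> m \<Longrightarrow> 0 \<le> Emax j m x"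
  unfolding Emax_def using E_nonneg[of j x] by (subst Max_ge_iff) (auto intro!: bexI[of _ j])

lemma E_coarser: "y \<in> cell j x \<Longrightarrow> i \<le> j \<Longrightarrow> E i y = E i x"
  using cell_antimono[of i j x] by (intro E_cell) blast

lemma E_le_power: "E j x \<le> (2 ^ CARD('n)) ^ j * E 0 x"
proof (induction j)
  case (Suc j)
  have "E (Suc j) x \<le> 2 ^ CARD('n) * E j x" by (rule E_Suc_le)
  also have "\<dots> \<le> 2 ^ CARD('n) * ((2 ^ CARD('n)) ^ j * E 0 x)" using Suc by (intro mult_left_mono) auto
  finally show ?case by simp
qed simp

text \<open>Stopping the first time that the mean exceeds \<open>t\<close>: the mean over the stopping cell
  is at most \<open>2\<^sup>n t\<close>, because its parent was not selected.\<close>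

lemma nn_integral_superlevel_Emax_le:
  assumes t: "E 0 x0 \<le> t" and C: "C \<ge> 0"
    and [measurable]: "f \<in> borel_measurable lebesgue"
    and f: "\<And>x j. x \<in> cell 0 x0 \<Longrightarrow> j \<le> m \<Longrightarrow> t < E j x \<Longrightarrow> (\<And>i. i < j \<Longrightarrow> E i x \<le> t) \<Longrightarrow>
       (\<integral>\<^sup>+y\<in>cell j x. f y \<partial>lebesgue) \<le> ennreal C * (\<integral>\<^sup>+y\<in>cell j x. ennreal (v y) \<partial>lebesgue)"
  shows "(\<integral>\<^sup>+x. (f x * indicator (cell 0 x0) x) * indicator {x. t < Emax 0 m x} x \<partial>lebesgue)
     \<le> ennreal (C * 2 ^ CARD('n) * t) * (\<integral>\<^sup>+x. indicator (cell 0 x0) x * indicator {x. t < Emax 0 m x} x \<partial>lebesgue)"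
proof -
  have t0: "t \<ge> 0" using t E_nonneg[of 0 x0] by linarith
  define L where "L j = {x \<in> cell 0 x0. t < E j x \<and> (\<forall>i<j. E i x \<le> t)}" for j
  have sat: "saturated j (L j)" for j
    unfolding saturated_def
  proof (intro ballI subsetI)
    fix x y assume x: "x \<in> L j" and y: "y \<in> cell j x"
    have "cell 0 x = cell 0 x0" using x by (intro cell_eq) (simp add: L_def)
    then have "y \<in> cell 0 x0" using y cell_antimono[of 0 j x] by auto
    moreover have "\<forall>i\<le>j. E i y = E i x" using E_coarser[OF y] by blast
    ultimately show "y \<in> L j" using x by (auto simp: L_def)
  qed
  have disj: "disjoint_family_on L {..m}"
    unfolding disjoint_family_on_def
  proof (intro ballI impI)
    fix i j :: nat assume "i \<noteq> j"
    then consider "i < j" | "j < i" by linarith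
    then show "L i \<inter> L j = {}" by cases (fastforce simp: L_def)+
  qed
  have UN: "x \<in> cell 0 x0 \<and> t < Emax 0 m x \<longleftrightarrow> x \<in> (\<Union>j\<in>{..m}. L j)" for x
  proof
    assume x: "x \<in> cell 0 x0 \<and> t < Emax 0 m x"
    then obtain i where i: "i \<le> m" "t < E i x" using less_Emax_iff[of 0 m t x] by auto
    define j where "j = (LEAST i. t < E i x)"
    have "t < E j x" unfolding j_def by (rule LeastI) (rule i)
    moreover have "j \<le> m" using Least_le[of "\<lambda>i. t < E i x", OF i(2)] i(1) by (simp add: j_def)
    moreover have "\<forall>i<j. E i x \<le> t" using not_less_Least[of _ "\<lambda>i. t < E i x"] unfolding j_def by (auto simp: not_less)
    ultimately show "x \<in> (\<Union>j\<in>{..m}. L j)" using x by (auto simp: L_def)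
  next
    assume "x \<in> (\<Union>j\<in>{..m}. L j)"
    then show "x \<in> cell 0 x0 \<and> t < Emax 0 m x"
      using less_Emax_iff[of 0 m t x] by (auto simp: L_def)
  qed
  have split: "(\<integral>\<^sup>+x. (h x * indicator (cell 0 x0) x) * indicator {x. t < Emax 0 m x} x \<partial>lebesgue) = (\<Sum>j\<le>m. \<integral>\<^sup>+x\<in>L j. h x \<partial>lebesgue)"
    if [measurable]: "h \<in> borel_measurable lebesgue" for h
  proof -
    have "(\<integral>\<^sup>+x. (h x * indicator (cell 0 x0) x) * indicator {x. t < Emax 0 m x} x \<partial>lebesgue)
        = (\<integral>\<^sup>+x\<in>(\<Union>j\<in>{..m}. L j). h x \<partial>lebesgue)"
      using UN by (intro nn_integral_cong) (auto simp: indicator_def)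
    also have "\<dots> = emeasure (density lebesgue h) (\<Union>j\<in>{..m}. L j)"
      using saturated_sets[OF sat] by (intro emeasure_density[symmetric]) auto
    also have "\<dots> = (\<Sum>j\<le>m. emeasure (density lebesgue h) (L j))"
      using saturated_sets[OF sat] disj by (intro sum_emeasure[symmetric]) auto
    also have "\<dots> = (\<Sum>j\<le>m. \<integral>\<^sup>+x\<in>L j. h x \<partial>lebesgue)"
      using saturated_sets[OF sat] by (intro sum.cong emeasure_density) auto
    finally show ?thesis .
  qed
  have "(\<integral>\<^sup>+x\<in>L j. f x \<partial>lebesgue) \<le> (\<integral>\<^sup>+x\<in>L j. ennreal (C * 2 ^ CARD('n) * t) \<partial>lebesgue)" if "j \<le> m" for j
  proof (rule saturated_nn_integral_mono[OF sat])
    fix x assume x: "x \<in> L j"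
    have "E 0 x = E 0 x0" using x by (intro E_cell) (simp add: L_def)
    then have "j \<noteq> 0" using x t by (intro notI) (simp add: L_def)
    then obtain k where k: "j = Suc k" by (cases j) auto
    have "E j x \<le> 2 ^ CARD('n) * E k x" unfolding k by (rule E_Suc_le)
    also have "\<dots> \<le> 2 ^ CARD('n) * t" using x k by (intro mult_left_mono) (auto simp: L_def)
    finally have E: "E j x \<le> 2 ^ CARD('n) * t" .
    have "(\<integral>\<^sup>+y\<in>cell j x. f y \<partial>lebesgue) \<le> ennreal C * (\<integral>\<^sup>+y\<in>cell j x. ennreal (v y) \<partial>lebesgue)"
      using x that by (intro f) (auto simp: L_def)
    also have "\<dots> = ennreal (C * (E j x * measure lebesgue (cell j x)))"
      unfolding nn_integral_cell using C by (simp add: ennreal_mult)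
    also have "\<dots> \<le> ennreal (C * (2 ^ CARD('n) * t * measure lebesgue (cell j x)))"
      using E C by (intro ennreal_leI mult_left_mono mult_right_mono) auto
    also have "\<dots> = (\<integral>\<^sup>+y\<in>cell j x. ennreal (C * 2 ^ CARD('n) * t) \<partial>lebesgue)"
      using C t0 by (subst nn_integral_cmult_indicator[OF cubes_measure(2)[OF cell_in_cubes]],
        subst cubes_measure(4)[OF cell_in_cubes]) (simp add: ennreal_mult[symmetric] mult.assoc)
    finally show "(\<integral>\<^sup>+y\<in>cell j x. f y \<partial>lebesgue) \<le> (\<integral>\<^sup>+y\<in>cell j x. ennreal (C * 2 ^ CARD('n) * t) \<partial>lebesgue)" .
  qed simp_all
  then have "(\<Sum>j\<le>m. \<integral>\<^sup>+x\<in>L j. f x \<partial>lebesgue) \<le> (\<Sum>j\<le>m. \<integral>\<^sup>+x\<in>L j. ennreal (C * 2 ^ CARD('n) * t) \<partial>lebesgue)"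
    by (intro sum_mono) simp
  then have "(\<integral>\<^sup>+x. (f x * indicator (cell 0 x0) x) * indicator {x. t < Emax 0 m x} x \<partial>lebesgue)
     \<le> (\<integral>\<^sup>+x. (ennreal (C * 2 ^ CARD('n) * t) * indicator (cell 0 x0) x) * indicator {x. t < Emax 0 m x} x \<partial>lebesgue)"
    by (simp only: split assms(3) borel_measurable_const)
  also have "\<dots> = ennreal (C * 2 ^ CARD('n) * t) * (\<integral>\<^sup>+x. indicator (cell 0 x0) x * indicator {x. t < Emax 0 m x} x \<partial>lebesgue)"
  proof -
    have [measurable]: "cell 0 x0 \<in> sets lebesgue" by (rule cubes_measure(2)[OF cell_in_cubes])
    have "{x \<in> space lebesgue. t < Emax 0 m x} \<in> sets lebesgue" by measurable
    then have [measurable]: "{x. t < Emax 0 m x} \<in> sets lebesgue" by simp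
    show ?thesis by (subst nn_integral_cmult[symmetric]) (auto simp: mult.assoc)
  qed
  finally show ?thesis .
qed

text \<open>The sharp reverse Hoelder inequality, by the argument of Hytonen and Perez. The integral \<open>J\<close> of the
  \<open>(1 + \<epsilon>)\<close>-th power of the dyadic maximal function satisfies \<open>J \<le> c + J / 2\<close> by the stopping
  argument above, because \<open>2\<^sup>n B \<epsilon> = 1 / 2\<close>. Only finitely many generations are used, so \<open>J\<close> is
  finite and can be absorbed. Applying the same argument to \<open>v\<close> in place of the maximal function removes the factor
  \<open>B\<close> from the conclusion; for \<open>q\<^sub>0 = \<infinity>\<close> the main theorem has no room for it.\<close>

theorem reverse_Holder:
  assumes B: "B \<ge> 1"
    and maximal: "\<And>x j m. x \<in> cell 0 x0 \<Longrightarrow> j \<le> m \<Longrightarrow>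
       (\<integral>\<^sup>+y\<in>cell j x. ennreal (Emax j m y) \<partial>lebesgue) \<le> ennreal B * (\<integral>\<^sup>+y\<in>cell j x. ennreal (v y) \<partial>lebesgue)"
    and \<epsilon>: "\<epsilon> = 1 / (2 ^ (CARD('n) + 1) * B)"
  shows "(\<integral>\<^sup>+y\<in>cell 0 x0. ennreal (v y powr (1 + \<epsilon>)) \<partial>lebesgue)
     \<le> ennreal (2 * E 0 x0 powr (1 + \<epsilon>) * measure lebesgue (cell 0 x0))"
proof -
  let ?N = "2 ^ CARD('n) :: real" and ?Q = "cell 0 x0"
  define e0 where "e0 = E 0 x0"
  define c where "c = measure lebesgue ?Q"
  have c: "c > 0" unfolding c_def by (rule measure_cell_pos)
  have e0: "e0 \<ge> 0" by (simp add: e0_def)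
  have \<epsilon>0: "\<epsilon> > 0" and \<epsilon>B: "B * ?N * \<epsilon> = 1 / 2" using B by (auto simp: \<epsilon>)
  have [measurable]: "?Q \<in> sets lebesgue" by (rule cubes_measure(2)[OF cell_in_cubes])
  have e0_powr: "e0 powr \<epsilon> * e0 = e0 powr (1 + \<epsilon>)" using e0 by (cases "e0 = 0") (auto simp: powr_add)
  have vQ: "(\<integral>\<^sup>+y\<in>?Q. ennreal (v y) \<partial>lebesgue) = ennreal (e0 * c)"
    unfolding nn_integral_cell e0_def c_def ..
  have bound: "(\<integral>\<^sup>+y\<in>?Q. ennreal (v y) * ennreal (Emax 0 m y powr \<epsilon>) \<partial>lebesgue) \<le> ennreal (2 * e0 powr (1 + \<epsilon>) * c)" for m
  proof -
    have M0: "Emax 0 m x \<ge> 0" for x by (rule Emax_nonneg) simp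
    define J where "J = (\<integral>\<^sup>+x\<in>?Q. ennreal (Emax 0 m x powr (1 + \<epsilon>)) \<partial>lebesgue)"
    have J': "(\<integral>\<^sup>+x. indicator ?Q x * ennreal (Emax 0 m x powr (1 + \<epsilon>)) \<partial>lebesgue) = J"
      by (simp add: J_def mult.commute)
    \<comment> \<open>Passing to a child multiplies a mean by at most \<open>2\<^sup>n\<close>, so \<open>J\<close> is finite.\<close>
    have "J \<le> (\<integral>\<^sup>+x\<in>?Q. ennreal ((?N ^ m * e0) powr (1 + \<epsilon>)) \<partial>lebesgue)"
      unfolding J_def
    proof (intro nn_integral_mono mult_indicator_mono)
      fix x assume x: "x \<in> ?Q"
      have "E i x \<le> ?N ^ m * e0" if "i \<le> m" for i
      proof -
        have "E i x \<le> ?N ^ i * E 0 x" by (rule E_le_power)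
        also have "E 0 x = e0" unfolding e0_def by (rule E_cell[OF x])
        also have "?N ^ i * e0 \<le> ?N ^ m * e0" using e0 that by (intro mult_right_mono power_increasing) auto
        finally show ?thesis .
      qed
      then have "Emax 0 m x \<le> ?N ^ m * e0" by (subst Emax_le_iff) auto
      then show "ennreal (Emax 0 m x powr (1 + \<epsilon>)) \<le> ennreal ((?N ^ m * e0) powr (1 + \<epsilon>))"
        using M0 \<epsilon>0 by (intro ennreal_leI powr_mono2) auto
    qed
    also have "\<dots> < \<infinity>"
      using cubes_measure(4)[OF cell_in_cubes, of 0 x0] by (simp add: nn_integral_cmult_indicator ennreal_mult_less_top del: emeasure_completion)
    finally obtain J' where JJ: "J = ennreal J'" "J' \<ge> 0" by (cases J) auto
    have lev: "(\<integral>\<^sup>+x. (f x * indicator ?Q x) * ennreal (Emax 0 m x powr \<epsilon>) \<partial>lebesgue)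
       \<le> ennreal (e0 powr \<epsilon>) * (\<integral>\<^sup>+x\<in>?Q. f x \<partial>lebesgue) + ennreal (C * ?N * \<epsilon> / (1 + \<epsilon>)) * J"
      if [measurable]: "f \<in> borel_measurable lebesgue" and C: "C \<ge> 0" and
        f: "\<And>t x j. e0 \<le> t \<Longrightarrow> x \<in> ?Q \<Longrightarrow> j \<le> m \<Longrightarrow> t < E j x \<Longrightarrow> (\<And>i. i < j \<Longrightarrow> E i x \<le> t) \<Longrightarrow>
         (\<integral>\<^sup>+y\<in>cell j x. f y \<partial>lebesgue) \<le> ennreal C * (\<integral>\<^sup>+y\<in>cell j x. ennreal (v y) \<partial>lebesgue)" for f C
      unfolding J'[symmetric]
    proof (rule nn_integral_powr_of_superlevel_le[OF sigma_finite_lebesgue])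
      fix t :: real assume t: "t > 0" "e0 \<le> t"
      show "(\<integral>\<^sup>+x. (f x * indicator ?Q x) * indicator {x. t < Emax 0 m x} x \<partial>lebesgue)
         \<le> ennreal (C * ?N * t) * (\<integral>\<^sup>+x. indicator ?Q x * indicator {x. t < Emax 0 m x} x \<partial>lebesgue)"
        using t C by (intro nn_integral_superlevel_Emax_le f) (auto simp: e0_def)
    qed (use C \<epsilon>0 e0 M0 in auto)
    have "(\<integral>\<^sup>+x. (ennreal (Emax 0 m x) * indicator ?Q x) * ennreal (Emax 0 m x powr \<epsilon>) \<partial>lebesgue)
       \<le> ennreal (e0 powr \<epsilon>) * (\<integral>\<^sup>+x\<in>?Q. ennreal (Emax 0 m x) \<partial>lebesgue) + ennreal (B * ?N * \<epsilon> / (1 + \<epsilon>)) * J"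
    proof (rule lev)
      fix t x j assume t: "e0 \<le> t" and x: "x \<in> ?Q" and j: "j \<le> m" "t < E j x" and i: "\<And>i. i < j \<Longrightarrow> E i x \<le> t"
      \<comment> \<open>On a stopping cell the earlier generations do not contribute to the maximum.\<close>
      have "Emax 0 m y = Emax j m y" if y: "y \<in> cell j x" for y
      proof -
        have Ey: "E i y = E i x" if "i \<le> j" for i using E_coarser[OF y that] .
        have "Emax j m y \<le> Emax 0 m y" unfolding Emax_def using j by (intro Max_mono) auto
        moreover have "Emax 0 m y \<le> Emax j m y"
        proof (subst Emax_le_iff, simp, intro ballI)
          fix k assume k: "k \<in> {0..m}"
          show "E k y \<le> Emax j m y"
          proof (cases "k < j")
            case True
            then have "E k y \<le> E j y" using i[OF True] j Ey by fastforce
            also have "\<dots> \<le> Emax j m y" unfolding Emax_def using j by (intro Max_ge) auto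
            finally show ?thesis .
          next
            case False
            then show ?thesis unfolding Emax_def using k by (intro Max_ge) auto
          qed
        qed
        ultimately show ?thesis by simp
      qed
      then have "(\<integral>\<^sup>+y\<in>cell j x. ennreal (Emax 0 m y) \<partial>lebesgue) = (\<integral>\<^sup>+y\<in>cell j x. ennreal (Emax j m y) \<partial>lebesgue)"
        by (intro nn_integral_cong) (auto simp: indicator_def)
      then show "(\<integral>\<^sup>+y\<in>cell j x. ennreal (Emax 0 m y) \<partial>lebesgue) \<le> ennreal B * (\<integral>\<^sup>+y\<in>cell j x. ennreal (v y) \<partial>lebesgue)"
        using maximal[OF x j(1)] by simp
    qed (use B in auto)
    also have "(\<integral>\<^sup>+x. (ennreal (Emax 0 m x) * indicator ?Q x) * ennreal (Emax 0 m x powr \<epsilon>) \<partial>lebesgue) = J"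
      unfolding J_def
    proof (intro nn_integral_cong)
      fix x
      have "Emax 0 m x * Emax 0 m x powr \<epsilon> = Emax 0 m x powr (1 + \<epsilon>)"
        using M0[of x] by (cases "Emax 0 m x = 0") (auto simp: powr_add)
      then show "ennreal (Emax 0 m x) * indicator ?Q x * ennreal (Emax 0 m x powr \<epsilon>) = ennreal (Emax 0 m x powr (1 + \<epsilon>)) * indicator ?Q x"
        using M0[of x] by (auto simp: indicator_def ennreal_mult[symmetric])
    qed
    also have "(\<integral>\<^sup>+x\<in>?Q. ennreal (Emax 0 m x) \<partial>lebesgue) \<le> ennreal B * ennreal (e0 * c)"
      using maximal[of x0 0 m] by (simp add: vQ)
    finally have "J \<le> ennreal (e0 powr \<epsilon>) * (ennreal B * ennreal (e0 * c)) + ennreal (B * ?N * \<epsilon> / (1 + \<epsilon>)) * J"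
      by (simp add: add_right_mono mult_left_mono)
    also have "\<dots> = ennreal (e0 powr \<epsilon> * (B * (e0 * c)) + B * ?N * \<epsilon> / (1 + \<epsilon>) * J')"
      unfolding JJ(1) using B e0 c \<epsilon>0 JJ(2) by (simp add: ennreal_mult[symmetric] ennreal_plus[symmetric] del: ennreal_plus)
    finally have "J' \<le> e0 powr \<epsilon> * (B * (e0 * c)) + B * ?N * \<epsilon> / (1 + \<epsilon>) * J'"
      unfolding JJ(1) using B e0 c \<epsilon>0 JJ(2) by (subst (asm) ennreal_le_iff) auto
    also have "\<dots> \<le> e0 powr \<epsilon> * (B * (e0 * c)) + 1 / 2 * J'"
      unfolding \<epsilon>B using JJ(2) \<epsilon>0 by (intro add_left_mono mult_right_mono) (auto simp: field_simps)
    also have "e0 powr \<epsilon> * (B * (e0 * c)) = B * (e0 powr (1 + \<epsilon>) * c)"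
      unfolding e0_powr[symmetric] by simp
    finally have Jle: "J' \<le> 2 * B * (e0 powr (1 + \<epsilon>) * c)" by simp
    have "(\<integral>\<^sup>+x. (ennreal (v x) * indicator ?Q x) * ennreal (Emax 0 m x powr \<epsilon>) \<partial>lebesgue)
       \<le> ennreal (e0 powr \<epsilon>) * (\<integral>\<^sup>+x\<in>?Q. ennreal (v x) \<partial>lebesgue) + ennreal (1 * ?N * \<epsilon> / (1 + \<epsilon>)) * J"
      by (rule lev) auto
    also have "\<dots> = ennreal (e0 powr (1 + \<epsilon>) * c + ?N * \<epsilon> / (1 + \<epsilon>) * J')"
      unfolding vQ JJ(1) e0_powr[symmetric] using e0 c \<epsilon>0 JJ(2)
      by (simp add: ennreal_mult[symmetric] ennreal_plus[symmetric] mult.assoc del: ennreal_plus)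
    also have "\<dots> \<le> ennreal (2 * e0 powr (1 + \<epsilon>) * c)"
    proof (rule ennreal_leI)
      have "?N * \<epsilon> / (1 + \<epsilon>) * J' \<le> ?N * \<epsilon> * (2 * B * (e0 powr (1 + \<epsilon>) * c))"
        using Jle JJ(2) \<epsilon>0 by (intro mult_mono) (auto simp: divide_le_eq)
      also have "\<dots> = 2 * (B * ?N * \<epsilon>) * (e0 powr (1 + \<epsilon>) * c)" by simp
      finally show "e0 powr (1 + \<epsilon>) * c + ?N * \<epsilon> / (1 + \<epsilon>) * J' \<le> 2 * e0 powr (1 + \<epsilon>) * c"
        unfolding \<epsilon>B by (simp add: mult.commute)
    qed
    finally show ?thesis by (simp add: ac_simps)
  qed
  have "(\<integral>\<^sup>+y\<in>?Q. ennreal (v y powr (1 + \<epsilon>)) \<partial>lebesgue)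
     \<le> (\<integral>\<^sup>+y. (SUP m. ennreal (v y) * ennreal (Emax 0 m y powr \<epsilon>) * indicator ?Q y) \<partial>lebesgue)"
  proof (intro nn_integral_mono_AE)
    show "AE y in lebesgue. ennreal (v y powr (1 + \<epsilon>)) * indicator ?Q y
       \<le> (SUP m. ennreal (v y) * ennreal (Emax 0 m y powr \<epsilon>) * indicator ?Q y)"
      using AE_less_E
    proof eventually_elim
      case (elim y)
      have "ennreal (v y powr (1 + \<epsilon>)) \<le> (SUP m. ennreal (v y) * ennreal (Emax 0 m y powr \<epsilon>))"
      proof (cases "v y = 0")
        case False
        then have v: "v y > 0" using v_nonneg[of y] by simp
        have "ennreal (v y powr \<epsilon>) \<le> (SUP m. ennreal (Emax 0 m y powr \<epsilon>))"
        proof (rule dense_le)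
          fix z assume z: "z < ennreal (v y powr \<epsilon>)"
          then obtain z' where z': "z = ennreal z'" "z' \<ge> 0" by (cases z) auto
          then have "z' < v y powr \<epsilon>" using z by (simp add: ennreal_less_iff)
          then have "z' powr (1/\<epsilon>) < (v y powr \<epsilon>) powr (1/\<epsilon>)" using z' \<epsilon>0 by (intro powr_less_mono2) auto
          then have "z' powr (1/\<epsilon>) < v y" using v \<epsilon>0 by (simp add: powr_powr)
          then obtain j where j: "z' powr (1/\<epsilon>) < E j y" using elim by blast
          also have "\<dots> \<le> Emax 0 j y" unfolding Emax_def by (intro Max_ge) auto
          finally have "(z' powr (1/\<epsilon>)) powr \<epsilon> \<le> Emax 0 j y powr \<epsilon>" using \<epsilon>0 by (intro powr_mono2) auto
          then have "z \<le> ennreal (Emax 0 j y powr \<epsilon>)" using z' \<epsilon>0 by (simp add: powr_powr ennreal_leI)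
          also have "\<dots> \<le> (SUP m. ennreal (Emax 0 m y powr \<epsilon>))" by (rule SUP_upper) simp
          finally show "z \<le> (SUP m. ennreal (Emax 0 m y powr \<epsilon>))" .
        qed
        then have "ennreal (v y) * ennreal (v y powr \<epsilon>) \<le> ennreal (v y) * (SUP m. ennreal (Emax 0 m y powr \<epsilon>))"
          by (intro mult_left_mono) auto
        also have "ennreal (v y) * ennreal (v y powr \<epsilon>) = ennreal (v y powr (1 + \<epsilon>))"
          using v by (simp add: ennreal_mult[symmetric] powr_add)
        also have "ennreal (v y) * (SUP m. ennreal (Emax 0 m y powr \<epsilon>)) = (SUP m. ennreal (v y) * ennreal (Emax 0 m y powr \<epsilon>))"
          by (rule SUP_mult_left_ennreal)
        finally show ?thesis .
      qed simp
      then show ?case by (cases "y \<in> ?Q") auto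
    qed
  qed
  also have "\<dots> = (SUP m. \<integral>\<^sup>+y. ennreal (v y) * ennreal (Emax 0 m y powr \<epsilon>) * indicator ?Q y \<partial>lebesgue)"
  proof (rule nn_integral_monotone_convergence_SUP)
    have "Emax 0 m y \<le> Emax 0 m' y" if "m \<le> m'" for m m' y
      unfolding Emax_def using that by (intro Max_mono) auto
    then show "incseq (\<lambda>m y. ennreal (v y) * ennreal (Emax 0 m y powr \<epsilon>) * indicator ?Q y)"
      unfolding incseq_def le_fun_def using \<epsilon>0 Emax_nonneg
      by (intro allI impI mult_right_mono mult_left_mono ennreal_leI powr_mono2) auto
  qed measurable
  also have "\<dots> \<le> ennreal (2 * e0 powr (1 + \<epsilon>) * c)"
    by (rule SUP_least) (rule bound)
  finally show ?thesis by (simp add: e0_def c_def)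
qed

end

section \<open>Reverse Hoelder inequalities on arbitrary cubes\<close>

text \<open>The Fujii-Wilson condition with constant \<open>B\<close>, with measurable minorants of the local maximal function in place
  of the maximal function itself. The minorants that occur are dyadic maximal functions of finitely many generations.\<close>

definition Fujii_Wilson :: "real \<Rightarrow> (real ^ 'n \<Rightarrow> real) \<Rightarrow> bool" where
  "Fujii_Wilson B v \<longleftrightarrow> (\<forall>R\<in>cubes. \<forall>u\<in>borel_measurable lebesgue.
     (\<forall>y\<in>R. \<exists>Q\<in>cubes. y \<in> Q \<and> Q \<subseteq> R \<and> u y \<le> mean v Q) \<longrightarrow>
     (\<integral>\<^sup>+y\<in>R. ennreal (u y) \<partial>lebesgue) \<le> ennreal B * (\<integral>\<^sup>+y\<in>R. ennreal (v y) \<partial>lebesgue))"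

lemma mean_cong: "(\<And>x. x \<in> Q \<Longrightarrow> f x = g x) \<Longrightarrow> mean f Q = mean g Q"
  unfolding mean_def by (intro arg_cong2[of _ _ _ _ "(/)"] arg_cong[of _ _ enn2real] nn_integral_cong) (auto simp: indicator_def)

text \<open>A cube with arbitrary faces agrees up to a null set with a half-open one, which is a cell of
  generation zero of the dyadic subdivision based at its own corner.\<close>

lemma cube_AE_eq_cell:
  fixes Q :: "(real ^ 'n) set"
  assumes "Q \<in> cubes"
  obtains a :: "real ^ 'n" and l where "l > 0" "AE x in lebesgue. x \<in> dyadic_cells.cell a l 0 a \<longleftrightarrow> x \<in> Q"
    "measure lebesgue (dyadic_cells.cell a l 0 a) = measure lebesgue Q"
proof -
  obtain l where l: "cube l Q" using assms by (auto simp: cubes_def)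
  obtain a where a: "l > 0" "box a (\<chi> i. a $ i + l) \<subseteq> Q" "Q \<subseteq> cbox a (\<chi> i. a $ i + l)"
    by (rule cube_between_boxes[OF l])
  interpret dyadic_cells a l by unfold_locales fact
  have "cell 0 a = {y. \<forall>i. \<lfloor>(y $ i - a $ i) / l\<rfloor> = 0}"
    by (auto simp: cell_def cell_index_def vec_eq_iff)
  also have "\<dots> = {y. \<forall>i. a $ i \<le> y $ i \<and> y $ i < a $ i + l}"
    using a(1) by (auto simp: floor_eq_iff field_simps)
  finally have "box a (\<chi> i. a $ i + l) \<subseteq> cell 0 a" "cell 0 a \<subseteq> cbox a (\<chi> i. a $ i + l)"
    by (auto simp: mem_box_cart less_imp_le)
  with a have "{x. \<not> (x \<in> cell 0 a \<longleftrightarrow> x \<in> Q)} \<subseteq> cbox a (\<chi> i. a $ i + l) - box a (\<chi> i. a $ i + l)"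
    by blast
  then have "negligible {x. \<not> (x \<in> cell 0 a \<longleftrightarrow> x \<in> Q)}"
    by (rule negligible_subset[OF negligible_frontier_interval])
  then have "AE x in lebesgue. x \<in> cell 0 a \<longleftrightarrow> x \<in> Q"
    by (intro AE_I'[of "{x. \<not> (x \<in> cell 0 a \<longleftrightarrow> x \<in> Q)}"]) (auto simp: negligible_iff_null_sets)
  moreover have "measure lebesgue (cell 0 a) = measure lebesgue Q"
    using measure_cell[of 0 a] cube_measure(2)[OF l] by simp
  ultimately show ?thesis using that a(1) by blast
qed

lemma reverse_Holder_cube:
  fixes v :: "real ^ 'n \<Rightarrow> real"
  assumes [measurable]: "v \<in> borel_measurable lebesgue" and v: "\<And>x. v x \<ge> 0"
    and B: "Fujii_Wilson B v" "B \<ge> 1" and Q: "Q \<in> cubes" and fin: "(\<integral>\<^sup>+x\<in>Q. ennreal (v x) \<partial>lebesgue) < \<infinity>"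
    and \<epsilon>: "\<epsilon> = 1 / (2 ^ (CARD('n) + 1) * B)"
  shows "(\<integral>\<^sup>+x\<in>Q. ennreal (v x powr (1 + \<epsilon>)) \<partial>lebesgue) \<le> ennreal (2 * mean v Q powr (1 + \<epsilon>) * measure lebesgue Q)"
proof -
  obtain a l where l: "l > 0" and AE: "AE x in lebesgue. x \<in> dyadic_cells.cell a l 0 a \<longleftrightarrow> x \<in> Q"
    and m: "measure lebesgue (dyadic_cells.cell a l 0 a) = measure lebesgue Q"
    by (rule cube_AE_eq_cell[OF Q])
  interpret dyadic_cells a l by unfold_locales fact
  let ?Q = "cell 0 a"
  have [measurable]: "?Q \<in> sets lebesgue" by (rule cubes_measure(2)[OF cell_in_cubes])
  have int: "(\<integral>\<^sup>+x\<in>?Q. f x \<partial>lebesgue) = (\<integral>\<^sup>+x\<in>Q. f x \<partial>lebesgue)" for f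
    using AE by (intro nn_integral_cong_AE, eventually_elim) (auto simp: indicator_def)
  have mean: "mean f ?Q = mean f Q" for f by (simp add: mean_def int m)
  define v' where "v' x = v x * indicator ?Q x" for x
  interpret dyadic_weight a l v'
  proof
    show "v' \<in> borel_measurable lebesgue" unfolding v'_def by measurable
    show "v' x \<ge> 0" for x using v by (simp add: v'_def)
    have "(\<integral>\<^sup>+x. ennreal (v' x) \<partial>lebesgue) = (\<integral>\<^sup>+x\<in>?Q. ennreal (v x) \<partial>lebesgue)"
      by (intro nn_integral_cong) (auto simp: v'_def indicator_def)
    then show "(\<integral>\<^sup>+x. ennreal (v' x) \<partial>lebesgue) < \<infinity>" using fin by (simp only: int)
  qed
  have E0: "E 0 a = mean v Q"
    unfolding E_def mean[symmetric] by (rule mean_cong) (simp add: v'_def)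
  have "(\<integral>\<^sup>+y\<in>?Q. ennreal (v' y powr (1 + \<epsilon>)) \<partial>lebesgue) \<le> ennreal (2 * E 0 a powr (1 + \<epsilon>) * measure lebesgue ?Q)"
  proof (rule reverse_Holder[OF B(2) _ \<epsilon>])
    fix x and j m :: nat assume x: "x \<in> ?Q" and jm: "j \<le> m"
    have sub: "cell i y \<subseteq> ?Q" if "y \<in> cell j x" for i y
    proof -
      have "y \<in> cell 0 x" using that cell_antimono[of 0 j x] by auto
      then have "cell 0 y = ?Q" using x by (metis cell_eq)
      then show ?thesis using cell_antimono[of 0 i y] by auto
    qed
    have "(\<integral>\<^sup>+y\<in>cell j x. ennreal (Emax j m y) \<partial>lebesgue) \<le> ennreal B * (\<integral>\<^sup>+y\<in>cell j x. ennreal (v y) \<partial>lebesgue)"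
    proof (rule B(1)[unfolded Fujii_Wilson_def, rule_format, OF cell_in_cubes])
      show "Emax j m \<in> borel_measurable lebesgue" using jm by measurable
      fix y assume y: "y \<in> cell j x"
      have "Emax j m y \<in> (\<lambda>i. E i y) ` {j..m}" unfolding Emax_def using jm by (intro Max_in) auto
      then obtain i where i: "i \<in> {j..m}" "Emax j m y = E i y" by auto
      have "E i y = mean v (cell i y)"
        unfolding E_def using sub[OF y, of i] by (intro mean_cong) (auto simp: v'_def)
      moreover have "cell i y \<subseteq> cell j x" using cell_antimono[of j i y] i cell_eq[OF y] by auto
      ultimately show "\<exists>Q\<in>cubes. y \<in> Q \<and> Q \<subseteq> cell j x \<and> Emax j m y \<le> mean v Q"
        using i cell_in_cubes by (intro bexI[of _ "cell i y"]) auto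
    qed
    also have "(\<integral>\<^sup>+y\<in>cell j x. ennreal (v y) \<partial>lebesgue) = (\<integral>\<^sup>+y\<in>cell j x. ennreal (v' y) \<partial>lebesgue)"
      using sub[of x j] by (intro nn_integral_cong) (auto simp: v'_def indicator_def)
    finally show "(\<integral>\<^sup>+y\<in>cell j x. ennreal (Emax j m y) \<partial>lebesgue) \<le> ennreal B * (\<integral>\<^sup>+y\<in>cell j x. ennreal (v' y) \<partial>lebesgue)" .
  qed
  also have "(\<integral>\<^sup>+y\<in>?Q. ennreal (v' y powr (1 + \<epsilon>)) \<partial>lebesgue) = (\<integral>\<^sup>+y\<in>?Q. ennreal (v y powr (1 + \<epsilon>)) \<partial>lebesgue)"
    by (intro nn_integral_cong) (auto simp: v'_def indicator_def)
  finally show ?thesis by (simp only: int E0 m)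
qed

text \<open>All averages of the sparse form reduce to means; the exponent \<open>\<alpha>\<close> becomes a power of the measure.\<close>

lemma avg_eq:
  fixes Q :: "(real ^ 'n) set"
  assumes Q: "Q \<in> cubes" and \<rho>: "\<rho> > 0" and fin: "(\<integral>\<^sup>+x\<in>Q. ennreal (norm (g x) powr \<rho>) \<partial>lebesgue) < \<infinity>"
  shows "avg \<alpha> \<rho> Q g = ennreal (mean (\<lambda>x. norm (g x) powr \<rho>) Q powr (1 / \<rho>) * measure lebesgue Q powr (\<alpha> / (real CARD('n) * \<rho>)))"
proof -
  define V where "V = measure lebesgue Q"
  define m where "m = mean (\<lambda>x. norm (g x) powr \<rho>) Q"
  have V: "V > 0" "emeasure lebesgue Q = ennreal V" using cubes_measure[OF Q] by (simp_all add: V_def)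
  have m: "m \<ge> 0" "(\<integral>\<^sup>+x\<in>Q. ennreal (norm (g x) powr \<rho>) \<partial>lebesgue) = ennreal (m * V)"
    using nn_integral_eq_mean[OF Q fin] by (simp_all add: m_def V_def)
  have "m * V / V powr (1 - \<alpha> / real CARD('n)) = m * V powr (\<alpha> / real CARD('n))"
    using V by (simp add: powr_diff)
  then have "avg \<alpha> \<rho> Q g = epowr (ennreal (m * V powr (\<alpha> / real CARD('n)))) (1 / \<rho>)"
    unfolding avg_def m(2) V(2) epowr_real[OF V(1)] using V m(1) by (simp add: divide_ennreal)
  also have "\<dots> = ennreal ((m * V powr (\<alpha> / real CARD('n))) powr (1 / \<rho>))"
    using m \<rho> by (intro epowr_pos) auto
  also have "\<dots> = ennreal (m powr (1 / \<rho>) * V powr (\<alpha> / (real CARD('n) * \<rho>)))"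
    using m V by (simp add: powr_mult powr_powr)
  finally show ?thesis by (simp add: m_def V_def)
qed

text \<open>A reverse Hoelder inequality for \<open>\<mu>\<close> makes \<open>\<mu>\<^sup>s\<close> an \<open>A\<^sub>\<infinity>\<close> weight: its means are at most
  \<open>R\<^sup>s\<close> times the \<open>s\<close>-th power of means of \<open>\<mu>\<close>, and the maximal function is bounded on \<open>L\<^sup>s\<close>.
  This is the source of the power \<open>s\<close> of the reverse Hoelder constant in the main theorem.\<close>

lemma Fujii_Wilson_of_reverse_Holder:
  fixes \<mu> :: "real ^ 'n \<Rightarrow> real"
  assumes [measurable]: "\<mu> \<in> borel_measurable lebesgue" and \<mu>: "\<And>x. \<mu> x \<ge> 0" and s: "s > 1" and R: "R > 0"
    and RH: "\<And>Q. Q \<in> cubes \<Longrightarrow> mean (\<lambda>x. \<mu> x powr s) Q \<le> (R * mean \<mu> Q) powr s"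
  shows "Fujii_Wilson (R powr s * carleson_const CARD('n) s) (\<lambda>x. \<mu> x powr s)"
  unfolding Fujii_Wilson_def
proof (intro ballI impI)
  fix K :: "(real ^ 'n) set" and u
  assume K: "K \<in> cubes" and [measurable]: "u \<in> borel_measurable lebesgue"
    and u: "\<forall>y\<in>K. \<exists>Q\<in>cubes. y \<in> Q \<and> Q \<subseteq> K \<and> u y \<le> mean (\<lambda>x. \<mu> x powr s) Q"
  have [measurable]: "K \<in> sets lebesgue" by (rule cubes_measure(2)[OF K])
  define G where "G x = \<mu> x * indicator K x" for x
  define z where "z x = max 0 (u x) powr (1 / s) / R * indicator K x" for x
  have [measurable]: "G \<in> borel_measurable lebesgue" "z \<in> borel_measurable lebesgue"
    unfolding G_def z_def by measurable
  have "(\<integral>\<^sup>+x. ennreal (z x powr s) \<partial>lebesgue) \<le> ennreal (carleson_const CARD('n) s) * (\<integral>\<^sup>+x. ennreal (G x powr s) \<partial>lebesgue)"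
  proof (rule nn_integral_powr_maximal)
    fix x and t :: real assume t: "0 < t" "t < z x"
    then have x: "x \<in> K" by (cases "x \<in> K") (auto simp: z_def)
    then obtain Q where Q: "Q \<in> cubes" "x \<in> Q" "Q \<subseteq> K" "u x \<le> mean (\<lambda>x. \<mu> x powr s) Q" using u by blast
    have "max 0 (u x) \<le> (R * mean \<mu> Q) powr s"
      using Q(4) RH[OF Q(1)] by simp
    then have "max 0 (u x) powr (1 / s) \<le> ((R * mean \<mu> Q) powr s) powr (1 / s)"
      using s by (intro powr_mono2) auto
    then have "max 0 (u x) powr (1 / s) \<le> R * mean \<mu> Q" using s R by (simp add: powr_powr)
    then have "z x \<le> mean \<mu> Q" using x R by (simp add: z_def field_simps)
    also have "mean \<mu> Q = mean G Q" using Q(3) by (intro mean_cong) (auto simp: G_def)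
    finally show "\<exists>Q\<in>cubes. x \<in> Q \<and> t < mean G Q" using Q t by force
  qed (use \<mu> R s in \<open>auto simp: G_def z_def\<close>)
  also have "(\<integral>\<^sup>+x. ennreal (G x powr s) \<partial>lebesgue) = (\<integral>\<^sup>+x\<in>K. ennreal (\<mu> x powr s) \<partial>lebesgue)"
    by (intro nn_integral_cong) (auto simp: G_def indicator_def)
  finally have *: "(\<integral>\<^sup>+x. ennreal (z x powr s) \<partial>lebesgue) \<le> ennreal (carleson_const CARD('n) s) * (\<integral>\<^sup>+x\<in>K. ennreal (\<mu> x powr s) \<partial>lebesgue)" .
  have "(\<integral>\<^sup>+y\<in>K. ennreal (u y) \<partial>lebesgue) \<le> (\<integral>\<^sup>+x. ennreal (R powr s) * ennreal (z x powr s) \<partial>lebesgue)"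
  proof (intro nn_integral_mono)
    fix x show "ennreal (u x) * indicator K x \<le> ennreal (R powr s) * ennreal (z x powr s)"
    proof (cases "x \<in> K \<and> u x > 0")
      case True
      then have "R powr s * z x powr s = u x" using R s by (simp add: z_def powr_divide powr_powr)
      then show ?thesis using True by (simp add: ennreal_mult[symmetric])
    qed (auto simp: indicator_def ennreal_neg)
  qed
  also have "\<dots> = ennreal (R powr s) * (\<integral>\<^sup>+x. ennreal (z x powr s) \<partial>lebesgue)"
    by (rule nn_integral_cmult) measurable
  also have "\<dots> \<le> ennreal (R powr s) * (ennreal (carleson_const CARD('n) s) * (\<integral>\<^sup>+x\<in>K. ennreal (\<mu> x powr s) \<partial>lebesgue))"
    by (intro mult_left_mono *) simp
  also have "\<dots> = ennreal (R powr s * carleson_const CARD('n) s) * (\<integral>\<^sup>+x\<in>K. ennreal (\<mu> x powr s) \<partial>lebesgue)"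
    using carleson_const_nonneg[of "CARD('n)" s] s by (simp add: ennreal_mult mult.assoc)
  finally show "(\<integral>\<^sup>+y\<in>K. ennreal (u y) \<partial>lebesgue) \<le> \<dots>" .
qed

text \<open>The local maximal function on a cube \<open>K\<close> dominates the means over all cubes inside \<open>K\<close>.\<close>

lemma Fujii_Wilson_of_A_inf:
  fixes v :: "real ^ 'n \<Rightarrow> real"
  assumes [measurable]: "v \<in> borel_measurable lebesgue" and v: "\<And>x. v x \<ge> 0"
    and fin: "\<And>Q. Q \<in> cubes \<Longrightarrow> (\<integral>\<^sup>+x\<in>Q. ennreal (v x) \<partial>lebesgue) < \<infinity>"
    and B: "A_inf_const v \<le> ennreal B"
  shows "Fujii_Wilson B v"
  unfolding Fujii_Wilson_def
proof (intro ballI impI)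
  fix K :: "(real ^ 'n) set" and u
  assume K: "K \<in> cubes" and [measurable]: "u \<in> borel_measurable lebesgue"
    and u: "\<forall>y\<in>K. \<exists>Q\<in>cubes. y \<in> Q \<and> Q \<subseteq> K \<and> u y \<le> mean v Q"
  define M where "M = (\<integral>\<^sup>+x\<in>K. maximal (\<lambda>y. v y * indicator K y) x \<partial>lebesgue)"
  define I where "I = (\<integral>\<^sup>+x\<in>K. ennreal (v x) \<partial>lebesgue)"
  have "(\<integral>\<^sup>+y\<in>K. ennreal (u y) \<partial>lebesgue) \<le> M"
    unfolding M_def
  proof (intro nn_integral_mono mult_indicator_mono)
    fix y assume "y \<in> K"
    then obtain Q where Q: "Q \<in> cubes" "y \<in> Q" "Q \<subseteq> K" "u y \<le> mean v Q" using u by blast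
    have *: "(\<integral>\<^sup>+x\<in>Q. ennreal (norm (v x * indicator K x) powr 1) \<partial>lebesgue) = (\<integral>\<^sup>+x\<in>Q. ennreal (v x) \<partial>lebesgue)"
      using Q(3) v by (intro nn_integral_cong) (auto simp: indicator_def)
    have "avg 0 1 Q (\<lambda>y. v y * indicator K y) = ennreal (mean (\<lambda>x. norm (v x * indicator K x) powr 1) Q)"
      using avg_eq[OF Q(1), of 1 "\<lambda>y. v y * indicator K y" 0] fin[OF Q(1)] cubes_measure(3)[OF Q(1)] unfolding * by simp
    also have "mean (\<lambda>x. norm (v x * indicator K x) powr 1) Q = mean v Q"
      using Q(3) v by (intro mean_cong) auto
    finally have "ennreal (u y) \<le> avg 0 1 Q (\<lambda>y. v y * indicator K y) * indicator Q y"
      using Q by (simp add: ennreal_leI)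
    also have "\<dots> \<le> maximal (\<lambda>y. v y * indicator K y) y"
      unfolding maximal_def by (rule SUP_upper[OF Q(1)])
    finally show "ennreal (u y) \<le> maximal (\<lambda>y. v y * indicator K y) y" .
  qed
  also have "M \<le> ennreal B * I"
  proof -
    have le: "M / I \<le> ennreal B"
      unfolding M_def I_def by (rule order_trans[OF SUP_upper[OF K] B[unfolded A_inf_const_def]])
    have I: "I < \<infinity>" unfolding I_def by (rule fin[OF K])
    show ?thesis
    proof (cases "I = 0")
      case True
      then have "M = 0" using le by (cases "M = 0") (auto simp: ennreal_divide_zero top_unique divide_ennreal_def ennreal_mult_top)
      then show ?thesis by simp
    next
      case False
      then have "M / I * I = M" using I by (simp add: ennreal_divide_times mult_divide_eq_ennreal)
      then show ?thesis using le by (metis mult_right_mono zero_le)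
    qed
  qed
  finally show "(\<integral>\<^sup>+y\<in>K. ennreal (u y) \<partial>lebesgue) \<le> ennreal B * (\<integral>\<^sup>+y\<in>K. ennreal (v y) \<partial>lebesgue)"
    by (simp add: I_def)
qed

section \<open>The weighted estimate for one sparse family\<close>

lemma mean_pos:
  fixes v :: "real ^ 'n \<Rightarrow> real"
  assumes [measurable]: "v \<in> borel_measurable lebesgue" and pos: "AE x in lebesgue. v x > 0"
    and Q: "Q \<in> cubes" and fin: "(\<integral>\<^sup>+x\<in>Q. ennreal (v x) \<partial>lebesgue) < \<infinity>"
  shows "mean v Q > 0"
proof (rule ccontr)
  assume "\<not> ?thesis"
  then have "mean v Q = 0" using mean_nonneg[of v Q] by linarith
  then have "(\<integral>\<^sup>+x\<in>Q. ennreal (v x) \<partial>lebesgue) = 0" using nn_integral_eq_mean[OF Q fin] by simp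
  moreover have [measurable]: "Q \<in> sets lebesgue" by (rule cubes_measure(2)[OF Q])
  ultimately have "AE x in lebesgue. ennreal (v x) * indicator Q x = 0"
    by (subst (asm) nn_integral_0_iff_AE) auto
  with pos have "AE x in lebesgue. x \<notin> Q"
    by eventually_elim (auto simp: indicator_def split: if_splits)
  then have "emeasure lebesgue Q = 0" by (subst AE_iff_measurable[symmetric]) auto
  then show False using cubes_measure(3,4)[OF Q] by simp
qed

text \<open>The supremum in the essential infimum is attained, as it is the limit of a sequence.\<close>

lemma AE_ess_inf_on_le: "AE x in lebesgue. x \<in> Q \<longrightarrow> ess_inf_on Q v \<le> ennreal (v x)"
proof -
  let ?C = "{c. AE x in lebesgue. x \<in> Q \<longrightarrow> c \<le> ennreal (v x)}"
  have "0 \<in> ?C" by simp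
  then obtain f :: "nat \<Rightarrow> ennreal" where f: "range f \<subseteq> ?C" "Sup ?C = (SUP i. f i)"
    using ennreal_Sup_countable_SUP[of ?C] by blast
  have "AE x in lebesgue. \<forall>i. x \<in> Q \<longrightarrow> f i \<le> ennreal (v x)"
    using f(1) by (subst AE_all_countable) auto
  then show ?thesis
    unfolding ess_inf_on_def f(2) by eventually_elim (auto intro: SUP_least)
qed

lemma nn_integral_le_imp_mean_le:
  assumes Q: "Q \<in> cubes" and le: "(\<integral>\<^sup>+x\<in>Q. ennreal (f x) \<partial>lebesgue) \<le> ennreal (c * measure lebesgue Q)" and "c \<ge> 0"
  shows "mean f Q \<le> c"
proof -
  have "(\<integral>\<^sup>+x\<in>Q. ennreal (f x) \<partial>lebesgue) < \<infinity>" by (rule le_less_trans[OF le]) simp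
  from nn_integral_eq_mean[OF Q this] le have "ennreal (mean f Q * measure lebesgue Q) \<le> ennreal (c * measure lebesgue Q)" by simp
  then have "mean f Q * measure lebesgue Q \<le> c * measure lebesgue Q"
    using assms(3) by (subst (asm) ennreal_le_iff) auto
  then show ?thesis using cubes_measure(3)[OF Q] by simp
qed

lemma mean_Holder:
  fixes f g h :: "real ^ 'n \<Rightarrow> real"
  assumes [measurable]: "f \<in> borel_measurable lebesgue" "g \<in> borel_measurable lebesgue"
    and pos: "\<And>x. f x \<ge> 0" "\<And>x. g x \<ge> 0" and \<theta>: "0 < \<theta>" "\<theta> < 1" and Q: "Q \<in> cubes"
    and F: "(\<integral>\<^sup>+x\<in>Q. ennreal (f x) \<partial>lebesgue) < \<infinity>"
    and G: "(\<integral>\<^sup>+x\<in>Q. ennreal (g x) \<partial>lebesgue) < \<infinity>"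
    and h: "AE x in lebesgue. x \<in> Q \<longrightarrow> h x \<le> f x powr \<theta> * g x powr (1 - \<theta>)"
  shows "mean h Q \<le> mean f Q powr \<theta> * mean g Q powr (1 - \<theta>)"
proof (rule nn_integral_le_imp_mean_le[OF Q])
  let ?V = "measure lebesgue Q"
  have V: "?V > 0" by (rule cubes_measure(3)[OF Q])
  have [measurable]: "Q \<in> sets lebesgue" by (rule cubes_measure(2)[OF Q])
  have ind: "(\<integral>\<^sup>+x. ennreal (k x * indicator Q x) \<partial>lebesgue) = (\<integral>\<^sup>+x\<in>Q. ennreal (k x) \<partial>lebesgue)" for k
    by (intro nn_integral_cong) (auto simp: indicator_def)
  have "(\<integral>\<^sup>+x\<in>Q. ennreal (h x) \<partial>lebesgue) \<le> (\<integral>\<^sup>+x. ennreal ((f x * indicator Q x) powr \<theta> * (g x * indicator Q x) powr (1 - \<theta>)) \<partial>lebesgue)"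
    using h by (intro nn_integral_mono_AE, eventually_elim) (auto simp: indicator_def ennreal_leI)
  also have "\<dots> \<le> ennreal ((mean f Q * ?V) powr \<theta> * (mean g Q * ?V) powr (1 - \<theta>))"
  proof (rule nn_integral_Holder_powr)
    show "(\<integral>\<^sup>+x. ennreal (f x * indicator Q x) \<partial>lebesgue) = ennreal (mean f Q * ?V)"
      unfolding ind by (rule nn_integral_eq_mean[OF Q F])
    show "(\<integral>\<^sup>+x. ennreal (g x * indicator Q x) \<partial>lebesgue) = ennreal (mean g Q * ?V)"
      unfolding ind by (rule nn_integral_eq_mean[OF Q G])
  qed (use pos \<theta> V in auto)
  also have "(mean f Q * ?V) powr \<theta> * (mean g Q * ?V) powr (1 - \<theta>) = mean f Q powr \<theta> * mean g Q powr (1 - \<theta>) * (?V powr \<theta> * ?V powr (1 - \<theta>))"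
    using V by (simp add: powr_mult)
  also have "?V powr \<theta> * ?V powr (1 - \<theta>) = ?V" using V by (simp flip: powr_add)
  finally show "(\<integral>\<^sup>+x\<in>Q. ennreal (h x) \<partial>lebesgue) \<le> ennreal (mean f Q powr \<theta> * mean g Q powr (1 - \<theta>) * ?V)" .
qed simp

text \<open>How the \<open>A\<^sub>r\<close> condition enters: it trades the unweighted mean of \<open>h\<close> for one of \<open>w h\<close>, by Hoelder's
  inequality with \<open>h = (w h) w\<^sup>-\<^sup>1\<close>, or by the lower bound for \<open>w\<close> in the endpoint case \<open>p\<^sub>0 = p\<close>.
  The exponent \<open>r\<close> is such that the dual weight is the power of \<open>w\<^sup>-\<^sup>1\<close> that appears in Hoelder's
  inequality.\<close>

lemma mean_le_A_const:
  fixes w :: "real ^ 'n \<Rightarrow> real" and h :: "real ^ 'n \<Rightarrow> 'a :: {real_normed_field, euclidean_space}"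
  assumes [measurable]: "w \<in> borel_measurable lebesgue" "h \<in> borel_measurable lebesgue"
    and w: "\<And>x. w x \<ge> 0" "AE x in lebesgue. w x > 0"
    and p: "1 \<le> p\<^sub>0" "p\<^sub>0 \<le> p" and q: "q > 0" and r: "r = (1 / p\<^sub>0 - 1 / p) * q + 1"
    and A: "A_const r (\<lambda>x. w x powr q) \<le> ennreal A" "A \<ge> 0"
    and Q: "Q \<in> cubes" and fin: "(\<integral>\<^sup>+x\<in>Q. ennreal (w x powr q) \<partial>lebesgue) < \<infinity>"
    and F: "(\<integral>\<^sup>+x\<in>Q. ennreal ((w x * norm (h x)) powr p) \<partial>lebesgue) < \<infinity>"
  shows "mean (\<lambda>x. norm (h x) powr p\<^sub>0) Q powr (1 / p\<^sub>0)
    \<le> (A / mean (\<lambda>x. w x powr q) Q) powr (1 / q) * mean (\<lambda>x. (w x * norm (h x)) powr p) Q powr (1 / p)"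
proof -
  let ?\<mu> = "\<lambda>x. w x powr q" and ?F = "\<lambda>x. (w x * norm (h x)) powr p"
  let ?V = "measure lebesgue Q"
  define m where "m = mean ?\<mu> Q"
  have [measurable]: "Q \<in> sets lebesgue" by (rule cubes_measure(2)[OF Q])
  have V: "?V > 0" "emeasure lebesgue Q = ennreal ?V" using cubes_measure[OF Q] by auto
  have m: "m > 0" unfolding m_def using w(2) by (intro mean_pos[OF _ _ Q fin]) auto
  have mI: "(\<integral>\<^sup>+x\<in>Q. ennreal (?\<mu> x) \<partial>lebesgue) / emeasure lebesgue Q = ennreal m"
    unfolding nn_integral_eq_mean[OF Q fin] V(2) using V(1) m by (simp add: divide_ennreal m_def[symmetric])
  have AQ: "ennreal m * (if r = 1 then inverse (ess_inf_on Q ?\<mu>)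
         else epowr ((\<integral>\<^sup>+x\<in>Q. epowr (ennreal (?\<mu> x)) (1 - r / (r - 1)) \<partial>lebesgue) / emeasure lebesgue Q) (r - 1)) \<le> ennreal A"
    unfolding mI[symmetric] by (rule order_trans[OF SUP_upper[OF Q] A(1)[unfolded A_const_def]])
  show ?thesis
  proof (cases "p\<^sub>0 = p")
    case True
    define c where "c = ess_inf_on Q ?\<mu>"
    have c: "AE x in lebesgue. x \<in> Q \<longrightarrow> c \<le> ennreal (?\<mu> x)" unfolding c_def by (rule AE_ess_inf_on_le)
    have mc: "ennreal m * inverse c \<le> ennreal A" using AQ True r by (simp add: c_def)
    have "c \<noteq> 0"
    proof
      assume "c = 0"
      then have "ennreal m * top \<le> ennreal A" using mc by simp
      then show False using m by (simp add: ennreal_mult_top top_unique)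
    qed
    moreover have "c \<noteq> top"
    proof
      assume "c = top"
      from c have "AE x in lebesgue. x \<notin> Q" by eventually_elim (use \<open>c = top\<close> in \<open>auto simp: top_unique\<close>)
      then have "emeasure lebesgue Q = 0" by (subst AE_iff_measurable[symmetric]) auto
      then show False using V by simp
    qed
    ultimately obtain c' where c': "c = ennreal c'" "c' > 0" by (cases c) (auto simp: less_le)
    have "m / c' \<le> A" using mc c' m A(2) by (simp add: inverse_ennreal ennreal_mult[symmetric] divide_inverse)
    then have A0: "A > 0" using m c' by (smt (verit) divide_pos_pos)
    have cm: "m / A \<le> c'" using \<open>m / c' \<le> A\<close> c' A0 by (simp add: field_simps)
    have "mean (\<lambda>x. norm (h x) powr p) Q \<le> (A / m) powr (p / q) * mean ?F Q"
    proof (rule nn_integral_le_imp_mean_le[OF Q])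
      have "(\<integral>\<^sup>+x\<in>Q. ennreal (norm (h x) powr p) \<partial>lebesgue) \<le> (\<integral>\<^sup>+x. ennreal ((A / m) powr (p / q)) * (ennreal (?F x) * indicator Q x) \<partial>lebesgue)"
        using c
      proof (intro nn_integral_mono_AE, eventually_elim)
        case (elim x)
        show ?case
        proof (cases "x \<in> Q")
          case True
          then have "m / A \<le> ?\<mu> x" using elim cm c' by simp
          then have "(m / A) powr (p / q) \<le> (?\<mu> x) powr (p / q)" using m A0 p q by (intro powr_mono2) auto
          also have "\<dots> = w x powr p" using q by (simp add: powr_powr)
          finally have "(A / m) powr (p / q) * ((m / A) powr (p / q) * norm (h x) powr p) \<le> (A / m) powr (p / q) * (w x powr p * norm (h x) powr p)"
            by (intro mult_left_mono mult_right_mono) auto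
          moreover have "(A / m) powr (p / q) * (m / A) powr (p / q) = 1"
            using A0 m by (simp add: powr_mult[symmetric])
          ultimately have "norm (h x) powr p \<le> (A / m) powr (p / q) * ?F x"
            using w(1)[of x] by (simp add: powr_mult mult.assoc[symmetric])
          then show ?thesis using True by (simp add: ennreal_mult[symmetric] ennreal_leI)
        qed simp
      qed
      also have "\<dots> = ennreal ((A / m) powr (p / q)) * ennreal (mean ?F Q * ?V)"
        unfolding nn_integral_eq_mean[OF Q F, symmetric] by (rule nn_integral_cmult) measurable
      finally show "(\<integral>\<^sup>+x\<in>Q. ennreal (norm (h x) powr p) \<partial>lebesgue) \<le> ennreal ((A / m) powr (p / q) * mean ?F Q * ?V)"
        using V(1) by (simp add: ennreal_mult[symmetric] mult.assoc)
    qed simp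
    then have "mean (\<lambda>x. norm (h x) powr p) Q powr (1 / p) \<le> ((A / m) powr (p / q) * mean ?F Q) powr (1 / p)"
      using p by (intro powr_mono2) auto
    also have "\<dots> = (A / m) powr (1 / q) * mean ?F Q powr (1 / p)"
      using p q A0 m by (simp add: powr_mult powr_powr)
    finally show ?thesis using True by (simp add: m_def)
  next
    case False
    then have p': "p\<^sub>0 < p" using p by simp
    define \<tau> where "\<tau> = 1 / p\<^sub>0 - 1 / p"
    have \<tau>: "\<tau> > 0" using p p' by (simp add: \<tau>_def field_simps)
    have r1: "r - 1 = \<tau> * q" "r \<noteq> 1" "r - 1 > 0" using r \<tau> q by (auto simp: \<tau>_def)
    have ex: "1 - r / (r - 1) = - 1 / (\<tau> * q)" using r1 by (simp add: field_simps)
    let ?N = "\<lambda>x. w x powr (- 1 / \<tau>)"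
    have "(\<integral>\<^sup>+x\<in>Q. epowr (ennreal (?\<mu> x)) (1 - r / (r - 1)) \<partial>lebesgue) = (\<integral>\<^sup>+x\<in>Q. ennreal (?N x) \<partial>lebesgue)"
    proof (intro nn_integral_cong_AE)
      show "AE x in lebesgue. epowr (ennreal (?\<mu> x)) (1 - r / (r - 1)) * indicator Q x = ennreal (?N x) * indicator Q x"
        using w(2)
      proof eventually_elim
        case (elim x)
        have "epowr (ennreal (?\<mu> x)) (1 - r / (r - 1)) = ennreal (?N x)"
          unfolding ex using elim q by (subst epowr_real) (simp_all add: powr_powr)
        then show ?case by simp
      qed
    qed
    then have AN: "ennreal m * epowr ((\<integral>\<^sup>+x\<in>Q. ennreal (?N x) \<partial>lebesgue) / emeasure lebesgue Q) (r - 1) \<le> ennreal A"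
      using AQ r1 by simp
    have N: "(\<integral>\<^sup>+x\<in>Q. ennreal (?N x) \<partial>lebesgue) < \<infinity>"
    proof (rule ccontr)
      assume "\<not> ?thesis"
      then have "(\<integral>\<^sup>+x\<in>Q. ennreal (?N x) \<partial>lebesgue) = top" by (simp add: less_top[symmetric])
      then have "ennreal m * top \<le> ennreal A" using AN r1 V by (simp add: ennreal_top_divide)
      then show False using m by (simp add: ennreal_mult_top top_unique)
    qed
    have "(\<integral>\<^sup>+x\<in>Q. ennreal (?N x) \<partial>lebesgue) / emeasure lebesgue Q = ennreal (mean ?N Q)"
      unfolding nn_integral_eq_mean[OF Q N] V(2) using V(1) by (simp add: divide_ennreal)
    then have "ennreal (m * mean ?N Q powr (r - 1)) \<le> ennreal A"
      using AN m r1 by (simp add: epowr_pos ennreal_mult)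
    then have mN: "m * mean ?N Q powr (\<tau> * q) \<le> A" using A(2) r1 by (simp)
    have Nle: "mean ?N Q powr \<tau> \<le> (A / m) powr (1 / q)"
    proof -
      have "mean ?N Q powr \<tau> = (mean ?N Q powr (\<tau> * q)) powr (1 / q)" using q by (simp add: powr_powr)
      also have "\<dots> \<le> (A / m) powr (1 / q)" using mN m q by (intro powr_mono2) (auto simp: field_simps)
      finally show ?thesis .
    qed
    have pp: "0 < p\<^sub>0 / p" "p\<^sub>0 / p < 1" using p p' by auto
    have "mean (\<lambda>x. norm (h x) powr p\<^sub>0) Q \<le> mean ?F Q powr (p\<^sub>0 / p) * mean ?N Q powr (1 - p\<^sub>0 / p)"
    proof (rule mean_Holder[OF _ _ _ _ pp Q F N])
      show "AE x in lebesgue. x \<in> Q \<longrightarrow> norm (h x) powr p\<^sub>0 \<le> ?F x powr (p\<^sub>0 / p) * ?N x powr (1 - p\<^sub>0 / p)"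
        using w(2)
      proof eventually_elim
        case (elim x)
        have "1 / \<tau> * (1 - p\<^sub>0 / p) = p\<^sub>0" using p p' \<tau> by (simp add: \<tau>_def field_simps)
        then have "?N x powr (1 - p\<^sub>0 / p) = w x powr (- p\<^sub>0)" by (simp add: powr_powr)
        moreover have "?F x powr (p\<^sub>0 / p) = w x powr p\<^sub>0 * norm (h x) powr p\<^sub>0"
          using elim p p' by (simp add: powr_powr powr_mult)
        ultimately have "?F x powr (p\<^sub>0 / p) * ?N x powr (1 - p\<^sub>0 / p) = w x powr p\<^sub>0 * norm (h x) powr p\<^sub>0 * w x powr (- p\<^sub>0)"
          by (simp only:)
        also have "\<dots> = norm (h x) powr p\<^sub>0" using elim by (simp add: powr_minus)
        finally show ?case by (simp only: order_refl simp_thms)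
      qed
    qed auto
    then have "mean (\<lambda>x. norm (h x) powr p\<^sub>0) Q powr (1 / p\<^sub>0) \<le> (mean ?F Q powr (p\<^sub>0 / p) * mean ?N Q powr (1 - p\<^sub>0 / p)) powr (1 / p\<^sub>0)"
      using p by (intro powr_mono2) auto
    also have "\<dots> = mean ?N Q powr \<tau> * mean ?F Q powr (1 / p)"
    proof -
      have "(1 - p\<^sub>0 / p) / p\<^sub>0 = \<tau>" using p by (simp add: \<tau>_def field_simps)
      then show ?thesis using p by (simp add: powr_mult powr_powr)
    qed
    also have "\<dots> \<le> (A / m) powr (1 / q) * mean ?F Q powr (1 / p)"
      by (intro mult_right_mono Nle) simp
    finally show ?thesis by (simp add: m_def)
  qed
qed

text \<open>How the reverse Hoelder inequality enters: the weight comes out as the power \<open>1 / q\<close> of the mean of \<open>w\<^sup>q\<close>,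
  which cancels the one from the \<open>A\<^sub>r\<close> condition, and because of \<open>\<epsilon>\<close> the exponent of the mean of the
  indicator is strictly larger than \<open>1 / \<rho> - 1 / (s q)\<close>, which is \<open>1 - 1 / q\<close> for the exponents of the
  main theorem.\<close>

lemma mean_le_reverse_Holder:
  fixes w :: "real ^ 'n \<Rightarrow> real" and g :: "real ^ 'n \<Rightarrow> 'a :: {real_normed_field, euclidean_space}"
  assumes [measurable]: "w \<in> borel_measurable lebesgue" "E \<in> sets lebesgue"
    and w: "\<And>x. w x \<ge> 0" and q: "q > 0" and s: "s \<ge> 1" and \<epsilon>: "\<epsilon> > 0" and \<rho>: "1 \<le> \<rho>" "\<rho> \<le> s * q"
    and R: "R > 0" and Q: "Q \<in> cubes"
    and RH: "(\<integral>\<^sup>+x\<in>Q. ennreal (w x powr (s * q * (1 + \<epsilon>))) \<partial>lebesgue) \<le> ennreal (2 * (R * mean (\<lambda>x. w x powr q) Q) powr (s * (1 + \<epsilon>)) * measure lebesgue Q)"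
    and g: "\<And>x. norm (g x) \<le> w x * indicator E x"
  shows "mean (\<lambda>x. norm (g x) powr \<rho>) Q powr (1 / \<rho>)
     \<le> 2 * (R * mean (\<lambda>x. w x powr q) Q) powr (1 / q) * mean (indicator E) Q powr (1 / \<rho> - 1 / (s * q * (1 + \<epsilon>)))"
proof -
  define m where "m = R * mean (\<lambda>x. w x powr q) Q"
  have m: "m \<ge> 0" using R by (simp add: m_def)
  let ?W = "\<lambda>x. w x powr (s * q * (1 + \<epsilon>))"
  define \<theta> where "\<theta> = \<rho> / (s * q * (1 + \<epsilon>))"
  have sq: "s * q > 0" using s q by simp
  have lt: "s * q < s * q * (1 + \<epsilon>)" using sq \<epsilon> by (simp add: field_simps)
  then have \<theta>: "0 < \<theta>" "\<theta> < 1" using \<rho> by (auto simp: \<theta>_def divide_less_eq)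
  have W: "mean ?W Q \<le> 2 * m powr (s * (1 + \<epsilon>))"
    by (rule nn_integral_le_imp_mean_le[OF Q RH[folded m_def]]) simp
  have [measurable]: "Q \<in> sets lebesgue" by (rule cubes_measure(2)[OF Q])
  have E: "(\<integral>\<^sup>+x\<in>Q. ennreal (indicator E x) \<partial>lebesgue) < \<infinity>"
  proof -
    have "(\<integral>\<^sup>+x\<in>Q. ennreal (indicator E x) \<partial>lebesgue) \<le> (\<integral>\<^sup>+x. indicator Q x \<partial>lebesgue)"
      by (intro nn_integral_mono) (auto simp: indicator_def)
    also have "\<dots> = ennreal (measure lebesgue Q)" using cubes_measure(4)[OF Q] by (simp del: emeasure_completion)
    finally show ?thesis by (simp add: le_less_trans)
  qed
  have "mean (\<lambda>x. norm (g x) powr \<rho>) Q \<le> mean ?W Q powr \<theta> * mean (indicator E) Q powr (1 - \<theta>)"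
  proof (rule mean_Holder[OF _ _ _ _ \<theta> Q _ E])
    show "(\<integral>\<^sup>+x\<in>Q. ennreal (?W x) \<partial>lebesgue) < \<infinity>" by (rule le_less_trans[OF RH]) simp
    have "norm (g x) powr \<rho> \<le> ?W x powr \<theta> * indicator E x powr (1 - \<theta>)" for x
    proof (cases "x \<in> E")
      case True
      have "norm (g x) powr \<rho> \<le> w x powr \<rho>" using g[of x] True \<rho> by (intro powr_mono2) auto
      also have "\<dots> = ?W x powr \<theta>" using q s \<epsilon> by (simp add: powr_powr \<theta>_def)
      finally show ?thesis using True by simp
    qed (use g[of x] in simp)
    then show "AE x in lebesgue. x \<in> Q \<longrightarrow> norm (g x) powr \<rho> \<le> ?W x powr \<theta> * indicator E x powr (1 - \<theta>)" by simp
  qed auto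
  also have "\<dots> \<le> (2 * m powr (s * (1 + \<epsilon>))) powr \<theta> * mean (indicator E) Q powr (1 - \<theta>)"
    using W \<theta> by (intro mult_right_mono powr_mono2) auto
  finally have "mean (\<lambda>x. norm (g x) powr \<rho>) Q powr (1 / \<rho>) \<le> ((2 * m powr (s * (1 + \<epsilon>))) powr \<theta> * mean (indicator E) Q powr (1 - \<theta>)) powr (1 / \<rho>)"
    using \<rho> by (intro powr_mono2) auto
  also have "\<dots> = 2 powr (\<theta> / \<rho>) * m powr (s * (1 + \<epsilon>) * (\<theta> / \<rho>)) * mean (indicator E) Q powr ((1 - \<theta>) / \<rho>)"
    by (simp add: powr_mult powr_powr)
  also have "s * (1 + \<epsilon>) * (\<theta> / \<rho>) = 1 / q" using s \<epsilon> \<rho> by (simp add: \<theta>_def)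
  also have "(1 - \<theta>) / \<rho> = 1 / \<rho> - 1 / (s * q * (1 + \<epsilon>))" using \<rho> by (simp add: \<theta>_def diff_divide_distrib)
  also have "2 powr (\<theta> / \<rho>) * m powr (1 / q) * mean (indicator E) Q powr (1 / \<rho> - 1 / (s * q * (1 + \<epsilon>)))
     \<le> 2 * m powr (1 / q) * mean (indicator E) Q powr (1 / \<rho> - 1 / (s * q * (1 + \<epsilon>)))"
  proof -
    have "\<theta> / \<rho> \<le> 1" using \<theta> \<rho> by (simp add: divide_le_eq)
    then have "2 powr (\<theta> / \<rho>) \<le> 2 powr (1::real)" by (intro powr_mono) auto
    then show ?thesis by (intro mult_right_mono) auto
  qed
  finally show ?thesis by (simp add: m_def)
qed

lemma powr_mult_le_sum:
  fixes x y :: real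
  assumes "x \<ge> 0" "y \<ge> 0" "a \<ge> 0" "b \<ge> 0"
  shows "x powr a * y powr b \<le> x powr (a + b) + y powr (a + b)"
proof -
  have "x powr a * y powr b \<le> max x y powr a * max x y powr b"
    using assms by (intro mult_mono powr_mono2) auto
  also have "\<dots> = max x y powr (a + b)" by (simp add: powr_add)
  also have "\<dots> \<le> x powr (a + b) + y powr (a + b)" by (simp add: max_def)
  finally show ?thesis .
qed

definition sparse_const :: "nat \<Rightarrow> real \<Rightarrow> real \<Rightarrow> real" where
  "sparse_const n \<eta> \<sigma> = 16 * 2 ^ n * maximal_bound n * (2 + 2 * maximal_bound n) * \<sigma> / \<eta>"

lemma major_parts_subset: "major_parts \<eta> F E \<Longrightarrow> F' \<subseteq> F \<Longrightarrow> major_parts \<eta> F' E"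
  unfolding major_parts_def disjoint_family_on_def by (meson finite_subset subsetD subset_trans)

text \<open>A weight together with the quantitative information that its classes provide. In the application
  \<open>\<rho> = q\<^sub>0'\<close> and \<open>s = (q\<^sub>0 / q)'\<close>, and the relation between them eliminates \<open>q\<^sub>0\<close>. The number \<open>B\<close> bounds
  the Fujii-Wilson constant of \<open>w\<^sup>q\<^sup>s\<close>, and \<open>R\<close> the reverse Hoelder constant of \<open>w\<^sup>q\<close>, with
  \<open>B\<close> the \<open>A\<^sub>\<infinity>\<close> constant and \<open>R = 1\<close> for \<open>q\<^sub>0 = \<infinity>\<close>.\<close>

locale sparse_weight =
  fixes w :: "real ^ 'n \<Rightarrow> real" and p\<^sub>0 p q r s \<rho> \<eta> A R B \<epsilon> :: real
  assumes w_measurable [measurable]: "w \<in> borel_measurable lebesgue"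
    and w: "\<And>x. w x \<ge> 0" "AE x in lebesgue. w x > 0"
    and p: "1 \<le> p\<^sub>0" "p\<^sub>0 \<le> p" "p \<le> q" and r: "r = (1 / p\<^sub>0 - 1 / p) * q + 1"
    and s: "s \<ge> 1" and \<rho>: "\<rho> \<ge> 1" "1 / \<rho> = 1 - 1 / q + 1 / (s * q)" and \<eta>: "\<eta> > 0"
    and B: "B \<ge> 1" and \<epsilon>: "\<epsilon> = 1 / (2 ^ (CARD('n) + 1) * B)" and R: "R > 0"
    and fin: "\<And>Q. Q \<in> cubes \<Longrightarrow> (\<integral>\<^sup>+x\<in>Q. ennreal (w x powr q) \<partial>lebesgue) < \<infinity>"
    and RH: "\<And>Q. Q \<in> cubes \<Longrightarrow> (\<integral>\<^sup>+x\<in>Q. ennreal (w x powr (s * q * (1 + \<epsilon>))) \<partial>lebesgue)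
               \<le> ennreal (2 * (R * mean (\<lambda>x. w x powr q) Q) powr (s * (1 + \<epsilon>)) * measure lebesgue Q)"
    and A: "A_const r (\<lambda>x. w x powr q) \<le> ennreal A" "A \<ge> 0"
begin

text \<open>The part of the sparse form over a finite family, in terms of means. In the main theorem \<open>1 / p - 1 / q\<close> is
  \<open>\<alpha> / (n \<rho>)\<close>.\<close>

definition sparse_form :: "(real ^ 'n) set set \<Rightarrow> (real ^ 'n \<Rightarrow> 'a :: real_normed_vector) \<Rightarrow> (real ^ 'n \<Rightarrow> 'a) \<Rightarrow> real" where
  "sparse_form \<F> h g = (\<Sum>Q\<in>\<F>. mean (\<lambda>x. norm (h x) powr p\<^sub>0) Q powr (1 / p\<^sub>0) * mean (\<lambda>x. norm (g x) powr \<rho>) Q powr (1 / \<rho>)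
              * measure lebesgue Q powr (1 + (1 / p - 1 / q)))"

definition weak_const :: real where
  "weak_const = sparse_const CARD('n) \<eta> (s * q) * (A powr (1 / q) * (R powr (1 / q) * B))"

text \<open>The weights cancel in each summand, and what remains is \<open>\<bar>Q\<bar>\<close> times a product of a power of the mean of
  \<open>F = \<bar>w h\<bar>\<^sup>p\<close> and a power of the mean of the indicator of \<open>S\<close>. On the cubes that meet \<open>S\<close>, the former mean
  is at most of order \<open>\<Phi> / e\<close>, and the latter is at most one. So both are means with a bound as in
  \<open>carleson_bounded\<close>, and since the two powers add up to \<open>1 + \<delta>\<close>, the sum costs only one factor
  \<open>1 / \<delta>\<close>, which is of the order of \<open>B\<close>.\<close>

lemma sparse_family_bound:
  fixes h g :: "real ^ 'n \<Rightarrow> 'a :: {real_normed_field, euclidean_space}"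
  assumes [measurable]: "h \<in> borel_measurable lebesgue" and S [measurable]: "S \<in> sets lebesgue"
    and \<F>: "major_parts \<eta> \<F> E"
    and \<Phi>: "(\<integral>\<^sup>+x. ennreal ((w x * norm (h x)) powr p) \<partial>lebesgue) \<le> ennreal \<Phi>" "\<Phi> > 0"
    and e: "emeasure lebesgue S \<le> ennreal e" "e > 0"
    and g: "\<And>x. norm (g x) \<le> w x * indicator S x"
    and small: "\<And>Q. Q \<in> \<F> \<Longrightarrow> Q \<inter> S \<noteq> {} \<Longrightarrow> mean (\<lambda>x. (w x * norm (h x)) powr p) Q \<le> 2 * maximal_bound CARD('n) * \<Phi> / e"
  shows "sparse_form \<F> h g \<le> weak_const * (\<Phi> powr (1 / p) * e powr (1 - 1 / q))"
proof -
  let ?F = "\<lambda>x. (w x * norm (h x)) powr p" and ?V = "measure lebesgue" and ?mb = "maximal_bound CARD('n)"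
  let ?t = "\<lambda>Q. mean (\<lambda>x. norm (h x) powr p\<^sub>0) Q powr (1 / p\<^sub>0) * mean (\<lambda>x. norm (g x) powr \<rho>) Q powr (1 / \<rho>)
              * ?V Q powr (1 + (1 / p - 1 / q))"
  have q: "q \<ge> 1" "q > 0" "p > 0" using p by auto
  have sq: "s * q \<ge> 1" using s q mult_mono[of 1 s 1 q] by simp
  have "2 ^ (CARD('n) + 1) * B \<ge> 1"
    using mult_mono[of 1 "2 ^ (CARD('n) + 1) :: real" 1 B] B one_le_power[of "2 :: real" "CARD('n) + 1"] by simp
  then have \<epsilon>0: "\<epsilon> > 0" "\<epsilon> \<le> 1" using B by (auto simp: \<epsilon>)
  have mb: "?mb > 0" by (simp add: maximal_bound_pos)
  have "1 / \<rho> \<ge> 1 / (s * q)" using \<rho> q by simp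
  then have \<rho>sq: "\<rho> \<le> s * q" using \<rho>(1) sq by (simp add: divide_simps split: if_splits)
  define b where "b = 1 / \<rho> - 1 / (s * q * (1 + \<epsilon>))"
  define \<delta> where "\<delta> = \<epsilon> / (s * q * (1 + \<epsilon>))"
  have \<delta>: "\<delta> > 0" using \<epsilon>0 sq by (simp add: \<delta>_def)
  have "\<epsilon> \<le> s * q * (1 + \<epsilon>)" using \<epsilon>0 sq mult_mono[of 1 "s * q" \<epsilon> "1 + \<epsilon>"] by simp
  then have \<delta>1: "\<delta> \<le> 1" using \<epsilon>0 sq by (simp add: \<delta>_def divide_le_eq)
  have "1 / (s * q) = (1 + \<epsilon>) / (s * q * (1 + \<epsilon>))" using \<epsilon>0 by simp
  then have "1 / (s * q) - 1 / (s * q * (1 + \<epsilon>)) = \<delta>"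
    unfolding \<delta>_def by (simp only: diff_divide_distrib[symmetric]) simp
  then have b: "1 / q + b = 1 + \<delta>" by (simp add: b_def \<rho>(2))
  have "1 / q \<le> 1" using q by simp
  then have b0: "b \<ge> 0" using b \<delta> by linarith
  have inv\<delta>: "(1 + \<delta>) / \<delta> \<le> 8 * 2 ^ CARD('n) * (s * q) * B"
  proof -
    have "(1 + \<delta>) / \<delta> \<le> 2 / \<delta>" using \<delta> \<delta>1 by (intro divide_right_mono) auto
    also have "\<dots> = 2 * (s * q) * (1 + \<epsilon>) / \<epsilon>" using \<delta> \<epsilon>0 by (simp add: \<delta>_def)
    also have "\<dots> \<le> 2 * (s * q) * 2 / \<epsilon>" using \<epsilon>0 sq by (intro divide_right_mono mult_left_mono) auto
    also have "\<dots> = 8 * 2 ^ CARD('n) * (s * q) * B" by (simp add: \<epsilon>)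
    finally show ?thesis .
  qed
  \<comment> \<open>The cubes that do not meet \<open>S\<close> contribute nothing, since \<open>g\<close> vanishes there.\<close>
  define \<G> where "\<G> = {Q \<in> \<F>. Q \<inter> S \<noteq> {}}"
  have \<G>: "major_parts \<eta> \<G> E" by (rule major_parts_subset[OF \<F>]) (auto simp: \<G>_def)
  have cubes: "Q \<in> cubes" if "Q \<in> \<G>" for Q using \<G> that by (auto simp: major_parts_def)
  have zero: "?t Q = 0" if "Q \<in> \<F> - \<G>" for Q
  proof -
    have "norm (g x) = 0" if "x \<in> Q" for x
    proof -
      have "x \<notin> S" using \<open>Q \<in> \<F> - \<G>\<close> that by (auto simp: \<G>_def)
      then show ?thesis using g[of x] by simp
    qed
    then have "mean (\<lambda>x. norm (g x) powr \<rho>) Q = mean (\<lambda>x. 0) Q" by (intro mean_cong) simp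
    then show ?thesis by (simp add: mean_def)
  qed
  define \<xi> where "\<xi> Q = mean (indicator S) Q" for Q
  define f where "f Q = mean ?F Q" for Q
  define c0 where "c0 = 2 * (A powr (1 / q) * R powr (1 / q)) * \<Phi> powr (1 / p - 1 / q) * (\<Phi> / e) powr (1 / q)"
  have c0: "c0 \<ge> 0" by (simp add: c0_def)
  have single: "?t Q \<le> c0 * ((e / \<Phi>) powr (1 + \<delta>) * (f Q powr (1 + \<delta>) * ?V Q) + \<xi> Q powr (1 + \<delta>) * ?V Q)" if "Q \<in> \<G>" for Q
  proof -
    note Q = cubes[OF that]
    have V: "?V Q > 0" by (rule cubes_measure(3)[OF Q])
    define m where "m = mean (\<lambda>x. w x powr q) Q"
    have m: "m > 0" unfolding m_def using w(2) by (intro mean_pos[OF _ _ Q fin[OF Q]]) auto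
    have FQ: "(\<integral>\<^sup>+x\<in>Q. ennreal (?F x) \<partial>lebesgue) \<le> ennreal \<Phi>"
      by (rule order_trans[OF _ \<Phi>(1)]) (intro nn_integral_mono, simp add: indicator_def)
    then have FQ': "(\<integral>\<^sup>+x\<in>Q. ennreal (?F x) \<partial>lebesgue) < \<infinity>" by (rule le_less_trans) simp
    have fV: "f Q * ?V Q \<le> \<Phi>"
      using FQ \<Phi>(2) unfolding nn_integral_eq_mean[OF Q FQ'] by (simp add: f_def)
    have f0: "f Q \<ge> 0" "\<xi> Q \<ge> 0" by (simp_all add: f_def \<xi>_def)
    have 1: "mean (\<lambda>x. norm (h x) powr p\<^sub>0) Q powr (1 / p\<^sub>0) \<le> (A / m) powr (1 / q) * f Q powr (1 / p)"
      unfolding m_def f_def using p q by (intro mean_le_A_const[OF _ _ w _ _ _ r A Q fin[OF Q] FQ']) auto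
    have 2: "mean (\<lambda>x. norm (g x) powr \<rho>) Q powr (1 / \<rho>) \<le> 2 * (R * m) powr (1 / q) * \<xi> Q powr b"
      unfolding m_def \<xi>_def b_def
      using q by (intro mean_le_reverse_Holder[OF _ _ w(1) _ s \<epsilon>0(1) \<rho>(1) \<rho>sq R Q RH[OF Q] g]) auto
    have "?t Q \<le> ((A / m) powr (1 / q) * f Q powr (1 / p)) * (2 * (R * m) powr (1 / q) * \<xi> Q powr b) * ?V Q powr (1 + (1 / p - 1 / q))"
      by (intro mult_right_mono mult_mono 1 2) auto
    also have "\<dots> = 2 * ((A / m) powr (1 / q) * (R * m) powr (1 / q)) * (f Q powr (1 / p) * ?V Q powr (1 / p - 1 / q)) * \<xi> Q powr b * ?V Q"
      using V by (simp add: powr_add)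
    also have "(A / m) powr (1 / q) * (R * m) powr (1 / q) = A powr (1 / q) * R powr (1 / q)"
      using A(2) m R by (simp add: powr_mult powr_divide)
    also have "f Q powr (1 / p) * ?V Q powr (1 / p - 1 / q) = f Q powr (1 / q) * (f Q * ?V Q) powr (1 / p - 1 / q)"
      using f0 V by (simp add: powr_mult powr_add[symmetric] mult.assoc[symmetric])
    also have "2 * (A powr (1 / q) * R powr (1 / q)) * (f Q powr (1 / q) * (f Q * ?V Q) powr (1 / p - 1 / q)) * \<xi> Q powr b * ?V Q
       \<le> 2 * (A powr (1 / q) * R powr (1 / q)) * (f Q powr (1 / q) * \<Phi> powr (1 / p - 1 / q)) * \<xi> Q powr b * ?V Q"
      using fV f0 V p q by (intro mult_right_mono mult_left_mono powr_mono2) (auto simp: frac_le)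
    also have "f Q powr (1 / q) = (\<Phi> / e) powr (1 / q) * (e / \<Phi> * f Q) powr (1 / q)"
      using \<Phi>(2) e(2) f0 by (simp add: powr_mult powr_divide)
    also have "2 * (A powr (1 / q) * R powr (1 / q)) * ((\<Phi> / e) powr (1 / q) * (e / \<Phi> * f Q) powr (1 / q) * \<Phi> powr (1 / p - 1 / q)) * \<xi> Q powr b * ?V Q
        = c0 * ((e / \<Phi> * f Q) powr (1 / q) * \<xi> Q powr b) * ?V Q"
      by (simp add: c0_def)
    also have "\<dots> \<le> c0 * ((e / \<Phi> * f Q) powr (1 + \<delta>) + \<xi> Q powr (1 + \<delta>)) * ?V Q"
    proof (rule mult_right_mono[OF mult_left_mono[OF _ c0]])
      have "e / \<Phi> * f Q \<ge> 0" using f0 e(2) \<Phi>(2) by simp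
      then show "(e / \<Phi> * f Q) powr (1 / q) * \<xi> Q powr b \<le> (e / \<Phi> * f Q) powr (1 + \<delta>) + \<xi> Q powr (1 + \<delta>)"
        using powr_mult_le_sum[of "e / \<Phi> * f Q" "\<xi> Q" "1 / q" b, unfolded b] f0 q b0 by simp
    qed (use V in simp)
    also have "(e / \<Phi> * f Q) powr (1 + \<delta>) = (e / \<Phi>) powr (1 + \<delta>) * f Q powr (1 + \<delta>)"
      using e(2) \<Phi>(2) f0 by (simp add: powr_mult del: times_divide_eq_left)
    finally show ?thesis by (simp add: algebra_simps)
  qed
  have c1: "2 * ?mb * \<Phi> / e > 0" using mb \<Phi> e by simp
  have sum1: "(\<Sum>Q\<in>\<G>. f Q powr (1 + \<delta>) * ?V Q) \<le> ?mb / \<eta> * \<Phi> * (2 * ?mb * \<Phi> / e) powr \<delta> * (1 + \<delta>) / \<delta>"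
    unfolding f_def using small
    by (intro carleson_bounded[OF \<G> \<eta> _ \<Phi>(1) less_imp_le[OF \<Phi>(2)] c1 _ \<delta>]) (auto simp: \<G>_def)
  have sum2: "(\<Sum>Q\<in>\<G>. \<xi> Q powr (1 + \<delta>) * ?V Q) \<le> ?mb / \<eta> * e * 1 powr \<delta> * (1 + \<delta>) / \<delta>"
    unfolding \<xi>_def
  proof (rule carleson_bounded[OF \<G> \<eta> _ _ _ _ _ \<delta>])
    show "(\<integral>\<^sup>+x. ennreal (indicator S x) \<partial>lebesgue) \<le> ennreal e"
      unfolding ennreal_indicator nn_integral_indicator[OF S] by (rule e(1))
    fix Q assume "Q \<in> \<G>"
    note Q = cubes[OF this]
    show "mean (indicator S) Q \<le> 1"
    proof (rule nn_integral_le_imp_mean_le[OF Q])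
      have "(\<integral>\<^sup>+x\<in>Q. ennreal (indicator S x) \<partial>lebesgue) \<le> (\<integral>\<^sup>+x. indicator Q x \<partial>lebesgue)"
        by (intro nn_integral_mono) (auto simp: indicator_def)
      also have "\<dots> = ennreal (1 * ?V Q)" using cubes_measure(2,4)[OF Q] by (simp del: emeasure_completion)
      finally show "(\<integral>\<^sup>+x\<in>Q. ennreal (indicator S x) \<partial>lebesgue) \<le> ennreal (1 * ?V Q)" .
    qed simp
  qed (use e in auto)
  have pw: "(2 * ?mb) powr \<delta> \<le> 1 + 2 * ?mb"
  proof -
    have "(2 * ?mb) powr \<delta> \<le> (1 + 2 * ?mb) powr \<delta>" using mb \<delta> by (intro powr_mono2) auto
    also have "\<dots> \<le> (1 + 2 * ?mb) powr 1" using mb \<delta>1 by (intro powr_mono) auto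
    finally show ?thesis using mb by simp
  qed
  have "(\<Sum>Q\<in>\<F>. ?t Q) = (\<Sum>Q\<in>\<G>. ?t Q)"
    using \<F> zero by (intro sum.mono_neutral_right) (auto simp: \<G>_def major_parts_def)
  also have "\<dots> \<le> (\<Sum>Q\<in>\<G>. c0 * ((e / \<Phi>) powr (1 + \<delta>) * (f Q powr (1 + \<delta>) * ?V Q) + \<xi> Q powr (1 + \<delta>) * ?V Q))"
    by (intro sum_mono single)
  also have "\<dots> = c0 * ((e / \<Phi>) powr (1 + \<delta>) * (\<Sum>Q\<in>\<G>. f Q powr (1 + \<delta>) * ?V Q) + (\<Sum>Q\<in>\<G>. \<xi> Q powr (1 + \<delta>) * ?V Q))"
    by (simp only: sum.distrib sum_distrib_left[symmetric])
  also have "\<dots> \<le> c0 * ((e / \<Phi>) powr (1 + \<delta>) * (?mb / \<eta> * \<Phi> * (2 * ?mb * \<Phi> / e) powr \<delta> * (1 + \<delta>) / \<delta>) + ?mb / \<eta> * e * 1 powr \<delta> * (1 + \<delta>) / \<delta>)"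
    using c0 by (intro mult_left_mono add_mono sum1 sum2) auto
  also have "(e / \<Phi>) powr (1 + \<delta>) * (?mb / \<eta> * \<Phi> * (2 * ?mb * \<Phi> / e) powr \<delta> * (1 + \<delta>) / \<delta>) = ?mb / \<eta> * e * (2 * ?mb) powr \<delta> * (1 + \<delta>) / \<delta>"
  proof -
    have "(e / \<Phi>) powr (1 + \<delta>) * (2 * ?mb * \<Phi> / e) powr \<delta> * \<Phi> = e * (2 * ?mb) powr \<delta>"
      using e(2) \<Phi>(2) mb by (simp add: powr_add powr_divide powr_mult)
    then have "(?mb / \<eta> * (1 + \<delta>) / \<delta>) * ((e / \<Phi>) powr (1 + \<delta>) * (2 * ?mb * \<Phi> / e) powr \<delta> * \<Phi>) = (?mb / \<eta> * (1 + \<delta>) / \<delta>) * (e * (2 * ?mb) powr \<delta>)"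
      by simp
    then show ?thesis by (simp add: ac_simps)
  qed
  also have "c0 * (?mb / \<eta> * e * (2 * ?mb) powr \<delta> * (1 + \<delta>) / \<delta> + ?mb / \<eta> * e * 1 powr \<delta> * (1 + \<delta>) / \<delta>)
      = c0 * (?mb / \<eta> * e) * (((2 * ?mb) powr \<delta> + 1) * ((1 + \<delta>) / \<delta>))"
    by (simp add: algebra_simps add_divide_distrib)
  also have "\<dots> \<le> c0 * (?mb / \<eta> * e) * ((2 + 2 * ?mb) * (8 * 2 ^ CARD('n) * (s * q) * B))"
    using c0 mb \<eta> e(2) pw \<delta> inv\<delta> by (intro mult_left_mono mult_mono) auto
  also have "c0 * (?mb / \<eta> * e) * ((2 + 2 * ?mb) * (8 * 2 ^ CARD('n) * (s * q) * B))
     = (c0 * e) * (?mb / \<eta>) * ((2 + 2 * ?mb) * (8 * 2 ^ CARD('n) * (s * q) * B))"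
    by (simp only: mult.assoc mult.commute mult.left_commute)
  also have "c0 * e = 2 * (A powr (1 / q) * R powr (1 / q)) * (\<Phi> powr (1 / p) * e powr (1 - 1 / q))"
  proof -
    have "\<Phi> powr (1 / p - 1 / q) * (\<Phi> / e) powr (1 / q) * e = \<Phi> powr (1 / p) * e powr (1 - 1 / q)"
      using \<Phi>(2) e(2) by (simp add: powr_divide powr_diff)
    then show ?thesis unfolding c0_def by (simp only: mult.assoc)
  qed
  finally show ?thesis by (simp add: sparse_form_def weak_const_def sparse_const_def ac_simps)
qed

end

section \<open>Smooth bump functions\<close>

primrec flat_poly :: "nat \<Rightarrow> real poly" where
  "flat_poly 0 = 1"
| "flat_poly (Suc k) = [:0, 0, 1:] * (flat_poly k - pderiv (flat_poly k))"

text \<open>The \<open>k\<close>-th derivative of \<open>exp (- 1 / t)\<close>, extended by zero to \<open>t \<le> 0\<close>.\<close>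

definition flat :: "nat \<Rightarrow> real \<Rightarrow> real" where
  "flat k t = (if t > 0 then poly (flat_poly k) (1 / t) * exp (- 1 / t) else 0)"

lemma poly_times_exp_tendsto_0: "((\<lambda>u::real. poly p u * exp (- u)) \<longlongrightarrow> 0) at_top"
proof -
  have "(\<lambda>u::real. poly p u * exp (- u)) = (\<lambda>u. \<Sum>i\<le>degree p. coeff p i * (u ^ i / exp u))"
    by (simp add: fun_eq_iff poly_altdef sum_distrib_right exp_minus divide_inverse mult.assoc)
  moreover have "((\<lambda>u::real. \<Sum>i\<le>degree p. coeff p i * (u ^ i / exp u)) \<longlongrightarrow> (\<Sum>i\<le>degree p. coeff p i * 0)) at_top"
    by (intro tendsto_sum tendsto_mult tendsto_const tendsto_power_div_exp_0)
  ultimately show ?thesis by simp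
qed

lemma flat_has_derivative: "(flat k has_real_derivative flat (Suc k) t) (at t)"
proof -
  consider "t > 0" | "t < 0" | "t = 0" by linarith
  then show ?thesis
  proof cases
    case 1
    have "((\<lambda>t. poly (flat_poly k) (1 / t) * exp (- 1 / t)) has_real_derivative flat (Suc k) t) (at t)"
      using 1 by (auto intro!: derivative_eq_intros DERIV_chain2[OF poly_DERIV] simp: flat_def power2_eq_square field_simps)
    then show ?thesis
      by (rule has_field_derivative_transform_within_open[of _ _ _ "{0<..}"]) (use 1 in \<open>auto simp: flat_def\<close>)
  next
    case 2
    have "((\<lambda>t. 0) has_real_derivative flat (Suc k) t) (at t)" using 2 by (simp add: flat_def)
    then show ?thesis
      by (rule has_field_derivative_transform_within_open[of _ _ _ "{..<0}"]) (use 2 in \<open>auto simp: flat_def\<close>)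
  next
    case 3
    have "((\<lambda>h. flat k h / h) \<longlongrightarrow> 0) (at_right 0)"
    proof -
      have "((\<lambda>h. poly ([:0, 1:] * flat_poly k) (inverse h) * exp (- inverse h)) \<longlongrightarrow> 0) (at_right 0)"
        by (rule filterlim_compose[OF poly_times_exp_tendsto_0 filterlim_inverse_at_top_right])
      moreover have "eventually (\<lambda>h. poly ([:0, 1:] * flat_poly k) (inverse h) * exp (- inverse h) = flat k h / h) (at_right 0)"
        by (auto simp: eventually_at_right_field flat_def divide_inverse intro!: exI[of _ 1])
      ultimately show ?thesis by (rule Lim_transform_eventually)
    qed
    moreover have "((\<lambda>h. flat k h / h) \<longlongrightarrow> 0) (at_left 0)"
    proof (rule Lim_transform_eventually[OF tendsto_const])
      show "eventually (\<lambda>h. 0 = flat k h / h) (at_left 0)"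
        by (auto simp: eventually_at_left_field flat_def intro!: exI[of _ "-1"])
    qed
    ultimately have "((\<lambda>h. flat k h / h) \<longlongrightarrow> 0) (at 0)" by (intro filterlim_split_at)
    then show ?thesis using 3 by (simp add: DERIV_def flat_def)
  qed
qed

lemma flat_0_bounds: "0 \<le> flat 0 t" "flat 0 t \<le> 1"
  by (auto simp: flat_def)

lemma flat_0_tendsto_1:
  assumes "t > 0"
  shows "(\<lambda>m. flat 0 (real m * t)) \<longlonglongrightarrow> 1"
proof -
  have "(\<lambda>m. exp (- (1 / t) * inverse (real m))) \<longlonglongrightarrow> exp (- (1 / t) * 0)"
    by (intro tendsto_intros LIMSEQ_inverse_real_of_nat[THEN LIMSEQ_imp_Suc] )
  moreover have "eventually (\<lambda>m. exp (- (1 / t) * inverse (real m)) = flat 0 (real m * t)) sequentially"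
    using eventually_gt_at_top[of 0] by eventually_elim (use assms in \<open>auto simp: flat_def divide_inverse\<close>)
  ultimately show ?thesis by (auto intro: Lim_transform_eventually)
qed

lemma C_k_SucI:
  fixes f :: "real ^ 'n \<Rightarrow> 'b :: real_normed_vector"
  assumes "\<And>x. (f has_derivative D x) (at x)" "\<And>i. C_k k (\<lambda>x. D x (axis i 1))"
  shows "C_k (Suc k) f"
proof -
  have "frechet_derivative f (at x) = D x" for x using frechet_derivative_at[OF assms(1)] by simp
  then show ?thesis using assms by (auto simp: differentiable_def)
qed

lemma C_k_SucD:
  fixes f :: "real ^ 'n \<Rightarrow> 'b :: real_normed_vector"
  assumes "C_k (Suc k) f"
  shows "(f has_derivative frechet_derivative f (at x)) (at x)" "C_k k (\<lambda>x. frechet_derivative f (at x) (axis i 1))"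
  using assms by (auto simp: frechet_derivative_works)

lemma C_k_lower:
  fixes f :: "real ^ 'n \<Rightarrow> 'b :: real_normed_vector"
  shows "C_k (Suc k) f \<Longrightarrow> C_k k f"
proof (induction k arbitrary: f)
  case 0
  then show ?case
    using differentiable_imp_continuous_within[of f _ UNIV]
    by (auto simp: continuous_on_eq_continuous_within)
next
  case (Suc k)
  note * = iffD1[OF C_k.simps(2) Suc.prems]
  show ?case
    by (rule iffD2[OF C_k.simps(2)], intro conjI allI Suc.IH) (rule spec[OF conjunct1[OF *]], rule spec[OF conjunct2[OF *]])
qed

lemma C_k_const: "C_k k (\<lambda>x. c)"
proof (induction k arbitrary: c)
  case (Suc k)
  show ?case by (rule C_k_SucI[where D = "\<lambda>x h. 0"]) (auto intro!: derivative_eq_intros Suc)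
qed auto

lemma C_k_add: "C_k k f \<Longrightarrow> C_k k g \<Longrightarrow> C_k k (\<lambda>x. f x + g x)"
proof (induction k arbitrary: f g)
  case (Suc k)
  note f = C_k_SucD[OF Suc.prems(1)] and g = C_k_SucD[OF Suc.prems(2)]
  show ?case by (rule C_k_SucI[OF has_derivative_add[OF f(1) g(1)]]) (rule Suc.IH[OF f(2) g(2)])
qed (auto intro: continuous_intros)

lemma C_k_bounded_linear:
  assumes L: "bounded_linear L"
  shows "C_k k f \<Longrightarrow> C_k k (\<lambda>x. L (f x))"
proof (induction k arbitrary: f)
  case 0
  then show ?case using bounded_linear.continuous_on[OF L] by simp
next
  case (Suc k)
  note f = C_k_SucD[OF Suc.prems]
  show ?case by (rule C_k_SucI[OF bounded_linear.has_derivative[OF L f(1)]]) (rule Suc.IH[OF f(2)])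
qed

lemma C_k_mult:
  fixes f g :: "real ^ 'n \<Rightarrow> real"
  shows "C_k k f \<Longrightarrow> C_k k g \<Longrightarrow> C_k k (\<lambda>x. f x * g x)"
proof (induction k arbitrary: f g)
  case (Suc k)
  note f = C_k_SucD[OF Suc.prems(1)] and g = C_k_SucD[OF Suc.prems(2)]
  show ?case
    by (rule C_k_SucI[OF has_derivative_mult[OF f(1) g(1)]])
       (rule C_k_add[OF Suc.IH[OF C_k_lower[OF Suc.prems(1)] g(2)] Suc.IH[OF f(2) C_k_lower[OF Suc.prems(2)]]])
qed (auto intro: continuous_intros)

lemma C_k_prod:
  fixes f :: "'i \<Rightarrow> real ^ 'n \<Rightarrow> real"
  assumes "\<And>i. i \<in> I \<Longrightarrow> C_k k (f i)"
  shows "C_k k (\<lambda>x. \<Prod>i\<in>I. f i x)"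
  using assms by (induction I rule: infinite_finite_induct) (auto intro: C_k_const C_k_mult)

text \<open>Partial derivatives only shift \<open>j\<close>, so smoothness follows by induction for all \<open>j\<close> at once.\<close>

lemma C_k_flat:
  fixes i :: "'n::finite"
  shows "C_k k (\<lambda>x :: real ^ 'n. flat j (c * x $ i + d))"
proof (induction k arbitrary: j)
  case 0
  have "continuous_on UNIV (flat j)"
    using flat_has_derivative[of j] by (meson DERIV_isCont continuous_at_imp_continuous_on)
  then show ?case
    by (auto intro!: continuous_on_compose2[of UNIV "flat j"] continuous_intros)
next
  case (Suc k)
  show ?case
  proof (rule C_k_SucI)
    fix x :: "real ^ 'n"
    have 1: "((\<lambda>x :: real ^ 'n. c * x $ i + d) has_derivative (\<lambda>h. c * h $ i)) (at x)"
      by (auto intro!: derivative_eq_intros bounded_linear.has_derivative[OF bounded_linear_vec_nth])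
    show "((\<lambda>x :: real ^ 'n. flat j (c * x $ i + d)) has_derivative (\<lambda>h. flat (Suc j) (c * x $ i + d) * (c * h $ i))) (at x)"
      using has_derivative_compose[OF 1 flat_has_derivative[unfolded has_field_derivative_def]] .
  next
    fix m :: 'n
    have "C_k k (\<lambda>x. flat (Suc j) (c * x $ i + d) * (c * (axis m 1 :: real ^ 'n) $ i))"
      by (intro C_k_mult Suc C_k_const)
    then show "C_k k (\<lambda>x. flat (Suc j) (c * x $ i + d) * (c * (axis m 1 :: real ^ 'n) $ i))" .
  qed
qed

definition box_bump :: "real ^ 'n \<Rightarrow> real ^ 'n \<Rightarrow> nat \<Rightarrow> real ^ 'n \<Rightarrow> real" where
  "box_bump a b m x = (\<Prod>i\<in>UNIV. flat 0 (real m * (x $ i - a $ i)) * flat 0 (real m * (b $ i - x $ i)))"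

lemma C_k_box_bump:
  fixes a b :: "real ^ 'n"
  shows "C_k k (box_bump a b m)"
proof -
  have "C_k k (\<lambda>x :: real ^ 'n. \<Prod>i\<in>UNIV. flat 0 (real m * x $ i + - (real m * a $ i)) * flat 0 ((- real m) * x $ i + real m * b $ i))"
    by (intro C_k_prod C_k_mult C_k_flat)
  then show ?thesis unfolding box_bump_def by (simp add: algebra_simps)
qed

lemma box_bump_bounds: "0 \<le> box_bump a b m x" "box_bump a b m x \<le> 1"
  unfolding box_bump_def by (auto intro!: prod_nonneg prod_le_1 mult_le_one simp: flat_0_bounds)

lemma box_bump_outside:
  assumes "x \<notin> box a b"
  shows "box_bump a b m x = 0"
proof -
  obtain i where "x $ i \<le> a $ i \<or> b $ i \<le> x $ i" using assms unfolding mem_box_cart not_all not_less de_Morgan_conj by blast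
  then have "flat 0 (real m * (x $ i - a $ i)) = 0 \<or> flat 0 (real m * (b $ i - x $ i)) = 0"
    by (auto simp: flat_def zero_less_mult_iff)
  then show ?thesis unfolding box_bump_def by (intro prod_zero) auto
qed

text \<open>The product of one-dimensional bumps tends to the indicator of the open box, since \<open>exp (- 1 / (m t))\<close> tends to one for \<open>t > 0\<close>.\<close>

lemma box_bump_tendsto: "(\<lambda>m. box_bump a b m x) \<longlonglongrightarrow> indicator (box a b) x"
proof (cases "x \<in> box a b")
  case True
  then have "(\<lambda>m. box_bump a b m x) \<longlonglongrightarrow> (\<Prod>i\<in>(UNIV :: 'a set). 1 * 1)"
    unfolding box_bump_def by (intro tendsto_prod tendsto_mult flat_0_tendsto_1) (auto simp: mem_box_cart)
  then show ?thesis using True by simp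
qed (simp add: box_bump_outside)

lemma test_functionsI:
  fixes f :: "real ^ 'n \<Rightarrow> 'b :: real_normed_vector"
  assumes "\<And>k. C_k k f" "\<And>x. x \<notin> box a b \<Longrightarrow> f x = 0"
  shows "f \<in> test_functions"
proof -
  have "closure {x. f x \<noteq> 0} \<subseteq> cbox a b"
    using assms(2) box_subset_cbox by (intro closure_minimal) (auto simp: subset_iff)
  then have "compact (closure {x. f x \<noteq> 0})"
    by (metis Int_absorb1 closed_Int_compact closed_closure compact_cbox inf_commute)
  then show ?thesis using assms(1) by (simp add: test_functions_def)
qed

lemma test_functions_continuous: "f \<in> test_functions \<Longrightarrow> continuous_on UNIV f"
  using C_k.simps(1)[of f] unfolding test_functions_def by blast

lemma test_functions_measurable:
  fixes f :: "real ^ 'n \<Rightarrow> 'b :: {real_normed_vector, second_countable_topology}"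
  assumes "f \<in> test_functions"
  shows "f \<in> borel_measurable lebesgue"
  using borel_measurable_continuous_onI[OF test_functions_continuous[OF assms]] by (simp add: measurable_completion)

lemma test_functions_bounded_support:
  assumes "f \<in> test_functions"
  shows "bounded {x. f x \<noteq> 0}"
  using assms by (simp add: test_functions_def)

lemma test_functions_support:
  assumes "f \<in> test_functions"
  obtains a b where "\<And>x. x \<notin> box a b \<Longrightarrow> f x = 0"
proof -
  have "bounded {x. f x \<noteq> 0}" by (rule test_functions_bounded_support[OF assms])
  then obtain a where "{x. f x \<noteq> 0} \<subseteq> box (- a) a" using bounded_subset_box_symmetric by blast
  then show ?thesis using that by blast
qed

lemma test_functions_bounded_linear:
  fixes f :: "real ^ 'n \<Rightarrow> 'b :: real_normed_vector"
  assumes f: "f \<in> test_functions" and L: "bounded_linear L"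
  shows "(\<lambda>x. L (f x)) \<in> test_functions"
proof -
  obtain a b where "\<And>x. x \<notin> box a b \<Longrightarrow> f x = 0" using test_functions_support[OF f] by blast
  then show ?thesis
    using f L by (intro test_functionsI[of _ a b] C_k_bounded_linear[OF L])
      (auto simp: test_functions_def linear_0 bounded_linear.linear)
qed

lemma test_functions_add:
  fixes f g :: "real ^ 'n \<Rightarrow> 'b :: real_normed_vector"
  assumes f: "f \<in> test_functions" and g: "g \<in> test_functions"
  shows "(\<lambda>x. f x + g x) \<in> test_functions"
proof -
  have "bounded ({x. f x \<noteq> 0} \<union> {x. g x \<noteq> 0})"
    using f g by (simp add: bounded_Un test_functions_bounded_support)
  then obtain a where "{x. f x \<noteq> 0} \<union> {x. g x \<noteq> 0} \<subseteq> box (- a) a" using bounded_subset_box_symmetric by blast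
  then have "f x = 0 \<and> g x = 0" if "x \<notin> box (- a) a" for x using that by blast
  then show ?thesis
    using f g by (intro test_functionsI[of _ "- a" a] C_k_add) (auto simp: test_functions_def)
qed

lemma test_functions_diff:
  fixes f g :: "real ^ 'n \<Rightarrow> 'b :: real_normed_vector"
  assumes "f \<in> test_functions" and g: "g \<in> test_functions"
  shows "(\<lambda>x. f x - g x) \<in> test_functions"
  using test_functions_add[OF assms(1) test_functions_bounded_linear[OF g bounded_linear_minus[OF bounded_linear_ident]]]
  by simp

lemma box_bump_test: "box_bump a b m \<in> test_functions"
  by (rule test_functionsI[of _ a b]) (auto simp: C_k_box_bump box_bump_outside)

lemma zero_test: "(\<lambda>x. 0) \<in> test_functions"
  by (rule test_functionsI[of _ 0 0]) (auto intro: C_k_const)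

section \<open>Density of test functions in weighted spaces\<close>

lemma powr_norm_add_le:
  fixes x y :: "'b :: real_normed_vector"
  assumes "t > 0"
  shows "norm (x + y) powr t \<le> 2 powr t * (norm x powr t + norm y powr t)"
proof -
  have "norm (x + y) powr t \<le> (2 * max (norm x) (norm y)) powr t"
    using assms norm_triangle_ineq[of x y] by (intro powr_mono2) auto
  also have "\<dots> = 2 powr t * max (norm x) (norm y) powr t" by (simp add: powr_mult)
  also have "\<dots> \<le> 2 powr t * (norm x powr t + norm y powr t)"
    by (intro mult_left_mono) (auto simp: max_def)
  finally show ?thesis .
qed

lemma nn_integral_powr_norm_add_le:
  fixes f g :: "'a \<Rightarrow> 'b :: {real_normed_vector, second_countable_topology}"
  assumes [measurable]: "f \<in> borel_measurable M" "g \<in> borel_measurable M" and "t > 0"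
  shows "(\<integral>\<^sup>+x. ennreal (norm (f x + g x) powr t) \<partial>M)
     \<le> ennreal (2 powr t) * ((\<integral>\<^sup>+x. ennreal (norm (f x) powr t) \<partial>M) + (\<integral>\<^sup>+x. ennreal (norm (g x) powr t) \<partial>M))"
proof -
  have "(\<integral>\<^sup>+x. ennreal (norm (f x + g x) powr t) \<partial>M)
     \<le> (\<integral>\<^sup>+x. ennreal (2 powr t) * (ennreal (norm (f x) powr t) + ennreal (norm (g x) powr t)) \<partial>M)"
    using powr_norm_add_le[OF \<open>t > 0\<close>]
    by (intro nn_integral_mono) (simp add: ennreal_plus[symmetric] ennreal_mult[symmetric] ennreal_leI del: ennreal_plus)
  also have "\<dots> = ennreal (2 powr t) * ((\<integral>\<^sup>+x. ennreal (norm (f x) powr t) \<partial>M) + (\<integral>\<^sup>+x. ennreal (norm (g x) powr t) \<partial>M))"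
    by (simp add: nn_integral_cmult nn_integral_add)
  finally show ?thesis .
qed

text \<open>A finite measure on a box. It is defined on all Lebesgue measurable sets and absolutely continuous, so
  Borel sets suffice for the approximation of indicators.\<close>

locale finite_box_measure =
  fixes a b :: "real ^ 'n" and M :: "(real ^ 'n) measure" and t :: real
  assumes sets_M [measurable_cong]: "sets M = sets lebesgue"
    and finite_M: "emeasure M UNIV < \<infinity>"
    and outside_null: "AE x in M. x \<in> box a b"
    and absolutely_continuous: "\<And>A. A \<in> null_sets lebesgue \<Longrightarrow> A \<in> null_sets M"
    and t_pos: "t > 0"
begin

lemma space_M [simp]: "space M = UNIV"
  using sets_eq_imp_space_eq[OF sets_M] by simp

text \<open>Approximability in the \<open>t\<close>-th power of the \<open>L\<^sup>t\<close> distance, by test functions that vanish outside the box.\<close>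

definition approximable :: "(real ^ 'n \<Rightarrow> 'b :: {real_normed_vector, second_countable_topology}) \<Rightarrow> bool" where
  "approximable g \<longleftrightarrow> g \<in> borel_measurable M \<and> (\<forall>\<delta>>0. \<exists>\<phi>\<in>test_functions. (\<forall>x. x \<notin> box a b \<longrightarrow> \<phi> x = 0) \<and>
     (\<integral>\<^sup>+x. ennreal (norm (g x - \<phi> x) powr t) \<partial>M) \<le> ennreal \<delta>)"

lemma measurable_test: "\<phi> \<in> test_functions \<Longrightarrow> (\<phi> :: real ^ 'n \<Rightarrow> 'b :: {real_normed_vector, second_countable_topology}) \<in> borel_measurable M"
  using test_functions_measurable measurable_cong_sets[OF sets_M refl] by blast

lemma approximable_limit:
  fixes g :: "real ^ 'n \<Rightarrow> 'b :: {real_normed_vector, second_countable_topology}"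
  assumes [measurable]: "g \<in> borel_measurable M"
    and lim: "\<And>\<delta>. \<delta> > 0 \<Longrightarrow> \<exists>g'. approximable g' \<and> (\<integral>\<^sup>+x. ennreal (norm (g x - g' x) powr t) \<partial>M) \<le> ennreal \<delta>"
  shows "approximable g"
  unfolding approximable_def
proof (intro conjI allI impI)
  fix \<delta> :: real assume \<delta>: "\<delta> > 0"
  define d where "d = \<delta> / (2 * 2 powr t)"
  have d: "d > 0" "2 powr t * (d + d) = \<delta>" using \<delta> by (simp_all add: d_def)
  obtain g' where g': "approximable g'" "(\<integral>\<^sup>+x. ennreal (norm (g x - g' x) powr t) \<partial>M) \<le> ennreal d"
    using lim[OF d(1)] by blast
  have [measurable]: "g' \<in> borel_measurable M" using g'(1) by (simp add: approximable_def)
  obtain \<phi> where \<phi>: "\<phi> \<in> test_functions" "\<forall>x. x \<notin> box a b \<longrightarrow> \<phi> x = 0" "(\<integral>\<^sup>+x. ennreal (norm (g' x - \<phi> x) powr t) \<partial>M) \<le> ennreal d"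
    using g'(1) d(1) unfolding approximable_def by blast
  note [measurable] = measurable_test[OF \<phi>(1)]
  have "(\<integral>\<^sup>+x. ennreal (norm ((g x - g' x) + (g' x - \<phi> x)) powr t) \<partial>M)
     \<le> ennreal (2 powr t) * ((\<integral>\<^sup>+x. ennreal (norm (g x - g' x) powr t) \<partial>M) + (\<integral>\<^sup>+x. ennreal (norm (g' x - \<phi> x) powr t) \<partial>M))"
    by (rule nn_integral_powr_norm_add_le[OF _ _ t_pos]) measurable
  also have "\<dots> \<le> ennreal (2 powr t) * (ennreal d + ennreal d)"
    by (intro mult_left_mono add_mono g' \<phi>) simp
  also have "\<dots> = ennreal \<delta>" using d by (simp add: ennreal_plus[symmetric] ennreal_mult[symmetric] del: ennreal_plus)
  finally have "(\<integral>\<^sup>+x. ennreal (norm (g x - \<phi> x) powr t) \<partial>M) \<le> ennreal \<delta>" by simp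
  then show "\<exists>\<phi>\<in>test_functions. (\<forall>x. x \<notin> box a b \<longrightarrow> \<phi> x = 0) \<and> (\<integral>\<^sup>+x. ennreal (norm (g x - \<phi> x) powr t) \<partial>M) \<le> ennreal \<delta>"
    using \<phi> by blast
qed simp

lemma approximable_add:
  fixes g h :: "real ^ 'n \<Rightarrow> 'b :: {real_normed_vector, second_countable_topology}"
  assumes g: "approximable g" and h: "approximable h"
  shows "approximable (\<lambda>x. g x + h x)"
  unfolding approximable_def
proof (intro conjI allI impI)
  have [measurable]: "g \<in> borel_measurable M" "h \<in> borel_measurable M" using g h by (auto simp: approximable_def)
  show "(\<lambda>x. g x + h x) \<in> borel_measurable M" by measurable
  fix \<delta> :: real assume \<delta>: "\<delta> > 0"
  define d where "d = \<delta> / (2 * 2 powr t)"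
  have d: "d > 0" "2 powr t * (d + d) = \<delta>" using \<delta> by (simp_all add: d_def)
  obtain \<phi> where \<phi>: "\<phi> \<in> test_functions" "\<forall>x. x \<notin> box a b \<longrightarrow> \<phi> x = 0" "(\<integral>\<^sup>+x. ennreal (norm (g x - \<phi> x) powr t) \<partial>M) \<le> ennreal d"
    using g d(1) unfolding approximable_def by blast
  obtain \<psi> where \<psi>: "\<psi> \<in> test_functions" "\<forall>x. x \<notin> box a b \<longrightarrow> \<psi> x = 0" "(\<integral>\<^sup>+x. ennreal (norm (h x - \<psi> x) powr t) \<partial>M) \<le> ennreal d"
    using h d(1) unfolding approximable_def by blast
  note [measurable] = measurable_test[OF \<phi>(1)] measurable_test[OF \<psi>(1)]
  have "(\<integral>\<^sup>+x. ennreal (norm ((g x + h x) - (\<phi> x + \<psi> x)) powr t) \<partial>M) = (\<integral>\<^sup>+x. ennreal (norm ((g x - \<phi> x) + (h x - \<psi> x)) powr t) \<partial>M)"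
    by (simp add: algebra_simps)
  also have "\<dots> \<le> ennreal (2 powr t) * ((\<integral>\<^sup>+x. ennreal (norm (g x - \<phi> x) powr t) \<partial>M) + (\<integral>\<^sup>+x. ennreal (norm (h x - \<psi> x) powr t) \<partial>M))"
    by (rule nn_integral_powr_norm_add_le[OF _ _ t_pos]) measurable
  also have "\<dots> \<le> ennreal (2 powr t) * (ennreal d + ennreal d)"
    by (intro mult_left_mono add_mono \<psi> \<phi>) simp
  also have "\<dots> = ennreal \<delta>" using d by (simp add: ennreal_plus[symmetric] ennreal_mult[symmetric] del: ennreal_plus)
  finally show "\<exists>\<phi>\<in>test_functions. (\<forall>x. x \<notin> box a b \<longrightarrow> \<phi> x = 0) \<and> (\<integral>\<^sup>+x. ennreal (norm ((g x + h x) - \<phi> x) powr t) \<partial>M) \<le> ennreal \<delta>"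
    using \<phi>(2) \<psi>(2) by (intro bexI[OF _ test_functions_add[OF \<phi>(1) \<psi>(1)]]) auto
qed

lemma approximable_bounded_linear:
  fixes g :: "real ^ 'n \<Rightarrow> 'b :: {real_normed_vector, second_countable_topology}"
    and L :: "'b \<Rightarrow> 'c :: {real_normed_vector, second_countable_topology}"
  assumes g: "approximable g" and L: "bounded_linear L"
  shows "approximable (\<lambda>x. L (g x))"
  unfolding approximable_def
proof (intro conjI allI impI)
  have [measurable]: "g \<in> borel_measurable M" using g by (auto simp: approximable_def)
  have [measurable]: "L \<in> borel_measurable borel"
    using L by (intro borel_measurable_continuous_onI linear_continuous_on) 
  show "(\<lambda>x. L (g x)) \<in> borel_measurable M" by measurable
  obtain K where K: "K > 0" "\<And>x. norm (L x) \<le> norm x * K"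
    using bounded_linear.pos_bounded[OF L] by blast
  fix \<delta> :: real assume \<delta>: "\<delta> > 0"
  define d where "d = \<delta> / K powr t"
  have d: "d > 0" "K powr t * d = \<delta>" using \<delta> K by (simp_all add: d_def)
  obtain \<phi> where \<phi>: "\<phi> \<in> test_functions" "\<forall>x. x \<notin> box a b \<longrightarrow> \<phi> x = 0" "(\<integral>\<^sup>+x. ennreal (norm (g x - \<phi> x) powr t) \<partial>M) \<le> ennreal d"
    using g d(1) unfolding approximable_def by blast
  note [measurable] = measurable_test[OF \<phi>(1)]
  have "(\<integral>\<^sup>+x. ennreal (norm (L (g x) - L (\<phi> x)) powr t) \<partial>M) \<le> (\<integral>\<^sup>+x. ennreal (K powr t) * ennreal (norm (g x - \<phi> x) powr t) \<partial>M)"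
  proof (intro nn_integral_mono)
    fix x
    have "norm (L (g x) - L (\<phi> x)) \<le> K * norm (g x - \<phi> x)"
      using K(2)[of "g x - \<phi> x"] by (simp add: linear_diff[OF bounded_linear.linear[OF L]] mult.commute)
    then have "norm (L (g x) - L (\<phi> x)) powr t \<le> (K * norm (g x - \<phi> x)) powr t" using t_pos by (intro powr_mono2) auto
    then show "ennreal (norm (L (g x) - L (\<phi> x)) powr t) \<le> ennreal (K powr t) * ennreal (norm (g x - \<phi> x) powr t)"
      using K(1) by (simp add: powr_mult ennreal_mult[symmetric] ennreal_leI)
  qed
  also have "\<dots> = ennreal (K powr t) * (\<integral>\<^sup>+x. ennreal (norm (g x - \<phi> x) powr t) \<partial>M)"
    by (rule nn_integral_cmult) measurable
  also have "\<dots> \<le> ennreal (K powr t) * ennreal d" by (intro mult_left_mono \<phi>) simp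
  also have "\<dots> = ennreal \<delta>" using d K by (simp add: ennreal_mult[symmetric])
  finally show "\<exists>\<phi>\<in>test_functions. (\<forall>x. x \<notin> box a b \<longrightarrow> \<phi> x = 0) \<and> (\<integral>\<^sup>+x. ennreal (norm (L (g x) - \<phi> x) powr t) \<partial>M) \<le> ennreal \<delta>"
    using \<phi>(2) by (intro bexI[OF _ test_functions_bounded_linear[OF \<phi>(1) L]]) (auto simp: linear_0 bounded_linear.linear[OF L])
qed

lemma nn_integral_powr_tendsto_0:
  fixes f :: "nat \<Rightarrow> real ^ 'n \<Rightarrow> 'b :: {real_normed_vector, second_countable_topology}"
  assumes [measurable]: "\<And>i. f i \<in> borel_measurable M" "u \<in> borel_measurable M"
    and le: "\<And>i. AE x in M. norm (f i x) powr t \<le> u x" and u: "(\<integral>\<^sup>+x. ennreal (u x) \<partial>M) < \<infinity>"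
    and lim: "AE x in M. (\<lambda>i. f i x) \<longlonglongrightarrow> 0" and \<delta>: "\<delta> > 0"
  shows "\<exists>i. (\<integral>\<^sup>+x. ennreal (norm (f i x) powr t) \<partial>M) \<le> ennreal \<delta>"
proof -
  have "(\<lambda>i. \<integral>\<^sup>+x. ennreal (norm (f i x) powr t) \<partial>M) \<longlonglongrightarrow> (\<integral>\<^sup>+x. 0 \<partial>M)"
  proof (rule nn_integral_dominated_convergence[where w = "\<lambda>x. ennreal (u x)"])
    show "AE x in M. ennreal (norm (f i x) powr t) \<le> ennreal (u x)" for i
      using le[of i] by eventually_elim (rule ennreal_leI)
    show "AE x in M. (\<lambda>i. ennreal (norm (f i x) powr t)) \<longlonglongrightarrow> 0"
      using lim
    proof eventually_elim
      case (elim x)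
      then have "(\<lambda>i. norm (f i x)) \<longlonglongrightarrow> 0" by (rule tendsto_norm_zero)
      then have "(\<lambda>i. norm (f i x) powr t) \<longlonglongrightarrow> 0"
        using t_pos tendsto_zero_powrI[of "\<lambda>i. norm (f i x)" sequentially "\<lambda>_. t" t] by simp
      then show ?case using tendsto_ennrealI[of "\<lambda>i. norm (f i x) powr t" 0] by simp
    qed
  qed (use u in auto)
  then have "eventually (\<lambda>i. (\<integral>\<^sup>+x. ennreal (norm (f i x) powr t) \<partial>M) < ennreal \<delta>) sequentially"
    using \<delta> by (intro order_tendstoD(2)) auto
  then show ?thesis unfolding eventually_sequentially by (meson less_imp_le order_refl)
qed

lemma approximable_indicator_box: "approximable (indicator (box c d) :: real ^ 'n \<Rightarrow> real)"
  unfolding approximable_def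
proof (intro conjI allI impI)
  have [measurable]: "box c d \<in> sets M" by (simp add: sets_M)
  show "(indicator (box c d) :: real ^ 'n \<Rightarrow> real) \<in> borel_measurable M" by measurable
  fix \<delta> :: real assume \<delta>: "\<delta> > 0"
  define c' :: "real ^ 'n" where "c' = (\<chi> i. max (a $ i) (c $ i))"
  define d' :: "real ^ 'n" where "d' = (\<chi> i. min (b $ i) (d $ i))"
  have box: "box c' d' = box a b \<inter> box c d" by (auto simp: mem_box_cart c'_def d'_def)
  note [measurable] = measurable_test[OF box_bump_test]
  have "\<exists>m. (\<integral>\<^sup>+x. ennreal (norm (indicator (box c d) x - box_bump c' d' m x) powr t) \<partial>M) \<le> ennreal \<delta>"
  proof (rule nn_integral_powr_tendsto_0[where u = "\<lambda>x. 1"])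
    fix m
    have "norm (indicator (box c d) x - box_bump c' d' m x) powr t \<le> 1" for x
    proof -
      have "norm (indicator (box c d) x - box_bump c' d' m x) \<le> 1"
        using box_bump_bounds[of c' d' m x] by (auto simp: indicator_def)
      then have "norm (indicator (box c d) x - box_bump c' d' m x) powr t \<le> 1 powr t" using t_pos by (intro powr_mono2) auto
      then show ?thesis by simp
    qed
    then show "AE x in M. norm (indicator (box c d) x - box_bump c' d' m x) powr t \<le> 1" by simp
  next
    show "AE x in M. (\<lambda>m. indicator (box c d) x - box_bump c' d' m x) \<longlonglongrightarrow> 0"
      using outside_null
    proof eventually_elim
      case (elim x)
      then have "indicator (box c d) x = (indicator (box c' d') x :: real)" by (simp add: box indicator_def)
      then show ?case using tendsto_diff[OF tendsto_const[of "indicator (box c d) x"] box_bump_tendsto[of c' d' x]] by simp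
    qed
  qed (use finite_M \<delta> in auto)
  then obtain m where "(\<integral>\<^sup>+x. ennreal (norm (indicator (box c d) x - box_bump c' d' m x) powr t) \<partial>M) \<le> ennreal \<delta>" ..
  moreover have "box_bump c' d' m x = 0" if "x \<notin> box a b" for x using that by (intro box_bump_outside) (simp add: box)
  ultimately show "\<exists>\<phi>\<in>test_functions. (\<forall>x. x \<notin> box a b \<longrightarrow> \<phi> x = 0) \<and>
     (\<integral>\<^sup>+x. ennreal (norm (indicator (box c d) x - \<phi> x :: real) powr t) \<partial>M) \<le> ennreal \<delta>"
    by (intro bexI[of _ "box_bump c' d' m"] conjI box_bump_test) auto
qed

lemma approximable_cong:
  fixes g h :: "real ^ 'n \<Rightarrow> 'b :: {real_normed_vector, second_countable_topology}"
  assumes g: "approximable g" and [measurable]: "h \<in> borel_measurable M" and eq: "AE x in M. g x = h x"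
  shows "approximable h"
proof -
  have "(\<integral>\<^sup>+x. ennreal (norm (h x - g x) powr t) \<partial>M) = (\<integral>\<^sup>+x. 0 \<partial>M)"
    using eq by (intro nn_integral_cong_AE, eventually_elim) simp
  then show ?thesis using g by (intro approximable_limit) (auto intro!: exI[of _ g])
qed

lemma approximable_sum:
  fixes g :: "'i \<Rightarrow> real ^ 'n \<Rightarrow> 'b :: {real_normed_vector, second_countable_topology}"
  assumes "\<And>i. i \<in> I \<Longrightarrow> approximable (g i)"
  shows "approximable (\<lambda>x. \<Sum>i\<in>I. g i x)"
proof -
  have "approximable (\<lambda>x. 0 :: 'b)"
    unfolding approximable_def using zero_test by (auto intro!: bexI[OF _ zero_test])
  then show ?thesis
    using assms by (induction I rule: infinite_finite_induct) (auto intro: approximable_add)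
qed

text \<open>The sets with an approximable indicator form a Dynkin system that contains the boxes.\<close>

lemma approximable_indicator_borel:
  assumes "A \<in> sets borel"
  shows "approximable (indicator A :: real ^ 'n \<Rightarrow> real)"
proof -
  let ?G = "range (\<lambda>(c, d). box c d) :: (real ^ 'n) set set"
  have A: "A \<in> sigma_sets UNIV ?G"
    using assms unfolding borel_eq_box by (simp add: sets_measure_of)
  have "Int_stable ?G" by (auto simp: Int_stable_def box_Int_box)
  moreover have "?G \<subseteq> Pow UNIV" by simp
  ultimately show ?thesis using A
  proof (induction rule: sigma_sets_induct_disjoint)
    case (basic A)
    then show ?case by (auto intro: approximable_indicator_box)
  next
    case empty
    show ?case using approximable_sum[of "{}" "\<lambda>_ _. 0 :: real"] by (simp add: indicator_def)
  next
    case (compl A)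
    have one: "approximable (\<lambda>x. 1 :: real)"
      by (rule approximable_cong[OF approximable_indicator_box[of a b]]) (use outside_null in auto)
    have "approximable (\<lambda>x. 1 + (- indicator A x :: real))"
      by (intro approximable_add one approximable_bounded_linear[OF compl(2)] bounded_linear_minus bounded_linear_ident)
    moreover have "(\<lambda>x. 1 + (- indicator A x :: real)) = indicator (UNIV - A)" by (auto simp: indicator_def fun_eq_iff)
    ultimately show ?case by simp
  next
    case (union A)
    have [measurable]: "A i \<in> sets M" for i
    proof -
      have "A i \<in> sets borel" using union(2) unfolding borel_eq_box by (auto simp: sets_measure_of)
      then show ?thesis using sets_M by simp
    qed
    show ?case
    proof (rule approximable_limit)
      fix \<delta> :: real assume \<delta>: "\<delta> > 0"
      have "\<exists>m. (\<integral>\<^sup>+x. ennreal (norm (indicator (\<Union>i. A i) x - (\<Sum>i<m. indicator (A i) x :: real)) powr t) \<partial>M) \<le> ennreal \<delta>"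
      proof (rule nn_integral_powr_tendsto_0[where u = "\<lambda>x. 1"])
        have ind: "(\<Sum>i<m. indicator (A i) x :: real) = indicator (\<Union>i<m. A i) x" for m x
          using union(1) by (intro indicator_UN_disjoint[symmetric]) (auto simp: disjoint_family_on_def)
        show "AE x in M. norm (indicator (\<Union>i. A i) x - (\<Sum>i<m. indicator (A i) x :: real)) powr t \<le> 1" for m
          unfolding ind using t_pos by (intro AE_I2) (auto simp: indicator_def)
        show "AE x in M. (\<lambda>m. indicator (\<Union>i. A i) x - (\<Sum>i<m. indicator (A i) x :: real)) \<longlonglongrightarrow> 0"
        proof (intro AE_I2)
          fix x
          have "eventually (\<lambda>m. indicator (\<Union>i. A i) x - (\<Sum>i<m. indicator (A i) x :: real) = 0) sequentially"
          proof (cases "\<exists>i. x \<in> A i")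
            case True
            then obtain i where i: "x \<in> A i" by blast
            show ?thesis
              unfolding ind using eventually_gt_at_top[of i] by eventually_elim (use i in \<open>auto simp: indicator_def\<close>)
          qed (auto simp: ind indicator_def)
          then show "(\<lambda>m. indicator (\<Union>i. A i) x - (\<Sum>i<m. indicator (A i) x :: real)) \<longlonglongrightarrow> 0"
            by (rule tendsto_eventually)
        qed
      qed (use finite_M \<delta> in auto)
      then obtain m where m: "(\<integral>\<^sup>+x. ennreal (norm (indicator (\<Union>i. A i) x - (\<Sum>i<m. indicator (A i) x :: real)) powr t) \<partial>M) \<le> ennreal \<delta>" ..
      have "approximable (\<lambda>x. \<Sum>i<m. indicator (A i) x :: real)" by (rule approximable_sum[OF union(3)])
      with m show "\<exists>g'. approximable g' \<and> (\<integral>\<^sup>+x. ennreal (norm (indicator (\<Union>i. A i) x - g' x :: real) powr t) \<partial>M) \<le> ennreal \<delta>"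
        by (intro exI[of _ "\<lambda>x. \<Sum>i<m. indicator (A i) x"] conjI)
    qed measurable
  qed
qed

lemma approximable_indicator:
  assumes A: "A \<in> sets lebesgue"
  shows "approximable (indicator A :: real ^ 'n \<Rightarrow> real)"
proof -
  obtain S N N' where A': "A = S \<union> N" "N \<subseteq> N'" "N' \<in> null_sets lborel" "S \<in> sets lborel"
    using A by (rule sets_completionE)
  have "N' \<in> null_sets M" using A'(3) by (intro absolutely_continuous) (simp add: null_sets_completionI)
  then have "AE x in M. x \<notin> N'" by (rule AE_not_in)
  then have "AE x in M. indicator S x = (indicator A x :: real)"
    by eventually_elim (use A' in \<open>auto simp: indicator_def\<close>)
  moreover have "indicator A \<in> borel_measurable M" using A sets_M by simp
  moreover have "approximable (indicator S :: real ^ 'n \<Rightarrow> real)"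
    using A'(4) by (intro approximable_indicator_borel) simp
  ultimately show ?thesis using approximable_cong by blast
qed

text \<open>Approximation by simple functions, whose level sets have approximable indicators.\<close>

theorem approximable_powr_integrable:
  fixes g :: "real ^ 'n \<Rightarrow> 'b :: {real_normed_vector, second_countable_topology}"
  assumes [measurable]: "g \<in> borel_measurable M" and fin: "(\<integral>\<^sup>+x. ennreal (norm (g x) powr t) \<partial>M) < \<infinity>"
  shows "approximable g"
proof (rule approximable_limit)
  fix \<delta> :: real assume \<delta>: "\<delta> > 0"
  obtain s where "\<forall>i. simple_function M (s i)" "\<forall>x\<in>space M. (\<lambda>i. s i x) \<longlonglongrightarrow> g x" "\<forall>i. \<forall>x\<in>space M. dist (s i x) 0 \<le> 2 * dist (g x) 0"
    using borel_measurable_implies_sequence_metric[OF assms(1), of 0] by blast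
  then have s: "\<And>i. simple_function M (s i)" "\<And>x. (\<lambda>i. s i x) \<longlonglongrightarrow> g x" "\<And>i x. norm (s i x) \<le> 2 * norm (g x)"
    by simp_all
  have [measurable]: "s i \<in> borel_measurable M" for i using borel_measurable_simple_function[OF s(1)] .
  have "\<exists>i. (\<integral>\<^sup>+x. ennreal (norm (g x - s i x) powr t) \<partial>M) \<le> ennreal \<delta>"
  proof (rule nn_integral_powr_tendsto_0[where u = "\<lambda>x. 3 powr t * norm (g x) powr t"])
    show "AE x in M. norm (g x - s i x) powr t \<le> 3 powr t * norm (g x) powr t" for i
    proof (intro AE_I2)
      fix x
      have "norm (g x - s i x) \<le> 3 * norm (g x)" using norm_triangle_ineq4[of "g x" "s i x"] s(3)[of i x] by simp
      then have "norm (g x - s i x) powr t \<le> (3 * norm (g x)) powr t" using t_pos by (intro powr_mono2) auto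
      then show "norm (g x - s i x) powr t \<le> 3 powr t * norm (g x) powr t" by (simp add: powr_mult)
    qed
    have "(\<integral>\<^sup>+x. ennreal (3 powr t * norm (g x) powr t) \<partial>M) = ennreal (3 powr t) * (\<integral>\<^sup>+x. ennreal (norm (g x) powr t) \<partial>M)"
      by (subst nn_integral_cmult[symmetric]) (auto simp: ennreal_mult)
    then show "(\<integral>\<^sup>+x. ennreal (3 powr t * norm (g x) powr t) \<partial>M) < \<infinity>" using fin by (simp add: ennreal_mult_less_top)
    show "AE x in M. (\<lambda>i. g x - s i x) \<longlonglongrightarrow> 0"
    proof (intro AE_I2)
      fix x
      have "(\<lambda>i. g x - s i x) \<longlonglongrightarrow> g x - g x" by (intro tendsto_diff tendsto_const s(2))
      then show "(\<lambda>i. g x - s i x) \<longlonglongrightarrow> 0" by simp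
    qed
  qed (use \<delta> in auto)
  moreover have "approximable (s i)" for i
  proof -
    have fin: "finite (range (s i))" using simple_functionD(1)[OF s(1)[of i]] by simp
    have "approximable (\<lambda>x. \<Sum>y\<in>range (s i). indicator (s i -` {y}) x *\<^sub>R y)"
    proof (intro approximable_sum approximable_bounded_linear[OF _ bounded_linear_scaleR_left] approximable_indicator)
      show "s i -` {y} \<in> sets lebesgue" for y
        using simple_functionD(2)[OF s(1)[of i], of "{y}"] sets_M by simp
    qed
    moreover have "(\<lambda>x. \<Sum>y\<in>range (s i). indicator (s i -` {y}) x *\<^sub>R y) = s i"
    proof
      fix x
      have "(\<Sum>y\<in>range (s i). indicator (s i -` {y}) x *\<^sub>R y) = (\<Sum>y\<in>range (s i). if y = s i x then y else 0)"
        by (intro sum.cong) (auto simp: indicator_def)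
      also have "\<dots> = s i x" using fin by simp
      finally show "(\<Sum>y\<in>range (s i). indicator (s i -` {y}) x *\<^sub>R y) = s i x" .
    qed
    ultimately show ?thesis by simp
  qed
  ultimately show "\<exists>g'. approximable g' \<and> (\<integral>\<^sup>+x. ennreal (norm (g x - g' x) powr t) \<partial>M) \<le> ennreal \<delta>" by blast
qed simp

end

lemma test_functions_dense_box:
  fixes g :: "real ^ 'n \<Rightarrow> 'b :: {real_normed_vector, second_countable_topology}" and W :: "real ^ 'n \<Rightarrow> real"
  assumes [measurable]: "g \<in> borel_measurable lebesgue" "W \<in> borel_measurable lebesgue" and t: "t > 0"
    and W: "(\<integral>\<^sup>+x\<in>box a b. ennreal (W x) \<partial>lebesgue) < \<infinity>"
    and g: "(\<integral>\<^sup>+x\<in>box a b. ennreal (norm (g x) powr t) * ennreal (W x) \<partial>lebesgue) < \<infinity>" and \<delta>: "\<delta> > 0"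
  obtains \<phi> where "\<phi> \<in> test_functions" "\<And>x. x \<notin> box a b \<Longrightarrow> \<phi> x = 0"
    "(\<integral>\<^sup>+x\<in>box a b. ennreal (norm (g x - \<phi> x) powr t) * ennreal (W x) \<partial>lebesgue) \<le> ennreal \<delta>"
proof -
  define k where "k x = ennreal (W x) * indicator (box a b) x" for x
  have [measurable]: "box a b \<in> sets lebesgue" by simp
  have [measurable]: "k \<in> borel_measurable lebesgue" unfolding k_def by measurable
  define M where "M = density lebesgue k"
  have int: "(\<integral>\<^sup>+x. ennreal (norm (f x) powr t) \<partial>M) = (\<integral>\<^sup>+x\<in>box a b. ennreal (norm (f x) powr t) * ennreal (W x) \<partial>lebesgue)"
    if [measurable]: "f \<in> borel_measurable lebesgue" for f :: "real ^ 'n \<Rightarrow> 'b"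
    unfolding M_def by (subst nn_integral_density) (auto simp: k_def ac_simps)
  interpret finite_box_measure a b M t
  proof
    show "sets M = sets lebesgue" by (simp add: M_def)
    show "emeasure M UNIV < \<infinity>" using W by (simp add: M_def emeasure_density k_def)
    show "AE x in M. x \<in> box a b" unfolding M_def by (subst AE_density) (auto simp: k_def indicator_def)
    show "A \<in> null_sets M" if "A \<in> null_sets lebesgue" for A
      using that unfolding M_def by (subst null_sets_density_iff) (auto dest: AE_not_in)
  qed (fact t)
  have gM: "g \<in> borel_measurable M" using measurable_cong_sets[OF sets_M refl] assms(1) by blast
  have "approximable g" by (rule approximable_powr_integrable[OF gM]) (use g in \<open>simp add: int\<close>)
  then obtain \<phi> where \<phi>: "\<phi> \<in> test_functions" "\<forall>x. x \<notin> box a b \<longrightarrow> \<phi> x = 0"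
     "(\<integral>\<^sup>+x. ennreal (norm (g x - \<phi> x) powr t) \<partial>M) \<le> ennreal \<delta>"
    using \<delta> unfolding approximable_def by blast
  note [measurable] = test_functions_measurable[OF \<phi>(1)]
  show ?thesis using \<phi> by (intro that[of \<phi>]) (auto simp: int)
qed

text \<open>Since \<open>g\<close> has a finite integral, its part outside a large box is negligible.\<close>

lemma test_functions_dense:
  fixes g :: "real ^ 'n \<Rightarrow> 'b :: {real_normed_vector, second_countable_topology}" and W :: "real ^ 'n \<Rightarrow> real"
  assumes [measurable]: "g \<in> borel_measurable lebesgue" "W \<in> borel_measurable lebesgue" and t: "t > 0"
    and W: "\<And>a b. (\<integral>\<^sup>+x\<in>box a b. ennreal (W x) \<partial>lebesgue) < \<infinity>"
    and g: "(\<integral>\<^sup>+x. ennreal (norm (g x) powr t) * ennreal (W x) \<partial>lebesgue) < \<infinity>" and \<delta>: "\<delta> > 0"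
  obtains \<phi> where "\<phi> \<in> test_functions" "(\<integral>\<^sup>+x. ennreal (norm (g x - \<phi> x) powr t) * ennreal (W x) \<partial>lebesgue) \<le> ennreal \<delta>"
proof -
  define U :: "nat \<Rightarrow> (real ^ 'n) set" where "U m = box (- (\<chi> i. real m)) (\<chi> i. real m)" for m
  let ?G = "\<lambda>x. ennreal (norm (g x) powr t) * ennreal (W x)"
  have [measurable]: "U m \<in> sets lebesgue" for m by (simp add: U_def)
  have "(\<lambda>m. \<integral>\<^sup>+x. ?G x * indicator (- U m) x \<partial>lebesgue) \<longlonglongrightarrow> (\<integral>\<^sup>+x. 0 \<partial>(lebesgue :: (real ^ 'n) measure))"
  proof (rule nn_integral_dominated_convergence[where w = ?G])
    show "AE x in lebesgue. ?G x * indicator (- U m) x \<le> ?G x" for m by (auto simp: indicator_def)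
    show "AE x in lebesgue. (\<lambda>m. ?G x * indicator (- U m) x) \<longlonglongrightarrow> 0"
    proof (intro AE_I2)
      fix x :: "real ^ 'n"
      have "eventually (\<lambda>m. norm x < real m) sequentially"
        using eventually_gt_at_top[of "nat \<lceil>norm x\<rceil>"] by eventually_elim linarith
      then have "eventually (\<lambda>m. ?G x * indicator (- U m) x = 0) sequentially"
      proof eventually_elim
        case (elim m)
        have "\<bar>x $ i\<bar> < real m" for i using component_le_norm_cart[of x i] elim by linarith
        then have "x \<in> U m" unfolding U_def mem_box_cart by (auto simp: abs_less_iff minus_less_iff)
        then show ?case by simp
      qed
      then show "(\<lambda>m. ?G x * indicator (- U m) x) \<longlonglongrightarrow> 0" by (rule tendsto_eventually)
    qed
  qed (use g in auto)
  then have "eventually (\<lambda>m. (\<integral>\<^sup>+x. ?G x * indicator (- U m) x \<partial>lebesgue) < ennreal (\<delta> / 2)) sequentially"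
    using \<delta> by (intro order_tendstoD(2)) auto
  then obtain m where m: "(\<integral>\<^sup>+x. ?G x * indicator (- U m) x \<partial>lebesgue) < ennreal (\<delta> / 2)"
    by (auto simp: eventually_sequentially)
  have gU: "(\<integral>\<^sup>+x\<in>U m. ?G x \<partial>lebesgue) < \<infinity>"
    by (rule le_less_trans[OF _ g]) (intro nn_integral_mono, simp add: indicator_def)
  obtain \<phi> where \<phi>: "\<phi> \<in> test_functions" "\<And>x. x \<notin> U m \<Longrightarrow> \<phi> x = 0"
    "(\<integral>\<^sup>+x\<in>U m. ennreal (norm (g x - \<phi> x) powr t) * ennreal (W x) \<partial>lebesgue) \<le> ennreal (\<delta> / 2)"
    by (rule test_functions_dense_box[OF assms(1,2) t W gU[unfolded U_def] half_gt_zero[OF \<delta>], folded U_def])  (assumption | rule that)+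
  note [measurable] = test_functions_measurable[OF \<phi>(1)]
  have "(\<integral>\<^sup>+x. ennreal (norm (g x - \<phi> x) powr t) * ennreal (W x) \<partial>lebesgue)
     = (\<integral>\<^sup>+x. ennreal (norm (g x - \<phi> x) powr t) * ennreal (W x) * indicator (U m) x + ?G x * indicator (- U m) x \<partial>lebesgue)"
    using \<phi>(2) by (intro nn_integral_cong) (auto simp: indicator_def)
  also have "\<dots> = (\<integral>\<^sup>+x\<in>U m. ennreal (norm (g x - \<phi> x) powr t) * ennreal (W x) \<partial>lebesgue) + (\<integral>\<^sup>+x. ?G x * indicator (- U m) x \<partial>lebesgue)"
    by (rule nn_integral_add) measurable
  also have "\<dots> \<le> ennreal (\<delta> / 2) + ennreal (\<delta> / 2)" using \<phi>(3) m by (intro add_mono) auto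
  also have "\<dots> = ennreal \<delta>" using \<delta> by (simp add: ennreal_plus[symmetric] del: ennreal_plus)
  finally show ?thesis using that \<phi>(1) by blast
qed

section \<open>The weak type estimate for test functions\<close>

lemma ennreal_infsum_le:
  fixes f :: "'a \<Rightarrow> ennreal"
  assumes "\<And>F. finite F \<Longrightarrow> F \<subseteq> A \<Longrightarrow> sum f F \<le> x"
  shows "infsum f A \<le> x"
  by (subst nonneg_infsum_complete) (auto intro!: SUP_least assms)

lemma test_functions_norm_bounded:
  fixes f :: "real ^ 'n \<Rightarrow> 'b :: {real_normed_vector, second_countable_topology}"
  assumes f: "f \<in> test_functions"
  obtains C where "C > 0" "\<And>x. norm (f x) \<le> C"
proof -
  have "compact (closure {x. f x \<noteq> 0})" using f by (simp only: test_functions_def mem_Collect_eq)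
  moreover have "continuous_on (closure {x. f x \<noteq> 0}) f"
    using test_functions_continuous[OF f] continuous_on_subset by blast
  ultimately have "bounded (f ` closure {x. f x \<noteq> 0})" by (intro compact_imp_bounded compact_continuous_image)
  then obtain C where C: "C > 0" "\<And>x. x \<in> closure {x. f x \<noteq> 0} \<Longrightarrow> norm (f x) \<le> C"
    unfolding bounded_pos by auto
  have "norm (f x) \<le> C" for x
    using C closure_subset[of "{x. f x \<noteq> 0}"] by (cases "f x = 0") auto
  then show ?thesis using that C(1) by blast
qed

lemma nn_integral_test_function:
  fixes f :: "real ^ 'n \<Rightarrow> 'b :: {real_normed_vector, second_countable_topology}"
  assumes f: "f \<in> test_functions" and "t > 0"
  shows "(\<integral>\<^sup>+x. ennreal (norm (f x) powr t) \<partial>lebesgue) < \<infinity>"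
proof -
  obtain C where C: "C > 0" "\<And>x. norm (f x) \<le> C" using test_functions_norm_bounded[OF f] by blast
  obtain a b where ab: "\<And>x. x \<notin> box a b \<Longrightarrow> f x = 0" using test_functions_support[OF f] by blast
  have "(\<integral>\<^sup>+x. ennreal (norm (f x) powr t) \<partial>lebesgue) \<le> (\<integral>\<^sup>+x. ennreal (C powr t) * indicator (box a b) x \<partial>lebesgue)"
    using C ab assms(2) by (intro nn_integral_mono) (auto simp: indicator_def intro!: ennreal_leI powr_mono2)
  also have "\<dots> = ennreal (C powr t) * emeasure lebesgue (box a b)"
    by (rule nn_integral_cmult_indicator) simp
  also have "\<dots> < \<infinity>" using emeasure_lborel_box_finite[of a b] by (simp add: ennreal_mult_less_top)
  finally show ?thesis .
qed

lemma set_nn_integral_finite: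
  "(\<integral>\<^sup>+x. f x \<partial>M) < \<infinity> \<Longrightarrow> (\<integral>\<^sup>+x\<in>Q. f x \<partial>M) < \<infinity>" for f :: "'a \<Rightarrow> ennreal"
  by (erule le_less_trans[rotated]) (intro nn_integral_mono, simp add: indicator_def)

lemma mean_add_le:
  fixes g k :: "real ^ 'n \<Rightarrow> 'b :: {real_normed_vector, second_countable_topology}"
  assumes [measurable]: "g \<in> borel_measurable lebesgue" "k \<in> borel_measurable lebesgue" and \<rho>: "\<rho> \<ge> 1" and Q: "Q \<in> cubes"
    and g: "(\<integral>\<^sup>+x\<in>Q. ennreal (norm (g x) powr \<rho>) \<partial>lebesgue) < \<infinity>" and k: "(\<integral>\<^sup>+x\<in>Q. ennreal (norm (k x) powr \<rho>) \<partial>lebesgue) < \<infinity>"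
  shows "mean (\<lambda>x. norm (g x + k x) powr \<rho>) Q powr (1 / \<rho>)
     \<le> 4 * (mean (\<lambda>x. norm (g x) powr \<rho>) Q powr (1 / \<rho>) + mean (\<lambda>x. norm (k x) powr \<rho>) Q powr (1 / \<rho>))"
proof -
  let ?m = "\<lambda>g. mean (\<lambda>x. norm (g x) powr \<rho>) Q"
  have [measurable]: "Q \<in> sets lebesgue" by (rule cubes_measure(2)[OF Q])
  have V: "measure lebesgue Q > 0" by (rule cubes_measure(3)[OF Q])
  have "?m (\<lambda>x. g x + k x) \<le> 2 powr \<rho> * (?m g + ?m k)"
  proof (rule nn_integral_le_imp_mean_le[OF Q])
    have "(\<integral>\<^sup>+x\<in>Q. ennreal (norm (g x + k x) powr \<rho>) \<partial>lebesgue)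
        \<le> (\<integral>\<^sup>+x. ennreal (2 powr \<rho>) * (ennreal (norm (g x) powr \<rho>) * indicator Q x + ennreal (norm (k x) powr \<rho>) * indicator Q x) \<partial>lebesgue)"
      using powr_norm_add_le[of \<rho>] \<rho>
      by (intro nn_integral_mono) (auto simp: indicator_def ennreal_plus[symmetric] ennreal_mult[symmetric] intro!: ennreal_leI simp del: ennreal_plus)
    also have "\<dots> = ennreal (2 powr \<rho>) * (ennreal (?m g * measure lebesgue Q) + ennreal (?m k * measure lebesgue Q))"
      unfolding nn_integral_eq_mean[OF Q g, symmetric] nn_integral_eq_mean[OF Q k, symmetric]
      by (simp add: nn_integral_cmult nn_integral_add)
    also have "\<dots> = ennreal (2 powr \<rho> * (?m g + ?m k) * measure lebesgue Q)"
      using V by (simp add: ennreal_plus[symmetric] ennreal_mult[symmetric] algebra_simps del: ennreal_plus)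
    finally show "(\<integral>\<^sup>+x\<in>Q. ennreal (norm (g x + k x) powr \<rho>) \<partial>lebesgue) \<le> ennreal (2 powr \<rho> * (?m g + ?m k) * measure lebesgue Q)" .
  qed simp
  also have "\<dots> \<le> 2 powr \<rho> * (2 * max (?m g) (?m k))" by (intro mult_left_mono) auto
  finally have "?m (\<lambda>x. g x + k x) powr (1 / \<rho>) \<le> (2 powr \<rho> * (2 * max (?m g) (?m k))) powr (1 / \<rho>)"
    using \<rho> by (intro powr_mono2) auto
  also have "\<dots> = 2 * (2 powr (1 / \<rho>) * max (?m g) (?m k) powr (1 / \<rho>))"
    using \<rho> by (simp add: powr_mult powr_powr max_def)
  also have "\<dots> \<le> 2 * (2 * (?m g powr (1 / \<rho>) + ?m k powr (1 / \<rho>)))"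
  proof (intro mult_left_mono mult_mono)
    have "2 powr (1 / \<rho>) \<le> 2 powr (1 :: real)" using \<rho> by (intro powr_mono) auto
    then show "2 powr (1 / \<rho>) \<le> 2" by simp
    show "max (?m g) (?m k) powr (1 / \<rho>) \<le> ?m g powr (1 / \<rho>) + ?m k powr (1 / \<rho>)" by (auto simp: max_def)
  qed auto
  finally show ?thesis by simp
qed

context sparse_weight
begin

lemma q_pos: "q \<ge> 1" "q > 0" "p > 0" "p\<^sub>0 > 0" "\<rho> > 0"
  using p \<rho> by auto

lemma sparse_form_add_le:
  fixes h g k :: "real ^ 'n \<Rightarrow> 'a :: {real_normed_field, euclidean_space}"
  assumes "g \<in> borel_measurable lebesgue" "k \<in> borel_measurable lebesgue" and \<F>: "\<F> \<subseteq> cubes"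
    and "(\<integral>\<^sup>+x. ennreal (norm (g x) powr \<rho>) \<partial>lebesgue) < \<infinity>" "(\<integral>\<^sup>+x. ennreal (norm (k x) powr \<rho>) \<partial>lebesgue) < \<infinity>"
  shows "sparse_form \<F> h (\<lambda>x. g x + k x) \<le> 4 * (sparse_form \<F> h g + sparse_form \<F> h k)"
proof -
  let ?m = "\<lambda>g Q. mean (\<lambda>x. norm (g x) powr \<rho>) Q powr (1 / \<rho>)"
  let ?h = "\<lambda>Q. mean (\<lambda>x. norm (h x) powr p\<^sub>0) Q powr (1 / p\<^sub>0)" and ?V = "\<lambda>Q. measure lebesgue Q powr (1 + (1 / p - 1 / q))"
  have "sparse_form \<F> h (\<lambda>x. g x + k x) \<le> (\<Sum>Q\<in>\<F>. ?h Q * (4 * (?m g Q + ?m k Q)) * ?V Q)"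
    unfolding sparse_form_def using assms
    by (intro sum_mono mult_right_mono mult_left_mono mean_add_le \<rho> set_nn_integral_finite) auto
  also have "\<dots> = (\<Sum>Q\<in>\<F>. 4 * (?h Q * ?m g Q * ?V Q) + 4 * (?h Q * ?m k Q * ?V Q))"
    by (intro sum.cong refl) (simp add: algebra_simps)
  also have "\<dots> = 4 * (sparse_form \<F> h g + sparse_form \<F> h k)"
    unfolding sparse_form_def sum.distrib sum_distrib_left[symmetric] by simp
  finally show ?thesis .
qed

text \<open>Continuity of the form in its second argument for a fixed test function \<open>h\<close>, uniformly over all sparse
  families. The strict inequality between the exponents in the definition of the class of operators says that \<open>\<delta> > 0\<close>:
  part of the power \<open>1 / p\<^sub>0\<close> of the mean of \<open>\<bar>h\<bar>\<close> pays for the power of \<open>\<bar>Q\<bar>\<close>, and the remaining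
  powers still add up to \<open>1 + \<delta>\<close>, so that the maximal theorem applies.\<close>

lemma sparse_form_continuous:
  fixes h :: "real ^ 'n \<Rightarrow> 'a :: {real_normed_field, euclidean_space}"
  assumes h: "h \<in> test_functions" and \<delta>: "\<delta> > 0" "\<delta> = 1 / p\<^sub>0 - (1 / p - 1 / q) + 1 / \<rho> - 1"
  obtains C where "C \<ge> 0"
    "\<And>\<F> E k \<tau>. major_parts \<eta> \<F> E \<Longrightarrow> k \<in> borel_measurable lebesgue \<Longrightarrow> \<tau> > 0 \<Longrightarrow>
       (\<integral>\<^sup>+x. ennreal (norm (k x :: 'a) powr (\<rho> * (1 + \<delta>))) \<partial>lebesgue) \<le> ennreal (\<tau> powr (\<rho> * (1 + \<delta>))) \<Longrightarrow>
       sparse_form \<F> h k \<le> C * \<tau>"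
proof -
  note [measurable] = test_functions_measurable[OF h]
  define \<theta> where "\<theta> = 1 / p - 1 / q"
  define \<beta> where "\<beta> = 1 / p\<^sub>0 - \<theta>"
  have \<theta>: "\<theta> \<ge> 0" using p by (simp add: \<theta>_def frac_le)
  have "1 / \<rho> \<le> 1" using \<rho>(1) by simp
  then have \<beta>: "\<beta> \<ge> 0" "\<beta> + 1 / \<rho> = 1 + \<delta>" using \<delta> by (auto simp: \<beta>_def \<theta>_def)
  define X where "X Q = mean (\<lambda>x. norm (h x) powr p\<^sub>0) Q" for Q
  let ?V = "measure lebesgue :: (real ^ 'n) set \<Rightarrow> real"
  obtain H where H: "(\<integral>\<^sup>+x. ennreal (norm (h x) powr p\<^sub>0) \<partial>lebesgue) = ennreal H" "H \<ge> 0"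
    using nn_integral_test_function[OF h q_pos(4)] by (cases "\<integral>\<^sup>+x. ennreal (norm (h x) powr p\<^sub>0) \<partial>lebesgue") auto
  have "p\<^sub>0 * (1 + \<delta>) > 0" using q_pos \<delta> by simp
  then obtain I where I: "(\<integral>\<^sup>+x. ennreal (norm (h x) powr (p\<^sub>0 * (1 + \<delta>))) \<partial>lebesgue) = ennreal I" "I \<ge> 0"
    using nn_integral_test_function[OF h] by (cases "\<integral>\<^sup>+x. ennreal (norm (h x) powr (p\<^sub>0 * (1 + \<delta>))) \<partial>lebesgue") fastforce+
  define c where "c = carleson_const CARD('n) (1 + \<delta>) / \<eta>"
  have c: "c \<ge> 0" using carleson_const_nonneg[of "CARD('n)" "1 + \<delta>"] \<delta> \<eta> by (simp add: c_def)
  show ?thesis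
  proof (rule that[of "H powr \<theta> * (c * I + c)"])
    show "H powr \<theta> * (c * I + c) \<ge> 0" using c I by simp
    fix \<F> :: "(real ^ 'n) set set" and E and k :: "real ^ 'n \<Rightarrow> 'a" and \<tau> :: real
    assume \<F>: "major_parts \<eta> \<F> E" and [measurable]: "k \<in> borel_measurable lebesgue" and \<tau>: "\<tau> > 0"
      and k: "(\<integral>\<^sup>+x. ennreal (norm (k x) powr (\<rho> * (1 + \<delta>))) \<partial>lebesgue) \<le> ennreal (\<tau> powr (\<rho> * (1 + \<delta>)))"
    define Y where "Y Q = mean (\<lambda>x. norm (k x) powr \<rho>) Q" for Q
    have XY: "X Q \<ge> 0" "Y Q \<ge> 0" for Q by (simp_all add: X_def Y_def)
    have \<F>c: "Q \<in> cubes" if "Q \<in> \<F>" for Q using \<F> that by (auto simp: major_parts_def)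
    have le: "X Q powr (1 / p\<^sub>0) * Y Q powr (1 / \<rho>) * ?V Q powr (1 + \<theta>)
        \<le> \<tau> * H powr \<theta> * (X Q powr (1 + \<delta>) * ?V Q + (1 / \<tau> powr \<rho>) powr (1 + \<delta>) * (Y Q powr (1 + \<delta>) * ?V Q))" if "Q \<in> \<F>" for Q
    proof -
      note Q = \<F>c[OF that]
      have V: "?V Q > 0" by (rule cubes_measure(3)[OF Q])
      have fin: "(\<integral>\<^sup>+x\<in>Q. ennreal (norm (h x) powr p\<^sub>0) \<partial>lebesgue) < \<infinity>"
        using H by (intro set_nn_integral_finite) simp
      have "ennreal (X Q * ?V Q) \<le> ennreal H"
        unfolding X_def nn_integral_eq_mean[OF Q fin, symmetric] H(1)[symmetric]
        by (intro nn_integral_mono) (simp add: indicator_def)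
      then have XV: "X Q * ?V Q \<le> H" using H by simp
      have "X Q powr (1 / p\<^sub>0) * ?V Q powr (1 + \<theta>) = X Q powr \<beta> * (X Q * ?V Q) powr \<theta> * ?V Q"
        using XY V by (simp add: powr_mult powr_add \<beta>_def powr_diff)
      also have "\<dots> \<le> X Q powr \<beta> * H powr \<theta> * ?V Q"
        using XY V XV \<theta> by (intro mult_right_mono mult_left_mono powr_mono2) auto
      finally have "X Q powr (1 / p\<^sub>0) * ?V Q powr (1 + \<theta>) * Y Q powr (1 / \<rho>) \<le> X Q powr \<beta> * H powr \<theta> * ?V Q * Y Q powr (1 / \<rho>)"
        by (rule mult_right_mono) simp
      also have "X Q powr \<beta> * H powr \<theta> * ?V Q * Y Q powr (1 / \<rho>)
          = \<tau> * H powr \<theta> * ((X Q powr \<beta> * (1 / \<tau> powr \<rho> * Y Q) powr (1 / \<rho>)) * ?V Q)"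
      proof -
        have "Y Q powr (1 / \<rho>) = \<tau> * (1 / \<tau> powr \<rho> * Y Q) powr (1 / \<rho>)"
          using \<tau> XY q_pos by (simp add: powr_mult powr_divide powr_powr)
        then show ?thesis by (simp only: mult.assoc mult.commute mult.left_commute)
      qed
      also have "\<dots> \<le> \<tau> * H powr \<theta> * ((X Q powr (1 + \<delta>) + (1 / \<tau> powr \<rho> * Y Q) powr (1 + \<delta>)) * ?V Q)"
      proof (intro mult_left_mono mult_right_mono)
        have "1 / \<tau> powr \<rho> * Y Q \<ge> 0" using XY by simp
        then show "X Q powr \<beta> * (1 / \<tau> powr \<rho> * Y Q) powr (1 / \<rho>) \<le> X Q powr (1 + \<delta>) + (1 / \<tau> powr \<rho> * Y Q) powr (1 + \<delta>)"
          using powr_mult_le_sum[of "X Q" "1 / \<tau> powr \<rho> * Y Q" \<beta> "1 / \<rho>", unfolded \<beta>(2)] XY \<beta>(1) q_pos by simp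
      qed (use \<tau> V in auto)
      also have "(1 / \<tau> powr \<rho> * Y Q) powr (1 + \<delta>) = (1 / \<tau> powr \<rho>) powr (1 + \<delta>) * Y Q powr (1 + \<delta>)"
        by (rule powr_mult)
      also have "(X Q powr (1 + \<delta>) + (1 / \<tau> powr \<rho>) powr (1 + \<delta>) * Y Q powr (1 + \<delta>)) * ?V Q
          = X Q powr (1 + \<delta>) * ?V Q + (1 / \<tau> powr \<rho>) powr (1 + \<delta>) * (Y Q powr (1 + \<delta>) * ?V Q)"
        by (simp only: distrib_right mult.assoc)
      finally show ?thesis by (simp only: mult.assoc mult.commute mult.left_commute)
    qed
    have sumX: "(\<Sum>Q\<in>\<F>. X Q powr (1 + \<delta>) * ?V Q) \<le> c * I"
      unfolding X_def c_def
    proof (rule carleson_strong[OF \<F> \<eta>])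
      show "(\<integral>\<^sup>+x. ennreal ((norm (h x) powr p\<^sub>0) powr (1 + \<delta>)) \<partial>lebesgue) \<le> ennreal I"
        using I(1) by (simp add: powr_powr)
    qed (use I \<delta> in auto)
    have sumY: "(\<Sum>Q\<in>\<F>. Y Q powr (1 + \<delta>) * ?V Q) \<le> c * \<tau> powr (\<rho> * (1 + \<delta>))"
      unfolding Y_def c_def
    proof (rule carleson_strong[OF \<F> \<eta>])
      show "(\<integral>\<^sup>+x. ennreal ((norm (k x) powr \<rho>) powr (1 + \<delta>)) \<partial>lebesgue) \<le> ennreal (\<tau> powr (\<rho> * (1 + \<delta>)))"
        using k by (simp add: powr_powr)
    qed (use \<delta> in auto)
    have "sparse_form \<F> h k = (\<Sum>Q\<in>\<F>. X Q powr (1 / p\<^sub>0) * Y Q powr (1 / \<rho>) * ?V Q powr (1 + \<theta>))"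
      by (simp add: sparse_form_def X_def Y_def \<theta>_def)
    also have "\<dots> \<le> (\<Sum>Q\<in>\<F>. \<tau> * H powr \<theta> * (X Q powr (1 + \<delta>) * ?V Q + (1 / \<tau> powr \<rho>) powr (1 + \<delta>) * (Y Q powr (1 + \<delta>) * ?V Q)))"
      by (intro sum_mono le)
    also have "\<dots> = \<tau> * H powr \<theta> * ((\<Sum>Q\<in>\<F>. X Q powr (1 + \<delta>) * ?V Q) + (1 / \<tau> powr \<rho>) powr (1 + \<delta>) * (\<Sum>Q\<in>\<F>. Y Q powr (1 + \<delta>) * ?V Q))"
      by (simp only: sum.distrib sum_distrib_left[symmetric])
    also have "\<dots> \<le> \<tau> * H powr \<theta> * (c * I + (1 / \<tau> powr \<rho>) powr (1 + \<delta>) * (c * \<tau> powr (\<rho> * (1 + \<delta>))))"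
      using \<tau> by (intro mult_left_mono add_mono sumX sumY) auto
    also have "(1 / \<tau> powr \<rho>) powr (1 + \<delta>) * (c * \<tau> powr (\<rho> * (1 + \<delta>))) = c"
      using \<tau> by (simp add: powr_divide powr_powr)
    finally show "sparse_form \<F> h k \<le> H powr \<theta> * (c * I + c) * \<tau>" by (simp only: mult.assoc mult.commute mult.left_commute)
  qed
qed

lemma sum_avg_eq_sparse_form:
  fixes h g :: "real ^ 'n \<Rightarrow> 'a :: {real_normed_field, euclidean_space}"
  assumes \<F>: "finite \<F>" "\<F> \<subseteq> cubes" and h: "h \<in> test_functions" and g: "g \<in> test_functions"
    and \<alpha>: "1 / p - 1 / q = \<alpha> / (real CARD('n) * \<rho>)"
  shows "(\<Sum>Q\<in>\<F>. avg 0 p\<^sub>0 Q h * avg \<alpha> \<rho> Q g * emeasure lebesgue Q) = ennreal (sparse_form \<F> h g)"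
proof -
  have "avg 0 p\<^sub>0 Q h * avg \<alpha> \<rho> Q g * emeasure lebesgue Q = ennreal (mean (\<lambda>x. norm (h x) powr p\<^sub>0) Q powr (1 / p\<^sub>0) * mean (\<lambda>x. norm (g x) powr \<rho>) Q powr (1 / \<rho>)
              * measure lebesgue Q powr (1 + (1 / p - 1 / q)))" if "Q \<in> \<F>" for Q
  proof -
    have Q: "Q \<in> cubes" using that \<F> by blast
    have "measure lebesgue Q > 0" by (rule cubes_measure(3)[OF Q])
    then show ?thesis
      unfolding \<alpha> cubes_measure(4)[OF Q]
        avg_eq[OF Q q_pos(4) set_nn_integral_finite[OF nn_integral_test_function[OF h q_pos(4)]]]
        avg_eq[OF Q q_pos(5) set_nn_integral_finite[OF nn_integral_test_function[OF g q_pos(5)]]]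
      by (simp add: ennreal_mult[symmetric] powr_add ac_simps)
  qed
  then show ?thesis
    unfolding sparse_form_def by (subst sum_ennreal[symmetric]) (auto intro!: sum.cong)
qed

end

text \<open>Small values of \<open>x\<close> are controlled by \<open>\<omega>\<close>, large ones by a power. This bounds a pairing with a
  locally integrable function by an \<open>L\<^sup>t\<close> norm with respect to a measure that has this function as density.\<close>

lemma le_add_powr_split:
  fixes x \<omega> t :: real
  assumes "x \<ge> 0" "\<omega> > 0" "t \<ge> 1"
  shows "x \<le> \<omega> + \<omega> powr (1 - t) * x powr t"
proof (cases "x \<le> \<omega>")
  case False
  then have "1 powr (t - 1) \<le> (x / \<omega>) powr (t - 1)" using assms by (intro powr_mono2) auto
  then have "x * 1 \<le> x * (x / \<omega>) powr (t - 1)" using assms by (intro mult_left_mono) auto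
  also have "x * (x / \<omega>) powr (t - 1) = \<omega> powr (1 - t) * x powr t"
    using False assms by (simp add: powr_divide powr_diff)
  also have "\<dots> \<le> \<omega> + \<omega> powr (1 - t) * x powr t" using assms by simp
  finally show ?thesis by simp
qed (use assms in \<open>simp add: add_increasing2\<close>)

lemma box_in_lebesgue [measurable]: "box a (b :: 'a :: euclidean_space) \<in> sets lebesgue"
  by simp

lemma locally_integrable_measurable:
  fixes u :: "real ^ 'n \<Rightarrow> 'a :: {banach, second_countable_topology}"
  assumes "locally_integrable u"
  shows "u \<in> borel_measurable lebesgue"
proof (rule borel_measurable_LIMSEQ_metric)
  fix m :: nat
  have "set_integrable lebesgue (cball 0 (real m)) u" using assms unfolding locally_integrable_def by simp
  then show "(\<lambda>x. indicator (cball 0 (real m)) x *\<^sub>R u x) \<in> borel_measurable lebesgue"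
    unfolding set_integrable_def by (rule borel_measurable_integrable)
next
  fix x :: "real ^ 'n"
  have "eventually (\<lambda>m. indicator (cball 0 (real m)) x *\<^sub>R u x = u x) sequentially"
    using eventually_ge_at_top[of "nat \<lceil>norm x\<rceil>"]
    by eventually_elim (auto simp: indicator_def nat_le_iff ceiling_le_iff)
  then show "(\<lambda>m. indicator (cball 0 (real m)) x *\<^sub>R u x) \<longlonglongrightarrow> u x" by (rule tendsto_eventually)
qed

lemma locally_integrable_nn_integral_box:
  fixes u :: "real ^ 'n \<Rightarrow> 'a :: {banach, second_countable_topology}"
  assumes "locally_integrable u"
  shows "(\<integral>\<^sup>+x\<in>box a b. ennreal (norm (u x)) \<partial>lebesgue) < \<infinity>"
proof -
  have "integrable lebesgue (\<lambda>x. indicator (cbox a b) x *\<^sub>R u x)"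
    using assms compact_cbox unfolding locally_integrable_def set_integrable_def by blast
  then have "(\<integral>\<^sup>+x. ennreal (norm (indicator (cbox a b) x *\<^sub>R u x)) \<partial>lebesgue) < \<infinity>"
    unfolding integrable_iff_bounded by blast
  then show ?thesis
    by (rule le_less_trans[rotated]) (use box_subset_cbox[of a b] in \<open>auto intro!: nn_integral_mono simp: indicator_def\<close>)
qed

context sparse_weight
begin

lemma weak_const_nonneg: "weak_const \<ge> 0"
  using maximal_bound_pos[of "CARD('n)"] q_pos s \<eta> B by (simp add: weak_const_def sparse_const_def)

text \<open>The set where \<open>w \<bar>u\<bar>\<close> exceeds \<open>y\<close> is tested against the function \<open>g\<close> that equals \<open>w\<close> times the conjugate
  phase of \<open>u\<close> on the part \<open>S\<close> of the set where the maximal function of \<open>\<bar>w h\<bar>\<^sup>p\<close> is small. As the sparse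
  domination is available for test functions only and its families depend on \<open>g\<close>, the function \<open>g\<close> is replaced by a
  test function at the cost of an error that is small uniformly over all sparse families.\<close>

lemma level_set_le:
  fixes u h :: "real ^ 'n \<Rightarrow> 'a :: {real_normed_field, euclidean_space}"
  assumes h: "h \<in> test_functions" and u: "locally_integrable u"
    and \<alpha>: "1 / p - 1 / q = \<alpha> / (real CARD('n) * \<rho>)" and \<delta>: "\<delta> > 0" "\<delta> = 1 / p\<^sub>0 - (1 / p - 1 / q) + 1 / \<rho> - 1"
    and dom: "\<And>g. g \<in> test_functions \<Longrightarrow> \<exists>S. (\<forall>j<N. sparse \<eta> (S j)) \<and>
            ennreal (norm (\<integral>x. u x * g x \<partial>lebesgue)) \<le> ennreal c * (\<Sum>j<N. \<Sum>\<^sub>\<infinity>Q\<in>S j.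
                   avg 0 p\<^sub>0 Q h * avg \<alpha> \<rho> Q g * emeasure lebesgue Q)"
    and \<Phi>: "(\<integral>\<^sup>+x. ennreal ((w x * norm (h x)) powr p) \<partial>lebesgue) \<le> ennreal \<Phi>" "\<Phi> > 0"
    and y: "y > 0" and e: "e > 0" and k: "k \<ge> 0"
    and D: "emeasure lebesgue {x \<in> box (- a) a. w x \<le> k \<and> y < w x * norm (u x)} = ennreal e"
  shows "y * e powr (1 / q) \<le> 8 * (max 0 c * real N * weak_const) * \<Phi> powr (1 / p)"
proof -
  note hm [measurable] = test_functions_measurable[OF h]
  note [measurable] = locally_integrable_measurable[OF u]
  let ?U = "box (- a) a" and ?mb = "maximal_bound CARD('n)" and ?kb = "ball_cube_ratio CARD('n)"
  let ?F = "\<lambda>x. (w x * norm (h x)) powr p"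
  have kb: "?kb > 0" by (simp add: ball_cube_ratio_pos)
  \<comment> \<open>By the weak type bound, removing this level set of the maximal function costs at most half of the measure.\<close>
  define t0 where "t0 = 2 * 5 ^ CARD('n) * \<Phi> / e"
  have t0: "t0 > 0" using \<Phi> e by (simp add: t0_def)
  define \<Omega> where "\<Omega> = superlevel (\<lambda>x. ennreal (?F x)) t0"
  have [measurable]: "\<Omega> \<in> sets lebesgue" unfolding \<Omega>_def by (rule sets_superlevel)
  define D0 where "D0 = {x \<in> ?U. w x \<le> k \<and> y < w x * norm (u x)}"
  have "{x \<in> space lebesgue. x \<in> ?U \<and> w x \<le> k \<and> y < w x * norm (u x)} \<in> sets lebesgue" by measurable
  then have [measurable]: "D0 \<in> sets lebesgue" by (simp add: D0_def)
  define S where "S = D0 - \<Omega>"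
  have S [measurable]: "S \<in> sets lebesgue" by (simp add: S_def)
  have SU: "S \<subseteq> ?U" by (auto simp: S_def D0_def)
  have eD: "emeasure lebesgue D0 = ennreal e" using D by (simp add: D0_def)
  have S_le: "emeasure lebesgue S \<le> ennreal e" unfolding eD[symmetric] by (rule emeasure_mono) (auto simp: S_def)
  then obtain eS where eS: "emeasure lebesgue S = ennreal eS" "eS \<ge> 0" by (cases "emeasure lebesgue S") (auto simp: top_unique)
  have half: "e / 2 \<le> eS"
  proof -
    have "emeasure lebesgue \<Omega> \<le> ennreal (5 ^ CARD('n) / t0) * (\<integral>\<^sup>+x. ennreal (?F x) \<partial>lebesgue)"
      unfolding \<Omega>_def by (rule superlevel_weak_type) (use t0 in auto)
    also have "\<dots> \<le> ennreal (5 ^ CARD('n) / t0) * ennreal \<Phi>" by (intro mult_left_mono \<Phi>) simp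
    also have "\<dots> = ennreal (e / 2)" using e \<Phi>(2) t0 by (simp add: ennreal_mult[symmetric] t0_def)
    finally have \<Omega>: "emeasure lebesgue \<Omega> \<le> ennreal (e / 2)" .
    have "ennreal e \<le> emeasure lebesgue (S \<union> \<Omega>)" unfolding eD[symmetric] by (rule emeasure_mono) (auto simp: S_def)
    also have "\<dots> \<le> emeasure lebesgue S + emeasure lebesgue \<Omega>" by (rule emeasure_subadditive) measurable
    also have "\<dots> \<le> ennreal eS + ennreal (e / 2)" unfolding eS(1) by (intro add_left_mono \<Omega>)
    also have "\<dots> = ennreal (eS + e / 2)" using eS e by simp
    finally show ?thesis using eS e by (subst (asm) ennreal_le_iff) auto
  qed
  define g where "g x = (if x \<in> S then (w x * norm (u x)) *\<^sub>R inverse (u x) else 0)" for x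
  have u0: "u x \<noteq> 0" "w x \<le> k" "y < w x * norm (u x)" if "x \<in> S" for x
    using that y by (auto simp: S_def D0_def)
  have gm [measurable]: "g \<in> borel_measurable lebesgue"
    unfolding g_def by measurable
  have g_norm: "norm (g x) \<le> w x * indicator S x" for x
    using w(1)[of x] u0[of x] by (auto simp: g_def norm_inverse mult.assoc)
  have g_le: "norm (g x) \<le> k * indicator S x" for x
    using g_norm[of x] u0(2)[of x] by (auto simp: indicator_def split: if_splits)
  have ug: "u x * g x = of_real (w x * norm (u x)) * indicator S x" for x
    using u0[of x] by (auto simp: g_def scaleR_conv_of_real)
  define t where "t = \<rho> * (1 + \<delta>)"
  have t: "t \<ge> 1" using \<rho>(1) \<delta>(1) mult_mono[of 1 \<rho> 1 "1 + \<delta>"] by (simp add: t_def)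
  obtain C where C: "C \<ge> 0" "\<And>\<F> E k \<tau>. major_parts \<eta> \<F> E \<Longrightarrow> k \<in> borel_measurable lebesgue \<Longrightarrow> \<tau> > 0 \<Longrightarrow>
       (\<integral>\<^sup>+x. ennreal (norm (k x :: 'a) powr t) \<partial>lebesgue) \<le> ennreal (\<tau> powr t) \<Longrightarrow> sparse_form \<F> h k \<le> C * \<tau>"
    using sparse_form_continuous[OF h \<delta>] unfolding t_def by metis
  obtain I where I: "(\<integral>\<^sup>+x\<in>?U. ennreal (norm (u x)) \<partial>lebesgue) = ennreal I" "I \<ge> 0"
    using locally_integrable_nn_integral_box[OF u, of "- a" a]
    by (cases "\<integral>\<^sup>+x\<in>?U. ennreal (norm (u x)) \<partial>lebesgue") auto
  let ?M = "weak_const * (\<Phi> powr (1 / p) * e powr (1 - 1 / q))"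
  have gfin: "(\<integral>\<^sup>+x. ennreal (norm (g x) powr \<rho>) \<partial>lebesgue) < \<infinity>"
  proof -
    have "(\<integral>\<^sup>+x. ennreal (norm (g x) powr \<rho>) \<partial>lebesgue) \<le> (\<integral>\<^sup>+x. ennreal (k powr \<rho>) * indicator S x \<partial>lebesgue)"
    proof (intro nn_integral_mono)
      fix x show "ennreal (norm (g x) powr \<rho>) \<le> ennreal (k powr \<rho>) * indicator S x"
        using g_le[of x] q_pos by (cases "x \<in> S") (auto intro!: ennreal_leI powr_mono2)
    qed
    also have "\<dots> = ennreal (k powr \<rho>) * ennreal eS" unfolding eS(1)[symmetric] by (rule nn_integral_cmult_indicator) measurable
    finally show ?thesis by (simp add: le_less_trans ennreal_mult_less_top)
  qed
  have main: "sparse_form \<F> h g \<le> ?M" if \<F>: "major_parts \<eta> \<F> E" for \<F> E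
  proof (rule sparse_family_bound[OF hm S \<F> \<Phi> S_le e g_norm])
    fix Q assume Q: "Q \<in> \<F>" "Q \<inter> S \<noteq> {}"
    have Qc: "Q \<in> cubes" using \<F> Q by (auto simp: major_parts_def)
    show "mean ?F Q \<le> 2 * ?mb * \<Phi> / e"
    proof (rule ccontr)
      assume "\<not> ?thesis"
      then have gt: "mean ?F Q > ?kb * t0" by (simp add: maximal_bound_def t0_def ac_simps)
      have "Q \<subseteq> superlevel (\<lambda>x. ennreal (?F x)) (?kb * t0 / ?kb)"
        using kb t0 by (intro mean_gt_imp_subset_superlevel[OF Qc _ gt]) simp
      then have "Q \<subseteq> \<Omega>" using kb by (simp add: \<Omega>_def)
      then show False using Q(2) by (auto simp: S_def)
    qed
  qed
  have approx: "y * eS \<le> max 0 c * real N * (4 * ?M) + 3 * \<xi>" if \<xi>: "\<xi> > 0" for \<xi>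
  proof -
    \<comment> \<open>First \<open>\<omega>\<close>, then \<open>\<tau>\<close>: the error is \<open>\<omega> I + \<omega>\<^sup>1\<^sup>-\<^sup>t \<tau>\<^sup>t\<close> in the pairing and a multiple of \<open>\<tau>\<close> in
      the form.\<close>
    define \<omega> where "\<omega> = \<xi> / (I + 1)"
    have \<omega>: "\<omega> > 0" "\<omega> * I \<le> \<xi>" using \<xi> I(2) by (auto simp: \<omega>_def field_simps)
    define K where "K = max 0 c * real N * (4 * C) + 1"
    have K: "K > 0" "max 0 c * real N * (4 * C) \<le> K" using C(1) by (auto simp: K_def add_nonneg_pos)
    define \<tau> where "\<tau> = min (\<xi> / K) ((\<xi> * \<omega> powr (t - 1)) powr (1 / t))"
    have \<tau>: "\<tau> > 0" using \<xi> K \<omega> by (simp add: \<tau>_def)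
    have \<tau>1: "max 0 c * real N * (4 * C) * \<tau> \<le> \<xi>"
    proof -
      have "max 0 c * real N * (4 * C) * \<tau> \<le> K * \<tau>" using K \<tau> by (intro mult_right_mono) auto
      also have "\<dots> \<le> K * (\<xi> / K)" using K by (intro mult_left_mono) (auto simp: \<tau>_def)
      finally show ?thesis using K by simp
    qed
    have \<tau>2: "\<omega> powr (1 - t) * \<tau> powr t \<le> \<xi>"
    proof -
      have "\<tau> powr t \<le> ((\<xi> * \<omega> powr (t - 1)) powr (1 / t)) powr t" using \<tau> t by (intro powr_mono2) (auto simp: \<tau>_def)
      also have "\<dots> = \<xi> * \<omega> powr (t - 1)" using \<xi> t by (simp add: powr_powr)
      finally have "\<omega> powr (1 - t) * \<tau> powr t \<le> \<omega> powr (1 - t) * (\<xi> * \<omega> powr (t - 1))" by (intro mult_left_mono) auto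
      also have "\<dots> = \<xi> * (\<omega> powr (1 - t) * \<omega> powr (t - 1))" by simp
      also have "\<dots> = \<xi>" using \<omega> by (simp flip: powr_add)
      finally show ?thesis .
    qed
    \<comment> \<open>The density \<open>1 + \<bar>u\<bar>\<close> controls both errors at the same time.\<close>
    have Wfin: "(\<integral>\<^sup>+x\<in>?U. ennreal (1 + norm (u x)) \<partial>lebesgue) < \<infinity>"
    proof -
      have "(\<integral>\<^sup>+x\<in>?U. ennreal (1 + norm (u x)) \<partial>lebesgue) = (\<integral>\<^sup>+x. indicator ?U x + ennreal (norm (u x)) * indicator ?U x \<partial>lebesgue)"
        by (intro nn_integral_cong) (auto simp: indicator_def)
      also have "\<dots> = emeasure lebesgue ?U + ennreal I" unfolding I(1)[symmetric] by (subst nn_integral_add) auto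
      finally show ?thesis using emeasure_lborel_box_finite[of "- a" a] by simp
    qed
    have gW: "(\<integral>\<^sup>+x\<in>?U. ennreal (norm (g x) powr t) * ennreal (1 + norm (u x)) \<partial>lebesgue) < \<infinity>"
    proof -
      have "(\<integral>\<^sup>+x\<in>?U. ennreal (norm (g x) powr t) * ennreal (1 + norm (u x)) \<partial>lebesgue)
         \<le> (\<integral>\<^sup>+x. ennreal (k powr t) * (ennreal (1 + norm (u x)) * indicator ?U x) \<partial>lebesgue)"
      proof (intro nn_integral_mono)
        fix x
        have "norm (g x) \<le> k" using g_le[of x] k by (cases "x \<in> S") auto
        then have "norm (g x) powr t \<le> k powr t" using t by (intro powr_mono2) auto
        then have "ennreal (norm (g x) powr t) * (ennreal (1 + norm (u x)) * indicator ?U x) \<le> ennreal (k powr t) * (ennreal (1 + norm (u x)) * indicator ?U x)"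
          by (intro mult_right_mono ennreal_leI) auto
        then show "ennreal (norm (g x) powr t) * ennreal (1 + norm (u x)) * indicator ?U x \<le> ennreal (k powr t) * (ennreal (1 + norm (u x)) * indicator ?U x)"
          by (simp only: mult.assoc)
      qed
      also have "\<dots> = ennreal (k powr t) * (\<integral>\<^sup>+x\<in>?U. ennreal (1 + norm (u x)) \<partial>lebesgue)"
        by (rule nn_integral_cmult) measurable
      also have "\<dots> < \<infinity>" using Wfin by (simp add: ennreal_mult_less_top)
      finally show ?thesis .
    qed
    have tp: "t > 0" "\<tau> powr t > 0" using t \<tau> by auto
    have Wm: "(\<lambda>x. 1 + norm (u x)) \<in> borel_measurable lebesgue" by measurable
    obtain g' where g': "g' \<in> test_functions" "\<And>x. x \<notin> ?U \<Longrightarrow> g' x = 0"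
      "(\<integral>\<^sup>+x\<in>?U. ennreal (norm (g x - g' x) powr t) * ennreal (1 + norm (u x)) \<partial>lebesgue) \<le> ennreal (\<tau> powr t)"
      by (rule test_functions_dense_box[OF gm Wm tp(1) Wfin gW tp(2)]) (assumption | rule that)+
    note [measurable] = test_functions_measurable[OF g'(1)]
    define d where "d x = g' x - g x" for x
    have [measurable]: "d \<in> borel_measurable lebesgue" unfolding d_def by measurable
    have dU: "d x = 0" if "x \<notin> ?U" for x using that g'(2) SU by (auto simp: d_def g_def)
    have dW: "(\<integral>\<^sup>+x\<in>?U. ennreal (norm (d x) powr t) * ennreal (1 + norm (u x)) \<partial>lebesgue) \<le> ennreal (\<tau> powr t)"
      using g'(3) unfolding d_def by (simp only: norm_minus_commute)
    have dt: "(\<integral>\<^sup>+x. ennreal (norm (d x) powr t) \<partial>lebesgue) \<le> ennreal (\<tau> powr t)"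
    proof (rule order_trans[OF _ dW], intro nn_integral_mono)
      fix x
      have "norm (d x) powr t \<le> norm (d x) powr t * (1 + norm (u x))" by (simp add: algebra_simps)
      then show "ennreal (norm (d x) powr t) \<le> ennreal (norm (d x) powr t) * ennreal (1 + norm (u x)) * indicator ?U x"
        using dU[of x] by (cases "x \<in> ?U") (auto simp: ennreal_mult[symmetric] intro: ennreal_leI simp del: ennreal_plus)
    qed
    have ud: "(\<integral>\<^sup>+x. ennreal (norm (u x * d x)) \<partial>lebesgue) \<le> ennreal (2 * \<xi>)"
    proof -
      have "(\<integral>\<^sup>+x. ennreal (norm (u x * d x)) \<partial>lebesgue) \<le> (\<integral>\<^sup>+x. ennreal \<omega> * (ennreal (norm (u x)) * indicator ?U x)
          + ennreal (\<omega> powr (1 - t)) * (ennreal (norm (d x) powr t) * ennreal (1 + norm (u x)) * indicator ?U x) \<partial>lebesgue)"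
      proof (intro nn_integral_mono)
        fix x
        have "norm (u x * d x) \<le> norm (u x) * (\<omega> + \<omega> powr (1 - t) * norm (d x) powr t)"
          unfolding norm_mult using \<omega> t by (intro mult_left_mono le_add_powr_split) auto
        also have "\<dots> \<le> \<omega> * norm (u x) + \<omega> powr (1 - t) * (norm (d x) powr t * (1 + norm (u x)))"
          by (simp add: algebra_simps)
        finally show "ennreal (norm (u x * d x)) \<le> ennreal \<omega> * (ennreal (norm (u x)) * indicator ?U x)
          + ennreal (\<omega> powr (1 - t)) * (ennreal (norm (d x) powr t) * ennreal (1 + norm (u x)) * indicator ?U x)"
          using \<omega> dU[of x]
          by (cases "x \<in> ?U") (auto simp: ennreal_mult[symmetric] ennreal_plus[symmetric] intro!: ennreal_leI simp del: ennreal_plus)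
      qed
      also have "\<dots> = ennreal \<omega> * ennreal I + ennreal (\<omega> powr (1 - t)) * (\<integral>\<^sup>+x\<in>?U. ennreal (norm (d x) powr t) * ennreal (1 + norm (u x)) \<partial>lebesgue)"
        unfolding I(1)[symmetric] by (simp add: nn_integral_add nn_integral_cmult)
      also have "\<dots> \<le> ennreal \<omega> * ennreal I + ennreal (\<omega> powr (1 - t)) * ennreal (\<tau> powr t)"
        by (intro add_left_mono mult_left_mono dW) simp
      also have "\<dots> = ennreal (\<omega> * I + \<omega> powr (1 - t) * \<tau> powr t)"
        using \<omega> I(2) by (simp add: ennreal_mult[symmetric] ennreal_plus[symmetric] del: ennreal_plus)
      also have "\<dots> \<le> ennreal (2 * \<xi>)" using \<omega>(2) \<tau>2 by (intro ennreal_leI) simp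
      finally show ?thesis .
    qed
    have formle: "sparse_form \<F> h g' \<le> 4 * (?M + C * \<tau>)" if \<F>: "major_parts \<eta> \<F> E" for \<F> E
    proof -
      have dfin: "(\<integral>\<^sup>+x. ennreal (norm (d x) powr \<rho>) \<partial>lebesgue) < \<infinity>"
      proof -
        have "(\<integral>\<^sup>+x. ennreal (norm (g' x + - g x) powr \<rho>) \<partial>lebesgue) \<le> ennreal (2 powr \<rho>) * ((\<integral>\<^sup>+x. ennreal (norm (g' x) powr \<rho>) \<partial>lebesgue) + (\<integral>\<^sup>+x. ennreal (norm (- g x) powr \<rho>) \<partial>lebesgue))"
          by (rule nn_integral_powr_norm_add_le[OF _ _ q_pos(5)]) measurable
        also have "\<dots> < \<infinity>" using nn_integral_test_function[OF g'(1) q_pos(5)] gfin by (simp add: ennreal_mult_less_top)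
        finally show ?thesis by (simp add: d_def)
      qed
      have "sparse_form \<F> h (\<lambda>x. g x + d x) \<le> 4 * (sparse_form \<F> h g + sparse_form \<F> h d)"
        using \<F> gfin dfin by (intro sparse_form_add_le) (auto simp: major_parts_def)
      also have "\<dots> \<le> 4 * (?M + C * \<tau>)" by (intro mult_left_mono add_mono main[OF \<F>] C(2)[OF \<F> _ \<tau> dt]) auto
      finally show ?thesis by (simp add: d_def)
    qed
    have int_g': "norm (\<integral>x. u x * g' x \<partial>lebesgue) \<le> max 0 c * real N * (4 * (?M + C * \<tau>))"
    proof -
      obtain S' where S': "\<And>j. j < N \<Longrightarrow> sparse \<eta> (S' j)" "ennreal (norm (\<integral>x. u x * g' x \<partial>lebesgue)) \<le> ennreal c * (\<Sum>j<N. \<Sum>\<^sub>\<infinity>Q\<in>S' j.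
                   avg 0 p\<^sub>0 Q h * avg \<alpha> \<rho> Q g' * emeasure lebesgue Q)"
        using dom[OF g'(1)] by blast
      have M0: "?M + C * \<tau> \<ge> 0"
        using weak_const_nonneg C(1) \<tau> by simp
      have "(\<Sum>\<^sub>\<infinity>Q\<in>S' j. avg 0 p\<^sub>0 Q h * avg \<alpha> \<rho> Q g' * emeasure lebesgue Q) \<le> ennreal (4 * (?M + C * \<tau>))" if j: "j < N" for j
      proof (rule ennreal_infsum_le)
        fix \<F> assume \<F>: "finite \<F>" "\<F> \<subseteq> S' j"
        obtain E where E: "disjoint_family_on E (S' j)" "\<forall>Q\<in>S' j. E Q \<in> sets lebesgue \<and> E Q \<subseteq> Q \<and>
                 emeasure lebesgue (E Q) \<ge> ennreal \<eta> * emeasure lebesgue Q"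
          using S'(1)[OF j] unfolding sparse_def by blast
        have "S' j \<subseteq> cubes" using S'(1)[OF j] unfolding sparse_def dyadic_grid_def cubes_def by blast
        then have \<F>m: "major_parts \<eta> \<F> E"
          using \<F> E disjoint_family_on_mono[OF \<F>(2) E(1)] unfolding major_parts_def by blast
        have "(\<Sum>Q\<in>\<F>. avg 0 p\<^sub>0 Q h * avg \<alpha> \<rho> Q g' * emeasure lebesgue Q) = ennreal (sparse_form \<F> h g')"
          using \<F>(1) \<F>m by (intro sum_avg_eq_sparse_form[OF _ _ h g'(1) \<alpha>]) (auto simp: major_parts_def)
        also have "\<dots> \<le> ennreal (4 * (?M + C * \<tau>))" by (intro ennreal_leI formle[OF \<F>m])
        finally show "(\<Sum>Q\<in>\<F>. avg 0 p\<^sub>0 Q h * avg \<alpha> \<rho> Q g' * emeasure lebesgue Q) \<le> \<dots>" .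
      qed
      then have "(\<Sum>j<N. \<Sum>\<^sub>\<infinity>Q\<in>S' j. avg 0 p\<^sub>0 Q h * avg \<alpha> \<rho> Q g' * emeasure lebesgue Q) \<le> (\<Sum>j<N. ennreal (4 * (?M + C * \<tau>)))"
        by (intro sum_mono) simp
      also have "\<dots> = ennreal (real N * (4 * (?M + C * \<tau>)))" using M0 by (simp add: ennreal_of_nat_eq_real_of_nat ennreal_mult)
      finally have "ennreal (norm (\<integral>x. u x * g' x \<partial>lebesgue)) \<le> ennreal c * ennreal (real N * (4 * (?M + C * \<tau>)))"
        using S'(2) by (meson mult_left_mono order_trans zero_le)
      also have "ennreal c = ennreal (max 0 c)" by (cases "c \<ge> 0") (auto simp: ennreal_neg max_def)
      also have "ennreal (max 0 c) * ennreal (real N * (4 * (?M + C * \<tau>))) = ennreal (max 0 c * real N * (4 * (?M + C * \<tau>)))"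
        using M0 by (simp add: ennreal_mult[symmetric] mult.assoc)
      finally show ?thesis using M0 by (subst (asm) ennreal_le_iff) auto
    qed
    have ig: "integrable lebesgue (\<lambda>x. u x * g x)"
    proof (rule integrableI_bounded)
      have "(\<integral>\<^sup>+x. ennreal (norm (u x * g x)) \<partial>lebesgue) \<le> (\<integral>\<^sup>+x. ennreal k * (ennreal (norm (u x)) * indicator ?U x) \<partial>lebesgue)"
      proof (intro nn_integral_mono)
        fix x
        have "norm (u x * g x) \<le> norm (u x) * (k * indicator S x)"
          unfolding norm_mult by (intro mult_left_mono g_le) simp
        then show "ennreal (norm (u x * g x)) \<le> ennreal k * (ennreal (norm (u x)) * indicator ?U x)"
          using SU k by (cases "x \<in> S") (auto simp: ennreal_mult[symmetric] mult.commute intro: ennreal_leI)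
      qed
      also have "\<dots> = ennreal k * ennreal I" unfolding I(1)[symmetric] by (rule nn_integral_cmult) measurable
      finally show "(\<integral>\<^sup>+x. ennreal (norm (u x * g x)) \<partial>lebesgue) < \<infinity>" by (simp add: le_less_trans ennreal_mult_less_top)
    qed measurable
    have id: "integrable lebesgue (\<lambda>x. u x * d x)"
      by (rule integrableI_bounded) (use ud in \<open>auto intro: le_less_trans\<close>)
    have "(\<integral>x. u x * g' x \<partial>lebesgue) = (\<integral>x. u x * g x + u x * d x \<partial>lebesgue)"
      by (simp add: d_def algebra_simps)
    also have "\<dots> = (\<integral>x. u x * g x \<partial>lebesgue) + (\<integral>x. u x * d x \<partial>lebesgue)" by (rule Bochner_Integration.integral_add[OF ig id])
    finally have split: "(\<integral>x. u x * g' x \<partial>lebesgue) = (\<integral>x. u x * g x \<partial>lebesgue) + (\<integral>x. u x * d x \<partial>lebesgue)" .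
    have "norm (\<integral>x. u x * g x \<partial>lebesgue) = norm ((\<integral>x. u x * g' x \<partial>lebesgue) - (\<integral>x. u x * d x \<partial>lebesgue))"
      by (simp only: split add_diff_cancel_right')
    also have "\<dots> \<le> norm (\<integral>x. u x * g' x \<partial>lebesgue) + norm (\<integral>x. u x * d x \<partial>lebesgue)"
      by (rule norm_triangle_ineq4)
    also have "norm (\<integral>x. u x * d x \<partial>lebesgue) \<le> 2 * \<xi>"
    proof -
      have "ennreal (norm (\<integral>x. u x * d x \<partial>lebesgue)) \<le> ennreal (2 * \<xi>)"
        by (rule order_trans[OF integral_norm_bound_ennreal[OF id] ud])
      then show ?thesis using \<xi> by simp
    qed
    also have "norm (\<integral>x. u x * g' x \<partial>lebesgue) + 2 * \<xi> \<le> max 0 c * real N * (4 * ?M) + max 0 c * real N * (4 * C) * \<tau> + 2 * \<xi>"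
      using int_g' by (simp add: algebra_simps)
    also have "\<dots> \<le> max 0 c * real N * (4 * ?M) + 3 * \<xi>" using \<tau>1 by simp
    finally have le: "norm (\<integral>x. u x * g x \<partial>lebesgue) \<le> max 0 c * real N * (4 * ?M) + 3 * \<xi>" by simp
    have "y * eS \<le> norm (\<integral>x. u x * g x \<partial>lebesgue)"
    proof -
      define \<phi> where "\<phi> x = norm (u x * g x)" for x
      have \<phi>: "\<phi> x = w x * norm (u x) * indicator S x" for x
        using w(1)[of x] by (auto simp: \<phi>_def ug indicator_def norm_mult)
      have i\<phi>: "integrable lebesgue \<phi>" unfolding \<phi>_def by (rule integrable_norm[OF ig])
      have "(\<integral>x. u x * g x \<partial>lebesgue) = (\<integral>x. of_real (\<phi> x) \<partial>lebesgue)"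
        by (intro Bochner_Integration.integral_cong) (auto simp: \<phi> ug indicator_def)
      also have "\<dots> = of_real (\<integral>x. \<phi> x \<partial>lebesgue)" by (rule integral_bounded_linear[OF bounded_linear_of_real i\<phi>])
      finally have eq: "norm (\<integral>x. u x * g x \<partial>lebesgue) = (\<integral>x. \<phi> x \<partial>lebesgue)"
        by (simp add: \<phi>_def integral_nonneg_AE)
      have "ennreal (y * eS) = (\<integral>\<^sup>+x. ennreal y * indicator S x \<partial>lebesgue)"
        using y eS(2) unfolding nn_integral_cmult_indicator[OF S] eS(1) by (simp add: ennreal_mult)
      also have "\<dots> \<le> (\<integral>\<^sup>+x. ennreal (\<phi> x) \<partial>lebesgue)"
      proof (intro nn_integral_mono)
        fix x show "ennreal y * indicator S x \<le> ennreal (\<phi> x)"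
          using u0(3)[of x] by (cases "x \<in> S") (auto simp: \<phi> intro!: ennreal_leI)
      qed
      also have "\<dots> = ennreal (\<integral>x. \<phi> x \<partial>lebesgue)"
        by (rule nn_integral_eq_integral[OF i\<phi>]) (simp add: \<phi>_def)
      finally show ?thesis unfolding eq by (subst (asm) ennreal_le_iff) (auto simp: \<phi>_def integral_nonneg_AE)
    qed
    with le show ?thesis by simp
  qed
  have "y * eS \<le> max 0 c * real N * (4 * ?M)"
  proof (rule field_le_epsilon)
    fix \<xi> :: real assume "\<xi> > 0"
    then show "y * eS \<le> max 0 c * real N * (4 * ?M) + \<xi>" using approx[of "\<xi> / 3"] by simp
  qed
  moreover have "y * (e / 2) \<le> y * eS" using half y by (intro mult_left_mono) auto
  ultimately have "y * e \<le> 8 * (max 0 c * real N * weak_const) * \<Phi> powr (1 / p) * e powr (1 - 1 / q)" by simp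
  moreover have "y * e = y * e powr (1 / q) * e powr (1 - 1 / q)" using e by (simp add: powr_add[symmetric])
  ultimately show ?thesis using e by simp
qed

end

lemma weak_norm_leI:
  assumes "q > 0" "b \<ge> 0" "\<And>y. y > 0 \<Longrightarrow> emeasure lebesgue {x. norm (f x) > y} \<le> ennreal ((b / y) powr q)"
  shows "weak_norm q f \<le> ennreal b"
  unfolding weak_norm_def
proof (rule SUP_least)
  fix y :: real assume "y \<in> {0<..}"
  then have y: "y > 0" by simp
  have "ennreal y * epowr (emeasure lebesgue {x. norm (f x) > y}) (1 / q) \<le> ennreal y * ennreal (b / y)"
    using assms y by (intro mult_left_mono epowr_le) auto
  also have "\<dots> = ennreal b" using y assms by (simp add: ennreal_mult[symmetric])
  finally show "ennreal y * epowr (emeasure lebesgue {x. norm (f x) > y}) (1 / q) \<le> ennreal b" .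
qed

lemma weak_norm_leD:
  assumes "weak_norm q f \<le> ennreal b" "q > 0" "b \<ge> 0" "y > 0"
  shows "emeasure lebesgue {x. norm (f x) > y} \<le> ennreal ((b / y) powr q)"
proof -
  have "ennreal y * epowr (emeasure lebesgue {x. norm (f x) > y}) (1 / q) \<le> ennreal b"
    using assms(1) assms(4) unfolding weak_norm_def by (meson SUP_le_iff greaterThan_iff order_trans)
  then have "ennreal (1 / y) * (ennreal y * epowr (emeasure lebesgue {x. norm (f x) > y}) (1 / q)) \<le> ennreal (1 / y) * ennreal b"
    by (rule mult_left_mono) simp
  also have "ennreal (1 / y) * (ennreal y * epowr (emeasure lebesgue {x. norm (f x) > y}) (1 / q)) = epowr (emeasure lebesgue {x. norm (f x) > y}) (1 / q)"
    using assms(4) by (simp add: mult.assoc[symmetric] ennreal_mult[symmetric])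
  also have "ennreal (1 / y) * ennreal b = ennreal (b / y)" using assms by (simp add: ennreal_mult[symmetric])
  finally show ?thesis using assms by (intro epowr_le_imp_le) auto
qed

lemma Lp_norm_le_iff:
  assumes "p > 0" "b \<ge> 0"
  shows "Lp_norm p f \<le> ennreal b \<longleftrightarrow> (\<integral>\<^sup>+x. ennreal (norm (f x) powr p) \<partial>lebesgue) \<le> ennreal (b powr p)"
  unfolding Lp_norm_def using epowr_le_imp_le epowr_le assms by blast

context sparse_weight
begin

lemma nn_integral_weight_finite: "(\<integral>\<^sup>+x\<in>box a b. ennreal (w x powr p) \<partial>lebesgue) < \<infinity>"
proof -
  obtain m where m: "m > 0" "\<And>x. x \<in> box a b \<Longrightarrow> norm x \<le> m" using bounded_box[of a b] unfolding bounded_pos by blast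
  define Q where "Q = {x :: real ^ 'n. \<forall>i. x $ i \<in> {- m..m}}"
  have sub: "x \<in> Q" if "x \<in> box a b" for x
  proof -
    have "\<bar>x $ i\<bar> \<le> m" for i using m(2)[OF that] component_le_norm_cart[of x i] by linarith
    then show ?thesis by (simp add: Q_def abs_le_iff minus_le_iff)
  qed
  have Q: "Q \<in> cubes"
    unfolding cubes_def cube_def Q_def using m(1)
    by (intro CollectI exI[of _ "2 * m"] conjI exI[of _ "\<chi> i. - m"] exI[of _ "\<lambda>i. {- m..m}"]) auto
  have [measurable]: "Q \<in> sets lebesgue" by (rule cubes_measure(2)[OF Q])
  have "(\<integral>\<^sup>+x\<in>box a b. ennreal (w x powr p) \<partial>lebesgue) \<le> (\<integral>\<^sup>+x. indicator Q x + ennreal (w x powr q) * indicator Q x \<partial>lebesgue)"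
  proof (intro nn_integral_mono)
    fix x
    have "w x powr p \<le> 1 + w x powr q"
    proof (cases "w x \<le> 1")
      case True
      then have "w x powr p \<le> 1 powr p" using w(1) q_pos by (intro powr_mono2) auto
      then show ?thesis by (simp add: add_increasing2)
    next
      case False
      then have "w x powr p \<le> w x powr q" using p by (intro powr_mono) auto
      then show ?thesis by simp
    qed
    then have "ennreal (w x powr p) \<le> 1 + ennreal (w x powr q)"
      by (metis ennreal_leI ennreal_plus ennreal_1 powr_ge_zero zero_le_one)
    then show "ennreal (w x powr p) * indicator (box a b) x \<le> indicator Q x + ennreal (w x powr q) * indicator Q x"
      using sub[of x] by (cases "x \<in> box a b") auto
  qed
  also have "\<dots> = emeasure lebesgue Q + (\<integral>\<^sup>+x\<in>Q. ennreal (w x powr q) \<partial>lebesgue)"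
    by (subst nn_integral_add) auto
  also have "\<dots> < \<infinity>" using fin[OF Q] cubes_measure(4)[OF Q] by (simp del: emeasure_completion)
  finally show ?thesis .
qed

text \<open>Exhaust the level set by bounded pieces of finite measure on which \<open>w\<close> is bounded, and let
  \<open>\<Phi>\<close> decrease to the integral of \<open>\<bar>w h\<bar>\<^sup>p\<close>.\<close>

theorem weak_type_test_functions:
  fixes u h :: "real ^ 'n \<Rightarrow> 'a :: {real_normed_field, euclidean_space}"
  assumes h: "h \<in> test_functions" and u: "locally_integrable u"
    and \<alpha>: "1 / p - 1 / q = \<alpha> / (real CARD('n) * \<rho>)" and \<delta>: "\<delta> > 0" "\<delta> = 1 / p\<^sub>0 - (1 / p - 1 / q) + 1 / \<rho> - 1"
    and dom: "\<And>g. g \<in> test_functions \<Longrightarrow> \<exists>S. (\<forall>j<N. sparse \<eta> (S j)) \<and>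
            ennreal (norm (\<integral>x. u x * g x \<partial>lebesgue)) \<le> ennreal c * (\<Sum>j<N. \<Sum>\<^sub>\<infinity>Q\<in>S j.
                   avg 0 p\<^sub>0 Q h * avg \<alpha> \<rho> Q g * emeasure lebesgue Q)"
  shows "weak_norm q (\<lambda>x. w x *\<^sub>R u x) \<le> ennreal (8 * (max 0 c * real N * weak_const)) * Lp_norm p (\<lambda>x. w x *\<^sub>R h x)"
proof -
  note [measurable] = test_functions_measurable[OF h] locally_integrable_measurable[OF u]
  define K where "K = 8 * (max 0 c * real N * weak_const)"
  have K: "K \<ge> 0" using weak_const_nonneg by (simp add: K_def)
  have nw: "norm (w x *\<^sub>R (z :: 'a)) = w x * norm z" for x z using w(1)[of x] by simp
  obtain C where C: "C > 0" "\<And>x. norm (h x) \<le> C" using test_functions_norm_bounded[OF h] by blast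
  obtain a0 b0 where ab: "\<And>x. x \<notin> box a0 b0 \<Longrightarrow> h x = 0" using test_functions_support[OF h] by blast
  have "(\<integral>\<^sup>+x. ennreal ((w x * norm (h x)) powr p) \<partial>lebesgue) \<le> (\<integral>\<^sup>+x. ennreal (C powr p) * (ennreal (w x powr p) * indicator (box a0 b0) x) \<partial>lebesgue)"
  proof (intro nn_integral_mono)
    fix x
    show "ennreal ((w x * norm (h x)) powr p) \<le> ennreal (C powr p) * (ennreal (w x powr p) * indicator (box a0 b0) x)"
    proof (cases "x \<in> box a0 b0")
      case True
      have "(w x * norm (h x)) powr p \<le> (C * w x) powr p"
        using C(1) C(2)[of x] w(1)[of x] q_pos mult_mono[of "norm (h x)" C "w x" "w x"] by (intro powr_mono2) (auto simp: mult.commute)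
      also have "\<dots> = C powr p * w x powr p" using C(1) w(1)[of x] by (simp add: powr_mult)
      finally show ?thesis using True by (simp add: ennreal_mult[symmetric] ennreal_leI)
    qed (simp add: ab)
  qed
  also have "\<dots> = ennreal (C powr p) * (\<integral>\<^sup>+x\<in>box a0 b0. ennreal (w x powr p) \<partial>lebesgue)"
    by (rule nn_integral_cmult) measurable
  also have "\<dots> < \<infinity>" using nn_integral_weight_finite[of a0 b0] by (simp add: ennreal_mult_less_top)
  finally obtain I where I: "(\<integral>\<^sup>+x. ennreal ((w x * norm (h x)) powr p) \<partial>lebesgue) = ennreal I" "I \<ge> 0"
    by (cases "\<integral>\<^sup>+x. ennreal ((w x * norm (h x)) powr p) \<partial>lebesgue") auto
  have le: "weak_norm q (\<lambda>x. w x *\<^sub>R u x) \<le> ennreal (K * \<Phi> powr (1 / p))" if \<Phi>: "\<Phi> > I" for \<Phi>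
  proof (rule weak_norm_leI[OF q_pos(2)])
    show "K * \<Phi> powr (1 / p) \<ge> 0" using K by simp
    fix y :: real assume y: "y > 0"
    define U :: "nat \<Rightarrow> (real ^ 'n) set" where "U m = box (- (\<chi> i. real m)) (\<chi> i. real m)" for m
    define G where "G m = {x \<in> U m. w x \<le> real m \<and> y < w x * norm (u x)}" for m
    have "{x \<in> space lebesgue. x \<in> U m \<and> w x \<le> real m \<and> y < w x * norm (u x)} \<in> sets lebesgue" for m
      unfolding U_def by measurable
    then have [measurable]: "G m \<in> sets lebesgue" for m by (simp add: G_def)
    have inc: "incseq G"
      unfolding incseq_def G_def U_def
      by (auto simp: mem_box_cart) (meson le_less_trans less_le_trans neg_le_iff_le of_nat_mono order_trans)+
    have "{x. norm (w x *\<^sub>R u x) > y} = (\<Union>m. G m)"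
    proof (intro equalityI subsetI)
      fix x assume x: "x \<in> {x. norm (w x *\<^sub>R u x) > y}"
      obtain m where m: "max (norm x + 1) (w x) \<le> real m" using real_arch_simple by blast
      have "\<bar>x $ i\<bar> < real m" for i using component_le_norm_cart[of x i] m by linarith
      then have "x \<in> U m" unfolding U_def mem_box_cart by (auto simp: abs_less_iff minus_less_iff)
      then have "x \<in> G m" using x m unfolding nw by (auto simp: G_def)
      then show "x \<in> (\<Union>m. G m)" by blast
    qed (auto simp: G_def nw simp del: norm_scaleR)
    then have "emeasure lebesgue {x. norm (w x *\<^sub>R u x) > y} = (SUP m. emeasure lebesgue (G m))"
      using SUP_emeasure_incseq[OF _ inc, of lebesgue] by (simp add: image_subset_iff del: emeasure_completion)
    also have "\<dots> \<le> ennreal ((K * \<Phi> powr (1 / p) / y) powr q)"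
    proof (rule SUP_least)
      fix m
      have "emeasure lebesgue (G m) \<le> emeasure lebesgue (U m)" by (intro emeasure_mono) (auto simp: G_def U_def)
      also have "\<dots> < \<infinity>" unfolding U_def using emeasure_lborel_box_finite by simp
      finally obtain e where e: "emeasure lebesgue (G m) = ennreal e" "e \<ge> 0" by (cases "emeasure lebesgue (G m)") auto
      show "emeasure lebesgue (G m) \<le> ennreal ((K * \<Phi> powr (1 / p) / y) powr q)"
      proof (cases "e = 0")
        case False
        then have e0: "e > 0" using e by simp
        have \<Phi>': "(\<integral>\<^sup>+x. ennreal ((w x * norm (h x)) powr p) \<partial>lebesgue) \<le> ennreal \<Phi>" "\<Phi> > 0"
          unfolding I(1) using \<Phi> I(2) by (auto intro: ennreal_leI)
        have "y * e powr (1 / q) \<le> K * \<Phi> powr (1 / p)"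
          unfolding K_def
          by (rule level_set_le[OF h u \<alpha> \<delta> dom \<Phi>' y e0, of "real m" "\<chi> i. real m"]) (use e in \<open>auto simp: G_def U_def\<close>)
        then have "e powr (1 / q) \<le> K * \<Phi> powr (1 / p) / y" using y by (simp add: field_simps)
        then have "(e powr (1 / q)) powr q \<le> (K * \<Phi> powr (1 / p) / y) powr q" using q_pos by (intro powr_mono2) auto
        then show ?thesis unfolding e(1) using e0 q_pos by (simp add: powr_powr ennreal_leI)
      qed (simp add: e(1) del: emeasure_completion)
    qed
    finally show "emeasure lebesgue {x. norm (w x *\<^sub>R u x) > y} \<le> ennreal ((K * \<Phi> powr (1 / p) / y) powr q)" .
  qed
  have "(\<lambda>m. I + inverse (real (Suc m))) \<longlonglongrightarrow> I" using tendsto_add[OF tendsto_const LIMSEQ_inverse_real_of_nat, of I] by simp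
  then have "(\<lambda>m. ennreal (K * (I + inverse (real (Suc m))) powr (1 / p))) \<longlonglongrightarrow> ennreal (K * I powr (1 / p))"
    using I(2) q_pos by (intro tendsto_ennrealI tendsto_mult tendsto_const tendsto_powr2) auto
  moreover have "weak_norm q (\<lambda>x. w x *\<^sub>R u x) \<le> ennreal (K * (I + inverse (real (Suc m))) powr (1 / p))" for m
    by (rule le) simp
  ultimately have "weak_norm q (\<lambda>x. w x *\<^sub>R u x) \<le> ennreal (K * I powr (1 / p))"
    by (intro LIMSEQ_le_const) auto
  also have "\<dots> = ennreal K * Lp_norm p (\<lambda>x. w x *\<^sub>R h x)"
    unfolding Lp_norm_def nw I(1) using I(2) q_pos K by (simp add: epowr_pos ennreal_mult)
  finally show ?thesis by (simp only: K_def)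
qed

end

section \<open>Extension by density\<close>

lemma powr_add_le:
  fixes x y a :: real
  assumes "x \<ge> 0" "y \<ge> 0" "0 < a" "a \<le> 1"
  shows "(x + y) powr a \<le> 2 * (x powr a + y powr a)"
proof -
  have "(x + y) powr a \<le> (2 * max x y) powr a" using assms by (intro powr_mono2) auto
  also have "\<dots> = 2 powr a * max x y powr a" by (simp add: powr_mult)
  also have "\<dots> \<le> 2 powr 1 * (x powr a + y powr a)"
    using assms by (intro mult_mono powr_mono) (auto simp: max_def)
  finally show ?thesis by simp
qed

lemma epowr_add_le:
  assumes "0 < a" "a \<le> 1"
  shows "epowr (x + y) a \<le> 2 * (epowr x a + epowr y a)"
proof (cases "x = top \<or> y = top")
  case True
  then show ?thesis using assms by (auto simp: ennreal_mult_top)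
next
  case False
  then obtain x' y' where "x = ennreal x'" "x' \<ge> 0" "y = ennreal y'" "y' \<ge> 0" by (cases x; cases y) auto
  then show ?thesis
    using powr_add_le[of x' y' a] assms
    by (simp add: ennreal_plus[symmetric] epowr_pos ennreal_numeral[symmetric] ennreal_mult[symmetric] ennreal_leI del: ennreal_plus ennreal_numeral)
qed

lemma epowr_mult_const:
  assumes "c \<ge> 0" "a > 0"
  shows "epowr (ennreal c * x) a \<le> ennreal (c powr a) * epowr x a"
proof (cases x)
  case (real r)
  then show ?thesis using assms by (simp add: ennreal_mult[symmetric] epowr_pos powr_mult)
next
  case top
  then show ?thesis using assms by (cases "c = 0") (auto simp: ennreal_mult_top epowr_def)
qed

lemma Lp_norm_add_le:
  fixes f g :: "real ^ 'n \<Rightarrow> 'b :: {real_normed_vector, second_countable_topology}"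
  assumes [measurable]: "f \<in> borel_measurable lebesgue" "g \<in> borel_measurable lebesgue" and p: "p \<ge> 1"
  shows "Lp_norm p (\<lambda>x. f x + g x) \<le> 4 * (Lp_norm p f + Lp_norm p g)"
proof -
  have p': "0 < 1 / p" "1 / p \<le> 1" using p by auto
  have "Lp_norm p (\<lambda>x. f x + g x) \<le> epowr (ennreal (2 powr p) * ((\<integral>\<^sup>+x. ennreal (norm (f x) powr p) \<partial>lebesgue) + (\<integral>\<^sup>+x. ennreal (norm (g x) powr p) \<partial>lebesgue))) (1 / p)"
    unfolding Lp_norm_def using p by (intro epowr_mono nn_integral_powr_norm_add_le) auto
  also have "\<dots> \<le> ennreal ((2 powr p) powr (1 / p)) * epowr ((\<integral>\<^sup>+x. ennreal (norm (f x) powr p) \<partial>lebesgue) + (\<integral>\<^sup>+x. ennreal (norm (g x) powr p) \<partial>lebesgue)) (1 / p)"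
    using p by (intro epowr_mult_const) auto
  also have "\<dots> \<le> ennreal ((2 powr p) powr (1 / p)) * (2 * (Lp_norm p f + Lp_norm p g))"
    unfolding Lp_norm_def by (intro mult_left_mono epowr_add_le p') simp
  also have "ennreal ((2 powr p) powr (1 / p)) = 2" using p by (simp add: powr_powr)
  finally show ?thesis by (simp add: mult.assoc[symmetric])
qed

text \<open>The quasi-triangle inequality: where a sum exceeds \<open>y\<close>, one of the summands exceeds \<open>y / 2\<close>.\<close>

lemma weak_norm_add_le:
  fixes f g :: "real ^ 'n \<Rightarrow> 'b :: {real_normed_vector, second_countable_topology}"
  assumes [measurable]: "f \<in> borel_measurable lebesgue" "g \<in> borel_measurable lebesgue" and q: "q \<ge> 1"
  shows "weak_norm q (\<lambda>x. f x + g x) \<le> 4 * (weak_norm q f + weak_norm q g)"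
  unfolding weak_norm_def[of q "\<lambda>x. f x + g x"]
proof (rule SUP_least)
  fix y :: real assume "y \<in> {0<..}"
  then have y: "y > 0" by simp
  have q': "0 < 1 / q" "1 / q \<le> 1" using q by auto
  let ?E = "\<lambda>f y. emeasure lebesgue {x. norm (f x :: 'b) > y}"
  have meas: "{x. norm (k x) > y / 2} \<in> sets lebesgue" if [measurable]: "k \<in> borel_measurable lebesgue" for k :: "real ^ 'n \<Rightarrow> 'b"
  proof -
    have "{x \<in> space lebesgue. norm (k x) > y / 2} \<in> sets lebesgue" by measurable
    then show ?thesis by simp
  qed
  have sub: "{x. norm (f x + g x) > y} \<subseteq> {x. norm (f x) > y / 2} \<union> {x. norm (g x) > y / 2}"
  proof
    fix x assume "x \<in> {x. norm (f x + g x) > y}"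
    then have "y < norm (f x) + norm (g x)" using norm_triangle_ineq[of "f x" "g x"] by simp
    then show "x \<in> {x. norm (f x) > y / 2} \<union> {x. norm (g x) > y / 2}" by auto
  qed
  have "?E (\<lambda>x. f x + g x) y \<le> emeasure lebesgue ({x. norm (f x) > y / 2} \<union> {x. norm (g x) > y / 2})"
    by (rule emeasure_mono[OF sub]) (intro sets.Un meas assms)
  also have "\<dots> \<le> ?E f (y / 2) + ?E g (y / 2)" by (intro emeasure_subadditive meas assms)
  finally have "epowr (?E (\<lambda>x. f x + g x) y) (1 / q) \<le> epowr (?E f (y / 2) + ?E g (y / 2)) (1 / q)"
    by (rule epowr_mono[OF _ q'(1)])
  also have "\<dots> \<le> 2 * (epowr (?E f (y / 2)) (1 / q) + epowr (?E g (y / 2)) (1 / q))"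
    by (rule epowr_add_le[OF q'])
  finally have "ennreal y * epowr (?E (\<lambda>x. f x + g x) y) (1 / q) \<le> ennreal y * (2 * (epowr (?E f (y / 2)) (1 / q) + epowr (?E g (y / 2)) (1 / q)))"
    by (rule mult_left_mono) simp
  also have "ennreal y = 2 * ennreal (y / 2)" using y by (simp add: ennreal_numeral[symmetric] ennreal_mult[symmetric] del: ennreal_numeral)
  also have "2 * ennreal (y / 2) * (2 * (epowr (?E f (y / 2)) (1 / q) + epowr (?E g (y / 2)) (1 / q)))
      = (2 * 2) * (ennreal (y / 2) * epowr (?E f (y / 2)) (1 / q) + ennreal (y / 2) * epowr (?E g (y / 2)) (1 / q))"
    by (simp only: distrib_left mult.assoc mult.commute mult.left_commute)
  also have "\<dots> \<le> (2 * 2) * (weak_norm q f + weak_norm q g)"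
    unfolding weak_norm_def using y by (intro mult_left_mono add_mono SUP_upper) auto
  finally show "ennreal y * epowr (?E (\<lambda>x. f x + g x) y) (1 / q) \<le> 4 * (weak_norm q f + weak_norm q g)"
    unfolding \<open>ennreal y = 2 * ennreal (y / 2)\<close> by simp
qed

lemma weak_norm_cong_AE:
  fixes f g :: "real ^ 'n \<Rightarrow> 'b :: {real_normed_vector, second_countable_topology}"
    and f' :: "real ^ 'n \<Rightarrow> 'c :: {real_normed_vector, second_countable_topology}"
  assumes [measurable]: "f' \<in> borel_measurable lebesgue"
    and le: "AE x in lebesgue. norm (f x) \<le> norm (f' x)" and q: "q > 0"
  shows "weak_norm q f \<le> weak_norm q f'"
  unfolding weak_norm_def
proof (intro SUP_mono' mult_left_mono epowr_mono)
  fix y :: real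
  have "{x \<in> space lebesgue. norm (f' x) > y} \<in> sets lebesgue" by measurable
  then show "emeasure lebesgue {x. y < norm (f x)} \<le> emeasure lebesgue {x. y < norm (f' x)}"
    using le by (intro emeasure_mono_AE) (auto elim!: eventually_mono)
qed (use q in auto)

text \<open>How sublinearity enters the extension: differences of \<open>\<bar>T\<bar>\<close> are controlled by \<open>\<bar>T\<bar>\<close> of differences.\<close>

lemma sublinear_diff:
  fixes T :: "(real ^ 'n \<Rightarrow> 'a :: {real_normed_field, euclidean_space}) \<Rightarrow> (real ^ 'n \<Rightarrow> 'a)"
  assumes T: "sublinear T" and f: "f \<in> test_functions" and g: "g \<in> test_functions"
  shows "AE x in lebesgue. \<bar>norm (T f x) - norm (T g x)\<bar> \<le> norm (T (\<lambda>x. f x - g x) x)"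
proof -
  note fg = test_functions_diff[OF f g] and gf = test_functions_diff[OF g f]
  have "AE x in lebesgue. norm (T (\<lambda>x. (f x - g x) + g x) x) \<le> norm (T (\<lambda>x. f x - g x) x) + norm (T g x)"
    by (rule T[unfolded sublinear_def, THEN conjunct1, rule_format, OF fg g])
  moreover have "AE x in lebesgue. norm (T (\<lambda>x. (g x - f x) + f x) x) \<le> norm (T (\<lambda>x. g x - f x) x) + norm (T f x)"
    by (rule T[unfolded sublinear_def, THEN conjunct1, rule_format, OF gf f])
  moreover have "AE x in lebesgue. norm (T (\<lambda>x. (- 1) * (f x - g x)) x) = norm (- 1 :: 'a) * norm (T (\<lambda>x. f x - g x) x)"
    by (rule T[unfolded sublinear_def, THEN conjunct2, rule_format, OF fg])
  ultimately show ?thesis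
    by eventually_elim (simp add: abs_le_iff)
qed

lemma geometric_increments_convergent:
  fixes z :: "nat \<Rightarrow> real"
  assumes "eventually (\<lambda>k. \<bar>z (Suc k) - z k\<bar> \<le> (1 / 2) ^ k) sequentially"
  shows "convergent z"
proof -
  have "summable (\<lambda>k. z (Suc k) - z k)"
    by (rule summable_comparison_test_ev[OF _ summable_geometric[of "1 / 2 :: real"]]) (use assms in auto)
  then have "convergent (\<lambda>k. z k - z 0)"
    unfolding summable_iff_convergent sum_lessThan_telescope .
  then show ?thesis by (simp add: convergent_diff_const_right_iff)
qed

text \<open>If all increments after step \<open>k\<close> are at most the terms of a geometric series with sum
  \<open>y\<close>, then the limit is within \<open>y\<close>.\<close>

lemma limit_increment_bound:
  fixes z :: "nat \<Rightarrow> real"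
  assumes "z \<longlonglongrightarrow> l" "\<And>i. \<bar>z (k + Suc i) - z (k + i)\<bar> \<le> y * (1 / 2) ^ Suc i"
  shows "\<bar>z k - l\<bar> \<le> y"
proof -
  have "\<bar>z (k + m) - z k\<bar> \<le> y * (1 - (1 / 2) ^ m)" for m
  proof (induction m)
    case (Suc m)
    have "\<bar>z (k + Suc m) - z k\<bar> \<le> y * (1 / 2) ^ Suc m + y * (1 - (1 / 2) ^ m)" using Suc assms(2)[of m] by linarith
    then show ?case by (simp add: algebra_simps)
  qed simp
  moreover have "0 \<le> y * (1 / 2) ^ Suc 0" by (rule order_trans[OF abs_ge_zero assms(2)])
  then have "y \<ge> 0" by simp
  ultimately have "\<bar>z (m + k) - z k\<bar> \<le> y" for m
    by (smt (verit, best) add.commute mult_left_le power_le_one zero_le_power divide_nonneg_nonneg)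
  moreover have "(\<lambda>m. \<bar>z (m + k) - z k\<bar>) \<longlonglongrightarrow> \<bar>l - z k\<bar>"
    by (intro tendsto_intros LIMSEQ_ignore_initial_segment assms(1))
  ultimately have "\<bar>l - z k\<bar> \<le> y" by (intro LIMSEQ_le_const2) auto
  then show ?thesis by (simp add: abs_minus_commute)
qed

text \<open>A sublinear operator with a weighted weak type bound for test functions.\<close>

locale test_bounded_operator =
  fixes T :: "(real ^ 'n \<Rightarrow> 'a :: {real_normed_field, euclidean_space}) \<Rightarrow> (real ^ 'n \<Rightarrow> 'a)" and w :: "real ^ 'n \<Rightarrow> real"
    and p q K :: real
  assumes T: "sublinear T" and T_measurable: "\<And>f. f \<in> test_functions \<Longrightarrow> T f \<in> borel_measurable lebesgue"
    and w_measurable [measurable]: "w \<in> borel_measurable lebesgue"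
    and w: "\<And>x. w x \<ge> 0" "AE x in lebesgue. w x > 0"
    and pq: "p \<ge> 1" "q \<ge> 1" and K: "K \<ge> 0"
    and w_finite: "\<And>a b. (\<integral>\<^sup>+x\<in>box a b. ennreal (w x powr p) \<partial>lebesgue) < \<infinity>"
    and bounded: "\<And>f. f \<in> test_functions \<Longrightarrow> weak_norm q (\<lambda>x. w x *\<^sub>R T f x) \<le> ennreal K * Lp_norm p (\<lambda>x. w x *\<^sub>R f x)"
begin

lemma norm_w [simp]: "norm (w x *\<^sub>R (z :: 'b :: real_normed_vector)) = w x * norm z" "\<bar>w x\<bar> = w x"
  using w(1)[of x] by auto

lemma weak_norm_diff_le:
  assumes f: "f \<in> test_functions" and g: "g \<in> test_functions"
  shows "weak_norm q (\<lambda>x. w x * (norm (T f x) - norm (T g x))) \<le> ennreal K * Lp_norm p (\<lambda>x. w x *\<^sub>R (f x - g x))"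
proof -
  note fg = test_functions_diff[OF f g]
  note [measurable] = T_measurable[OF fg]
  have "weak_norm q (\<lambda>x. w x * (norm (T f x) - norm (T g x))) \<le> weak_norm q (\<lambda>x. w x *\<^sub>R T (\<lambda>x. f x - g x) x)"
  proof (rule weak_norm_cong_AE)
    show "AE x in lebesgue. norm (w x * (norm (T f x) - norm (T g x))) \<le> norm (w x *\<^sub>R T (\<lambda>x. f x - g x) x)"
      using sublinear_diff[OF T f g] by eventually_elim (use w(1) in \<open>auto simp: abs_mult intro: mult_left_mono\<close>)
  qed (use pq in auto)
  also have "\<dots> \<le> ennreal K * Lp_norm p (\<lambda>x. w x *\<^sub>R (f x - g x))" by (rule bounded[OF fg])
  finally show ?thesis .
qed

text \<open>Completeness of weak \<open>L\<^sup>q\<close>, for a sequence of test functions \<open>\<phi>\<^sub>k\<close> that converges geometrically: by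
  Borel-Cantelli the functions \<open>w \<bar>T \<phi>\<^sub>k\<bar>\<close> converge almost everywhere, and distributing \<open>y\<close> over the increments
  as a geometric series shows that they converge in weak \<open>L\<^sup>q\<close> as well.\<close>

lemma density_value_exists:
  assumes h [measurable]: "h \<in> borel_measurable lebesgue" and fin: "Lp_norm p (\<lambda>x. w x *\<^sub>R h x) < \<infinity>"
  shows "\<exists>u. density_value p q w T h u"
proof -
  have p0: "p > 0" "q > 0" using pq by auto
  have hp: "(\<integral>\<^sup>+x. ennreal (norm (h x) powr p) * ennreal (w x powr p) \<partial>lebesgue) < \<infinity>"
  proof -
    have "(\<integral>\<^sup>+x. ennreal (norm (w x *\<^sub>R h x) powr p) \<partial>lebesgue) < \<infinity>"
    proof (rule ccontr)
      assume "\<not> ?thesis"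
      then have "(\<integral>\<^sup>+x. ennreal (norm (w x *\<^sub>R h x) powr p) \<partial>lebesgue) = top" by (simp add: less_top[symmetric])
      then show False using fin p0 by (simp add: Lp_norm_def)
    qed
    also have "(\<integral>\<^sup>+x. ennreal (norm (w x *\<^sub>R h x) powr p) \<partial>lebesgue) = (\<integral>\<^sup>+x. ennreal (norm (h x) powr p) * ennreal (w x powr p) \<partial>lebesgue)"
      using w(1) by (intro nn_integral_cong) (simp add: powr_mult ennreal_mult[symmetric] mult.commute)
    finally show ?thesis .
  qed
  have "\<exists>\<phi>\<in>test_functions. Lp_norm p (\<lambda>x. w x *\<^sub>R (\<phi> x - h x)) \<le> ennreal ((1 / 4) ^ k)" for k :: nat
  proof -
    have d: "((1 / 4 :: real) ^ k) powr p > 0" by simp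
    have wm: "(\<lambda>x. w x powr p) \<in> borel_measurable lebesgue" by measurable
    obtain \<phi> where \<phi>: "\<phi> \<in> test_functions" "(\<integral>\<^sup>+x. ennreal (norm (h x - \<phi> x) powr p) * ennreal (w x powr p) \<partial>lebesgue) \<le> ennreal (((1 / 4) ^ k) powr p)"
      by (rule test_functions_dense[OF h wm p0(1) w_finite hp d]) (assumption | rule that)+
    have "(\<integral>\<^sup>+x. ennreal (norm (w x *\<^sub>R (\<phi> x - h x)) powr p) \<partial>lebesgue) = (\<integral>\<^sup>+x. ennreal (norm (h x - \<phi> x) powr p) * ennreal (w x powr p) \<partial>lebesgue)"
      using w(1) by (intro nn_integral_cong) (simp add: powr_mult ennreal_mult[symmetric] mult.commute norm_minus_commute)
    then have "Lp_norm p (\<lambda>x. w x *\<^sub>R (\<phi> x - h x)) \<le> ennreal ((1 / 4) ^ k)"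
      using \<phi>(2) p0 by (subst Lp_norm_le_iff) auto
    then show ?thesis using \<phi>(1) by blast
  qed
  then obtain \<phi> where \<phi>: "\<And>k. \<phi> k \<in> test_functions" "\<And>k. Lp_norm p (\<lambda>x. w x *\<^sub>R (\<phi> k x - h x)) \<le> ennreal ((1 / 4) ^ k)"
    by metis
  note [measurable] = test_functions_measurable[OF \<phi>(1)] T_measurable[OF \<phi>(1)]
  define z where "z k x = w x * norm (T (\<phi> k) x)" for k x
  have [measurable]: "z k \<in> borel_measurable lebesgue" for k unfolding z_def by measurable
  have inc: "weak_norm q (\<lambda>x. z (Suc k) x - z k x) \<le> ennreal (K * (8 * (1 / 4) ^ k))" for k
  proof -
    have "weak_norm q (\<lambda>x. z (Suc k) x - z k x) \<le> ennreal K * Lp_norm p (\<lambda>x. w x *\<^sub>R (\<phi> (Suc k) x - \<phi> k x))"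
      using weak_norm_diff_le[OF \<phi>(1)[of "Suc k"] \<phi>(1)[of k]] by (simp add: z_def algebra_simps)
    also have "Lp_norm p (\<lambda>x. w x *\<^sub>R (\<phi> (Suc k) x - \<phi> k x)) = Lp_norm p (\<lambda>x. w x *\<^sub>R (\<phi> (Suc k) x - h x) + w x *\<^sub>R (h x - \<phi> k x))"
      by (simp add: scaleR_right_diff_distrib)
    also have "\<dots> \<le> 4 * (Lp_norm p (\<lambda>x. w x *\<^sub>R (\<phi> (Suc k) x - h x)) + Lp_norm p (\<lambda>x. w x *\<^sub>R (h x - \<phi> k x)))"
      by (rule Lp_norm_add_le[OF _ _ pq(1)]) measurable
    also have "Lp_norm p (\<lambda>x. w x *\<^sub>R (h x - \<phi> k x)) = Lp_norm p (\<lambda>x. w x *\<^sub>R (\<phi> k x - h x))"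
      by (simp add: Lp_norm_def norm_minus_commute)
    also have "4 * (Lp_norm p (\<lambda>x. w x *\<^sub>R (\<phi> (Suc k) x - h x)) + Lp_norm p (\<lambda>x. w x *\<^sub>R (\<phi> k x - h x))) \<le> 4 * (ennreal ((1 / 4) ^ k) + ennreal ((1 / 4) ^ k))"
      using order_trans[OF \<phi>(2)[of "Suc k"], of "ennreal ((1 / 4) ^ k)"] \<phi>(2)[of k]
      by (intro mult_left_mono add_mono) (auto intro!: ennreal_leI)
    also have "\<dots> = ennreal (8 * (1 / 4) ^ k)"
      by (simp add: ennreal_plus[symmetric] ennreal_numeral[symmetric] ennreal_mult[symmetric] del: ennreal_plus ennreal_numeral)
    finally have "weak_norm q (\<lambda>x. z (Suc k) x - z k x) \<le> ennreal K * ennreal (8 * (1 / 4) ^ k)"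
      by (simp add: mult_left_mono)
    then show ?thesis using K by (simp add: ennreal_mult)
  qed
  have level: "emeasure lebesgue {x. \<bar>z (Suc k) x - z k x\<bar> > y} \<le> ennreal ((K * (8 * (1 / 4) ^ k) / y) powr q)" if "y > 0" for k y
    using weak_norm_leD[OF inc p0(2) _ that, of k] K by simp
  have meas: "{x. \<bar>z i x - z j x\<bar> > y} \<in> sets lebesgue" for i j y
  proof -
    have "{x \<in> space lebesgue. \<bar>z i x - z j x\<bar> > y} \<in> sets lebesgue" by measurable
    then show ?thesis by simp
  qed
  have powr_le: "(b * (1 / 2) ^ k) powr q \<le> b powr q * (1 / 2) ^ k" if "b \<ge> 0" for b :: real and k
  proof -
    have "((1 / 2 :: real) ^ k) powr q \<le> ((1 / 2) ^ k) powr 1" using pq by (intro powr_mono') (auto simp: power_le_one)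
    then have "b powr q * ((1 / 2 :: real) ^ k) powr q \<le> b powr q * (1 / 2) ^ k" by (intro mult_left_mono) auto
    then show ?thesis using that by (simp add: powr_mult)
  qed
  have lev2: "emeasure lebesgue {x. \<bar>z (Suc k) x - z k x\<bar> > (1 / 2) ^ k} \<le> ennreal ((8 * K) powr q * (1 / 2) ^ k)" for k
  proof -
    have eq: "K * (8 * (1 / 4) ^ k) / (1 / 2) ^ k = 8 * K * (1 / 2) ^ k"
    proof -
      have "(1 / 4 :: real) ^ k = (1 / 2) ^ k * (1 / 2) ^ k" by (simp add: power_mult_distrib[symmetric])
      then show ?thesis by simp
    qed
    have pos: "(1 / 2 :: real) ^ k > 0" by simp
    show ?thesis
      by (rule order_trans[OF level[OF pos, of k, unfolded eq] ennreal_leI[OF powr_le]]) (use K in simp)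
  qed
  have conv: "AE x in lebesgue. convergent (\<lambda>k. z k x)"
  proof -
    let ?A = "\<lambda>k. {x. \<bar>z (Suc k) x - z k x\<bar> > (1 / 2) ^ k}"
    have finA: "emeasure lebesgue (?A k) < \<infinity>" for k using lev2[of k] by (rule le_less_trans) simp
    have "AE x in lebesgue. eventually (\<lambda>k. x \<in> space lebesgue - ?A k) sequentially"
    proof (rule borel_cantelli_AE1[OF meas finA])
      have "measure lebesgue (?A k) \<le> (8 * K) powr q * (1 / 2) ^ k" for k
        unfolding measure_def by (rule enn2real_leI[OF _ lev2]) simp
      moreover have "summable (\<lambda>k. (8 * K) powr q * (1 / 2 :: real) ^ k)"
        by (rule summable_mult[OF summable_geometric]) simp
      ultimately show "summable (\<lambda>k. measure lebesgue (?A k))"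
        by (rule_tac summable_comparison_test'[where N = 0]) (assumption, simp only: real_norm_def abs_of_nonneg[OF measure_nonneg])
    qed
    then show ?thesis
    proof eventually_elim
      case (elim x)
      then show ?case by (intro geometric_increments_convergent) (auto elim!: eventually_mono simp: not_less)
    qed
  qed
  define l where "l x = lim (\<lambda>k. z k x)" for x
  have [measurable]: "l \<in> borel_measurable lebesgue" unfolding l_def by measurable
  define u where "u x = (of_real (l x / w x) :: 'a)" for x
  have um: "u \<in> borel_measurable lebesgue" unfolding u_def by measurable
  have good: "AE x in lebesgue. (\<lambda>k. z k x) \<longlonglongrightarrow> l x \<and> w x * norm (u x) = l x"
    using conv w(2)
  proof eventually_elim
    case (elim x)
    then have lim: "(\<lambda>k. z k x) \<longlonglongrightarrow> l x" unfolding l_def by (simp add: convergent_LIMSEQ_iff)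
    then have "l x \<ge> 0" using w(1) by (intro LIMSEQ_le_const[OF lim]) (auto simp: z_def)
    then show ?case using lim elim(2) by (simp add: u_def norm_divide)
  qed
  have "weak_norm q (\<lambda>x. w x * (norm (T (\<phi> k) x) - norm (u x))) \<le> ennreal (32 * K * (1 / 4) ^ k)" for k
  proof (rule weak_norm_leI[OF p0(2)])
    show "32 * K * (1 / 4) ^ k \<ge> 0" using K by simp
    fix y :: real assume y: "y > 0"
    let ?A = "\<lambda>i. {x. \<bar>z (k + Suc i) x - z (k + i) x\<bar> > y * (1 / 2) ^ Suc i}"
    define b where "b = 16 * K * (1 / 4) ^ k / y"
    have b: "b \<ge> 0" using K y by (simp add: b_def)
    have A: "emeasure lebesgue (?A i) \<le> ennreal (b powr q * (1 / 2) ^ i)" for i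
    proof -
      have "K * (8 * (1 / 4) ^ (k + i)) / (y * (1 / 2) ^ Suc i) = b * (1 / 2) ^ i"
      proof -
        have "(1 / 4 :: real) ^ i = (1 / 2) ^ i * (1 / 2) ^ i" by (simp add: power_mult_distrib[symmetric])
        then show ?thesis using y by (simp add: b_def power_add)
      qed
      moreover have "y * (1 / 2) ^ Suc i > 0" using y by simp
      ultimately have "emeasure lebesgue (?A i) \<le> ennreal ((b * (1 / 2) ^ i) powr q)"
        using level[of "y * (1 / 2) ^ Suc i" "k + i"] by simp
      also have "\<dots> \<le> ennreal (b powr q * (1 / 2) ^ i)" by (intro ennreal_leI powr_le b)
      finally show ?thesis .
    qed
    have "emeasure lebesgue {x. y < norm (w x * (norm (T (\<phi> k) x) - norm (u x)))} \<le> emeasure lebesgue (\<Union>i. ?A i)"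
    proof (rule emeasure_mono_AE)
      show "AE x in lebesgue. x \<in> {x. y < norm (w x * (norm (T (\<phi> k) x) - norm (u x)))} \<longrightarrow> x \<in> (\<Union>i. ?A i)"
        using good
      proof eventually_elim
        case (elim x)
        have eq: "w x * (norm (T (\<phi> k) x) - norm (u x)) = z k x - l x" using elim by (simp add: z_def algebra_simps)
        show ?case
        proof (intro impI, rule ccontr)
          assume x: "x \<in> {x. y < norm (w x * (norm (T (\<phi> k) x) - norm (u x)))}" and "x \<notin> (\<Union>i. ?A i)"
          then have "x \<notin> ?A i" for i by blast
          then have "\<bar>z (k + Suc i) x - z (k + i) x\<bar> \<le> y * (1 / 2) ^ Suc i" for i unfolding mem_Collect_eq not_less .
          then have "\<bar>z k x - l x\<bar> \<le> y" by (rule limit_increment_bound[OF conjunct1[OF elim]])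
          then show False using x unfolding mem_Collect_eq eq by simp
        qed
      qed
      show "(\<Union>i. ?A i) \<in> sets lebesgue" by (rule sets.countable_nat_UN) (use meas in blast)
    qed
    also have "\<dots> \<le> (\<Sum>i. emeasure lebesgue (?A i))" by (rule emeasure_subadditive_countably) (use meas in blast)
    also have "\<dots> \<le> (\<Sum>i. ennreal (b powr q * (1 / 2) ^ i))" by (intro suminf_le A) auto
    also have "\<dots> = ennreal (b powr q * 2)"
    proof (rule suminf_ennreal_eq)
      show "(\<lambda>i. b powr q * (1 / 2) ^ i) sums (b powr q * 2)"
        using sums_mult[OF geometric_sums[of "1 / 2 :: real"], of "b powr q"] by simp
    qed simp
    also have "\<dots> \<le> ennreal ((2 * b) powr q)"
    proof (rule ennreal_leI)
      have "2 powr 1 \<le> (2::real) powr q" using pq by (intro powr_mono) auto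
      then have "b powr q * 2 \<le> b powr q * 2 powr q" by (intro mult_left_mono) auto
      then show "b powr q * 2 \<le> (2 * b) powr q" using b by (simp add: powr_mult mult.commute)
    qed
    also have "2 * b = 32 * K * (1 / 4) ^ k / y" by (simp add: b_def)
    finally show "emeasure lebesgue {x. y < norm (w x * (norm (T (\<phi> k) x) - norm (u x)))} \<le> ennreal ((32 * K * (1 / 4) ^ k / y) powr q)" .
  qed
  moreover have "(\<lambda>k. ennreal (c * (1 / 4) ^ k)) \<longlonglongrightarrow> 0" for c :: real
  proof -
    have "(\<lambda>k. c * (1 / 4) ^ k) \<longlonglongrightarrow> c * 0" by (intro tendsto_mult tendsto_const LIMSEQ_realpow_zero) auto
    then show ?thesis using tendsto_ennrealI by fastforce
  qed
  note zero = this[of "32 * K"] this[of 1, simplified]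
  ultimately have "(\<lambda>k. weak_norm q (\<lambda>x. w x * (norm (T (\<phi> k) x) - norm (u x)))) \<longlonglongrightarrow> 0"
    by (intro tendsto_sandwich[OF _ _ tendsto_const zero(1)]) auto
  moreover have "(\<lambda>k. Lp_norm p (\<lambda>x. w x *\<^sub>R (\<phi> k x - h x))) \<longlonglongrightarrow> 0"
    using \<phi>(2) by (intro tendsto_sandwich[OF _ _ tendsto_const zero(2)]) auto
  ultimately show ?thesis
    unfolding density_value_def using um \<phi>(1) by (intro exI[of _ u] conjI exI[of _ \<phi>]) auto
qed

text \<open>Passage to the limit in the a priori bound; the factor \<open>16\<close> comes from the two quasi-triangle inequalities.\<close>

lemma density_value_bounded:
  assumes h [measurable]: "h \<in> borel_measurable lebesgue" and fin: "Lp_norm p (\<lambda>x. w x *\<^sub>R h x) < \<infinity>"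
    and u: "density_value p q w T h u"
  shows "weak_norm q (\<lambda>x. w x *\<^sub>R u x) \<le> ennreal (16 * K) * Lp_norm p (\<lambda>x. w x *\<^sub>R h x)"
proof -
  obtain \<phi> where um [measurable]: "u \<in> borel_measurable lebesgue" and \<phi>: "\<And>k. \<phi> k \<in> test_functions"
    and lim: "(\<lambda>k::nat. Lp_norm p (\<lambda>x. w x *\<^sub>R (\<phi> k x - h x))) \<longlonglongrightarrow> 0"
      "(\<lambda>k. weak_norm q (\<lambda>x. w x * (norm (T (\<phi> k) x) - norm (u x)))) \<longlonglongrightarrow> 0"
    using u unfolding density_value_def by blast
  note [measurable] = test_functions_measurable[OF \<phi>] T_measurable[OF \<phi>]
  let ?L = "Lp_norm p (\<lambda>x. w x *\<^sub>R h x)"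
  let ?a = "\<lambda>k. Lp_norm p (\<lambda>x. w x *\<^sub>R (\<phi> k x - h x))"
  let ?b = "\<lambda>k. weak_norm q (\<lambda>x. w x * (norm (T (\<phi> k) x) - norm (u x)))"
  have le: "weak_norm q (\<lambda>x. w x *\<^sub>R u x) \<le> 4 * (ennreal K * (4 * (?a k + ?L)) + ?b k)" for k
  proof -
    have "weak_norm q (\<lambda>x. w x *\<^sub>R u x) = weak_norm q (\<lambda>x. w x * norm (T (\<phi> k) x) + - (w x * (norm (T (\<phi> k) x) - norm (u x))))"
      by (simp add: weak_norm_def algebra_simps abs_mult)
    also have "\<dots> \<le> 4 * (weak_norm q (\<lambda>x. w x * norm (T (\<phi> k) x)) + weak_norm q (\<lambda>x. - (w x * (norm (T (\<phi> k) x) - norm (u x)))))"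
      by (rule weak_norm_add_le[OF _ _ pq(2)]) measurable
    also have "weak_norm q (\<lambda>x. w x * norm (T (\<phi> k) x)) = weak_norm q (\<lambda>x. w x *\<^sub>R T (\<phi> k) x)"
      by (simp add: weak_norm_def abs_mult)
    also have "weak_norm q (\<lambda>x. - (w x * (norm (T (\<phi> k) x) - norm (u x)))) = ?b k"
      by (simp add: weak_norm_def)
    also have "4 * (weak_norm q (\<lambda>x. w x *\<^sub>R T (\<phi> k) x) + ?b k) \<le> 4 * (ennreal K * Lp_norm p (\<lambda>x. w x *\<^sub>R \<phi> k x) + ?b k)"
      by (intro mult_left_mono add_right_mono bounded[OF \<phi>]) simp
    also have "Lp_norm p (\<lambda>x. w x *\<^sub>R \<phi> k x) = Lp_norm p (\<lambda>x. w x *\<^sub>R (\<phi> k x - h x) + w x *\<^sub>R h x)"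
      by (simp add: scaleR_right_diff_distrib)
    also have "4 * (ennreal K * \<dots> + ?b k) \<le> 4 * (ennreal K * (4 * (?a k + ?L)) + ?b k)"
      by (intro mult_left_mono add_right_mono Lp_norm_add_le[OF _ _ pq(1)]) measurable
    finally show ?thesis .
  qed
  have "(\<lambda>k. 4 * (ennreal K * (4 * (?a k + ?L)) + ?b k)) \<longlonglongrightarrow> 4 * (ennreal K * (4 * (0 + ?L)) + 0)"
    by (intro ennreal_tendsto_cmult tendsto_add lim tendsto_const) auto
  then have "weak_norm q (\<lambda>x. w x *\<^sub>R u x) \<le> 4 * (ennreal K * (4 * (0 + ?L)) + 0)"
    by (rule LIMSEQ_le_const) (use le in auto)
  also have "\<dots> = ennreal (16 * K) * ?L"
  proof -
    have "4 * (ennreal K * (4 * ?L)) = ((4 * 4) * ennreal K) * ?L" by (simp only: mult.assoc mult.commute mult.left_commute)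
    also have "(4 * 4) * ennreal K = ennreal (16 * K)" using K by (simp add: ennreal_mult)
    finally show ?thesis by simp
  qed
  finally show ?thesis .
qed

theorem opnorm_le: "weighted_weak_opnorm p q w T \<le> ennreal (16 * K)"
  unfolding weighted_weak_opnorm_def
proof (rule Inf_lower, intro CollectI ballI impI)
  fix f :: "real ^ 'n \<Rightarrow> 'a" assume f [measurable]: "f \<in> borel_measurable lebesgue" and fin: "Lp_norm p f < \<infinity>"
  define h where "h x = inverse (w x) *\<^sub>R f x" for x
  have h [measurable]: "h \<in> borel_measurable lebesgue" unfolding h_def by measurable
  have Lp: "Lp_norm p (\<lambda>x. w x *\<^sub>R h x) = Lp_norm p f"
    unfolding Lp_norm_def
  proof (intro arg_cong2[of _ _ _ _ epowr] refl nn_integral_cong_AE)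
    show "AE x in lebesgue. ennreal (norm (w x *\<^sub>R h x) powr p) = ennreal (norm (f x) powr p)"
      using w(2) by eventually_elim (simp add: h_def)
  qed
  then show "(\<exists>u. density_value p q w T (\<lambda>x. inverse (w x) *\<^sub>R f x) u) \<and>
      (\<forall>u. density_value p q w T (\<lambda>x. inverse (w x) *\<^sub>R f x) u \<longrightarrow> weak_norm q (\<lambda>x. w x *\<^sub>R u x) \<le> ennreal (16 * K) * Lp_norm p f)"
    using density_value_exists[OF h] density_value_bounded[OF h] fin unfolding h_def[symmetric] by auto
qed

end

section \<open>Weights\<close>

lemma locally_integrable_cube_finite:
  fixes v :: "real ^ 'n \<Rightarrow> real"
  assumes "locally_integrable v" "Q \<in> cubes"
  shows "(\<integral>\<^sup>+x\<in>Q. ennreal (v x) \<partial>lebesgue) < \<infinity>"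
proof -
  obtain l where l: "cube l Q" using assms(2) by (auto simp: cubes_def)
  obtain a where a: "Q \<subseteq> cbox a (\<chi> i. a $ i + l)" by (rule cube_between_boxes[OF l])
  have "integrable lebesgue (\<lambda>x. indicator (cbox a (\<chi> i. a $ i + l)) x *\<^sub>R v x)"
    using assms(1) compact_cbox unfolding locally_integrable_def set_integrable_def by blast
  then have "(\<integral>\<^sup>+x. ennreal (norm (indicator (cbox a (\<chi> i. a $ i + l)) x *\<^sub>R v x)) \<partial>lebesgue) < \<infinity>"
    unfolding integrable_iff_bounded by blast
  then show ?thesis
  proof (rule le_less_trans[rotated], intro nn_integral_mono)
    fix x show "ennreal (v x) * indicator Q x \<le> ennreal (norm (indicator (cbox a (\<chi> i. a $ i + l)) x *\<^sub>R v x))"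
      using a by (cases "x \<in> Q") (auto intro!: ennreal_leI)
  qed
qed

text \<open>Test the condition with the constant function equal to the mean.\<close>

lemma Fujii_Wilson_ge_1:
  fixes v :: "real ^ 'n \<Rightarrow> real"
  assumes B: "Fujii_Wilson B v" and Q: "Q \<in> cubes" and fin: "(\<integral>\<^sup>+x\<in>Q. ennreal (v x) \<partial>lebesgue) < \<infinity>"
    and pos: "mean v Q > 0"
  shows "B \<ge> 1"
proof -
  define m where "m = mean v Q * measure lebesgue Q"
  have m: "m > 0" using pos cubes_measure(3)[OF Q] by (simp add: m_def)
  have "(\<integral>\<^sup>+y\<in>Q. ennreal (mean v Q) \<partial>lebesgue) \<le> ennreal B * (\<integral>\<^sup>+y\<in>Q. ennreal (v y) \<partial>lebesgue)"
    using B[unfolded Fujii_Wilson_def, rule_format, OF Q, of "\<lambda>_. mean v Q"] Q by auto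
  also have "(\<integral>\<^sup>+y\<in>Q. ennreal (v y) \<partial>lebesgue) = ennreal m" unfolding m_def by (rule nn_integral_eq_mean[OF Q fin])
  also have "(\<integral>\<^sup>+y\<in>Q. ennreal (mean v Q) \<partial>lebesgue) = ennreal m"
    unfolding nn_integral_cmult_indicator[OF cubes_measure(2)[OF Q]] cubes_measure(4)[OF Q] m_def
    using pos by (simp add: ennreal_mult[symmetric])
  finally have le: "ennreal m \<le> ennreal B * ennreal m" .
  have "B \<ge> 0"
  proof (rule ccontr)
    assume "\<not> ?thesis"
    then show False using le m by (simp add: ennreal_neg)
  qed
  then have "m \<le> B * m" using le m by (simp add: ennreal_mult[symmetric])
  then show ?thesis using m by simp
qed

text \<open>The successor keeps the side length positive for \<open>m = 0\<close>.\<close>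

definition centred_cube :: "nat \<Rightarrow> (real ^ 'n) set" where
  "centred_cube m = {x. \<forall>i. x $ i \<in> {- real (Suc m)..real (Suc m)}}"

lemma centred_cube_in_cubes: "centred_cube m \<in> cubes"
  unfolding cubes_def cube_def centred_cube_def
  by (intro CollectI exI[of _ "2 * real (Suc m)"] conjI exI[of _ "\<chi> i. - real (Suc m)"] exI[of _ "\<lambda>i. {- real (Suc m)..real (Suc m)}"]) auto

lemma eventually_in_centred_cube: "eventually (\<lambda>m. x \<in> centred_cube m) sequentially"
  using eventually_ge_at_top[of "nat \<lceil>norm x\<rceil>"]
proof eventually_elim
  case (elim m)
  then have "norm x \<le> real m" by linarith
  then have "x $ i \<in> {- real (Suc m)..real (Suc m)}" for i
    unfolding atLeastAtMost_iff using component_le_norm_cart[of x i] by linarith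
  then show ?case by (simp add: centred_cube_def)
qed

text \<open>A finite \<open>A\<^sub>r\<close> constant forces the weight to be positive almost everywhere on every cube
  that it charges.\<close>

lemma A_class_zero_or_pos:
  fixes w :: "real ^ 'n \<Rightarrow> real"
  assumes [measurable]: "w \<in> borel_measurable lebesgue" and w: "\<And>x. w x \<ge> 0" and q: "q > 0" and r: "r \<ge> 1"
    and A: "A_const r (\<lambda>x. w x powr q) < \<infinity>"
  shows "(AE x in lebesgue. w x = 0) \<or> (AE x in lebesgue. w x > 0)"
proof (rule disjCI)
  assume npos: "\<not> (AE x in lebesgue. w x > 0)"
  let ?\<mu> = "\<lambda>x. w x powr q"
  let ?J = "\<lambda>Q. \<integral>\<^sup>+x\<in>Q. epowr (ennreal (?\<mu> x)) (1 - r / (r - 1)) \<partial>lebesgue"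
  have pos: "AE x in lebesgue. x \<in> Q \<longrightarrow> w x > 0" if Q: "Q \<in> cubes" and ch: "(\<integral>\<^sup>+x\<in>Q. ennreal (?\<mu> x) \<partial>lebesgue) \<noteq> 0" for Q
  proof -
    have [measurable]: "Q \<in> sets lebesgue" by (rule cubes_measure(2)[OF Q])
    define a where "a = (\<integral>\<^sup>+x\<in>Q. ennreal (?\<mu> x) \<partial>lebesgue) / emeasure lebesgue Q"
    have a: "a \<noteq> 0" using ch unfolding a_def cubes_measure(4)[OF Q] by (simp add: ennreal_divide_eq_0_iff)
    define b where "b = (if r = 1 then inverse (ess_inf_on Q ?\<mu>) else epowr (?J Q / emeasure lebesgue Q) (r - 1))"
    have "a * b \<le> A_const r ?\<mu>" unfolding a_def b_def A_const_def by (rule SUP_upper[OF Q])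
    then have b: "b \<noteq> top" using A a by (auto simp: ennreal_mult_top top_unique)
    show ?thesis
    proof (cases "r = 1")
      case True
      then have e0: "ess_inf_on Q ?\<mu> \<noteq> 0" using b by (auto simp: b_def)
      show ?thesis
        using AE_ess_inf_on_le[of Q ?\<mu>]
      proof eventually_elim
        case (elim x)
        show ?case
        proof (intro impI, rule ccontr)
          assume "x \<in> Q" "\<not> w x > 0"
          then have "w x = 0" "ess_inf_on Q ?\<mu> \<le> ennreal (?\<mu> x)" using w[of x] elim by auto
          then show False using e0 by simp
        qed
      qed
    next
      case False
      then have r1: "r > 1" using r by simp
      have neg: "1 - r / (r - 1) < 0" using r1 by (simp add: field_simps)
      have J: "?J Q \<noteq> top"
      proof
        assume "?J Q = top"
        then have "b = top" using False r1 by (simp add: b_def cubes_measure(4)[OF Q] ennreal_top_divide del: emeasure_completion)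
        then show False using b by simp
      qed
      have eq: "epowr (ennreal (?\<mu> x)) (1 - r / (r - 1)) = (if w x = 0 then top else ennreal (?\<mu> x powr (1 - r / (r - 1))))" for x
      proof (cases "w x = 0")
        case True
        then show ?thesis using neg by (simp add: epowr_def)
      next
        case nz: False
        then have "?\<mu> x > 0" using w[of x] by simp
        then show ?thesis using nz by (simp add: epowr_real del: powr_gt_zero)
      qed
      have "AE x in lebesgue. (if w x = 0 then top else ennreal (?\<mu> x powr (1 - r / (r - 1)))) * indicator Q x \<noteq> top"
        using nn_integral_PInf_AE[of "\<lambda>x. (if w x = 0 then top else ennreal (?\<mu> x powr (1 - r / (r - 1)))) * indicator Q x" lebesgue]
          J[unfolded eq] by simp
      then show ?thesis
        by eventually_elim (use w in \<open>auto simp: less_le split: if_splits\<close>)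
    qed
  qed
  have zero: "(\<integral>\<^sup>+x\<in>centred_cube m. ennreal (?\<mu> x) \<partial>lebesgue) = 0" for m
  proof (rule ccontr)
    assume nz: "(\<integral>\<^sup>+x\<in>centred_cube m. ennreal (?\<mu> x) \<partial>lebesgue) \<noteq> 0"
    have "AE x in lebesgue. x \<in> centred_cube (m + j) \<longrightarrow> w x > 0" for j
    proof (rule pos[OF centred_cube_in_cubes])
      have sub: "centred_cube m \<subseteq> (centred_cube (m + j) :: (real ^ 'n) set)"
        unfolding centred_cube_def by (auto intro: order_trans[rotated] order_trans)
      have "(\<integral>\<^sup>+x\<in>centred_cube m. ennreal (?\<mu> x) \<partial>lebesgue) \<le> (\<integral>\<^sup>+x\<in>centred_cube (m + j). ennreal (?\<mu> x) \<partial>lebesgue)"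
        using sub by (intro nn_integral_mono) (auto simp: indicator_def)
      then show "(\<integral>\<^sup>+x\<in>centred_cube (m + j). ennreal (?\<mu> x) \<partial>lebesgue) \<noteq> 0" using nz by auto
    qed
    then have "AE x in lebesgue. \<forall>j. x \<in> centred_cube (m + j) \<longrightarrow> w x > 0" by (subst AE_all_countable) blast
    then have "AE x in lebesgue. w x > 0"
    proof eventually_elim
      case (elim x)
      obtain k where "\<forall>i\<ge>k. x \<in> centred_cube i" using eventually_in_centred_cube[of x] by (auto simp: eventually_sequentially)
      then have "x \<in> centred_cube (m + k)" by simp
      then show ?case using elim by blast
    qed
    then show False using npos by simp
  qed
  have "AE x in lebesgue. x \<in> centred_cube m \<longrightarrow> w x = 0" for m
  proof -
    have [measurable]: "centred_cube m \<in> sets lebesgue" by (rule cubes_measure(2)[OF centred_cube_in_cubes])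
    have "AE x in lebesgue. ennreal (?\<mu> x) * indicator (centred_cube m) x = 0"
      using zero[of m] by (subst (asm) nn_integral_0_iff_AE) auto
    then show ?thesis
      by eventually_elim (auto simp: indicator_def split: if_splits)
  qed
  then have "AE x in lebesgue. \<forall>m. x \<in> centred_cube m \<longrightarrow> w x = 0" by (subst AE_all_countable) blast
  then show "AE x in lebesgue. w x = 0"
  proof eventually_elim
    case (elim x)
    obtain k where "x \<in> centred_cube k" using eventually_in_centred_cube[of x] by (auto simp: eventually_sequentially)
    then show ?case using elim by blast
  qed
qed

text \<open>If the constant vanished, all means of functions \<open>h\<close> with \<open>w h\<close> bounded would vanish.\<close>

lemma A_const_nonzero:
  fixes w :: "real ^ 'n \<Rightarrow> real"
  assumes [measurable]: "w \<in> borel_measurable lebesgue" and w: "\<And>x. w x \<ge> 0" "AE x in lebesgue. w x > 0"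
    and p: "1 \<le> p\<^sub>0" "p\<^sub>0 \<le> p" and q: "q > 0" and r: "r = (1 / p\<^sub>0 - 1 / p) * q + 1"
    and Q: "Q \<in> cubes" and fin: "(\<integral>\<^sup>+x\<in>Q. ennreal (w x powr q) \<partial>lebesgue) < \<infinity>"
  shows "A_const r (\<lambda>x. w x powr q) \<noteq> 0"
proof
  assume "A_const r (\<lambda>x. w x powr q) = 0"
  then have A: "A_const r (\<lambda>x. w x powr q) \<le> ennreal 0" by simp
  \<comment> \<open>A positive function such that both \<open>h\<close> and \<open>w h\<close> are bounded.\<close>
  define h where "h x = 1 / (1 + w x)" for x
  have [measurable]: "h \<in> borel_measurable lebesgue" unfolding h_def by measurable
  have h: "0 < h x" "h x \<le> 1" "w x * h x \<le> 1" for x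
    using w(1)[of x] by (auto simp: h_def divide_le_eq add_pos_nonneg)
  have finite: "(\<integral>\<^sup>+x\<in>Q. ennreal (f x) \<partial>lebesgue) < \<infinity>" if "\<And>x. f x \<le> 1" for f
  proof -
    have "(\<integral>\<^sup>+x\<in>Q. ennreal (f x) \<partial>lebesgue) \<le> (\<integral>\<^sup>+x. indicator Q x \<partial>lebesgue)"
    proof (intro nn_integral_mono)
      fix x show "ennreal (f x) * indicator Q x \<le> indicator Q x"
        using ennreal_leI[OF that[of x]] by (auto simp: indicator_def)
    qed
    also have "\<dots> < \<infinity>" using cubes_measure(2,4)[OF Q] by (simp del: emeasure_completion)
    finally show ?thesis .
  qed
  have h1: "norm (h x) powr p\<^sub>0 \<le> 1" "(w x * norm (h x)) powr p \<le> 1" for x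
    using h[of x] w(1)[of x] p powr_mono2[of p\<^sub>0 "h x" 1] powr_mono2[of p "w x * h x" 1] by auto
  have "mean (\<lambda>x. norm (h x) powr p\<^sub>0) Q powr (1 / p\<^sub>0) \<le> (0 / mean (\<lambda>x. w x powr q) Q) powr (1 / q) * mean (\<lambda>x. (w x * norm (h x)) powr p) Q powr (1 / p)"
    by (rule mean_le_A_const[OF _ _ w p q r A _ Q fin finite[OF h1(2)]]) auto
  then have "mean (\<lambda>x. norm (h x) powr p\<^sub>0) Q = 0" by simp
  moreover have "mean (\<lambda>x. norm (h x) powr p\<^sub>0) Q > 0"
    using h(1) by (intro mean_pos[OF _ _ Q finite[OF h1(1)]]) (auto simp: less_imp_neq[symmetric])
  ultimately show False by simp
qed

text \<open>A weight that vanishes almost everywhere satisfies the \<open>A\<^sub>r\<close> condition with constant zero, so the operator norm must be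
  zero as well.\<close>

lemma opnorm_zero_weight:
  fixes T :: "(real ^ 'n \<Rightarrow> 'a :: {real_normed_field, euclidean_space}) \<Rightarrow> (real ^ 'n \<Rightarrow> 'a)"
  assumes "AE x in lebesgue. w x = (0 :: real)" and pq: "p > 0" "q > 0"
  shows "weighted_weak_opnorm p q w T = 0"
proof -
  have Lp: "Lp_norm p (\<lambda>x. w x *\<^sub>R (f x :: 'a)) = 0" for f
  proof -
    have "(\<integral>\<^sup>+x. ennreal (norm (w x *\<^sub>R f x) powr p) \<partial>lebesgue) = (\<integral>\<^sup>+x. 0 \<partial>(lebesgue :: (real ^ 'n) measure))"
      using assms(1) by (intro nn_integral_cong_AE, eventually_elim) simp
    then show ?thesis unfolding Lp_norm_def using pq by (simp add: epowr_def)
  qed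
  have weak: "weak_norm q f = 0" if "AE x in lebesgue. f x = 0" for f :: "real ^ 'n \<Rightarrow> 'b :: {real_normed_vector, second_countable_topology}"
  proof -
    have "weak_norm q f \<le> weak_norm q (\<lambda>x :: real ^ 'n. 0 :: 'b)"
      by (rule weak_norm_cong_AE) (use that pq in auto)
    also have "\<dots> \<le> ennreal 0" by (rule weak_norm_leI) (use pq in auto)
    finally show ?thesis by simp
  qed
  have weak1: "weak_norm q (\<lambda>x. w x *\<^sub>R (f x :: 'a)) = 0" for f
    by (rule weak, use assms(1) in eventually_elim) simp
  have weak2: "weak_norm q (\<lambda>x. w x * f x) = 0" for f
    by (rule weak, use assms(1) in eventually_elim) simp
  have "density_value p q w T h (\<lambda>x. 0)" for h
    unfolding density_value_def Lp weak2 by (auto intro!: exI[of _ "\<lambda>_ _. 0"] zero_test)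
  then have "weighted_weak_opnorm p q w T \<le> 0"
    unfolding weighted_weak_opnorm_def by (intro Inf_lower CollectI ballI impI conjI allI) (auto simp: weak1)
  then show ?thesis by simp
qed

section \<open>The operator norm\<close>

lemma opnorm_le_weak_const:
  fixes T :: "(real ^ 'n \<Rightarrow> 'a :: {real_normed_field, euclidean_space}) \<Rightarrow> (real ^ 'n \<Rightarrow> 'a)"
  assumes sw: "sparse_weight w p\<^sub>0 p q r s \<rho> \<eta> A R B \<epsilon>" and T: "T \<in> S_class \<alpha> p\<^sub>0 q\<^sub>0 N \<eta> c"
    and conj: "\<rho> = real_of_ereal (conj_exp q\<^sub>0)" and \<alpha>: "1 / p - 1 / q = \<alpha> / (real CARD('n) * \<rho>)"
    and \<delta>: "1 / p\<^sub>0 - (1 / p - 1 / q) + 1 / \<rho> - 1 > 0"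
  shows "weighted_weak_opnorm p q w T
     \<le> ennreal (128 * max 0 c * real N * (sparse_const CARD('n) \<eta> (s * q) * (A powr (1 / q) * (R powr (1 / q) * B))))"
proof -
  interpret sparse_weight w p\<^sub>0 p q r s \<rho> \<eta> A R B \<epsilon> by (fact sw)
  have sub: "sublinear T" and li: "\<And>f. f \<in> test_functions \<Longrightarrow> locally_integrable (T f)"
    using T by (auto simp: S_class_def)
  interpret test_bounded_operator T w p q "8 * (max 0 c * real N * weak_const)"
  proof
    fix f :: "real ^ 'n \<Rightarrow> 'a" assume f: "f \<in> test_functions"
    show "T f \<in> borel_measurable lebesgue" by (rule locally_integrable_measurable[OF li[OF f]])
    show "weak_norm q (\<lambda>x. w x *\<^sub>R T f x) \<le> ennreal (8 * (max 0 c * real N * weak_const)) * Lp_norm p (\<lambda>x. w x *\<^sub>R f x)"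
      by (rule weak_type_test_functions[OF f li[OF f] \<alpha> \<delta> refl]) (use T f in \<open>auto simp: S_class_def conj\<close>)
  qed (use sub w p weak_const_nonneg nn_integral_weight_finite in auto)
  have "weighted_weak_opnorm p q w T \<le> ennreal (16 * (8 * (max 0 c * real N * weak_const)))" by (rule opnorm_le)
  then show ?thesis by (simp add: weak_const_def mult.assoc)
qed

text \<open>The definition of the constant in real terms. A finite constant forces \<open>\<mu>\<^sup>s\<close> to be integrable
  over cubes, and Hoelder's inequality forces the constant to be at least one.\<close>

lemma RH_const_mean_le:
  fixes \<mu> :: "real ^ 'n \<Rightarrow> real"
  assumes [measurable]: "\<mu> \<in> borel_measurable lebesgue" and \<mu>: "\<And>x. \<mu> x \<ge> 0" "AE x in lebesgue. \<mu> x > 0"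
    and fin: "\<And>Q. Q \<in> cubes \<Longrightarrow> (\<integral>\<^sup>+x\<in>Q. ennreal (\<mu> x) \<partial>lebesgue) < \<infinity>"
    and s: "s > 1" and R: "RH_const s \<mu> = ennreal R" "R \<ge> 0" and Q: "Q \<in> cubes"
  shows "(\<integral>\<^sup>+x\<in>Q. ennreal (\<mu> x powr s) \<partial>lebesgue) < \<infinity>"
    and "mean (\<lambda>x. \<mu> x powr s) Q \<le> (R * mean \<mu> Q) powr s" and "R \<ge> 1"
proof -
  have V: "measure lebesgue Q > 0" by (rule cubes_measure(3)[OF Q])
  have m: "mean \<mu> Q > 0" by (rule mean_pos[OF _ \<mu>(2) Q fin[OF Q]]) simp
  have abs: "\<bar>\<mu> x\<bar> = \<mu> x" for x using \<mu>(1)[of x] by simp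
  have norm: "norm (\<mu> x) powr t = \<mu> x powr t" "norm (\<mu> x) powr 1 = \<mu> x" for x t using \<mu>(1)[of x] by auto
  have a1: "avg 0 1 Q \<mu> = ennreal (mean \<mu> Q)"
    using avg_eq[OF Q, of 1 \<mu> 0] fin[OF Q] V by (simp add: abs)
  have le: "avg 0 s Q \<mu> / ennreal (mean \<mu> Q) \<le> ennreal R"
    unfolding R(1)[symmetric] a1[symmetric] RH_const_def using s by (auto intro: SUP_upper[OF Q])
  show f: "(\<integral>\<^sup>+x\<in>Q. ennreal (\<mu> x powr s) \<partial>lebesgue) < \<infinity>"
  proof (rule ccontr)
    assume "\<not> ?thesis"
    then have "(\<integral>\<^sup>+x\<in>Q. ennreal (\<mu> x powr s) \<partial>lebesgue) = top" by (simp add: less_top[symmetric])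
    then have "avg 0 s Q \<mu> = top"
      unfolding avg_def norm cubes_measure(4)[OF Q] epowr_real[OF V] using s V by (simp add: ennreal_top_divide)
    then show False using le by (simp add: ennreal_top_divide top_unique)
  qed
  have "avg 0 s Q \<mu> = ennreal (mean (\<lambda>x. \<mu> x powr s) Q powr (1 / s))"
    using avg_eq[OF Q, of s \<mu> 0] f s V unfolding norm by simp
  then have le': "mean (\<lambda>x. \<mu> x powr s) Q powr (1 / s) \<le> R * mean \<mu> Q"
    using le m R(2) by (simp add: divide_ennreal pos_divide_le_eq)
  then have "(mean (\<lambda>x. \<mu> x powr s) Q powr (1 / s)) powr s \<le> (R * mean \<mu> Q) powr s"
    using s by (intro powr_mono2) auto
  then show "mean (\<lambda>x. \<mu> x powr s) Q \<le> (R * mean \<mu> Q) powr s" using s by (simp add: powr_powr)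
  have one: "(\<integral>\<^sup>+x\<in>Q. ennreal 1 \<partial>lebesgue) = ennreal (1 * measure lebesgue Q)"
    using cubes_measure(2,4)[OF Q] by (simp del: emeasure_completion)
  then have "mean (\<lambda>_. 1) Q \<le> 1" by (intro nn_integral_le_imp_mean_le[OF Q]) auto
  have "mean \<mu> Q \<le> mean (\<lambda>x. \<mu> x powr s) Q powr (1 / s) * mean (\<lambda>_. 1) Q powr (1 - 1 / s)"
    using s \<mu>(1) one by (intro mean_Holder[OF _ _ _ _ _ _ Q f]) (auto simp: powr_powr)
  also have "\<dots> \<le> mean (\<lambda>x. \<mu> x powr s) Q powr (1 / s) * 1 powr (1 - 1 / s)"
    using \<open>mean (\<lambda>_. 1) Q \<le> 1\<close> s by (intro mult_left_mono powr_mono2) auto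
  also have "\<dots> \<le> R * mean \<mu> Q" using le' by simp
  finally show "R \<ge> 1" using m by simp
qed

lemma conj_exp_finite:
  assumes "x > 1"
  shows "conj_exp (ereal x) = ereal (x / (x - 1))"
  using assms by (simp add: conj_exp_def one_ereal_def)

lemma conj_exp_infinity: "conj_exp \<infinity> = 1"
  by (simp add: conj_exp_def)

lemma sparse_const_nonneg: "n > 0 \<Longrightarrow> \<eta> > 0 \<Longrightarrow> \<sigma> \<ge> 0 \<Longrightarrow> sparse_const n \<eta> \<sigma> \<ge> 0"
  using maximal_bound_pos[of n] by (simp add: sparse_const_def)

theorem theorem1p3:
  fixes \<alpha> p\<^sub>0 p q \<eta> c :: real and q\<^sub>0 :: ereal and N :: nat
  assumes "0 \<le> \<alpha>" and "\<alpha> < real CARD('n)"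
    and "1 \<le> p\<^sub>0" and "p\<^sub>0 \<le> p" and "p \<le> q" and "ereal q < q\<^sub>0"
    and "1 / p\<^sub>0 - real_of_ereal (1 / q\<^sub>0)
           > \<alpha> / (real CARD('n) * real_of_ereal (conj_exp q\<^sub>0))"
    and "1 / p - 1 / q = \<alpha> / (real CARD('n) * real_of_ereal (conj_exp q\<^sub>0))"
    and "N > 0" and "0 < \<eta>" and "\<eta> \<le> 1"
  defines "r \<equiv> (1 / p\<^sub>0 - 1 / p) * q + 1"
    and "s \<equiv> real_of_ereal (conj_exp (q\<^sub>0 / ereal q))"
  shows "\<exists>C::real. \<forall>T \<in> S_class \<alpha> p\<^sub>0 q\<^sub>0 N \<eta> c. \<forall>w :: real ^ 'n \<Rightarrow> real.
    weight w \<longrightarrow> (\<lambda>x. w x powr q) \<in> A_class r \<inter> RH_class s \<longrightarrow>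
    weighted_weak_opnorm p q w
        (T :: (real ^ 'n \<Rightarrow> 'a :: {real_normed_field, euclidean_space}) \<Rightarrow> (real ^ 'n \<Rightarrow> 'a))
      \<le> ennreal C *
        (if q\<^sub>0 = \<infinity>
         then epowr (A_const r (\<lambda>x. w x powr q)) (1 / q) * A_inf_const (\<lambda>x. w x powr q)
         else epowr (A_const r (\<lambda>x. w x powr q)) (1 / q) *
              epowr (RH_const s (\<lambda>x. w x powr q)) (s + 2 / q))"
proof -
  define \<rho> where "\<rho> = real_of_ereal (conj_exp q\<^sub>0)"
  define \<kappa> where "\<kappa> = real_of_ereal (1 / q\<^sub>0)"
  have q: "q \<ge> 1" "q > 0" "p > 0" "p\<^sub>0 > 0" using assms by auto
  \<comment> \<open>All exponents in terms of the real number \<open>\<kappa> = 1 / q\<^sub>0\<close>, which is zero for \<open>q\<^sub>0 = \<infinity>\<close>.\<close>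
  have exps: "1 / \<rho> = 1 - \<kappa>" "1 / (s * q) = 1 / q - \<kappa>" "\<rho> \<ge> 1" "(q\<^sub>0 = \<infinity> \<and> s = 1) \<or> (q\<^sub>0 \<noteq> \<infinity> \<and> s > 1)"
  proof -
    consider "q\<^sub>0 = \<infinity>" | x where "q\<^sub>0 = ereal x" using assms(6) by (cases q\<^sub>0) auto
    then have "1 / \<rho> = 1 - \<kappa> \<and> 1 / (s * q) = 1 / q - \<kappa> \<and> \<rho> \<ge> 1 \<and> ((q\<^sub>0 = \<infinity> \<and> s = 1) \<or> (q\<^sub>0 \<noteq> \<infinity> \<and> s > 1))"
    proof cases
      case 1
      have "q\<^sub>0 / ereal q = \<infinity>" using 1 q by simp
      then show ?thesis using 1 q by (simp add: \<rho>_def \<kappa>_def s_def conj_exp_infinity)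
    next
      case 2
      then have x: "x > q" using assms(6) by simp
      then have "x / q > 1" using q by simp
      then have "s = (x / q) / (x / q - 1)" unfolding s_def 2 using conj_exp_finite[of "x / q"] q by simp
      then have s': "s = x / (x - q)" using q x by (simp add: field_simps)
      have \<rho>': "\<rho> = x / (x - 1)" unfolding \<rho>_def 2 using conj_exp_finite[of x] x q by simp
      have \<kappa>': "\<kappa> = 1 / x" unfolding \<kappa>_def 2 using x q by (simp add: one_ereal_def)
      show ?thesis unfolding s' \<rho>' \<kappa>' using x q 2 by (auto simp: field_simps)
    qed
    then show "1 / \<rho> = 1 - \<kappa>" "1 / (s * q) = 1 / q - \<kappa>" "\<rho> \<ge> 1" "(q\<^sub>0 = \<infinity> \<and> s = 1) \<or> (q\<^sub>0 \<noteq> \<infinity> \<and> s > 1)" by blast+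
  qed
  have s: "s \<ge> 1" using exps(4) by auto
  have \<rho>: "1 / \<rho> = 1 - 1 / q + 1 / (s * q)" using exps by simp
  have \<alpha>: "1 / p - 1 / q = \<alpha> / (real CARD('n) * \<rho>)" using assms(8) by (simp add: \<rho>_def)
  have \<delta>: "1 / p\<^sub>0 - (1 / p - 1 / q) + 1 / \<rho> - 1 > 0"
    using assms(7) unfolding \<alpha> exps(1) by (simp add: \<rho>_def \<kappa>_def)
  have r: "r \<ge> 1" using assms(3,4) q by (simp add: r_def frac_le)
  define L where "L = sparse_const CARD('n) \<eta> (s * q)"
  have L: "L \<ge> 0" using assms(10) s q by (simp add: L_def sparse_const_nonneg)
  define M where "M = (if q\<^sub>0 = \<infinity> then 1 else carleson_const CARD('n) s)"
  have M: "M \<ge> 0" using exps(4) by (auto simp: M_def carleson_const_nonneg)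
  define C where "C = 128 * max 0 c * real N * L * M + 1"
  have C: "C > 0" using L M by (simp add: C_def add_nonneg_pos)
  show ?thesis
  proof (intro exI[of _ C] ballI allI impI)
    fix T :: "(real ^ 'n \<Rightarrow> 'a) \<Rightarrow> (real ^ 'n \<Rightarrow> 'a)" and w :: "real ^ 'n \<Rightarrow> real"
    assume T: "T \<in> S_class \<alpha> p\<^sub>0 q\<^sub>0 N \<eta> c" and w: "weight w" and W: "(\<lambda>x. w x powr q) \<in> A_class r \<inter> RH_class s"
    let ?\<mu> = "\<lambda>x. w x powr q"
    let ?rhs = "ennreal C * (if q\<^sub>0 = \<infinity>
         then epowr (A_const r ?\<mu>) (1 / q) * A_inf_const ?\<mu>
         else epowr (A_const r ?\<mu>) (1 / q) * epowr (RH_const s ?\<mu>) (s + 2 / q))"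
    have w0: "\<And>x. w x \<ge> 0" and wm [measurable]: "w \<in> borel_measurable lebesgue"
      using w locally_integrable_measurable by (auto simp: weight_def)
    have A_fin: "A_const r ?\<mu> < \<infinity>" and \<mu>_int: "locally_integrable ?\<mu>" using W by (auto simp: A_class_def weight_def)
    have fin: "(\<integral>\<^sup>+x\<in>Q. ennreal (?\<mu> x) \<partial>lebesgue) < \<infinity>" if "Q \<in> cubes" for Q
      by (rule locally_integrable_cube_finite[OF \<mu>_int that])
    show "weighted_weak_opnorm p q w T \<le> ?rhs"
    proof (cases "AE x in lebesgue. w x = 0")
      case True
      then show ?thesis by (simp add: opnorm_zero_weight q)
    next
      case False
      then have w_pos: "AE x in lebesgue. w x > 0"
        using A_class_zero_or_pos[OF wm w0 q(2) r A_fin] by blast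
      obtain A where A: "A_const r ?\<mu> = ennreal A" "A \<ge> 0" using A_fin by (cases "A_const r ?\<mu>") auto
      have Q0: "centred_cube 0 \<in> (cubes :: (real ^ 'n) set set)" by (rule centred_cube_in_cubes)
      have m0: "mean ?\<mu> (centred_cube 0) > 0"
        using w_pos by (intro mean_pos[OF _ _ Q0 fin[OF Q0]]) auto
      \<comment> \<open>The two cases of the theorem differ only in the choice of \<open>B\<close> and \<open>R\<close>.\<close>
      have bound: "weighted_weak_opnorm p q w T \<le> ennreal (128 * max 0 c * real N * (L * (A powr (1 / q) * (R powr (1 / q) * B))))"
        if B: "B \<ge> 1" and R: "R > 0" and FW: "Fujii_Wilson B (\<lambda>x. ?\<mu> x powr s)"
          and sfin: "\<And>Q. Q \<in> cubes \<Longrightarrow> (\<integral>\<^sup>+x\<in>Q. ennreal (?\<mu> x powr s) \<partial>lebesgue) < \<infinity>"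
          and RHm: "\<And>Q. Q \<in> cubes \<Longrightarrow> mean (\<lambda>x. ?\<mu> x powr s) Q \<le> (R * mean ?\<mu> Q) powr s" for B R
      proof -
        define \<epsilon> where "\<epsilon> = 1 / (2 ^ (CARD('n) + 1) * B)"
        have \<epsilon>: "\<epsilon> > 0" using B by (simp add: \<epsilon>_def)
        have "sparse_weight w p\<^sub>0 p q r s \<rho> \<eta> A R B \<epsilon>"
        proof
          fix Q :: "(real ^ 'n) set" assume Q: "Q \<in> cubes"
          have pw: "(?\<mu> x powr s) powr (1 + \<epsilon>) = w x powr (s * q * (1 + \<epsilon>))" for x by (simp add: powr_powr ac_simps)
          have "(\<integral>\<^sup>+x\<in>Q. ennreal (w x powr (s * q * (1 + \<epsilon>))) \<partial>lebesgue) \<le> ennreal (2 * mean (\<lambda>x. ?\<mu> x powr s) Q powr (1 + \<epsilon>) * measure lebesgue Q)"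
            unfolding pw[symmetric] by (rule reverse_Holder_cube[OF _ _ FW B Q sfin[OF Q] \<epsilon>_def]) auto
          also have "\<dots> \<le> ennreal (2 * ((R * mean ?\<mu> Q) powr s) powr (1 + \<epsilon>) * measure lebesgue Q)"
            using RHm[OF Q] \<epsilon> by (intro ennreal_leI mult_right_mono mult_left_mono powr_mono2) auto
          finally show "(\<integral>\<^sup>+x\<in>Q. ennreal (w x powr (s * q * (1 + \<epsilon>))) \<partial>lebesgue) \<le> ennreal (2 * (R * mean ?\<mu> Q) powr (s * (1 + \<epsilon>)) * measure lebesgue Q)"
            by (simp add: powr_powr)
        qed (use wm w0 w_pos assms(3,4,5,10) r_def s exps(3) \<rho> B R fin A in \<open>auto simp: \<epsilon>_def\<close>)
        from opnorm_le_weak_const[OF this T \<rho>_def \<alpha> \<delta>] show ?thesis by (simp add: L_def)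
      qed
      show ?thesis
      proof (cases "q\<^sub>0 = \<infinity>")
        case True
        then have s1: "s = 1" using exps(4) by auto
        show ?thesis
        proof (cases "A_inf_const ?\<mu>")
          case top
          have "A \<noteq> 0"
            using A_const_nonzero[OF wm w0 w_pos assms(3,4) q(2) r_def[THEN meta_eq_to_obj_eq] Q0 fin[OF Q0]] A by auto
          then have "?rhs = \<infinity>" using True top A C q
            by (simp add: epowr_pos ennreal_mult_top)
          then show ?thesis by simp
        next
          case (real B)
          have B: "Fujii_Wilson B ?\<mu>"
            by (rule Fujii_Wilson_of_A_inf[OF _ _ fin]) (use real in auto)
          have B1: "B \<ge> 1" by (rule Fujii_Wilson_ge_1[OF B Q0 fin[OF Q0] m0])
          have pw1: "?\<mu> x powr s = ?\<mu> x" for x by (simp add: s1)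
          have "weighted_weak_opnorm p q w T \<le> ennreal (128 * max 0 c * real N * (L * (A powr (1 / q) * (1 powr (1 / q) * B))))"
            by (rule bound[OF B1]) (use B fin in \<open>auto simp: pw1 s1\<close>)
          also have "\<dots> \<le> ennreal (C * (A powr (1 / q) * B))"
            using B1 True by (intro ennreal_leI) (simp add: C_def M_def algebra_simps)
          also have "\<dots> = ?rhs" using True A real q C by (simp add: epowr_pos ennreal_mult)
          finally show ?thesis .
        qed
      next
        case False
        then have s1: "s > 1" using exps(4) by auto
        have "RH_const s ?\<mu> < \<infinity>" using W s1 by (auto simp: RH_class_def)
        then obtain R where R: "RH_const s ?\<mu> = ennreal R" "R \<ge> 0" by (cases "RH_const s ?\<mu>") auto
        have \<mu>_pos: "AE x in lebesgue. ?\<mu> x > 0" using w_pos by eventually_elim simp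
        have \<mu>_meas: "?\<mu> \<in> borel_measurable lebesgue" by measurable
        note RHm = RH_const_mean_le[OF \<mu>_meas powr_ge_zero \<mu>_pos fin s1 R]
        have R1: "R \<ge> 1" by (rule RHm(3)[OF _ Q0])
        define B where "B = R powr s * carleson_const CARD('n) s"
        have FW: "Fujii_Wilson B (\<lambda>x. ?\<mu> x powr s)"
          unfolding B_def using R1 by (intro Fujii_Wilson_of_reverse_Holder[OF \<mu>_meas _ s1 _ RHm(2)]) auto
        have ms: "mean (\<lambda>x. ?\<mu> x powr s) (centred_cube 0) > 0"
          using \<mu>_pos by (intro mean_pos[OF _ _ Q0 RHm(1)[OF _ Q0]]) auto
        have B1: "B \<ge> 1" by (rule Fujii_Wilson_ge_1[OF FW Q0 RHm(1)[OF _ Q0] ms])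
        have "weighted_weak_opnorm p q w T \<le> ennreal (128 * max 0 c * real N * (L * (A powr (1 / q) * (R powr (1 / q) * B))))"
          using R1 by (intro bound[OF B1 _ FW RHm(1) RHm(2)]) auto
        also have "128 * max 0 c * real N * (L * (A powr (1 / q) * (R powr (1 / q) * B)))
            = 128 * max 0 c * real N * L * M * (A powr (1 / q) * R powr (s + 1 / q))"
          using False by (simp add: B_def M_def powr_add)
        also have "ennreal \<dots> \<le> ennreal (C * (A powr (1 / q) * R powr (s + 2 / q)))"
        proof (rule ennreal_leI, rule mult_mono)
          show "128 * max 0 c * real N * L * M \<le> C" by (simp add: C_def)
          have "R powr (s + 1 / q) \<le> R powr (s + 2 / q)" using R1 q by (intro powr_mono) (auto simp: divide_right_mono)
          then show "A powr (1 / q) * R powr (s + 1 / q) \<le> A powr (1 / q) * R powr (s + 2 / q)" by (intro mult_left_mono) auto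
        qed (use C in auto)
        also have "\<dots> = ?rhs"
          using False A R q C s by (simp add: epowr_pos ennreal_mult add_pos_pos)
        finally show ?thesis .
      qed
    qed
  qed
qed


end
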